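(* Let $\Bbbk$ be an algebraically closed field of characteristic $0$, let $H$ be a finite-dimensional Hopf algebra over $\Bbbk$ with the dual Chevalley property, and let $\operatorname{gr}^c(H)\cong(\Bbbk\langle x,y\rangle/I)^*\times H_0$ be of tame corepresentation type (with $I$ one of the ideals (I1)–(I4) listed in the context). Suppose $\mathcal{P}^1=\{\mathcal{X}\}$ and $\mathcal{S}^1=\{C\}$ for some simple subcoalgebra $C$ with $\dim_{\Bbbk}(C)=4$. Write $\mathcal{C}=\begin{pmatrix} c_{11} & c_{12} \\ c_{21} & c_{22} \end{pmatrix}$ for the basic multiplicative matrix of $C$ and $\mathcal{X}=\begin{pmatrix} u \\ v \end{pmatrix}$, and suppose that the invertible matrix $K$ over $\Bbbk$ with $$\begin{pmatrix} c_{11}u & c_{12}u \\ c_{21}u & c_{22}u \\ c_{11}v & c_{12}v \\ c_{21}v & c_{22}v \end{pmatrix}=K\begin{pmatrix} uc_{11} & uc_{12} \\ uc_{21} & uc_{22} \\ vc_{11} & vc_{12} \\ vc_{21} & vc_{22} \end{pmatrix}$$ is diagonal, $K=\operatorname{diag}(\alpha_1,\alpha_2,\alpha_3,\alpha_4)$. If, in addition, $R_H$ is generated by $u,v$ as an algebra, then (1) $I=(x^2,\,y^2,\,(xy)^m-a(yx)^m)$ for some $0\neq a\in\Bbbk$ and $m\geq 1$; and, for these $a$ and $m$, (2) $\alpha_1=\alpha_4=-1$; (3) $a=(-1)^{m-1}\alpha_2^m$ or $a=(-1)^{m-1}\alpha_3^m$; (4) $\alpha_2\alpha_3$ is a primitive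 $m$th root of unity.
   Context: A Hopf algebra $H$ has the dual Chevalley property if its coradical $H_0$ is a Hopf subalgebra. $\{H_n\}$ is the coradical filtration, $H_{-1}=0$, and $\operatorname{gr}^c(H)=\bigoplus_{n\ge0}H_n/H_{n-1}$ is the associated coradically graded Hopf algebra, with coradical $H_0$ in degree $0$. Let $\pi:\operatorname{gr}^c(H)\to H_0$ be the projection onto degree $0$ and $R_H=\{h\in\operatorname{gr}^c(H)\mid(\mathrm{id}\otimes\pi)\Delta(h)=h\otimes1\}$, a subalgebra and a braided Hopf algebra in ${}^{H_0}_{H_0}\mathcal{YD}$ with $\operatorname{gr}^c(H)\cong R_H\times H_0$ (Radford biproduct: smash product and smash coproduct). It is known that $\operatorname{gr}^c(H)$ is of tame corepresentation type iff $\operatorname{gr}^c(H)\cong(\Bbbk\langle x,y\rangle/I)^*\times H_0$ as Hopf algebras for some $I$ of one of the forms: (I1) $(x^2-y^2,yx-ax^2,xy)$, $a\ne0$; (I2) $(x^2,y^2,(xy)^m-a(yx)^m)$, $a\neq0$, $m\ge1$; (I3) $(x^n-y^n,xy,yx)$, $n\ge2$; (I4) $(x^2,y^2,(xy)^mx-(yx)^my)$, $m\ge1$. Here $R_H\cong(\Bbbk\langle x,y\rangle/I)^*$ as coalgebras (dual coalgebra), and a statement "$I=I'$" is understood through this isomorphism, i.e. it means $R_H\cong(\Bbbk\langle x,y\rangle/I')^*$ as coalgebras. Let $\mathcal{S}$ be the set of simple subcoalgebras of $\operatorname{gr}^c(H)$ (equivalently of $H$), $C\wedge D=\Delta^{-1}(C\otimes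 \operatorname{gr}^c(H)+\operatorname{gr}^c(H)\otimes D)$, and $\mathcal{S}^1=\{C\in\mathcal{S}\mid C+\Bbbk1\neq C\wedge\Bbbk1\}$. A basic multiplicative matrix of $C\in\mathcal{S}$ with $\dim C=r^2$ is a matrix $\mathcal{C}=(c_{ij})_{r\times r}$ whose entries are a basis of $C$ with $\Delta(c_{ij})=\sum_tc_{it}\otimes c_{tj}$, $\varepsilon(c_{ij})=\delta_{ij}$; one is fixed for each $C$. A non-trivial $(\mathcal{C},1)$-primitive matrix is a column $\mathcal{X}=(x_i)_{r\times1}$ with $\Delta(x_i)=\sum_kc_{ik}\otimes x_k+x_i\otimes1$ and some $x_i$ not in the coradical. $\mathcal{P}^1$ is the union over $C\in\mathcal{S}^1$ of complete families of non-trivial $(\mathcal{C},1)$-primitive matrices: a family is complete if the spans of the classes of the entries of its members in $\operatorname{gr}^c(H)_1/\operatorname{gr}^c(H)_0$ (first two terms of the coradical filtration) form a direct sum equal to the subspace of elements $w$ whose left coaction (induced by $\Delta$) lies in $C\otimes(\cdot)$ and whose right coaction lies in $(\cdot)\otimes\Bbbk1$. The matrix $\mathcal{X}$ is chosen with entries homogeneous of degree $1$, so that $u,v\in R_H$. An invertible $K$ over $\Bbbk$ as displayed always exists in this situation. Corepresentation type of a finite-dimensional coalgebra means representation type of its dual algebra; tame excludes finite. *)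

theory Defs
  imports "Jordan_Normal_Form.VS_Connect" "HOL-Algebra.QuotRing"
begin

text \<open>Vector spaces over a field type are records of type \<open>module\<close> over \<^const>\<open>class_ring\<close>; all
  notions are relative to carriers.\<close>

section \<open>Tensor products\<close>

definition linear_forms :: "('k::field, 'v, 'm) module_scheme \<Rightarrow> ('v \<Rightarrow> 'k) set" where
  "linear_forms V = {\<phi>.
     (\<forall>x\<in>carrier V. \<forall>y\<in>carrier V. \<phi> (x \<oplus>\<^bsub>V\<^esub> y) = \<phi> x + \<phi> y) \<and>
     (\<forall>c. \<forall>x\<in>carrier V. \<phi> (c \<odot>\<^bsub>V\<^esub> x) = c * \<phi> x)}"

definition bilinear_forms ::
  "('k::field, 'v, 'm) module_scheme \<Rightarrow> ('k, 'w, 'n) module_scheme \<Rightarrow> ('v \<Rightarrow> 'w \<Rightarrow> 'k) set" where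
  "bilinear_forms V W = {\<beta>.
     (\<forall>v\<in>carrier V. \<beta> v \<in> linear_forms W) \<and> (\<forall>w\<in>carrier W. (\<lambda>v. \<beta> v w) \<in> linear_forms V)}"

definition trilinear_forms ::
  "('k::field, 'u, 'l) module_scheme \<Rightarrow> ('k, 'v, 'm) module_scheme \<Rightarrow> ('k, 'w, 'n) module_scheme \<Rightarrow>
   ('u \<Rightarrow> 'v \<Rightarrow> 'w \<Rightarrow> 'k) set" where
  "trilinear_forms U V W = {\<gamma>.
     (\<forall>u\<in>carrier U. \<gamma> u \<in> bilinear_forms V W) \<and>
     (\<forall>v\<in>carrier V. \<forall>w\<in>carrier W. (\<lambda>u. \<gamma> u v w) \<in> linear_forms U)}"

text \<open>Over a field, \<open>V \<otimes> W\<close> embeds into the dual of the space of bilinear forms on \<open>V \<times> W\<close>, the pure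
  tensor \<open>v \<otimes> w\<close> being evaluation at \<open>(v, w)\<close>. A tensor is therefore a functional \<open>T\<close> on bilinear
  forms that is a finite sum of such evaluations, and \<open>T (\<lambda>a b. \<dots>)\<close> reads as Sweedler notation: it
  is the sum of \<open>\<dots>\<close> over the summands \<open>a \<otimes> b\<close> of \<open>T\<close>. Identities in threefold tensor products are
  tested on all trilinear forms, identities between vectors on all linear forms.\<close>

type_synonym ('k, 'v, 'w) tensor = "('v \<Rightarrow> 'w \<Rightarrow> 'k) \<Rightarrow> 'k"

definition pure_tensor ::
  "('k::field, 'v, 'm) module_scheme \<Rightarrow> ('k, 'w, 'n) module_scheme \<Rightarrow> 'v \<Rightarrow> 'w \<Rightarrow> ('k, 'v, 'w) tensor" where
  "pure_tensor V W v w = (\<lambda>\<beta>\<in>bilinear_forms V W. \<beta> v w)"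

text \<open>The image of \<open>A \<otimes> B\<close> in \<open>V \<otimes> W\<close>, for subspaces \<open>A\<close> of \<open>V\<close> and \<open>B\<close> of \<open>W\<close>.\<close>

definition tensors ::
  "('k::field, 'v, 'm) module_scheme \<Rightarrow> ('k, 'w, 'n) module_scheme \<Rightarrow> 'v set \<Rightarrow> 'w set \<Rightarrow>
   ('k, 'v, 'w) tensor set" where
  "tensors V W A B = {T. \<exists>(n::nat) a b. (\<forall>i<n. a i \<in> A \<and> b i \<in> B) \<and>
     T = (\<lambda>\<beta>\<in>bilinear_forms V W. \<Sum>i<n. \<beta> (a i) (b i))}"

definition tensor_product ::
  "('k::field, 'v, 'm) module_scheme \<Rightarrow> ('k, 'w, 'n) module_scheme \<Rightarrow> ('k, ('k, 'v, 'w) tensor) module" where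
  "tensor_product V W =
    \<lparr>carrier = tensors V W (carrier V) (carrier W), mult = undefined, one = undefined,
     zero = (\<lambda>\<beta>\<in>bilinear_forms V W. 0),
     add = (\<lambda>T U. \<lambda>\<beta>\<in>bilinear_forms V W. T \<beta> + U \<beta>),
     smult = (\<lambda>c T. \<lambda>\<beta>\<in>bilinear_forms V W. c * T \<beta>)\<rparr>"

text \<open>The value of \<open>f \<otimes> g\<close> at \<open>T\<close>, where \<open>V\<close> and \<open>W\<close> are the codomains of \<open>f\<close> and \<open>g\<close>.\<close>

definition tensor_map ::
  "('k::field, 'v, 'm) module_scheme \<Rightarrow> ('k, 'w, 'n) module_scheme \<Rightarrow> ('a \<Rightarrow> 'v) \<Rightarrow> ('b \<Rightarrow> 'w) \<Rightarrow>
   ('k, 'a, 'b) tensor \<Rightarrow> ('k, 'v, 'w) tensor" where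
  "tensor_map V W f g T = (\<lambda>\<beta>\<in>bilinear_forms V W. T (\<lambda>a b. \<beta> (f a) (g b)))"


section \<open>Algebras, coalgebras, Hopf algebras\<close>

definition k_algebra :: "('k::field, 'v, 'm) module_scheme \<Rightarrow> bool" where
  "k_algebra A \<longleftrightarrow> vectorspace class_ring A \<and> ring A \<and>
     (\<forall>c. \<forall>x\<in>carrier A. \<forall>y\<in>carrier A.
        c \<odot>\<^bsub>A\<^esub> (x \<otimes>\<^bsub>A\<^esub> y) = (c \<odot>\<^bsub>A\<^esub> x) \<otimes>\<^bsub>A\<^esub> y \<and> c \<odot>\<^bsub>A\<^esub> (x \<otimes>\<^bsub>A\<^esub> y) = x \<otimes>\<^bsub>A\<^esub> (c \<odot>\<^bsub>A\<^esub> y))"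

definition alg_generated :: "('k::field, 'v, 'm) module_scheme \<Rightarrow> 'v set \<Rightarrow> 'v set" where
  "alg_generated A S = \<Inter>{B. S \<subseteq> B \<and> subspace class_ring B A \<and> \<one>\<^bsub>A\<^esub> \<in> B \<and>
     (\<forall>x\<in>B. \<forall>y\<in>B. x \<otimes>\<^bsub>A\<^esub> y \<in> B)}"

text \<open>Coalgebras that carry no algebra structure leave the fields \<open>mult\<close> and \<open>one\<close> unspecified.\<close>

record ('k, 'v) coalg = "('k, 'v) module" +
  comult :: "'v \<Rightarrow> ('v \<Rightarrow> 'v \<Rightarrow> 'k) \<Rightarrow> 'k"
  counit :: "'v \<Rightarrow> 'k"

definition with_coalg ::
  "('k, 'v) module \<Rightarrow> ('v \<Rightarrow> ('k, 'v, 'v) tensor) \<Rightarrow> ('v \<Rightarrow> 'k) \<Rightarrow> ('k, 'v) coalg" where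
  "with_coalg V d e =
    \<lparr>carrier = carrier V, mult = mult V, one = one V, zero = zero V, add = add V, smult = smult V,
     comult = d, counit = e\<rparr>"

definition coalgebra :: "('k::field, 'v) coalg \<Rightarrow> bool" where
  "coalgebra C \<longleftrightarrow> vectorspace class_ring C \<and>
     (\<forall>x\<in>carrier C. comult C x \<in> carrier (tensor_product C C)) \<and>
     (\<forall>x\<in>carrier C. \<forall>y\<in>carrier C.
        comult C (x \<oplus>\<^bsub>C\<^esub> y) = comult C x \<oplus>\<^bsub>tensor_product C C\<^esub> comult C y) \<and>
     (\<forall>c. \<forall>x\<in>carrier C. comult C (c \<odot>\<^bsub>C\<^esub> x) = c \<odot>\<^bsub>tensor_product C C\<^esub> comult C x) \<and>
     counit C \<in> linear_forms C \<and>
     (\<forall>x\<in>carrier C. \<forall>\<gamma>\<in>trilinear_forms C C C.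
        comult C x (\<lambda>a b. comult C a (\<lambda>a1 a2. \<gamma> a1 a2 b)) =
        comult C x (\<lambda>a b. comult C b (\<lambda>b1 b2. \<gamma> a b1 b2))) \<and>
     (\<forall>x\<in>carrier C. \<forall>\<phi>\<in>linear_forms C.
        comult C x (\<lambda>a b. counit C a * \<phi> b) = \<phi> x \<and> comult C x (\<lambda>a b. \<phi> a * counit C b) = \<phi> x)"

definition bialgebra :: "('k::field, 'v) coalg \<Rightarrow> bool" where
  "bialgebra H \<longleftrightarrow> k_algebra H \<and> coalgebra H \<and>
     (\<forall>x\<in>carrier H. \<forall>y\<in>carrier H. \<forall>\<beta>\<in>bilinear_forms H H.
        comult H (x \<otimes>\<^bsub>H\<^esub> y) \<beta> =
        comult H x (\<lambda>x1 x2. comult H y (\<lambda>y1 y2. \<beta> (x1 \<otimes>\<^bsub>H\<^esub> y1) (x2 \<otimes>\<^bsub>H\<^esub> y2)))) \<and>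
     comult H \<one>\<^bsub>H\<^esub> = pure_tensor H H \<one>\<^bsub>H\<^esub> \<one>\<^bsub>H\<^esub> \<and>
     (\<forall>x\<in>carrier H. \<forall>y\<in>carrier H. counit H (x \<otimes>\<^bsub>H\<^esub> y) = counit H x * counit H y) \<and>
     counit H \<one>\<^bsub>H\<^esub> = 1"

text \<open>Convolution inverse of the identity. No compatibility of multiplication and comultiplication
  is presupposed, so that it also serves for braided Hopf algebras.\<close>

definition is_antipode :: "('k::field, 'v) coalg \<Rightarrow> ('v \<Rightarrow> 'v) \<Rightarrow> bool" where
  "is_antipode H S \<longleftrightarrow> S \<in> LinearCombinations.module_hom class_ring H H \<and>
     (\<forall>x\<in>carrier H. \<forall>\<phi>\<in>linear_forms H.
        comult H x (\<lambda>a b. \<phi> (S a \<otimes>\<^bsub>H\<^esub> b)) = \<phi> (counit H x \<odot>\<^bsub>H\<^esub> \<one>\<^bsub>H\<^esub>) \<and>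
        comult H x (\<lambda>a b. \<phi> (a \<otimes>\<^bsub>H\<^esub> S b)) = \<phi> (counit H x \<odot>\<^bsub>H\<^esub> \<one>\<^bsub>H\<^esub>))"

definition hopf_algebra :: "('k::field, 'v) coalg \<Rightarrow> bool" where
  "hopf_algebra H \<longleftrightarrow> bialgebra H \<and> (\<exists>S. is_antipode H S)"

definition antipode :: "('k::field, 'v) coalg \<Rightarrow> 'v \<Rightarrow> 'v" where
  "antipode H = (THE S. is_antipode H S \<and> S \<in> extensional (carrier H))"

definition coalg_hom :: "('k::field, 'v) coalg \<Rightarrow> ('k, 'w) coalg \<Rightarrow> ('v \<Rightarrow> 'w) set" where
  "coalg_hom C D = {f \<in> LinearCombinations.module_hom class_ring C D. \<forall>x\<in>carrier C.
     comult D (f x) = tensor_map D D f f (comult C x) \<and> counit D (f x) = counit C x}"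

definition coalg_iso :: "('k::field, 'v) coalg \<Rightarrow> ('k, 'w) coalg \<Rightarrow> bool" where
  "coalg_iso C D \<longleftrightarrow> (\<exists>f\<in>coalg_hom C D. bij_betw f (carrier C) (carrier D))"

definition hopf_iso :: "('k::field, 'v) coalg \<Rightarrow> ('k, 'w) coalg \<Rightarrow> bool" where
  "hopf_iso H L \<longleftrightarrow> (\<exists>f\<in>coalg_hom H L. bij_betw f (carrier H) (carrier L) \<and>
     (\<forall>x\<in>carrier H. \<forall>y\<in>carrier H. f (x \<otimes>\<^bsub>H\<^esub> y) = f x \<otimes>\<^bsub>L\<^esub> f y) \<and> f \<one>\<^bsub>H\<^esub> = \<one>\<^bsub>L\<^esub>)"

definition subcoalgebra :: "('k::field, 'v) coalg \<Rightarrow> 'v set \<Rightarrow> bool" where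
  "subcoalgebra C D \<longleftrightarrow> subspace class_ring D C \<and> (\<forall>x\<in>D. comult C x \<in> tensors C C D D)"

text \<open>The subcoalgebra \<open>D\<close> as a coalgebra in its own right: its comultiplication takes values in
  \<open>D \<otimes> D\<close> rather than in \<open>C \<otimes> C\<close>, the two being related by the tensor square of the inclusion.\<close>

definition sub_coalg :: "('k::field, 'v) coalg \<Rightarrow> 'v set \<Rightarrow> ('k, 'v) coalg" where
  "sub_coalg C D = C\<lparr>carrier := D, comult := (\<lambda>x. THE T.
     T \<in> carrier (tensor_product (C\<lparr>carrier := D\<rparr>) (C\<lparr>carrier := D\<rparr>)) \<and>
     tensor_map C C id id T = comult C x)\<rparr>"

definition simple_subcoalgebras :: "('k::field, 'v) coalg \<Rightarrow> 'v set set" where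
  "simple_subcoalgebras C = {D. subcoalgebra C D \<and> D \<noteq> {\<zero>\<^bsub>C\<^esub>} \<and>
     (\<forall>E. subcoalgebra C E \<and> E \<subseteq> D \<longrightarrow> E = {\<zero>\<^bsub>C\<^esub>} \<or> E = D)}"

definition coradical :: "('k::field, 'v) coalg \<Rightarrow> 'v set" where
  "coradical C = LinearCombinations.module.span class_ring C (\<Union>(simple_subcoalgebras C))"

definition wedge :: "('k::field, 'v) coalg \<Rightarrow> 'v set \<Rightarrow> 'v set \<Rightarrow> 'v set" where
  "wedge C A B = {x \<in> carrier C.
     \<exists>T\<in>tensors C C A (carrier C). \<exists>U\<in>tensors C C (carrier C) B.
       comult C x = T \<oplus>\<^bsub>tensor_product C C\<^esub> U}"

primrec corad_filt :: "('k::field, 'v) coalg \<Rightarrow> nat \<Rightarrow> 'v set" where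
  "corad_filt C 0 = coradical C"
| "corad_filt C (Suc n) = wedge C (coradical C) (corad_filt C n)"

definition hopf_subalgebra :: "('k::field, 'v) coalg \<Rightarrow> 'v set \<Rightarrow> bool" where
  "hopf_subalgebra H A \<longleftrightarrow> subcoalgebra H A \<and> \<one>\<^bsub>H\<^esub> \<in> A \<and>
     (\<forall>x\<in>A. \<forall>y\<in>A. x \<otimes>\<^bsub>H\<^esub> y \<in> A) \<and> (\<forall>x\<in>A. antipode H x \<in> A)"

definition dual_chevalley :: "('k::field, 'v) coalg \<Rightarrow> bool" where
  "dual_chevalley H \<longleftrightarrow> hopf_subalgebra H (coradical H)"

abbreviation corad_hopf :: "('k::field, 'v) coalg \<Rightarrow> ('k, 'v) coalg" where
  "corad_hopf H \<equiv> sub_coalg H (coradical H)"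


section \<open>Quotients and duals\<close>

definition quot_space :: "('k::field, 'v, 'm) module_scheme \<Rightarrow> 'v set \<Rightarrow> ('k, 'v set) module" where
  "quot_space V W =
    \<lparr>carrier = a_rcosets\<^bsub>V\<^esub> W, mult = undefined, one = undefined, zero = W, add = set_add V,
     smult = (\<lambda>c X. \<Union>x\<in>X. W +>\<^bsub>V\<^esub> (c \<odot>\<^bsub>V\<^esub> x))\<rparr>"

text \<open>Multiplication and unit are those of the quotient ring \<open>A Quot I\<close>.\<close>

definition quot_alg :: "('k::field, 'v, 'm) module_scheme \<Rightarrow> 'v set \<Rightarrow> ('k, 'v set) module" where
  "quot_alg A I = (quot_space A I)\<lparr>mult := mult (A Quot I), one := one (A Quot I)\<rparr>"

definition dual_space :: "('k::field, 'v, 'm) module_scheme \<Rightarrow> ('k, 'v \<Rightarrow> 'k) module" where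
  "dual_space V =
    \<lparr>carrier = linear_forms V \<inter> extensional (carrier V), mult = undefined, one = undefined,
     zero = (\<lambda>x\<in>carrier V. 0),
     add = (\<lambda>f g. \<lambda>x\<in>carrier V. f x + g x),
     smult = (\<lambda>c f. \<lambda>x\<in>carrier V. c * f x)\<rparr>"

definition dual_algebra :: "('k::field, 'v) coalg \<Rightarrow> ('k, 'v \<Rightarrow> 'k) module" where
  "dual_algebra C = (dual_space C)
    \<lparr>mult := (\<lambda>f g. \<lambda>x\<in>carrier C. comult C x (\<lambda>a b. f a * g b)),
     one := (\<lambda>x\<in>carrier C. counit C x)\<rparr>"

text \<open>For a finite-dimensional algebra \<open>A\<close>: the comultiplication of \<open>f\<close> is the element of
  \<open>A* \<otimes> A*\<close> corresponding to the functional \<open>a \<otimes> b \<mapsto> f (a b)\<close>.\<close>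

definition dual_coalgebra :: "('k::field, 'v, 'm) module_scheme \<Rightarrow> ('k, 'v \<Rightarrow> 'k) coalg" where
  "dual_coalgebra A = with_coalg (dual_space A)
     (\<lambda>f. THE T. T \<in> carrier (tensor_product (dual_space A) (dual_space A)) \<and>
        (\<forall>a\<in>carrier A. \<forall>b\<in>carrier A. T (\<lambda>\<phi> \<psi>. \<phi> a * \<psi> b) = f (a \<otimes>\<^bsub>A\<^esub> b)))
     (\<lambda>f. f \<one>\<^bsub>A\<^esub>)"


section \<open>The free algebra on two generators and the ideals of tame type\<close>

datatype letter = LX | LY

definition free_alg :: "('k::field, letter list \<Rightarrow> 'k) module" where
  "free_alg =
    \<lparr>carrier = {p. finite {w. p w \<noteq> 0}},
     mult = (\<lambda>p q w. \<Sum>i\<le>length w. p (take i w) * q (drop i w)),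
     one = (\<lambda>w. if w = [] then 1 else 0),
     zero = (\<lambda>w. 0),
     add = (\<lambda>p q w. p w + q w),
     smult = (\<lambda>c p w. c * p w)\<rparr>"

definition gen_x :: "letter list \<Rightarrow> 'k::field" where
  "gen_x = (\<lambda>w. if w = [LX] then 1 else 0)"

definition gen_y :: "letter list \<Rightarrow> 'k::field" where
  "gen_y = (\<lambda>w. if w = [LY] then 1 else 0)"

definition ideal1 :: "'k::field \<Rightarrow> (letter list \<Rightarrow> 'k) set" where
  "ideal1 a = (let F = free_alg; x = gen_x; y = gen_y in
     Idl\<^bsub>F\<^esub> {x \<otimes>\<^bsub>F\<^esub> x \<ominus>\<^bsub>F\<^esub> y \<otimes>\<^bsub>F\<^esub> y, y \<otimes>\<^bsub>F\<^esub> x \<ominus>\<^bsub>F\<^esub> a \<odot>\<^bsub>F\<^esub> (x \<otimes>\<^bsub>F\<^esub> x), x \<otimes>\<^bsub>F\<^esub> y})"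

definition ideal2 :: "'k::field \<Rightarrow> nat \<Rightarrow> (letter list \<Rightarrow> 'k) set" where
  "ideal2 a m = (let F = free_alg; x = gen_x; y = gen_y in
     Idl\<^bsub>F\<^esub> {x \<otimes>\<^bsub>F\<^esub> x, y \<otimes>\<^bsub>F\<^esub> y,
       ((x \<otimes>\<^bsub>F\<^esub> y) [^]\<^bsub>F\<^esub> m) \<ominus>\<^bsub>F\<^esub> a \<odot>\<^bsub>F\<^esub> ((y \<otimes>\<^bsub>F\<^esub> x) [^]\<^bsub>F\<^esub> m)})"

definition ideal3 :: "nat \<Rightarrow> (letter list \<Rightarrow> 'k::field) set" where
  "ideal3 n = (let F = free_alg; x = gen_x; y = gen_y in
     Idl\<^bsub>F\<^esub> {(x [^]\<^bsub>F\<^esub> n) \<ominus>\<^bsub>F\<^esub> (y [^]\<^bsub>F\<^esub> n), x \<otimes>\<^bsub>F\<^esub> y, y \<otimes>\<^bsub>F\<^esub> x})"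

definition ideal4 :: "nat \<Rightarrow> (letter list \<Rightarrow> 'k::field) set" where
  "ideal4 m = (let F = free_alg; x = gen_x; y = gen_y in
     Idl\<^bsub>F\<^esub> {x \<otimes>\<^bsub>F\<^esub> x, y \<otimes>\<^bsub>F\<^esub> y,
       ((x \<otimes>\<^bsub>F\<^esub> y) [^]\<^bsub>F\<^esub> m) \<otimes>\<^bsub>F\<^esub> x \<ominus>\<^bsub>F\<^esub> ((y \<otimes>\<^bsub>F\<^esub> x) [^]\<^bsub>F\<^esub> m) \<otimes>\<^bsub>F\<^esub> y})"

definition tame_ideals :: "(letter list \<Rightarrow> 'k::field) set set" where
  "tame_ideals = {ideal1 a | a. a \<noteq> 0} \<union> {ideal2 a m | a m. a \<noteq> 0 \<and> m \<ge> 1} \<union>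
     {ideal3 n | n. n \<ge> 2} \<union> {ideal4 m | m. m \<ge> 1}"

abbreviation dual_quot :: "(letter list \<Rightarrow> 'k::field) set \<Rightarrow> ('k, (letter list \<Rightarrow> 'k) set \<Rightarrow> 'k) coalg" where
  "dual_quot I \<equiv> dual_coalgebra (quot_alg free_alg I)"


section \<open>Representation type\<close>

text \<open>Modules of dimension \<open>d\<close> are given by algebra homomorphisms into \<open>d \<times> d\<close> matrices.\<close>

definition is_rep :: "('k::field, 'v, 'm) module_scheme \<Rightarrow> nat \<Rightarrow> ('v \<Rightarrow> 'k mat) \<Rightarrow> bool" where
  "is_rep A d \<rho> \<longleftrightarrow> (\<forall>a\<in>carrier A. \<rho> a \<in> carrier_mat d d) \<and>
     (\<forall>a\<in>carrier A. \<forall>b\<in>carrier A. \<rho> (a \<oplus>\<^bsub>A\<^esub> b) = \<rho> a + \<rho> b \<and> \<rho> (a \<otimes>\<^bsub>A\<^esub> b) = \<rho> a * \<rho> b) \<and>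
     (\<forall>c. \<forall>a\<in>carrier A. \<rho> (c \<odot>\<^bsub>A\<^esub> a) = c \<cdot>\<^sub>m \<rho> a) \<and> \<rho> \<one>\<^bsub>A\<^esub> = 1\<^sub>m d"

definition rep_equiv ::
  "('k::field, 'v, 'm) module_scheme \<Rightarrow> nat \<Rightarrow> ('v \<Rightarrow> 'k mat) \<Rightarrow> ('v \<Rightarrow> 'k mat) \<Rightarrow> bool" where
  "rep_equiv A d \<rho> \<sigma> \<longleftrightarrow>
     (\<exists>P\<in>carrier_mat d d. invertible_mat P \<and> (\<forall>a\<in>carrier A. P * \<rho> a = \<sigma> a * P))"

definition indecomposable_rep ::
  "('k::field, 'v, 'm) module_scheme \<Rightarrow> nat \<Rightarrow> ('v \<Rightarrow> 'k mat) \<Rightarrow> bool" where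
  "indecomposable_rep A d \<rho> \<longleftrightarrow> is_rep A d \<rho> \<and> d > 0 \<and>
     \<not> (\<exists>d1 d2 \<rho>1 \<rho>2. d1 > 0 \<and> d2 > 0 \<and> d = d1 + d2 \<and> is_rep A d1 \<rho>1 \<and> is_rep A d2 \<rho>2 \<and>
          rep_equiv A d \<rho> (\<lambda>a. four_block_mat (\<rho>1 a) (0\<^sub>m d1 d2) (0\<^sub>m d2 d1) (\<rho>2 a)))"

definition finite_rep_type :: "('k::field, 'v, 'm) module_scheme \<Rightarrow> bool" where
  "finite_rep_type A \<longleftrightarrow> (\<exists>S. finite S \<and>
     (\<forall>d \<rho>. indecomposable_rep A d \<rho> \<longrightarrow> (\<exists>\<sigma>. (d, \<sigma>) \<in> S \<and> rep_equiv A d \<rho> \<sigma>)))"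

text \<open>An \<open>A\<close>-\<open>k[t]\<close>-bimodule that is free of rank \<open>d\<close> over \<open>k[t]\<close>; tensoring it with
  \<open>k[t]/(t - s)\<close> amounts to evaluating the matrix entries at \<open>s\<close>.\<close>

definition is_poly_rep :: "('k::field, 'v, 'm) module_scheme \<Rightarrow> nat \<Rightarrow> ('v \<Rightarrow> 'k poly mat) \<Rightarrow> bool" where
  "is_poly_rep A d \<rho> \<longleftrightarrow> (\<forall>a\<in>carrier A. \<rho> a \<in> carrier_mat d d) \<and>
     (\<forall>a\<in>carrier A. \<forall>b\<in>carrier A. \<rho> (a \<oplus>\<^bsub>A\<^esub> b) = \<rho> a + \<rho> b \<and> \<rho> (a \<otimes>\<^bsub>A\<^esub> b) = \<rho> a * \<rho> b) \<and>
     (\<forall>c. \<forall>a\<in>carrier A. \<rho> (c \<odot>\<^bsub>A\<^esub> a) = [:c:] \<cdot>\<^sub>m \<rho> a) \<and> \<rho> \<one>\<^bsub>A\<^esub> = 1\<^sub>m d"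

text \<open>Tameness in the sense of Drozd, excluding finite type. Only bimodules of rank \<open>d\<close> can
  contribute modules of dimension \<open>d\<close>.\<close>

definition tame_rep_type :: "('k::field, 'v, 'm) module_scheme \<Rightarrow> bool" where
  "tame_rep_type A \<longleftrightarrow> \<not> finite_rep_type A \<and>
     (\<forall>d>0. \<exists>Fam E. finite Fam \<and> finite E \<and> (\<forall>M\<in>Fam. is_poly_rep A d M) \<and>
        (\<forall>\<rho>. indecomposable_rep A d \<rho> \<longrightarrow>
           (\<exists>\<sigma>\<in>E. rep_equiv A d \<rho> \<sigma>) \<or>
           (\<exists>M\<in>Fam. \<exists>s. rep_equiv A d \<rho> (\<lambda>a. map_mat (\<lambda>p. poly p s) (M a)))))"

definition tame_corep_type :: "('k::field, 'v) coalg \<Rightarrow> bool" where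
  "tame_corep_type C \<longleftrightarrow> tame_rep_type (dual_algebra C)"


section \<open>The associated coradically graded Hopf algebra\<close>

text \<open>\<open>corad_below H n\<close> is \<open>H\<^bsub>n-1\<^esub>\<close>, with \<open>H\<^bsub>-1\<^esub> = 0\<close>.\<close>

definition corad_below :: "('k::field, 'v) coalg \<Rightarrow> nat \<Rightarrow> 'v set" where
  "corad_below H n = (case n of 0 \<Rightarrow> {\<zero>\<^bsub>H\<^esub>} | Suc m \<Rightarrow> corad_filt H m)"

text \<open>The class in degree \<open>n\<close> of \<open>h \<in> H\<^sub>n\<close>, as an element of the direct sum.\<close>

definition gr_class :: "('k::field, 'v) coalg \<Rightarrow> nat \<Rightarrow> 'v \<Rightarrow> nat \<Rightarrow> 'v set" where
  "gr_class H n h = (\<lambda>k. corad_below H k +>\<^bsub>H\<^esub> (if k = n then h else \<zero>\<^bsub>H\<^esub>))"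

definition rep :: "'v set \<Rightarrow> 'v" where
  "rep X = (SOME x. x \<in> X)"

definition gr_alg :: "('k::field, 'v) coalg \<Rightarrow> ('k, nat \<Rightarrow> 'v set) module" where
  "gr_alg H =
    \<lparr>carrier = {f. (\<forall>n. \<exists>h\<in>corad_filt H n. f n = corad_below H n +>\<^bsub>H\<^esub> h) \<and>
                   finite {n. f n \<noteq> corad_below H n}},
     mult = (\<lambda>f g n. corad_below H n +>\<^bsub>H\<^esub> (\<Oplus>\<^bsub>H\<^esub>i\<in>{..n}. rep (f i) \<otimes>\<^bsub>H\<^esub> rep (g (n - i)))),
     one = gr_class H 0 \<one>\<^bsub>H\<^esub>,
     zero = corad_below H,
     add = (\<lambda>f g n. f n <+>\<^bsub>H\<^esub> g n),
     smult = (\<lambda>c f n. corad_below H n +>\<^bsub>H\<^esub> (c \<odot>\<^bsub>H\<^esub> rep (f n)))\<rparr>"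

text \<open>Comultiplication of the class of \<open>h \<in> H\<^sub>n\<close>: write the comultiplication of \<open>h\<close> as a sum of
  tensors \<open>a \<otimes> b\<close> with \<open>a \<in> H\<^sub>i\<close>, \<open>b \<in> H\<^bsub>n-i\<^esub>\<close>, and take classes in degrees \<open>i\<close> and \<open>n - i\<close>.\<close>

definition gr_comult_hom ::
  "('k::field, 'v) coalg \<Rightarrow> nat \<Rightarrow> 'v \<Rightarrow> ('k, nat \<Rightarrow> 'v set, nat \<Rightarrow> 'v set) tensor" where
  "gr_comult_hom H n h = (THE T. \<exists>(r::nat) i a b.
     (\<forall>l<r. i l \<le> n \<and> a l \<in> corad_filt H (i l) \<and> b l \<in> corad_filt H (n - i l)) \<and>
     comult H h = (\<lambda>\<beta>\<in>bilinear_forms H H. \<Sum>l<r. \<beta> (a l) (b l)) \<and>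
     T = (\<lambda>\<beta>\<in>bilinear_forms (gr_alg H) (gr_alg H).
            \<Sum>l<r. \<beta> (gr_class H (i l) (a l)) (gr_class H (n - i l) (b l))))"

definition gr :: "('k::field, 'v) coalg \<Rightarrow> ('k, nat \<Rightarrow> 'v set) coalg" where
  "gr H = with_coalg (gr_alg H)
     (\<lambda>f. \<lambda>\<beta>\<in>bilinear_forms (gr_alg H) (gr_alg H).
        \<Sum>n | f n \<noteq> corad_below H n. gr_comult_hom H n (rep (f n)) \<beta>)
     (\<lambda>f. counit H (rep (f 0)))"

definition gr_component :: "('k::field, 'v) coalg \<Rightarrow> nat \<Rightarrow> (nat \<Rightarrow> 'v set) set" where
  "gr_component H n = gr_class H n ` corad_filt H n"

text \<open>Cosets of \<open>H\<^bsub>-1\<^esub> = 0\<close> are singletons, so degree 0 is identified with the coradical of \<open>H\<close>;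
  the inclusion is \<open>gr_class H 0\<close>.\<close>

definition gr_proj :: "(nat \<Rightarrow> 'v set) \<Rightarrow> 'v" where
  "gr_proj f = rep (f 0)"

definition coinvariants :: "('k::field, 'v) coalg \<Rightarrow> (nat \<Rightarrow> 'v set) set" where
  "coinvariants H = {f \<in> carrier (gr H).
     tensor_map (gr H) (corad_hopf H) id gr_proj (comult (gr H) f) =
     pure_tensor (gr H) (corad_hopf H) f \<one>\<^bsub>H\<^esub>}"

text \<open>The subalgebra of coinvariants with its comultiplication as a braided Hopf algebra,
  \<open>r \<mapsto> r\<^sub>1 S(\<pi>(r\<^sub>2)) \<otimes> r\<^sub>3\<close>.\<close>

definition braided_R :: "('k::field, 'v) coalg \<Rightarrow> ('k, nat \<Rightarrow> 'v set) coalg" where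
  "braided_R H = (let G = gr H; R = G\<lparr>carrier := coinvariants H\<rparr> in
     R\<lparr>comult := (\<lambda>r. THE T. T \<in> carrier (tensor_product R R) \<and>
        tensor_map G G id id T =
        (\<lambda>\<beta>\<in>bilinear_forms G G. comult G r (\<lambda>r1 s. comult G s (\<lambda>r2 r3.
           \<beta> (r1 \<otimes>\<^bsub>G\<^esub> gr_class H 0 (antipode (corad_hopf H) (gr_proj r2))) r3))))\<rparr>)"


section \<open>Braided Hopf algebras and the Radford biproduct\<close>

text \<open>\<open>B\<close> is a Hopf algebra in the category of left-left Yetter-Drinfeld modules over \<open>H\<close>, with
  action \<open>act\<close> and coaction \<open>coact\<close>.\<close>

definition left_module ::
  "('k::field, 'h) coalg \<Rightarrow> ('k, 'b) coalg \<Rightarrow> ('h \<Rightarrow> 'b \<Rightarrow> 'b) \<Rightarrow> bool" where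
  "left_module H B act \<longleftrightarrow>
     (\<forall>h\<in>carrier H. act h \<in> LinearCombinations.module_hom class_ring B B) \<and>
     (\<forall>b\<in>carrier B. (\<lambda>h. act h b) \<in> LinearCombinations.module_hom class_ring H B) \<and>
     (\<forall>g\<in>carrier H. \<forall>h\<in>carrier H. \<forall>b\<in>carrier B. act (g \<otimes>\<^bsub>H\<^esub> h) b = act g (act h b)) \<and>
     (\<forall>b\<in>carrier B. act \<one>\<^bsub>H\<^esub> b = b)"

definition left_comodule ::
  "('k::field, 'h) coalg \<Rightarrow> ('k, 'b) coalg \<Rightarrow> ('b \<Rightarrow> ('k, 'h, 'b) tensor) \<Rightarrow> bool" where
  "left_comodule H B coact \<longleftrightarrow>
     coact \<in> LinearCombinations.module_hom class_ring B (tensor_product H B) \<and>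
     (\<forall>b\<in>carrier B. \<forall>\<gamma>\<in>trilinear_forms H H B.
        coact b (\<lambda>x b0. comult H x (\<lambda>x1 x2. \<gamma> x1 x2 b0)) =
        coact b (\<lambda>x b0. coact b0 (\<lambda>z b00. \<gamma> x z b00))) \<and>
     (\<forall>b\<in>carrier B. \<forall>\<phi>\<in>linear_forms B. coact b (\<lambda>x b0. counit H x * \<phi> b0) = \<phi> b)"

definition yetter_drinfeld ::
  "('k::field, 'h) coalg \<Rightarrow> ('k, 'b) coalg \<Rightarrow> ('h \<Rightarrow> 'b \<Rightarrow> 'b) \<Rightarrow> ('b \<Rightarrow> ('k, 'h, 'b) tensor) \<Rightarrow> bool" where
  "yetter_drinfeld H B act coact \<longleftrightarrow> left_module H B act \<and> left_comodule H B coact \<and>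
     (\<forall>h\<in>carrier H. \<forall>b\<in>carrier B. \<forall>\<beta>\<in>bilinear_forms H B.
        comult H h (\<lambda>h1 h2. coact b (\<lambda>x b0. \<beta> (h1 \<otimes>\<^bsub>H\<^esub> x) (act h2 b0))) =
        comult H h (\<lambda>h1 h2. coact (act h1 b) (\<lambda>x b0. \<beta> (x \<otimes>\<^bsub>H\<^esub> h2) b0)))"

definition module_comodule_algebra ::
  "('k::field, 'h) coalg \<Rightarrow> ('k, 'b) coalg \<Rightarrow> ('h \<Rightarrow> 'b \<Rightarrow> 'b) \<Rightarrow> ('b \<Rightarrow> ('k, 'h, 'b) tensor) \<Rightarrow> bool" where
  "module_comodule_algebra H B act coact \<longleftrightarrow>
     (\<forall>h\<in>carrier H. \<forall>a\<in>carrier B. \<forall>b\<in>carrier B. \<forall>\<phi>\<in>linear_forms B.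
        \<phi> (act h (a \<otimes>\<^bsub>B\<^esub> b)) = comult H h (\<lambda>h1 h2. \<phi> (act h1 a \<otimes>\<^bsub>B\<^esub> act h2 b))) \<and>
     (\<forall>h\<in>carrier H. act h \<one>\<^bsub>B\<^esub> = counit H h \<odot>\<^bsub>B\<^esub> \<one>\<^bsub>B\<^esub>) \<and>
     (\<forall>a\<in>carrier B. \<forall>b\<in>carrier B. \<forall>\<beta>\<in>bilinear_forms H B.
        coact (a \<otimes>\<^bsub>B\<^esub> b) \<beta> =
        coact a (\<lambda>x a0. coact b (\<lambda>z b0. \<beta> (x \<otimes>\<^bsub>H\<^esub> z) (a0 \<otimes>\<^bsub>B\<^esub> b0)))) \<and>
     coact \<one>\<^bsub>B\<^esub> = pure_tensor H B \<one>\<^bsub>H\<^esub> \<one>\<^bsub>B\<^esub>"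

definition module_comodule_coalgebra ::
  "('k::field, 'h) coalg \<Rightarrow> ('k, 'b) coalg \<Rightarrow> ('h \<Rightarrow> 'b \<Rightarrow> 'b) \<Rightarrow> ('b \<Rightarrow> ('k, 'h, 'b) tensor) \<Rightarrow> bool" where
  "module_comodule_coalgebra H B act coact \<longleftrightarrow>
     (\<forall>h\<in>carrier H. \<forall>b\<in>carrier B. \<forall>\<beta>\<in>bilinear_forms B B.
        comult B (act h b) \<beta> =
        comult H h (\<lambda>h1 h2. comult B b (\<lambda>b1 b2. \<beta> (act h1 b1) (act h2 b2)))) \<and>
     (\<forall>h\<in>carrier H. \<forall>b\<in>carrier B. counit B (act h b) = counit H h * counit B b) \<and>
     (\<forall>b\<in>carrier B. \<forall>\<gamma>\<in>trilinear_forms H B B.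
        coact b (\<lambda>x b0. comult B b0 (\<lambda>c d. \<gamma> x c d)) =
        comult B b (\<lambda>b1 b2. coact b1 (\<lambda>x c. coact b2 (\<lambda>z d. \<gamma> (x \<otimes>\<^bsub>H\<^esub> z) c d)))) \<and>
     (\<forall>b\<in>carrier B. \<forall>\<phi>\<in>linear_forms H.
        coact b (\<lambda>x b0. \<phi> x * counit B b0) = \<phi> (counit B b \<odot>\<^bsub>H\<^esub> \<one>\<^bsub>H\<^esub>))"

definition yd_hopf_algebra ::
  "('k::field, 'h) coalg \<Rightarrow> ('k, 'b) coalg \<Rightarrow> ('h \<Rightarrow> 'b \<Rightarrow> 'b) \<Rightarrow> ('b \<Rightarrow> ('k, 'h, 'b) tensor) \<Rightarrow> bool" where
  "yd_hopf_algebra H B act coact \<longleftrightarrow>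
     k_algebra B \<and> coalgebra B \<and> yetter_drinfeld H B act coact \<and>
     module_comodule_algebra H B act coact \<and> module_comodule_coalgebra H B act coact \<and>
     (\<forall>a\<in>carrier B. \<forall>b\<in>carrier B. \<forall>\<beta>\<in>bilinear_forms B B.
        comult B (a \<otimes>\<^bsub>B\<^esub> b) \<beta> =
        comult B a (\<lambda>a1 a2. comult B b (\<lambda>b1 b2. coact a2 (\<lambda>x a20.
          \<beta> (a1 \<otimes>\<^bsub>B\<^esub> act x b1) (a20 \<otimes>\<^bsub>B\<^esub> b2))))) \<and>
     comult B \<one>\<^bsub>B\<^esub> = pure_tensor B B \<one>\<^bsub>B\<^esub> \<one>\<^bsub>B\<^esub> \<and>
     (\<forall>a\<in>carrier B. \<forall>b\<in>carrier B. counit B (a \<otimes>\<^bsub>B\<^esub> b) = counit B a * counit B b) \<and>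
     counit B \<one>\<^bsub>B\<^esub> = 1 \<and>
     (\<exists>S. is_antipode B S \<and>
        (\<forall>h\<in>carrier H. \<forall>b\<in>carrier B. S (act h b) = act h (S b)) \<and>
        (\<forall>b\<in>carrier B. coact (S b) = tensor_map H B id S (coact b)))"

text \<open>Smash product \<open>(a # g)(b # h) = a (g\<^sub>1 b) # g\<^sub>2 h\<close> and smash coproduct
  \<open>b # h \<mapsto> (b\<^sub>1 # (b\<^sub>2)\<^bsub>-1\<^esub> h\<^sub>1) \<otimes> ((b\<^sub>2)\<^bsub>0\<^esub> # h\<^sub>2)\<close> on \<open>B \<otimes> H\<close>.\<close>

definition biproduct_alg ::
  "('k::field, 'h) coalg \<Rightarrow> ('k, 'b) coalg \<Rightarrow> ('h \<Rightarrow> 'b \<Rightarrow> 'b) \<Rightarrow> ('k, ('k, 'b, 'h) tensor) module" where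
  "biproduct_alg H B act = (tensor_product B H)
    \<lparr>mult := (\<lambda>T U. \<lambda>\<beta>\<in>bilinear_forms B H. T (\<lambda>a g. U (\<lambda>b h. comult H g (\<lambda>g1 g2.
        \<beta> (a \<otimes>\<^bsub>B\<^esub> act g1 b) (g2 \<otimes>\<^bsub>H\<^esub> h))))),
     one := pure_tensor B H \<one>\<^bsub>B\<^esub> \<one>\<^bsub>H\<^esub>\<rparr>"

definition biproduct ::
  "('k::field, 'h) coalg \<Rightarrow> ('k, 'b) coalg \<Rightarrow> ('h \<Rightarrow> 'b \<Rightarrow> 'b) \<Rightarrow> ('b \<Rightarrow> ('k, 'h, 'b) tensor) \<Rightarrow>
   ('k, ('k, 'b, 'h) tensor) coalg" where
  "biproduct H B act coact = with_coalg (biproduct_alg H B act)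
     (\<lambda>T. \<lambda>\<Gamma>\<in>bilinear_forms (biproduct_alg H B act) (biproduct_alg H B act).
        T (\<lambda>b h. comult B b (\<lambda>b1 b2. coact b2 (\<lambda>x b20. comult H h (\<lambda>h1 h2.
          \<Gamma> (pure_tensor B H b1 (x \<otimes>\<^bsub>H\<^esub> h1)) (pure_tensor B H b20 h2))))))
     (\<lambda>T. T (\<lambda>b h. counit B b * counit H h))"

definition iso_to_biproduct ::
  "('k::field, 'v) coalg \<Rightarrow> ('k, 'b) coalg \<Rightarrow> ('k, 'h) coalg \<Rightarrow> bool" where
  "iso_to_biproduct H D L \<longleftrightarrow> (\<exists>m e act coact.
     yd_hopf_algebra L (D\<lparr>mult := m, one := e\<rparr>) act coact \<and>
     hopf_iso H (biproduct L (D\<lparr>mult := m, one := e\<rparr>) act coact))"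


section \<open>Multiplicative and primitive matrices\<close>

definition unit_line :: "('k::field, 'v) coalg \<Rightarrow> 'v set" where
  "unit_line G = {c \<odot>\<^bsub>G\<^esub> \<one>\<^bsub>G\<^esub> | c. True}"

definition S_one :: "('k::field, 'v) coalg \<Rightarrow> 'v set set" where
  "S_one G = {D \<in> simple_subcoalgebras G. D <+>\<^bsub>G\<^esub> unit_line G \<noteq> wedge G D (unit_line G)}"

definition basic_mult_matrix :: "('k::field, 'v) coalg \<Rightarrow> 'v set \<Rightarrow> 'v mat \<Rightarrow> bool" where
  "basic_mult_matrix G D M \<longleftrightarrow> square_mat M \<and>
     inj_on (\<lambda>p. M $$ p) ({..<dim_row M} \<times> {..<dim_row M}) \<and>
     vectorspace.basis class_ring (G\<lparr>carrier := D\<rparr>) ((\<lambda>p. M $$ p) ` ({..<dim_row M} \<times> {..<dim_row M})) \<and>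
     (\<forall>i<dim_row M. \<forall>j<dim_row M.
        comult G (M $$ (i, j)) =
          (\<lambda>\<beta>\<in>bilinear_forms G G. \<Sum>t<dim_row M. \<beta> (M $$ (i, t)) (M $$ (t, j))) \<and>
        counit G (M $$ (i, j)) = (if i = j then 1 else 0))"

definition nontrivial_primitive :: "('k::field, 'v) coalg \<Rightarrow> 'v mat \<Rightarrow> 'v vec \<Rightarrow> bool" where
  "nontrivial_primitive G M X \<longleftrightarrow> dim_vec X = dim_row M \<and>
     (\<forall>i<dim_vec X. X $ i \<in> carrier G \<and>
        comult G (X $ i) = (\<lambda>\<beta>\<in>bilinear_forms G G.
          (\<Sum>k<dim_vec X. \<beta> (M $$ (i, k)) (X $ k)) + \<beta> (X $ i) \<one>\<^bsub>G\<^esub>)) \<and>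
     (\<exists>i<dim_vec X. X $ i \<notin> coradical G)"

text \<open>\<open>G\<^sub>1/G\<^sub>0\<close> is handled as a subspace of \<open>G/G\<^sub>0\<close>, where the coactions \<open>(id \<otimes> q)\<Delta>\<close> and
  \<open>(q \<otimes> id)\<Delta>\<close> are available.\<close>

definition complete_family :: "('k::field, 'v) coalg \<Rightarrow> 'v set \<Rightarrow> 'v mat \<Rightarrow> 'v vec set \<Rightarrow> bool" where
  "complete_family G D M F \<longleftrightarrow>
    (let Q = quot_space G (corad_filt G 0);
         q = (\<lambda>w. corad_filt G 0 +>\<^bsub>G\<^esub> w);
         P = q ` corad_filt G 1;
         s = (\<lambda>X. LinearCombinations.module.span class_ring Q {q (X $ i) | i. i < dim_vec X})
     in (\<forall>X\<in>F. nontrivial_primitive G M X) \<and>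
        (\<forall>F' w. finite F' \<and> F' \<subseteq> F \<and> (\<forall>X\<in>F'. w X \<in> s X) \<and> finsum Q w F' = \<zero>\<^bsub>Q\<^esub> \<longrightarrow>
           (\<forall>X\<in>F'. w X = \<zero>\<^bsub>Q\<^esub>)) \<and>
        LinearCombinations.module.span class_ring Q (\<Union>X\<in>F. s X) =
          {q w | w. w \<in> corad_filt G 1 \<and>
             tensor_map G Q id q (comult G w) \<in> tensors G Q D P \<and>
             tensor_map Q G q id (comult G w) \<in> tensors Q G P (unit_line G)})"

definition is_P_one :: "('k::field, 'v) coalg \<Rightarrow> ('v set \<Rightarrow> 'v mat) \<Rightarrow> 'v vec set \<Rightarrow> bool" where
  "is_P_one G bm P \<longleftrightarrow>
     (\<exists>F. (\<forall>D\<in>S_one G. complete_family G D (bm D) (F D)) \<and> P = (\<Union>D\<in>S_one G. F D))"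

definition scalar_mat_mult ::
  "('k::field, 'v) coalg \<Rightarrow> 'k mat \<Rightarrow> 'v mat \<Rightarrow> 'v mat" where
  "scalar_mat_mult G K M = mat (dim_row K) (dim_col M)
     (\<lambda>(i, j). \<Oplus>\<^bsub>G\<^esub>l\<in>{..<dim_col K}. K $$ (i, l) \<odot>\<^bsub>G\<^esub> M $$ (l, j))"

end

theory Submission
  imports Defs
begin

text \<open>Since \<open>K\<close> is diagonal, the braided comultiplication of the coinvariants \<open>R\<close>, evaluated on words in
  \<open>u\<close> and \<open>v\<close>, is that of the tensor algebra with a diagonal braiding whose matrix \<open>q\<close> consists of
  the \<open>\<alpha>\<^sub>i\<close>. The isomorphism of \<open>R\<close> with the dual of \<open>k\<langle>x,y\<rangle>/I\<close> turns \<open>x\<close> and \<open>y\<close> into functionals on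
  words whose convolution products separate \<open>R\<close>. Evaluated on words of
  length two, the quadratic relations in \<open>I\<close> force \<open>\<alpha>\<^sub>1 = \<alpha>\<^sub>4 = -1\<close>; then \<open>u\<^sup>2 = v\<^sup>2 = 0\<close> and only alternating
  words survive. The functionals dual to \<open>u\<close> and \<open>v\<close> descend to \<open>R\<close>, and their convolution products
  pair with alternating words through the products \<open>(1 - Q) \<cdots> (1 - Q\<^sup>k)\<close>, where \<open>Q = \<alpha>\<^sub>2 \<alpha>\<^sub>3\<close>. Since
  \<open>R\<close> is finite-dimensional, \<open>Q\<close> is a root of unity, of order \<open>m\<close> say. The pairing of alternating
  words is nondegenerate in lengths less than \<open>2 m\<close>, while the two alternating words of length \<open>2 m\<close>
  are proportional in \<open>R\<close> and the longer ones vanish. So the pairing identifies \<open>R\<close> with the dual of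
  \<open>k\<langle>x,y\<rangle>/(x\<^sup>2, y\<^sup>2, (xy)\<^sup>m - a (yx)\<^sup>m)\<close>, where \<open>a\<close> is the factor of proportionality.\<close>

section \<open>Vector spaces and linear forms\<close>

text \<open>The given isomorphism of coalgebras need not respect degrees: the functionals on words
  that it yields may have components in every positive degree, and at first only their values on
  single letters are under control. So the new ideal is not recognised inside \<open>I\<close>; it
  is built from the pairing of words. A linear change makes the functionals agree on letters with
  the coordinates of u and v. The grading of R then shows that they differ from the coordinates by
  combinations of products of at least two factors (\<open>\<tau>_ind\<close>), and descending
  induction on the length removes this error. Independence of u and v is derived from independence
  of the entries of the matrix of C, and these entries must first be shown to have degree 0. Tensors
  are handled through the forms on which they are tested, so subspaces enter through projections,
  along which forms extend. The constant a is the scalar that a letter collects when it leaves the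
  longest alternating word at its far end instead of at the front; its sign comes from the diagonal
  entries -1 of q, and exchanging x and y inverts it, which explains the two alternatives for
  a.\<close>

locale vs =
  fixes V :: "('k::field, 'v, 'm) module_scheme" (structure)
  assumes vectorspace: "vectorspace class_ring V"
begin

lemma module: "Module.module class_ring V"
  using vectorspace by (simp add: vectorspace_def)

lemma abelian_group: "abelian_group V"
  using module by (simp add: Module.module_def)

sublocale abelian_group V by (rule abelian_group)

lemma smult_closed [simp, intro]: "x \<in> carrier V \<Longrightarrow> c \<odot> x \<in> carrier V"
  using module.smult_closed[OF module] by simp

lemma smult_add: "x \<in> carrier V \<Longrightarrow> (c + d) \<odot> x = c \<odot> x \<oplus> d \<odot> x"
  using module.smult_l_distr[OF module] by simp

lemma smult_distrib: "x \<in> carrier V \<Longrightarrow> y \<in> carrier V \<Longrightarrow> c \<odot> (x \<oplus> y) = c \<odot> x \<oplus> c \<odot> y"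
  using module.smult_r_distr[OF module] by simp

lemma smult_smult: "x \<in> carrier V \<Longrightarrow> c \<odot> (d \<odot> x) = (c * d) \<odot> x"
  using module.smult_assoc1[OF module] by simp

lemma smult_1 [simp]: "x \<in> carrier V \<Longrightarrow> 1 \<odot> x = x"
  using module.smult_one[OF module] by simp

lemma smult_0 [simp]: "x \<in> carrier V \<Longrightarrow> 0 \<odot> x = \<zero>"
  using module.lmult_0[OF module] by simp

lemma smult_zero [simp]: "c \<odot> \<zero> = \<zero>"
  using module.rmult_0[OF module] by simp

lemma smult_cancel: "x \<in> carrier V \<Longrightarrow> c \<odot> x \<oplus> (- c) \<odot> x = \<zero>"
  by (simp flip: smult_add)

lemma minus_eq_smult: "x \<in> carrier V \<Longrightarrow> y \<in> carrier V \<Longrightarrow> x \<ominus> y = x \<oplus> (- 1) \<odot> y"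
  using smult_cancel[of y 1] minus_equality[of "(- 1) \<odot> y" y] by (simp add: minus_eq a_comm)

lemma add_swap:
  "a \<in> carrier V \<Longrightarrow> b \<in> carrier V \<Longrightarrow> c \<in> carrier V \<Longrightarrow> d \<in> carrier V \<Longrightarrow>
   (a \<oplus> b) \<oplus> (c \<oplus> d) = (a \<oplus> c) \<oplus> (b \<oplus> d)"
  by (simp add: a_ac)

lemma subspace_iff: "subspace class_ring W V \<longleftrightarrow>
    W \<subseteq> carrier V \<and> \<zero> \<in> W \<and> (\<forall>x\<in>W. \<forall>y\<in>W. x \<oplus> y \<in> W) \<and> (\<forall>c. \<forall>x\<in>W. c \<odot> x \<in> W)"
  by (auto simp: subspace_def submodule_def vectorspace module)

lemma subspaceD:
  assumes "subspace class_ring W V"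
  shows "x \<in> W \<Longrightarrow> x \<in> carrier V" "\<zero> \<in> W" "x \<in> W \<Longrightarrow> y \<in> W \<Longrightarrow> x \<oplus> y \<in> W" "x \<in> W \<Longrightarrow> c \<odot> x \<in> W"
    "x \<in> W \<Longrightarrow> y \<in> W \<Longrightarrow> x \<ominus> y \<in> W" "W \<subseteq> carrier V"
  using assms by (auto simp: subspace_iff minus_eq_smult subset_iff)

lemma subspace_carrier: "subspace class_ring (carrier V) V"
  by (simp add: subspace_iff)

lemma subspace_zero: "subspace class_ring {\<zero>} V"
  by (simp add: subspace_iff)

lemma linear_formsD:
  assumes "\<phi> \<in> linear_forms V"
  shows "x \<in> carrier V \<Longrightarrow> y \<in> carrier V \<Longrightarrow> \<phi> (x \<oplus> y) = \<phi> x + \<phi> y"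
    "x \<in> carrier V \<Longrightarrow> \<phi> (c \<odot> x) = c * \<phi> x" "\<phi> \<zero> = 0"
    "x \<in> carrier V \<Longrightarrow> y \<in> carrier V \<Longrightarrow> \<phi> (x \<ominus> y) = \<phi> x - \<phi> y"
proof -
  show a: "x \<in> carrier V \<Longrightarrow> y \<in> carrier V \<Longrightarrow> \<phi> (x \<oplus> y) = \<phi> x + \<phi> y" for x y
    using assms by (auto simp: linear_forms_def)
  show s: "x \<in> carrier V \<Longrightarrow> \<phi> (c \<odot> x) = c * \<phi> x" for x c
    using assms by (auto simp: linear_forms_def)
  show "\<phi> \<zero> = 0" using s[of \<zero> 0] by simp
  show "x \<in> carrier V \<Longrightarrow> y \<in> carrier V \<Longrightarrow> \<phi> (x \<ominus> y) = \<phi> x - \<phi> y"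
    by (simp add: minus_eq_smult a s)
qed

lemma linear_formsI:
  "(\<And>x y. x \<in> carrier V \<Longrightarrow> y \<in> carrier V \<Longrightarrow> \<phi> (x \<oplus> y) = \<phi> x + \<phi> y) \<Longrightarrow>
   (\<And>c x. x \<in> carrier V \<Longrightarrow> \<phi> (c \<odot> x) = c * \<phi> x) \<Longrightarrow> \<phi> \<in> linear_forms V"
  by (simp add: linear_forms_def)

lemma linear_form_zero: "(\<lambda>x. 0) \<in> linear_forms V"
  by (rule linear_formsI) auto

lemma linear_form_add: "\<phi> \<in> linear_forms V \<Longrightarrow> \<psi> \<in> linear_forms V \<Longrightarrow> (\<lambda>x. \<phi> x + \<psi> x) \<in> linear_forms V"
  by (rule linear_formsI) (auto simp: linear_formsD algebra_simps)

lemma linear_form_diff: "\<phi> \<in> linear_forms V \<Longrightarrow> \<psi> \<in> linear_forms V \<Longrightarrow> (\<lambda>x. \<phi> x - \<psi> x) \<in> linear_forms V"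
  by (rule linear_formsI) (auto simp: linear_formsD algebra_simps)

lemma linear_form_scale: "\<phi> \<in> linear_forms V \<Longrightarrow> (\<lambda>x. c * \<phi> x) \<in> linear_forms V"
  by (rule linear_formsI) (auto simp: linear_formsD algebra_simps)

lemma linear_form_scale': "\<phi> \<in> linear_forms V \<Longrightarrow> (\<lambda>x. \<phi> x * c) \<in> linear_forms V"
  by (rule linear_formsI) (auto simp: linear_formsD algebra_simps)

lemma linear_form_sum: "(\<And>i. i \<in> A \<Longrightarrow> \<phi> i \<in> linear_forms V) \<Longrightarrow> (\<lambda>x. \<Sum>i\<in>A. \<phi> i x) \<in> linear_forms V"
  by (rule linear_formsI) (auto simp: linear_formsD sum.distrib sum_distrib_left)

text \<open>Zorn's lemma, since no finite dimension is assumed. If a maximal subspace M meeting W in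
  zero left a vector x outside W + M, then M plus the line of x would still meet W in zero: an
  element m + c x of W with c nonzero would express x through W and M.\<close>

lemma complement:
  assumes W: "subspace class_ring W V"
  obtains W' where "subspace class_ring W' V" "W \<inter> W' = {\<zero>}"
    "\<And>x. x \<in> carrier V \<Longrightarrow> \<exists>w\<in>W. \<exists>w'\<in>W'. x = w \<oplus> w'"
proof -
  define A where "A = {U. subspace class_ring U V \<and> W \<inter> U = {\<zero>}}"
  have "{\<zero>} \<in> A" using W by (auto simp: A_def subspace_iff)
  moreover have "\<Union>C \<in> A" if ne: "C \<noteq> {}" and "subset.chain A C" for C
  proof -
    have C: "U \<in> C \<Longrightarrow> subspace class_ring U V \<and> W \<inter> U = {\<zero>}" for U
      using that by (auto simp: A_def subset.chain_def)
    have ch: "U \<in> C \<Longrightarrow> U' \<in> C \<Longrightarrow> U \<subseteq> U' \<or> U' \<subseteq> U" for U U'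
      using that by (auto simp: subset.chain_def)
    have "subspace class_ring (\<Union>C) V" unfolding subspace_iff
    proof (intro conjI ballI allI)
      fix x y assume "x \<in> \<Union>C" "y \<in> \<Union>C"
      then obtain U U' where "x \<in> U" "U \<in> C" "y \<in> U'" "U' \<in> C" by auto
      with ch[of U U'] C[of U] C[of U'] show "x \<oplus> y \<in> \<Union>C"
        unfolding subspace_iff by (metis (no_types, lifting) UnionI subset_eq)
    next
      fix c x assume "x \<in> \<Union>C"
      then obtain U where "x \<in> U" "U \<in> C" by auto
      with C[of U] show "c \<odot> x \<in> \<Union>C" unfolding subspace_iff by blast
    next
      show "\<Union>C \<subseteq> carrier V" using C unfolding subspace_iff by blast
      obtain U where "U \<in> C" using ne by auto
      with C[of U] have "\<zero> \<in> U" using subspaceD(2) by simp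
      with \<open>U \<in> C\<close> show "\<zero> \<in> \<Union>C" by (meson UnionI)
    qed
    with C that(1) show ?thesis by (auto simp: A_def)
  qed
  ultimately obtain M where M: "M \<in> A" "\<And>X. X \<in> A \<Longrightarrow> M \<subseteq> X \<Longrightarrow> X = M"
    using subset_Zorn_nonempty[of A] by blast
  from M(1) have sM: "subspace class_ring M V" and iM: "W \<inter> M = {\<zero>}" by (auto simp: A_def)
  have "\<exists>w\<in>W. \<exists>m\<in>M. x = w \<oplus> m" if x: "x \<in> carrier V" for x
  proof (rule ccontr)
    assume no: "\<not> ?thesis"
    define U where "U = {m \<oplus> c \<odot> x | m c. m \<in> M}"
    have "subspace class_ring U V" unfolding subspace_iff
    proof (intro conjI ballI allI subsetI)
      show "\<zero> \<in> U" unfolding U_def using subspaceD(2)[OF sM] x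
        by (auto intro!: exI[of _ \<zero>] exI[of _ 0])
      fix y z assume "y \<in> U" "z \<in> U"
      then obtain m c m' c' where "y = m \<oplus> c \<odot> x" "m \<in> M" "z = m' \<oplus> c' \<odot> x" "m' \<in> M" by (auto simp: U_def)
      then have "y \<oplus> z = (m \<oplus> m') \<oplus> (c + c') \<odot> x" "m \<oplus> m' \<in> M"
        using subspaceD[OF sM] x by (auto simp: smult_add add_swap)
      then show "y \<oplus> z \<in> U" unfolding U_def by blast
    next
      fix d y assume "y \<in> U"
      then obtain m c where "y = m \<oplus> c \<odot> x" "m \<in> M" by (auto simp: U_def)
      then have "d \<odot> y = d \<odot> m \<oplus> (d * c) \<odot> x" "d \<odot> m \<in> M"
        using subspaceD[OF sM] x by (auto simp: smult_distrib smult_smult)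
      then show "d \<odot> y \<in> U" unfolding U_def by blast
    qed (use subspaceD[OF sM] x in \<open>auto simp: U_def\<close>)
    moreover have "W \<inter> U = {\<zero>}"
    proof -
      have "y = \<zero>" if yW: "y \<in> W" and yU: "y \<in> U" for y
      proof -
        obtain m c where y: "y = m \<oplus> c \<odot> x" "m \<in> M" using yU by (auto simp: U_def)
        have mc: "m \<in> carrier V" using y subspaceD[OF sM] by auto
        show ?thesis
        proof (cases "c = 0")
          case True then show ?thesis using y x mc yW iM by auto
        next
          case False
          have "(1/c) \<odot> y \<oplus> (-(1/c)) \<odot> m = (((1/c) \<odot> m \<oplus> (-(1/c)) \<odot> m)) \<oplus> x"
            using False mc x by (simp add: y smult_distrib smult_smult a_ac)
          also have "\<dots> = x" using mc x by (simp only: smult_cancel) simp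
          finally have "x = (1/c) \<odot> y \<oplus> (-(1/c)) \<odot> m" by simp
          with no subspaceD(4)[OF W yW] subspaceD(4)[OF sM y(2)] show ?thesis by blast
        qed
      qed
      then show ?thesis
        using subspaceD(2)[OF W] subspaceD(2)[OF \<open>subspace class_ring U V\<close>] by blast
    qed
    ultimately have "U \<in> A" by (simp add: A_def)
    moreover have "M \<subseteq> U"
    proof
      fix m assume "m \<in> M"
      then have "m = m \<oplus> 0 \<odot> x" using x subspaceD[OF sM] by simp
      then show "m \<in> U" unfolding U_def using \<open>m \<in> M\<close> by blast
    qed
    ultimately have "U = M" using M(2) by blast
    moreover have "x \<in> U" using x subspaceD(2)[OF sM] by (auto simp: U_def intro!: exI[of _ \<zero>] exI[of _ 1])
    ultimately have "x = \<zero> \<oplus> x" "x \<in> M" using x by auto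
    with no subspaceD(2)[OF W] show False by blast
  qed
  with sM iM that show thesis by blast
qed

text \<open>Projections take the place of bases and of restriction to subspaces: composing with one
  extends a form from W to V.\<close>

lemma projection:
  assumes W: "subspace class_ring W V"
  obtains P where "P \<in> LinearCombinations.module_hom class_ring V V" "\<And>x. x \<in> carrier V \<Longrightarrow> P x \<in> W" "\<And>w. w \<in> W \<Longrightarrow> P w = w"
proof -
  obtain W' where sW': "subspace class_ring W' V" and i: "W \<inter> W' = {\<zero>}"
    and dec: "\<And>x. x \<in> carrier V \<Longrightarrow> \<exists>w\<in>W. \<exists>w'\<in>W'. x = w \<oplus> w'"
    using complement[OF W] by metis
  note D = subspaceD[OF W] and D' = subspaceD[OF sW']
  have uniq: "w1 = w2" if "w1 \<in> W" "w2 \<in> W" "a \<in> W'" "b \<in> W'" "w1 \<oplus> a = w2 \<oplus> b" for w1 w2 a b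
  proof -
    have c: "w1 \<in> carrier V" "w2 \<in> carrier V" "a \<in> carrier V" "b \<in> carrier V" using that D D' by auto
    have "w1 \<ominus> w2 = b \<ominus> a"
    proof -
      have "(w1 \<ominus> w2) \<ominus> (b \<ominus> a) = (w1 \<oplus> a) \<ominus> (w2 \<oplus> b)"
        using c by (simp add: minus_eq minus_add a_ac)
      also have "\<dots> = \<zero>" using c that(5) by (simp add: minus_eq r_neg)
      finally show ?thesis using c minus_other_side[of "w1 \<ominus> w2" "b \<ominus> a"] by simp
    qed
    then have "w1 \<ominus> w2 \<in> W \<inter> W'" using D(5)[OF that(1,2)] D'(5)[OF that(4,3)] by simp
    then show ?thesis using i c by (simp add: minus_other_side)
  qed
  define P where "P x = (SOME w. w \<in> W \<and> (\<exists>w'\<in>W'. x = w \<oplus> w'))" for x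
  have P: "P x \<in> W \<and> (\<exists>w'\<in>W'. x = P x \<oplus> w')" if "x \<in> carrier V" for x
    unfolding P_def by (rule someI_ex) (use dec[OF that] in blast)
  have Peq: "P x = w" if "w \<in> W" "w' \<in> W'" "x = w \<oplus> w'" for x w w'
  proof -
    have "x \<in> carrier V" using that D D' by auto
    from P[OF this] obtain w'' where "P x \<in> W" "w'' \<in> W'" "x = P x \<oplus> w''" by blast
    with uniq[of "P x" w w'' w'] that show ?thesis by simp
  qed
  have "P \<in> LinearCombinations.module_hom class_ring V V" unfolding LinearCombinations.module_hom_def
  proof (safe, goal_cases)
    case (1 x) then show ?case using P D by blast
  next
    case (2 x y)
    obtain a b where a: "a \<in> W'" "x = P x \<oplus> a" "b \<in> W'" "y = P y \<oplus> b" using P 2 by metis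
    have c: "P x \<in> carrier V" "P y \<in> carrier V" "a \<in> carrier V" "b \<in> carrier V" using P 2 a D D' by auto
    have "x \<oplus> y = (P x \<oplus> P y) \<oplus> (a \<oplus> b)" using c a(2,4) by (metis add_swap)
    then show ?case by (rule Peq[rotated 2]) (use P 2 a D D' in auto)
  next
    case (3 r x)
    obtain a where a: "a \<in> W'" "x = P x \<oplus> a" using P 3 by metis
    have c: "P x \<in> carrier V" "a \<in> carrier V" using P 3 a D D' by auto
    have "r \<odot> x = r \<odot> P x \<oplus> r \<odot> a" using c a(2) by (metis smult_distrib)
    then show ?case by (rule Peq[rotated 2]) (use P 3 a D D' in auto)
  qed
  moreover have "P w = w" if "w \<in> W" for w by (rule Peq[OF that D'(2)]) (use that D in simp)
  ultimately show thesis using P that by blast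
qed

text \<open>With P a projection onto W, the vector v - P v is nonzero, and g x is the coordinate of
  x - P x along it, read off after a projection onto its line.\<close>

lemma separating_form:
  assumes W: "subspace class_ring W V" and v: "v \<in> carrier V" "v \<notin> W"
  obtains g where "g \<in> linear_forms V" "g v = 1" "\<And>w. w \<in> W \<Longrightarrow> g w = 0"
proof -
  obtain P where P: "P \<in> LinearCombinations.module_hom class_ring V V" "\<And>x. x \<in> carrier V \<Longrightarrow> P x \<in> W" "\<And>w. w \<in> W \<Longrightarrow> P w = w"
    by (rule projection[OF W]) blast
  have Pc: "x \<in> carrier V \<Longrightarrow> P x \<in> carrier V" for x using P(2) subspaceD[OF W] by auto
  have Pa: "P (x \<oplus> y) = P x \<oplus> P y" "P (c \<odot> x) = c \<odot> P x" if "x \<in> carrier V" "y \<in> carrier V" for x y c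
    using P(1) that by (auto simp: LinearCombinations.module_hom_def)
  define v' where "v' = v \<ominus> P v"
  have v': "v' \<in> carrier V" using v Pc by (simp add: v'_def)
  have nz: "v' \<noteq> \<zero>"
  proof
    assume "v' = \<zero>"
    then have "v = P v" using minus_other_side[OF v(1) Pc[OF v(1)]] by (simp add: v'_def)
    with P(2)[OF v(1)] v(2) show False by simp
  qed
  have sL: "subspace class_ring {c \<odot> v' | c. True} V"
    unfolding subspace_iff
  proof (intro conjI ballI allI subsetI)
    show "\<zero> \<in> {c \<odot> v' | c. True}" using v' by (auto intro!: exI[of _ 0])
    show "x \<oplus> y \<in> {c \<odot> v' | c. True}" if "x \<in> {c \<odot> v' | c. True}" "y \<in> {c \<odot> v' | c. True}" for x y
      using that v' by (auto simp flip: smult_add)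
    show "d \<odot> x \<in> {c \<odot> v' | c. True}" if "x \<in> {c \<odot> v' | c. True}" for x d
      using that v' by (auto simp: smult_smult)
  qed (use v' in auto)
  obtain Q where Q: "Q \<in> LinearCombinations.module_hom class_ring V V" "\<And>x. x \<in> carrier V \<Longrightarrow> Q x \<in> {c \<odot> v' | c. True}"
    "\<And>w. w \<in> {c \<odot> v' | c. True} \<Longrightarrow> Q w = w"
    by (rule projection[OF sL]) blast
  have Qa: "Q (x \<oplus> y) = Q x \<oplus> Q y" "Q (c \<odot> x) = c \<odot> Q x" if "x \<in> carrier V" "y \<in> carrier V" for x y c
    using Q(1) that by (auto simp: LinearCombinations.module_hom_def)
  have inj: "c = d" if "c \<odot> v' = d \<odot> v'" for c d
  proof (rule ccontr)
    assume "c \<noteq> d"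
    have "(c - d) \<odot> v' = c \<odot> v' \<oplus> (- d) \<odot> v'" using v' by (simp flip: smult_add)
    also have "\<dots> = \<zero>" using v' by (simp add: that smult_cancel)
    finally have "(1 / (c - d)) \<odot> ((c - d) \<odot> v') = \<zero>" by simp
    then show False using \<open>c \<noteq> d\<close> v' nz by (simp add: smult_smult)
  qed
  define h where "h x = (SOME c. Q x = c \<odot> v')" for x
  have h: "Q x = h x \<odot> v'" if "x \<in> carrier V" for x
    unfolding h_def by (rule someI_ex) (use Q(2)[OF that] in auto)
  have heq: "h x = c" if "Q x = c \<odot> v'" "x \<in> carrier V" for x c using h that inj by metis
  have hl: "h \<in> linear_forms V"
  proof (rule linear_formsI)
    show "h (x \<oplus> y) = h x + h y" if "x \<in> carrier V" "y \<in> carrier V" for x y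
      by (rule heq) (use that in \<open>simp_all add: Qa smult_add v' flip: h\<close>)
    show "h (c \<odot> x) = c * h x" if "x \<in> carrier V" for x c
      by (rule heq) (use that in \<open>simp_all add: Qa v' flip: h smult_smult\<close>)
  qed
  define g where "g x = h (x \<ominus> P x)" for x
  have "g \<in> linear_forms V"
    by (rule linear_formsI) (simp_all add: g_def linear_formsD[OF hl] Pc Pa algebra_simps)
  moreover have "g v = 1"
  proof -
    have "Q v' = 1 \<odot> v'" by (rule Q(3)[of v', THEN trans]) (use v' in \<open>auto intro!: exI[of _ 1]\<close>)
    then show ?thesis unfolding g_def v'_def[symmetric] using v' by (rule heq)
  qed
  moreover have "g w = 0" if "w \<in> W" for w
    using that P(3)[OF that] linear_formsD(3)[OF hl] subspaceD[OF W]
    by (simp add: g_def) (metis minus_other_side)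
  ultimately show thesis using that by blast
qed

lemma forms_separate:
  assumes "x \<in> carrier V" "y \<in> carrier V" "\<And>\<phi>. \<phi> \<in> linear_forms V \<Longrightarrow> \<phi> x = \<phi> y"
  shows "x = y"
proof (rule ccontr)
  assume "x \<noteq> y"
  then have "x \<ominus> y \<notin> {\<zero>}" using assms by (simp add: minus_other_side)
  then obtain g where "g \<in> linear_forms V" "g (x \<ominus> y) = 1"
    using separating_form[OF subspace_zero, of "x \<ominus> y"] assms by auto
  with assms(1,2) assms(3)[of g] show False by (simp add: linear_formsD)
qed

lemma in_subspaceI:
  assumes "subspace class_ring W V" "x \<in> carrier V"
    "\<And>\<phi>. \<phi> \<in> linear_forms V \<Longrightarrow> (\<And>w. w \<in> W \<Longrightarrow> \<phi> w = 0) \<Longrightarrow> \<phi> x = 0"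
  shows "x \<in> W"
proof (rule ccontr)
  assume "x \<notin> W"
  then obtain g where "g \<in> linear_forms V" "g x = 1" "\<And>w. w \<in> W \<Longrightarrow> g w = 0"
    by (rule separating_form[OF assms(1,2)]) blast
  with assms(3)[of g] show False by simp
qed

definition lincomb :: "'i set \<Rightarrow> ('i \<Rightarrow> 'k) \<Rightarrow> ('i \<Rightarrow> 'v) \<Rightarrow> 'v" where
  "lincomb A c e = (\<Oplus>i\<in>A. c i \<odot> e i)"

lemma lincomb_in:
  assumes "subspace class_ring W V" "\<And>i. i \<in> A \<Longrightarrow> e i \<in> W"
  shows "lincomb A c e \<in> W"
  using assms(2)
proof (induction A rule: infinite_finite_induct)
  case (insert i A)
  then have "lincomb (insert i A) c e = c i \<odot> e i \<oplus> lincomb A c e"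
    unfolding lincomb_def using subspaceD(1)[OF assms(1)] by (subst finsum_insert) auto
  then show ?case using insert subspaceD[OF assms(1)] by simp
qed (use subspaceD(2)[OF assms(1)] in \<open>simp_all add: lincomb_def\<close>)

lemma lincomb_closed: "(\<And>i. i \<in> A \<Longrightarrow> e i \<in> carrier V) \<Longrightarrow> lincomb A c e \<in> carrier V"
  using lincomb_in[OF subspace_carrier] by blast

lemma lincomb_insert:
  assumes "finite A" "i \<notin> A" "\<And>j. j \<in> insert i A \<Longrightarrow> e j \<in> carrier V"
  shows "lincomb (insert i A) c e = c i \<odot> e i \<oplus> lincomb A c e"
  unfolding lincomb_def using assms by (subst finsum_insert) auto

lemma form_lincomb:
  assumes "\<phi> \<in> linear_forms V" "\<And>i. i \<in> A \<Longrightarrow> e i \<in> carrier V"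
  shows "\<phi> (lincomb A c e) = (\<Sum>i\<in>A. c i * \<phi> (e i))"
  using assms(2)
proof (induction A rule: infinite_finite_induct)
  case (insert i A)
  have "\<phi> (lincomb (insert i A) c e) = \<phi> (c i \<odot> e i) + \<phi> (lincomb A c e)"
  proof -
    have e: "e i \<in> carrier V" "lincomb A c e \<in> carrier V" using insert by (auto intro!: lincomb_closed)
    show ?thesis using insert linear_formsD(1)[OF assms(1) smult_closed[OF e(1)] e(2)]
      by (subst lincomb_insert) auto
  qed
  with insert show ?case by (simp add: linear_formsD(2)[OF assms(1)])
qed (use linear_formsD(3)[OF assms(1)] in \<open>simp_all add: lincomb_def\<close>)

text \<open>Induction on A: inside the kernel of \<open>\<theta> j\<close> the remaining forms
  suffice, and a general x is moved into that kernel by subtracting a multiple of a vector e with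
  \<open>\<theta> j e = 1\<close>. W may be infinite-dimensional, as is the free algebra to which
  this is applied.\<close>

lemma kernel_lemma:
  assumes "finite A" "\<And>i. i \<in> A \<Longrightarrow> \<theta> i \<in> linear_forms V" "\<phi> \<in> linear_forms V"
    and "subspace class_ring W V" "\<And>x. x \<in> W \<Longrightarrow> (\<And>i. i \<in> A \<Longrightarrow> \<theta> i x = 0) \<Longrightarrow> \<phi> x = 0"
  shows "\<exists>a. \<forall>x\<in>W. \<phi> x = (\<Sum>i\<in>A. a i * \<theta> i x)"
  using assms
proof (induction A arbitrary: W rule: finite_induct)
  case (insert j A)
  note D = subspaceD[OF insert.prems(3)]
  have tj: "\<theta> j \<in> linear_forms V" using insert.prems by simp
  define W' where "W' = {x \<in> W. \<theta> j x = 0}"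
  have "subspace class_ring W' V"
    unfolding subspace_iff W'_def using D by (auto simp: linear_formsD[OF tj])
  moreover have "\<phi> x = 0" if "x \<in> W'" "\<And>i. i \<in> A \<Longrightarrow> \<theta> i x = 0" for x
    using that insert.prems(4)[of x] by (auto simp: W'_def)
  ultimately obtain a where a: "\<And>x. x \<in> W' \<Longrightarrow> \<phi> x = (\<Sum>i\<in>A. a i * \<theta> i x)"
    using insert.IH[of W'] insert.prems by auto
  show ?case
  proof (cases "\<forall>x\<in>W. \<theta> j x = 0")
    case True
    then show ?thesis using a insert.hyps by (auto simp: W'_def intro!: exI[of _ a])
  next
    case False
    then obtain e0 where e0: "e0 \<in> W" "\<theta> j e0 \<noteq> 0" by auto
    define e where "e = (1 / \<theta> j e0) \<odot> e0"
    have e: "e \<in> W" "\<theta> j e = 1" using e0 D by (auto simp: e_def linear_formsD[OF tj])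
    define b where "b = a(j := \<phi> e - (\<Sum>i\<in>A. a i * \<theta> i e))"
    have "\<phi> x = (\<Sum>i\<in>insert j A. b i * \<theta> i x)" if x: "x \<in> W" for x
    proof -
      let ?y = "x \<ominus> \<theta> j x \<odot> e"
      have xc: "x \<in> carrier V" "\<theta> j x \<odot> e \<in> carrier V" "e \<in> carrier V" using D x e by auto
      have "?y \<in> W'" using D(5)[OF x D(4)[OF e(1)]] xc e by (simp add: W'_def linear_formsD[OF tj])
      from a[OF this] have "\<phi> x - \<theta> j x * \<phi> e = (\<Sum>i\<in>A. a i * \<theta> i ?y)"
        using xc by (simp add: linear_formsD[OF insert.prems(2)])
      also have "\<dots> = (\<Sum>i\<in>A. a i * (\<theta> i x - \<theta> j x * \<theta> i e))"
        by (rule sum.cong) (use xc insert.prems(1) in \<open>auto simp: linear_formsD\<close>)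
      also have "\<dots> = (\<Sum>i\<in>A. a i * \<theta> i x) - \<theta> j x * (\<Sum>i\<in>A. a i * \<theta> i e)"
        by (simp add: sum_subtractf sum_distrib_left algebra_simps)
      finally have "\<phi> x = (\<Sum>i\<in>A. a i * \<theta> i x) + (\<phi> e - (\<Sum>i\<in>A. a i * \<theta> i e)) * \<theta> j x"
        by (simp add: algebra_simps)
      moreover have "(\<Sum>i\<in>A. b i * \<theta> i x) = (\<Sum>i\<in>A. a i * \<theta> i x)"
        by (rule sum.cong) (use insert.hyps in \<open>auto simp: b_def\<close>)
      ultimately show ?thesis using insert.hyps by (simp add: b_def)
    qed
    then show ?thesis by blast
  qed
qed auto

text \<open>The vectors \<open>e i\<close> may be dependent, so the coefficients c are not unique;
  the point is to choose them linearly in x. A vector \<open>e n\<close> that depends on the earlier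
  ones gets coefficient zero; otherwise a form separating it from their span reads off its
  coefficient. Membership in a span is expressed by testing on forms.\<close>

lemma frame:
  fixes n :: nat
  assumes "\<And>i. i < n \<Longrightarrow> e i \<in> carrier V"
  shows "\<exists>\<phi>. (\<forall>i<n. \<phi> i \<in> linear_forms V) \<and>
    (\<forall>x\<in>carrier V. \<forall>c. (\<forall>\<psi>\<in>linear_forms V. \<psi> x = (\<Sum>i<n. c i * \<psi> (e i))) \<longrightarrow>
       (\<forall>\<psi>\<in>linear_forms V. \<psi> x = (\<Sum>i<n. \<phi> i x * \<psi> (e i))))"
  using assms
proof (induction n)
  case (Suc n)
  define W where "W = {x \<in> carrier V. \<exists>c. \<forall>\<psi>\<in>linear_forms V. \<psi> x = (\<Sum>i<n. c i * \<psi> (e i))}"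
  obtain \<phi> where \<phi>: "\<And>i. i < n \<Longrightarrow> \<phi> i \<in> linear_forms V"
    "\<And>x \<psi>. x \<in> W \<Longrightarrow> \<psi> \<in> linear_forms V \<Longrightarrow> \<psi> x = (\<Sum>i<n. \<phi> i x * \<psi> (e i))"
  proof -
    have "\<And>i. i < n \<Longrightarrow> e i \<in> carrier V" using Suc.prems by simp
    from Suc.IH[OF this] obtain \<phi> where "\<forall>i<n. \<phi> i \<in> linear_forms V"
      "\<forall>x\<in>carrier V. \<forall>c. (\<forall>\<psi>\<in>linear_forms V. \<psi> x = (\<Sum>i<n. c i * \<psi> (e i))) \<longrightarrow>
       (\<forall>\<psi>\<in>linear_forms V. \<psi> x = (\<Sum>i<n. \<phi> i x * \<psi> (e i)))" by blast
    then show thesis by (intro that[of \<phi>]) (auto simp: W_def)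
  qed
  have en: "e n \<in> carrier V" using Suc.prems by simp
  have sW: "subspace class_ring W V" unfolding subspace_iff
  proof (intro conjI ballI allI)
    show "\<zero> \<in> W" unfolding W_def by (auto simp: linear_formsD intro!: exI[of _ "\<lambda>_. 0"])
    fix x y assume "x \<in> W" "y \<in> W"
    then obtain c d where "x \<in> carrier V" "y \<in> carrier V" "\<And>\<psi>. \<psi>\<in>linear_forms V \<Longrightarrow> \<psi> x = (\<Sum>i<n. c i * \<psi> (e i))"
      "\<And>\<psi>. \<psi>\<in>linear_forms V \<Longrightarrow> \<psi> y = (\<Sum>i<n. d i * \<psi> (e i))" unfolding W_def by blast
    then show "x \<oplus> y \<in> W" unfolding W_def
      by (auto simp: linear_formsD sum.distrib algebra_simps intro!: exI[of _ "\<lambda>i. c i + d i"])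
  next
    fix b x assume "x \<in> W"
    then obtain c where "x \<in> carrier V" "\<And>\<psi>. \<psi>\<in>linear_forms V \<Longrightarrow> \<psi> x = (\<Sum>i<n. c i * \<psi> (e i))"
      unfolding W_def by blast
    then show "b \<odot> x \<in> W" unfolding W_def
      by (auto simp: linear_formsD mult.assoc simp flip: sum_distrib_left intro!: exI[of _ "\<lambda>i. b * c i"])
  qed (auto simp: W_def)
  show ?case
  proof (cases "e n \<in> W")
    case True
    then obtain d where d: "\<And>\<psi>. \<psi>\<in>linear_forms V \<Longrightarrow> \<psi> (e n) = (\<Sum>i<n. d i * \<psi> (e i))"
      unfolding W_def by auto
    have "x \<in> W" if "x \<in> carrier V" "\<forall>\<psi>\<in>linear_forms V. \<psi> x = (\<Sum>i<Suc n. c i * \<psi> (e i))" for x c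
    proof -
      have "\<psi> x = (\<Sum>i<n. (c i + c n * d i) * \<psi> (e i))" if "\<psi> \<in> linear_forms V" for \<psi>
        using that \<open>\<forall>\<psi>\<in>linear_forms V. \<psi> x = _\<close> by (simp add: d algebra_simps sum.distrib sum_distrib_left)
      then show ?thesis unfolding W_def using that by (auto intro!: exI[of _ "\<lambda>i. c i + c n * d i"])
    qed
    then show ?thesis using \<phi>
      by (intro exI[of _ "\<phi>(n := \<lambda>x. 0)"]) (auto simp: less_Suc_eq linear_form_zero)
  next
    case False
    then obtain g where g: "g \<in> linear_forms V" "g (e n) = 1" "\<And>w. w \<in> W \<Longrightarrow> g w = 0"
      by (rule separating_form[OF sW en]) blast
    define \<phi>' where "\<phi>' = (\<lambda>i x. if i = n then g x else \<phi> i (x \<ominus> g x \<odot> e n))"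
    have "\<phi>' i \<in> linear_forms V" if "i < Suc n" for i
    proof (cases "i = n")
      case True then show ?thesis using g(1) by (simp add: \<phi>'_def)
    next
      case False
      with that have "\<phi> i \<in> linear_forms V" using \<phi> by simp
      note L = linear_formsD[OF this] linear_formsD[OF g(1)]
      show ?thesis by (rule linear_formsI) (use False en in \<open>simp_all add: \<phi>'_def L algebra_simps\<close>)
    qed
    moreover have "\<psi> x = (\<Sum>i<Suc n. \<phi>' i x * \<psi> (e i))"
      if x: "x \<in> carrier V" and c: "\<forall>\<psi>\<in>linear_forms V. \<psi> x = (\<Sum>i<Suc n. c i * \<psi> (e i))"
        and psi: "\<psi> \<in> linear_forms V" for x c \<psi>
    proof -
      have eW: "e i \<in> W" if "i < n" for i
        using that Suc.prems unfolding W_def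
        by (auto intro!: exI[of _ "\<lambda>j. if j = i then 1 else 0"] simp: if_distrib[of "\<lambda>c. c * _"] cong: if_cong)
      have "g x = c n" using c[rule_format, OF g(1)] g eW by simp
      then have "x \<ominus> g x \<odot> e n \<in> W"
        unfolding W_def using c x en by (auto simp: linear_formsD intro!: exI[of _ c])
      from \<phi>(2)[OF this psi] have "\<psi> x - g x * \<psi> (e n) = (\<Sum>i<n. \<phi> i (x \<ominus> g x \<odot> e n) * \<psi> (e i))"
        using x en psi by (simp add: linear_formsD)
      then show ?thesis by (simp add: \<phi>'_def algebra_simps)
    qed
    ultimately show ?thesis by (intro exI[of _ \<phi>']) blast
  qed
qed auto

end

section \<open>Tensors\<close>

lemma finite_enumerate:
  assumes "finite I"
  obtains n :: nat and h where "bij_betw h {..<n} I"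
  using ex_bij_betw_nat_finite[OF assms] that by (auto simp: atLeast0LessThan)

lemma bilinear_formsI:
  "(\<And>v. v \<in> carrier V \<Longrightarrow> \<beta> v \<in> linear_forms W) \<Longrightarrow>
   (\<And>w. w \<in> carrier W \<Longrightarrow> (\<lambda>v. \<beta> v w) \<in> linear_forms V) \<Longrightarrow> \<beta> \<in> bilinear_forms V W"
  by (simp add: bilinear_forms_def)

lemma bilinear_formsD:
  assumes "\<beta> \<in> bilinear_forms V W"
  shows "v \<in> carrier V \<Longrightarrow> \<beta> v \<in> linear_forms W" "w \<in> carrier W \<Longrightarrow> (\<lambda>v. \<beta> v w) \<in> linear_forms V"
  using assms by (auto simp: bilinear_forms_def)

lemma linear_forms_cong:
  assumes "vs V" "\<And>v. v \<in> carrier V \<Longrightarrow> \<phi> v = \<psi> v"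
  shows "\<phi> \<in> linear_forms V \<longleftrightarrow> \<psi> \<in> linear_forms V"
proof -
  interpret vs V by fact
  show ?thesis using assms(2) by (auto simp: linear_forms_def)
qed

lemma bilinear_forms_cong:
  assumes "vs V" "vs W" "\<And>v w. v \<in> carrier V \<Longrightarrow> w \<in> carrier W \<Longrightarrow> \<beta> v w = \<gamma> v w"
  shows "\<beta> \<in> bilinear_forms V W \<longleftrightarrow> \<gamma> \<in> bilinear_forms V W"
proof -
  have "\<beta> v \<in> linear_forms W \<longleftrightarrow> \<gamma> v \<in> linear_forms W" if "v \<in> carrier V" for v
    by (rule linear_forms_cong) (use assms that in auto)
  moreover have "(\<lambda>v. \<beta> v w) \<in> linear_forms V \<longleftrightarrow> (\<lambda>v. \<gamma> v w) \<in> linear_forms V" if "w \<in> carrier W" for w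
    by (rule linear_forms_cong) (use assms that in auto)
  ultimately show ?thesis by (auto simp: bilinear_forms_def)
qed

lemma bilinear_form_prod:
  assumes "vs V" "vs W" "\<phi> \<in> linear_forms V" "\<psi> \<in> linear_forms W"
  shows "(\<lambda>a b. \<phi> a * \<psi> b) \<in> bilinear_forms V W"
  using assms by (intro bilinear_formsI vs.linear_form_scale vs.linear_form_scale')

lemma bilinear_form_zero: "vs V \<Longrightarrow> vs W \<Longrightarrow> (\<lambda>a b. 0) \<in> bilinear_forms V W"
  by (intro bilinear_formsI vs.linear_form_zero)

lemma bilinear_form_add:
  assumes "vs V" "vs W" "\<beta> \<in> bilinear_forms V W" "\<gamma> \<in> bilinear_forms V W"
  shows "(\<lambda>a b. \<beta> a b + \<gamma> a b) \<in> bilinear_forms V W"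
  using assms by (intro bilinear_formsI vs.linear_form_add) (auto dest: bilinear_formsD)

lemma bilinear_form_scale:
  assumes "vs V" "vs W" "\<beta> \<in> bilinear_forms V W"
  shows "(\<lambda>a b. c * \<beta> a b) \<in> bilinear_forms V W"
  using assms by (intro bilinear_formsI vs.linear_form_scale) (auto dest: bilinear_formsD)

lemma bilinear_form_sum:
  assumes "vs V" "vs W" "\<And>i. i \<in> A \<Longrightarrow> \<beta> i \<in> bilinear_forms V W"
  shows "(\<lambda>a b. \<Sum>i\<in>A. \<beta> i a b) \<in> bilinear_forms V W"
  using assms by (intro bilinear_formsI vs.linear_form_sum) (auto dest: bilinear_formsD)

lemma linear_form_comp:
  assumes "vs V" "f \<in> LinearCombinations.module_hom class_ring V W" "\<phi> \<in> linear_forms W"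
  shows "(\<lambda>x. \<phi> (f x)) \<in> linear_forms V"
proof -
  have "f x \<in> carrier W" if "x \<in> carrier V" for x
    using assms(2) that by (auto simp: LinearCombinations.module_hom_def)
  then show ?thesis using assms(2,3) by (simp add: linear_forms_def LinearCombinations.module_hom_def)
qed

lemma bilinear_form_comp:
  assumes "vs V" "vs V'" "f \<in> LinearCombinations.module_hom class_ring V W"
    "g \<in> LinearCombinations.module_hom class_ring V' W'" "\<beta> \<in> bilinear_forms W W'"
  shows "(\<lambda>a b. \<beta> (f a) (g b)) \<in> bilinear_forms V V'"
proof (rule bilinear_formsI)
  fix v assume "v \<in> carrier V"
  then have "f v \<in> carrier W" using assms(3) by (auto simp: LinearCombinations.module_hom_def)
  from linear_form_comp[OF assms(2,4) bilinear_formsD(1)[OF assms(5) this]]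
  show "(\<lambda>b. \<beta> (f v) (g b)) \<in> linear_forms V'" .
next
  fix w assume "w \<in> carrier V'"
  then have "g w \<in> carrier W'" using assms(4) by (auto simp: LinearCombinations.module_hom_def)
  from linear_form_comp[OF assms(1,3) bilinear_formsD(2)[OF assms(5) this]]
  show "(\<lambda>v. \<beta> (f v) (g w)) \<in> linear_forms V" .
qed

text \<open>Expanding the \<open>b i\<close> by a frame of themselves turns the tensor into the sum
  of the \<open>y j \<otimes> b j\<close>, where \<open>y j\<close> collects the \<open>a l\<close>.
  The hypothesis, with a coordinate form of the frame for g, says that every form vanishes on
  \<open>y j\<close>, so \<open>y j\<close> is zero.\<close>

lemma product_forms_separate:
  fixes n :: nat
  assumes V: "vs V" and W: "vs W" and ab: "\<And>i. i < n \<Longrightarrow> a i \<in> carrier V" "\<And>i. i < n \<Longrightarrow> b i \<in> carrier W"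
    and z: "\<And>f g. f \<in> linear_forms V \<Longrightarrow> g \<in> linear_forms W \<Longrightarrow> (\<Sum>i<n. f (a i) * g (b i)) = 0"
    and \<beta>: "\<beta> \<in> bilinear_forms V W"
  shows "(\<Sum>i<n. \<beta> (a i) (b i)) = 0"
proof -
  interpret V: vs V by fact
  interpret W: vs W by fact
  obtain \<phi> where \<phi>: "\<And>i. i < n \<Longrightarrow> \<phi> i \<in> linear_forms W"
    "\<And>x c \<psi>. x \<in> carrier W \<Longrightarrow> (\<forall>\<psi>\<in>linear_forms W. \<psi> x = (\<Sum>i<n. c i * \<psi> (b i))) \<Longrightarrow>
       \<psi>\<in>linear_forms W \<Longrightarrow> \<psi> x = (\<Sum>i<n. \<phi> i x * \<psi> (b i))"
    using W.frame[of n b] ab(2) by blast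
  have b: "\<psi> (b l) = (\<Sum>i<n. \<phi> i (b l) * \<psi> (b i))" if "l < n" "\<psi> \<in> linear_forms W" for l \<psi>
  proof -
    have "\<psi> (b l) = (\<Sum>i<n. (if i = l then 1 else 0) * \<psi> (b i))" if "\<psi> \<in> linear_forms W" for \<psi>
      using \<open>l < n\<close> by (subst sum.remove[of _ l]) (auto intro!: sum.neutral)
    then show ?thesis using \<phi>(2)[of "b l" "\<lambda>j. if j = l then 1 else 0"] that ab by blast
  qed
  define y where "y j = V.lincomb {..<n} (\<lambda>l. \<phi> j (b l)) a" for j
  have y: "y j \<in> carrier V" for j unfolding y_def by (rule V.lincomb_closed) (use ab in auto)
  have fy: "f (y j) = (\<Sum>l<n. \<phi> j (b l) * f (a l))" if "f \<in> linear_forms V" for f j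
    unfolding y_def by (rule V.form_lincomb) (use that ab in auto)
  have y0: "y j = \<zero>\<^bsub>V\<^esub>" if "j < n" for j
    by (rule V.forms_separate[OF y]) (use z[OF _ \<phi>(1)[OF that]] in \<open>simp_all add: fy V.linear_formsD mult.commute\<close>)
  have "(\<Sum>i<n. \<beta> (a i) (b i)) = (\<Sum>i<n. \<Sum>j<n. \<phi> j (b i) * \<beta> (a i) (b j))"
    by (rule sum.cong[OF refl], rule b) (use ab bilinear_formsD(1)[OF \<beta>] in auto)
  also have "\<dots> = (\<Sum>j<n. \<Sum>i<n. \<phi> j (b i) * \<beta> (a i) (b j))" by (rule sum.swap)
  also have "\<dots> = (\<Sum>j<n. \<beta> (y j) (b j))"
    by (rule sum.cong[OF refl]) (use fy[OF bilinear_formsD(2)[OF \<beta>]] ab in auto)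
  also have "\<dots> = 0"
    by (rule sum.neutral) (use y0 V.linear_formsD(3)[OF bilinear_formsD(2)[OF \<beta>]] ab in auto)
  finally show ?thesis .
qed

lemma tensorsE:
  assumes "T \<in> tensors V W A B"
  obtains n :: nat and a b where "\<And>i. i < n \<Longrightarrow> a i \<in> A" "\<And>i. i < n \<Longrightarrow> b i \<in> B"
    "\<And>\<beta>. \<beta> \<in> bilinear_forms V W \<Longrightarrow> T \<beta> = (\<Sum>i<n. \<beta> (a i) (b i))" "T \<in> extensional (bilinear_forms V W)"
proof -
  from assms obtain n :: nat and a b where "\<forall>i<n. a i \<in> A \<and> b i \<in> B"
    "T = (\<lambda>\<beta>\<in>bilinear_forms V W. \<Sum>i<n. \<beta> (a i) (b i))" unfolding tensors_def by blast
  then show thesis by (intro that[of n a b]) auto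
qed

text \<open>Tensors are defined by sums over initial segments of the naturals; reindexing admits any
  finite index set, such as a product or a disjoint sum.\<close>

lemma tensors_sumI:
  fixes V :: "('k::field, 'v, 'm) module_scheme"
  assumes "finite I" "\<And>i. i \<in> I \<Longrightarrow> a i \<in> A" "\<And>i. i \<in> I \<Longrightarrow> b i \<in> B"
    "\<And>\<beta>. \<beta> \<in> bilinear_forms V W \<Longrightarrow> T \<beta> = (\<Sum>i\<in>I. \<beta> (a i) (b i))" "T \<in> extensional (bilinear_forms V W)"
  shows "T \<in> tensors V W A B"
proof -
  obtain n :: nat and h where h: "bij_betw h {..<n} I" by (rule finite_enumerate[OF assms(1)])
  have "T = (\<lambda>\<beta>\<in>bilinear_forms V W. \<Sum>i<n. \<beta> (a (h i)) (b (h i)))"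
  proof
    fix \<beta>
    show "T \<beta> = (\<lambda>\<beta>\<in>bilinear_forms V W. \<Sum>i<n. \<beta> (a (h i)) (b (h i))) \<beta>"
    proof (cases "\<beta> \<in> bilinear_forms V W")
      case True
      have "T \<beta> = (\<Sum>i<n. \<beta> (a (h i)) (b (h i)))"
        using assms(4)[OF True] sum.reindex_bij_betw[OF h, of "\<lambda>j. \<beta> (a j) (b j)"] by simp
      with True show ?thesis by (simp only: restrict_apply if_True)
    next
      case False
      with extensional_arb[OF assms(5) False] show ?thesis by (simp only: restrict_apply if_False)
    qed
  qed
  moreover have "h i \<in> I" if "i < n" for i using h that by (auto simp: bij_betw_def)
  ultimately show ?thesis unfolding tensors_def mem_Collect_eq using assms(2,3)
    by (intro exI[of _ n] exI[of _ "\<lambda>i. a (h i)"] exI[of _ "\<lambda>i. b (h i)"] conjI allI impI) simp_all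
qed

lemma tensors_mono: "T \<in> tensors V W A B \<Longrightarrow> A \<subseteq> A' \<Longrightarrow> B \<subseteq> B' \<Longrightarrow> T \<in> tensors V W A' B'"
  unfolding tensors_def by blast

lemma tensors_add:
  assumes "T \<in> tensors V W A B" "U \<in> tensors V W A B"
  shows "(\<lambda>\<beta>\<in>bilinear_forms V W. T \<beta> + U \<beta>) \<in> tensors V W A B"
proof -
  from assms(1) obtain n :: nat and a b where 1: "\<And>i. i < n \<Longrightarrow> a i \<in> A" "\<And>i. i < n \<Longrightarrow> b i \<in> B"
    "\<And>\<beta>. \<beta> \<in> bilinear_forms V W \<Longrightarrow> T \<beta> = (\<Sum>i<n. \<beta> (a i) (b i))" by (rule tensorsE) blast
  from assms(2) obtain m :: nat and c d where 2: "\<And>i. i < m \<Longrightarrow> c i \<in> A" "\<And>i. i < m \<Longrightarrow> d i \<in> B"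
    "\<And>\<beta>. \<beta> \<in> bilinear_forms V W \<Longrightarrow> U \<beta> = (\<Sum>i<m. \<beta> (c i) (d i))" by (rule tensorsE) blast
  show ?thesis
    by (rule tensors_sumI[where I = "{..<n} <+> {..<m}" and a = "case_sum a c" and b = "case_sum b d"])
      (use 1 2 in \<open>auto simp: sum.Plus\<close>)
qed

lemma tensors_scale:
  assumes "vs V" "vs W" "T \<in> tensors V W A B" "A \<subseteq> carrier V" "B \<subseteq> carrier W" "\<And>c a. a \<in> A \<Longrightarrow> c \<odot>\<^bsub>V\<^esub> a \<in> A"
  shows "(\<lambda>\<beta>\<in>bilinear_forms V W. c * T \<beta>) \<in> tensors V W A B"
proof -
  interpret V: vs V by fact
  from assms(3) obtain n :: nat and a b where 1: "\<And>i. i < n \<Longrightarrow> a i \<in> A" "\<And>i. i < n \<Longrightarrow> b i \<in> B"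
    "\<And>\<beta>. \<beta> \<in> bilinear_forms V W \<Longrightarrow> T \<beta> = (\<Sum>i<n. \<beta> (a i) (b i))" by (rule tensorsE) blast
  have "\<beta> (c \<odot>\<^bsub>V\<^esub> a i) (b i) = c * \<beta> (a i) (b i)" if "\<beta> \<in> bilinear_forms V W" "i < n" for \<beta> i
    using V.linear_formsD(2)[OF bilinear_formsD(2)[OF that(1), of "b i"]] 1 that assms by blast
  then show ?thesis
    by (intro tensors_sumI[where I = "{..<n}" and a = "\<lambda>i. c \<odot>\<^bsub>V\<^esub> a i" and b = b])
      (use 1 assms in \<open>auto simp: sum_distrib_left\<close>)
qed

lemma tensors_zero: "(\<lambda>\<beta>\<in>bilinear_forms V W. 0) \<in> tensors V W A B"
  by (rule tensors_sumI[where I = "{}"]) auto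

lemma carrier_tensor_product [simp]: "carrier (tensor_product V W) = tensors V W (carrier V) (carrier W)"
  by (simp add: tensor_product_def)

lemma add_tensor_product [simp]:
  "T \<oplus>\<^bsub>tensor_product V W\<^esub> U = (\<lambda>\<beta>\<in>bilinear_forms V W. T \<beta> + U \<beta>)"
  by (simp add: tensor_product_def)

lemma smult_tensor_product [simp]:
  "c \<odot>\<^bsub>tensor_product V W\<^esub> T = (\<lambda>\<beta>\<in>bilinear_forms V W. c * T \<beta>)"
  by (simp add: tensor_product_def)

text \<open>Apply \<open>product_forms_separate\<close> to the difference of the two tensors.
  Identities between tensors can then be checked on products of linear forms.\<close>

lemma tensor_eqI:
  assumes V: "vs V" and W: "vs W" and T: "T \<in> tensors V W (carrier V) (carrier W)"
    and U: "U \<in> tensors V W (carrier V) (carrier W)"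
    and eq: "\<And>f g. f \<in> linear_forms V \<Longrightarrow> g \<in> linear_forms W \<Longrightarrow> T (\<lambda>a b. f a * g b) = U (\<lambda>a b. f a * g b)"
  shows "T = U"
proof -
  have "(\<lambda>\<beta>\<in>bilinear_forms V W. (- 1) * U \<beta>) \<in> tensors V W (carrier V) (carrier W)"
    by (rule tensors_scale) (use V W U in \<open>auto simp: vs.smult_closed\<close>)
  from tensors_add[OF T this] obtain n :: nat and a b where
    1: "\<And>i. i < n \<Longrightarrow> a i \<in> carrier V" "\<And>i. i < n \<Longrightarrow> b i \<in> carrier W"
    "\<And>\<beta>. \<beta> \<in> bilinear_forms V W \<Longrightarrow> T \<beta> - U \<beta> = (\<Sum>i<n. \<beta> (a i) (b i))"
  proof (rule tensorsE, goal_cases)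
    case (1 n a b) then show ?case by (intro that[of n a b]) auto
  qed
  have "T \<beta> = U \<beta>" if "\<beta> \<in> bilinear_forms V W" for \<beta>
  proof -
    have "(\<Sum>i<n. f (a i) * g (b i)) = 0" if "f \<in> linear_forms V" "g \<in> linear_forms W" for f g
      using 1(3)[OF bilinear_form_prod[OF V W that]] eq[OF that] by simp
    from product_forms_separate[where n = n and a = a and b = b, OF V W 1(1) 1(2) this that] 1(3)[OF that]
    show ?thesis by simp
  qed
  moreover have "T \<in> extensional (bilinear_forms V W)" "U \<in> extensional (bilinear_forms V W)"
    using T U by (auto elim: tensorsE)
  ultimately show ?thesis by (auto intro: extensionalityI)
qed

text \<open>Both sides are \<open>undefined\<close> if the forms are not bilinear.\<close>

lemma tensor_cong:
  assumes "vs V" "vs W" "T \<in> tensors V W (carrier V) (carrier W)"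
    "\<And>v w. v \<in> carrier V \<Longrightarrow> w \<in> carrier W \<Longrightarrow> \<beta> v w = \<gamma> v w"
  shows "T \<beta> = T \<gamma>"
proof (cases "\<beta> \<in> bilinear_forms V W")
  case True
  then have "\<gamma> \<in> bilinear_forms V W" using bilinear_forms_cong[OF assms(1,2), of \<beta> \<gamma>] assms(4) by blast
  with True assms(3,4) show ?thesis by (elim tensorsE) (auto intro!: sum.cong)
next
  case False
  then have "\<gamma> \<notin> bilinear_forms V W" using bilinear_forms_cong[OF assms(1,2), of \<beta> \<gamma>] assms(4) by blast
  with False assms(3) show ?thesis by (elim tensorsE) (auto simp: extensional_def)
qed

lemma tensor_linear:
  assumes V: "vs V" and W: "vs W" and T: "T \<in> tensors V W (carrier V) (carrier W)"
  shows "\<beta> \<in> bilinear_forms V W \<Longrightarrow> \<gamma> \<in> bilinear_forms V W \<Longrightarrow> T (\<lambda>a b. \<beta> a b + \<gamma> a b) = T \<beta> + T \<gamma>"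
    "\<beta> \<in> bilinear_forms V W \<Longrightarrow> T (\<lambda>a b. c * \<beta> a b) = c * T \<beta>"
    "T (\<lambda>a b. 0) = 0"
    "(\<And>i. i \<in> A \<Longrightarrow> \<delta> i \<in> bilinear_forms V W) \<Longrightarrow> T (\<lambda>a b. \<Sum>i\<in>A. \<delta> i a b) = (\<Sum>i\<in>A. T (\<delta> i))"
proof -
  from T obtain n :: nat and a b where 1: "\<And>\<beta>. \<beta> \<in> bilinear_forms V W \<Longrightarrow> T \<beta> = (\<Sum>i<n. \<beta> (a i) (b i))"
    by (rule tensorsE) blast
  show "\<beta> \<in> bilinear_forms V W \<Longrightarrow> \<gamma> \<in> bilinear_forms V W \<Longrightarrow> T (\<lambda>a b. \<beta> a b + \<gamma> a b) = T \<beta> + T \<gamma>"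
    by (simp add: 1 bilinear_form_add[OF V W] sum.distrib)
  show "\<beta> \<in> bilinear_forms V W \<Longrightarrow> T (\<lambda>a b. c * \<beta> a b) = c * T \<beta>"
    by (simp add: 1 bilinear_form_scale[OF V W] sum_distrib_left)
  show "T (\<lambda>a b. 0) = 0" by (simp add: 1 bilinear_form_zero[OF V W])
  show "(\<And>i. i \<in> A \<Longrightarrow> \<delta> i \<in> bilinear_forms V W) \<Longrightarrow> T (\<lambda>a b. \<Sum>i\<in>A. \<delta> i a b) = (\<Sum>i\<in>A. T (\<delta> i))"
    by (simp add: 1 bilinear_form_sum[OF V W] sum.swap[of _ A])
qed

lemma tensor_linear_form:
  assumes "vs V" "vs W" "vs U" "T \<in> tensors V W (carrier V) (carrier W)"
    and "\<And>u. u \<in> carrier U \<Longrightarrow> \<beta> u \<in> bilinear_forms V W"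
    and "\<And>v w. v \<in> carrier V \<Longrightarrow> w \<in> carrier W \<Longrightarrow> (\<lambda>u. \<beta> u v w) \<in> linear_forms U"
  shows "(\<lambda>u. T (\<beta> u)) \<in> linear_forms U"
proof -
  interpret U: vs U by fact
  from assms(4) obtain n :: nat and a b where 1: "\<And>i. i < n \<Longrightarrow> a i \<in> carrier V" "\<And>i. i < n \<Longrightarrow> b i \<in> carrier W"
    "\<And>\<beta>. \<beta> \<in> bilinear_forms V W \<Longrightarrow> T \<beta> = (\<Sum>i<n. \<beta> (a i) (b i))" by (rule tensorsE) blast
  have "(\<lambda>u. \<Sum>i<n. \<beta> u (a i) (b i)) \<in> linear_forms U"
    by (rule U.linear_form_sum) (use assms(6) 1 in auto)
  then show ?thesis using linear_forms_cong[OF assms(3), of "\<lambda>u. T (\<beta> u)"] 1(3) assms(5) by simp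
qed

text \<open>With projections P and Q onto A and B, a \<otimes> b splits into P a \<otimes> b, (a - P
  a) \<otimes> Q b and (a - P a) \<otimes> (b - Q b). The first two summands make up T and U. On the
  third, f and g act as f - f \<circ> P and g - g \<circ> Q, which vanish on A and on B, so the
  condition removes it.\<close>

lemma wedge_iff:
  assumes C: "vs C" and A: "subspace class_ring A C" and B: "subspace class_ring B C"
    and x: "x \<in> carrier C" and d: "comult C x \<in> tensors C C (carrier C) (carrier C)"
  shows "x \<in> wedge C A B \<longleftrightarrow> (\<forall>f\<in>linear_forms C. \<forall>g\<in>linear_forms C.
    (\<forall>a\<in>A. f a = 0) \<longrightarrow> (\<forall>b\<in>B. g b = 0) \<longrightarrow> comult C x (\<lambda>a b. f a * g b) = 0)" (is "_ \<longleftrightarrow> ?R")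
proof
  interpret C: vs C by fact
  show ?R if "x \<in> wedge C A B"
  proof (intro ballI impI)
    fix f g assume fg: "f \<in> linear_forms C" "g \<in> linear_forms C" and z: "\<forall>a\<in>A. f a = 0" "\<forall>b\<in>B. g b = 0"
    from that obtain T U where TU: "T \<in> tensors C C A (carrier C)" "U \<in> tensors C C (carrier C) B"
      "comult C x = T \<oplus>\<^bsub>tensor_product C C\<^esub> U" unfolding wedge_def by auto
    have b: "(\<lambda>a b. f a * g b) \<in> bilinear_forms C C" using fg C by (intro bilinear_form_prod)
    have "T (\<lambda>a b. f a * g b) = 0" using TU(1) b z by (elim tensorsE) (auto intro!: sum.neutral)
    moreover have "U (\<lambda>a b. f a * g b) = 0" using TU(2) b z by (elim tensorsE) (auto intro!: sum.neutral)
    ultimately show "comult C x (\<lambda>a b. f a * g b) = 0" using b by (simp add: TU(3))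
  qed
  assume R: ?R
  obtain P where P: "P \<in> LinearCombinations.module_hom class_ring C C" "\<And>x. x \<in> carrier C \<Longrightarrow> P x \<in> A" "\<And>w. w \<in> A \<Longrightarrow> P w = w"
    by (rule C.projection[OF A]) blast
  obtain Q where Q: "Q \<in> LinearCombinations.module_hom class_ring C C" "\<And>x. x \<in> carrier C \<Longrightarrow> Q x \<in> B" "\<And>w. w \<in> B \<Longrightarrow> Q w = w"
    by (rule C.projection[OF B]) blast
  have Pc: "x \<in> carrier C \<Longrightarrow> P x \<in> carrier C" and Qc: "x \<in> carrier C \<Longrightarrow> Q x \<in> carrier C" for x
    using P Q by (auto simp: LinearCombinations.module_hom_def)
  from d obtain n :: nat and a b where 1: "\<And>i. i < n \<Longrightarrow> a i \<in> carrier C" "\<And>i. i < n \<Longrightarrow> b i \<in> carrier C"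
    "\<And>\<beta>. \<beta> \<in> bilinear_forms C C \<Longrightarrow> comult C x \<beta> = (\<Sum>i<n. \<beta> (a i) (b i))"
    "comult C x \<in> extensional (bilinear_forms C C)" by (rule tensorsE) blast
  define T where "T = (\<lambda>\<beta>\<in>bilinear_forms C C. \<Sum>i<n. \<beta> (P (a i)) (b i))"
  define U where "U = (\<lambda>\<beta>\<in>bilinear_forms C C. \<Sum>i<n. \<beta> (a i \<ominus>\<^bsub>C\<^esub> P (a i)) (Q (b i)))"
  have T: "T \<in> tensors C C A (carrier C)"
    by (rule tensors_sumI[where I = "{..<n}" and a = "\<lambda>i. P (a i)" and b = b]) (use 1 P in \<open>auto simp: T_def\<close>)
  have U: "U \<in> tensors C C (carrier C) B"
    by (rule tensors_sumI[where I = "{..<n}" and a = "\<lambda>i. a i \<ominus>\<^bsub>C\<^esub> P (a i)" and b = "\<lambda>i. Q (b i)"])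
      (use 1 Pc Q in \<open>auto simp: U_def\<close>)
  have "comult C x = T \<oplus>\<^bsub>tensor_product C C\<^esub> U"
  proof (rule tensor_eqI[OF C C d])
    show "T \<oplus>\<^bsub>tensor_product C C\<^esub> U \<in> tensors C C (carrier C) (carrier C)"
      unfolding add_tensor_product using T U A B
      by (intro tensors_add) (auto elim!: tensors_mono dest: C.subspaceD)
    fix f g assume fg: "f \<in> linear_forms C" "g \<in> linear_forms C"
    define f' where "f' x = f x - f (P x)" for x
    define g' where "g' x = g x - g (Q x)" for x
    have f': "f' \<in> linear_forms C" unfolding f'_def
      by (intro C.linear_form_diff fg linear_form_comp[OF C P(1)])
    have g': "g' \<in> linear_forms C" unfolding g'_def
      by (intro C.linear_form_diff fg linear_form_comp[OF C Q(1)])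
    have "\<forall>a\<in>A. f' a = 0" "\<forall>b\<in>B. g' b = 0" by (simp_all add: f'_def g'_def P(3) Q(3))
    with R f' g' have "comult C x (\<lambda>a b. f' a * g' b) = 0" by blast
    then have "(\<Sum>i<n. f' (a i) * g' (b i)) = 0" using 1(3) bilinear_form_prod[OF C C f' g'] by simp
    then have "(\<Sum>i<n. f (a i) * g (b i)) = (\<Sum>i<n. f (P (a i)) * g (b i)) + (\<Sum>i<n. (f (a i) - f (P (a i))) * g (Q (b i)))"
      by (simp add: f'_def g'_def algebra_simps sum.distrib sum_subtractf)
    moreover have "f (a i \<ominus>\<^bsub>C\<^esub> P (a i)) = f (a i) - f (P (a i))" if "i < n" for i
      using 1 Pc fg that by (simp add: C.linear_formsD)
    ultimately show "comult C x (\<lambda>a b. f a * g b) = (T \<oplus>\<^bsub>tensor_product C C\<^esub> U) (\<lambda>a b. f a * g b)"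
      using bilinear_form_prod[OF C C fg] by (simp add: 1(3) T_def U_def)
  qed
  then show "x \<in> wedge C A B" using T U x unfolding wedge_def by blast
qed

section \<open>Coalgebras and the coradical filtration\<close>

locale coalg =
  fixes C :: "('k::field, 'v) coalg" (structure)
  assumes coalgebra: "coalgebra C"
begin

sublocale vs C
  using coalgebra by (simp add: vs_def coalgebra_def)

lemma vs: "vs C" by unfold_locales

lemma comult_tensor: "x \<in> carrier C \<Longrightarrow> comult C x \<in> tensors C C (carrier C) (carrier C)"
  using coalgebra by (simp add: coalgebra_def)

lemma comult_form: "\<beta> \<in> bilinear_forms C C \<Longrightarrow> (\<lambda>x. comult C x \<beta>) \<in> linear_forms C"
  using coalgebra by (simp add: coalgebra_def linear_forms_def)

lemma counit_form: "counit C \<in> linear_forms C"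
  using coalgebra by (simp add: coalgebra_def)

lemmas comult_cong = tensor_cong[OF vs vs comult_tensor]
lemmas comult_linear = tensor_linear[OF vs vs comult_tensor]
lemmas form_prod = bilinear_form_prod[OF vs vs]

lemma comult_sum:
  assumes "x \<in> carrier C"
  obtains n :: nat and a b where "\<And>i. i < n \<Longrightarrow> a i \<in> carrier C" "\<And>i. i < n \<Longrightarrow> b i \<in> carrier C"
    "\<And>\<beta>. \<beta> \<in> bilinear_forms C C \<Longrightarrow> comult C x \<beta> = (\<Sum>i<n. \<beta> (a i) (b i))"
  by (rule tensorsE[OF comult_tensor[OF assms]]) blast

text \<open>The convolution product of the dual algebra, here without restriction to the
  carrier.\<close>

definition conv :: "('v \<Rightarrow> 'k) \<Rightarrow> ('v \<Rightarrow> 'k) \<Rightarrow> 'v \<Rightarrow> 'k" where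
  "conv f g = (\<lambda>x. comult C x (\<lambda>a b. f a * g b))"

lemma conv_form: "f \<in> linear_forms C \<Longrightarrow> g \<in> linear_forms C \<Longrightarrow> conv f g \<in> linear_forms C"
  unfolding conv_def by (intro comult_form form_prod)

lemma coassoc:
  "x \<in> carrier C \<Longrightarrow> \<gamma> \<in> trilinear_forms C C C \<Longrightarrow>
   comult C x (\<lambda>a b. comult C a (\<lambda>a1 a2. \<gamma> a1 a2 b)) = comult C x (\<lambda>a b. comult C b (\<lambda>b1 b2. \<gamma> a b1 b2))"
  using coalgebra by (simp add: coalgebra_def)

lemma counit_left: "x \<in> carrier C \<Longrightarrow> \<phi> \<in> linear_forms C \<Longrightarrow> comult C x (\<lambda>a b. counit C a * \<phi> b) = \<phi> x"
  and counit_right: "x \<in> carrier C \<Longrightarrow> \<phi> \<in> linear_forms C \<Longrightarrow> comult C x (\<lambda>a b. \<phi> a * counit C b) = \<phi> x"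
  using coalgebra by (auto simp: coalgebra_def)

text \<open>Exchanges one factor for a form that agrees with it on a subspace; the error is again a
  convolution, one factor of which vanishes on that subspace.\<close>

lemma conv_split:
  assumes x: "x \<in> carrier C" and fgh: "f \<in> linear_forms C" "g \<in> linear_forms C" "h \<in> linear_forms C"
  shows "conv f g x = conv f h x + conv f (\<lambda>y. g y - h y) x"
    "conv f g x = conv h g x + conv (\<lambda>y. f y - h y) g x"
proof -
  have "conv f g x = comult C x (\<lambda>a b. f a * h b + f a * (g b - h b))"
    unfolding conv_def by (rule comult_cong[OF x]) (simp add: algebra_simps)
  also have "\<dots> = conv f h x + conv f (\<lambda>y. g y - h y) x"
    unfolding conv_def by (intro comult_linear x form_prod linear_form_diff fgh)
  finally show "conv f g x = conv f h x + conv f (\<lambda>y. g y - h y) x" .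
  have "conv f g x = comult C x (\<lambda>a b. h a * g b + (f a - h a) * g b)"
    unfolding conv_def by (rule comult_cong[OF x]) (simp add: algebra_simps)
  also have "\<dots> = conv h g x + conv (\<lambda>y. f y - h y) g x"
    unfolding conv_def by (intro comult_linear x form_prod linear_form_diff fgh)
  finally show "conv f g x = conv h g x + conv (\<lambda>y. f y - h y) g x" .
qed

lemma conv_assoc:
  assumes "x \<in> carrier C" and fgh: "f \<in> linear_forms C" "g \<in> linear_forms C" "h \<in> linear_forms C"
  shows "conv (conv f g) h x = conv f (conv g h) x"
proof -
  have "(\<lambda>a b c. f a * g b * h c) \<in> trilinear_forms C C C"
    unfolding trilinear_forms_def mem_Collect_eq
    using fgh by (intro conjI ballI bilinear_formsI linear_form_scale linear_form_scale')
  from coassoc[OF assms(1) this]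
  have "comult C x (\<lambda>a b. comult C a (\<lambda>a1 a2. f a1 * g a2 * h b)) =
    comult C x (\<lambda>a b. comult C b (\<lambda>b1 b2. f a * g b1 * h b2))" .
  moreover have "comult C x (\<lambda>a b. comult C a (\<lambda>a1 a2. f a1 * g a2 * h b)) = conv (conv f g) h x"
    unfolding conv_def
    by (rule comult_cong[OF assms(1)]) (simp add: fgh comult_linear(2)[OF _ form_prod] mult.commute[of _ "h _"])
  moreover have "comult C x (\<lambda>a b. comult C b (\<lambda>b1 b2. f a * g b1 * h b2)) = conv f (conv g h) x"
    unfolding conv_def
    by (rule comult_cong[OF assms(1)]) (simp add: fgh comult_linear(2)[OF _ form_prod] mult.assoc)
  ultimately show ?thesis by simp
qed

text \<open>The element (id \<otimes> g)\<Delta>(x). A statement about one leg of the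
  comultiplication becomes membership of this element in a subspace.\<close>

lemma contraction_right:
  assumes "x \<in> carrier C" "g \<in> linear_forms C"
  obtains y where "y \<in> carrier C" "\<And>f. f \<in> linear_forms C \<Longrightarrow> f y = conv f g x"
proof -
  obtain n :: nat and a b where r: "\<And>i. i < n \<Longrightarrow> a i \<in> carrier C" "\<And>i. i < n \<Longrightarrow> b i \<in> carrier C"
    "\<And>\<beta>. \<beta> \<in> bilinear_forms C C \<Longrightarrow> comult C x \<beta> = (\<Sum>i<n. \<beta> (a i) (b i))" by (rule comult_sum[OF assms(1)]) blast
  show thesis
  proof (rule that[of "lincomb {..<n} (\<lambda>i. g (b i)) a"])
    show "lincomb {..<n} (\<lambda>i. g (b i)) a \<in> carrier C" by (rule lincomb_closed) (use r in auto)
    show "f (lincomb {..<n} (\<lambda>i. g (b i)) a) = conv f g x" if "f \<in> linear_forms C" for f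
      using r form_prod[OF that assms(2)] by (subst form_lincomb[OF that]) (auto simp: conv_def mult.commute)
  qed
qed

lemma contraction_left:
  assumes "x \<in> carrier C" "f \<in> linear_forms C"
  obtains y where "y \<in> carrier C" "\<And>g. g \<in> linear_forms C \<Longrightarrow> g y = conv f g x"
proof -
  obtain n :: nat and a b where r: "\<And>i. i < n \<Longrightarrow> a i \<in> carrier C" "\<And>i. i < n \<Longrightarrow> b i \<in> carrier C"
    "\<And>\<beta>. \<beta> \<in> bilinear_forms C C \<Longrightarrow> comult C x \<beta> = (\<Sum>i<n. \<beta> (a i) (b i))" by (rule comult_sum[OF assms(1)]) blast
  show thesis
  proof (rule that[of "lincomb {..<n} (\<lambda>i. f (a i)) b"])
    show "lincomb {..<n} (\<lambda>i. f (a i)) b \<in> carrier C" by (rule lincomb_closed) (use r in auto)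
    show "g (lincomb {..<n} (\<lambda>i. f (a i)) b) = conv f g x" if "g \<in> linear_forms C" for g
      using r form_prod[OF assms(2) that] by (subst form_lincomb[OF that]) (auto simp: conv_def mult.commute)
  qed
qed

lemma span_subspace: "S \<subseteq> carrier C \<Longrightarrow> subspace class_ring (LinearCombinations.module.span class_ring C S) C"
  using vectorspace.span_is_subspace[OF vectorspace] by simp

lemma span_induct:
  assumes "subspace class_ring W C" "S \<subseteq> W" "x \<in> LinearCombinations.module.span class_ring C S"
  shows "x \<in> W"
proof -
  have "S \<subseteq> carrier C" using assms subspaceD by blast
  have "LinearCombinations.module.span class_ring C S \<subseteq> W"
    by (rule module.span_is_subset[OF module assms(2)]) (use assms(1) in \<open>simp add: subspace_def\<close>)
  then show ?thesis using assms(3) by blast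
qed

lemma subspace_tensors:
  assumes "subspace class_ring A C" "subspace class_ring B C"
  shows "subspace class_ring {x \<in> carrier C. comult C x \<in> tensors C C A B} C"
  unfolding subspace_iff
proof (intro conjI ballI allI)
  note A = subspaceD[OF assms(1)] and B = subspaceD[OF assms(2)]
  have ext: "x \<in> carrier C \<Longrightarrow> comult C x \<in> extensional (bilinear_forms C C)" for x
    using comult_tensor by (blast elim: tensorsE)
  have "comult C \<zero> = (\<lambda>\<beta>\<in>bilinear_forms C C. 0)"
    by (rule extensionalityI[OF ext]) (auto simp: linear_formsD(3)[OF comult_form])
  then show "\<zero> \<in> {x \<in> carrier C. comult C x \<in> tensors C C A B}" by (simp add: tensors_zero)
  fix x y assume x: "x \<in> {x \<in> carrier C. comult C x \<in> tensors C C A B}"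
  { assume y: "y \<in> {x \<in> carrier C. comult C x \<in> tensors C C A B}"
    have "comult C (x \<oplus> y) = (\<lambda>\<beta>\<in>bilinear_forms C C. comult C x \<beta> + comult C y \<beta>)"
      by (rule extensionalityI[OF ext]) (use x y in \<open>auto simp: linear_formsD(1)[OF comult_form]\<close>)
    then show "x \<oplus> y \<in> {x \<in> carrier C. comult C x \<in> tensors C C A B}"
      using x y by (simp add: tensors_add) }
  fix c
  have "comult C (c \<odot> x) = (\<lambda>\<beta>\<in>bilinear_forms C C. c * comult C x \<beta>)"
    by (rule extensionalityI[OF ext]) (use x in \<open>auto simp: linear_formsD(2)[OF comult_form]\<close>)
  then show "c \<odot> x \<in> {x \<in> carrier C. comult C x \<in> tensors C C A B}"
    using x A B by (simp add: tensors_scale[OF vs vs])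
qed auto

section \<open>The coradical filtration in terms of convolution of forms\<close>

abbreviation F :: "nat \<Rightarrow> 'v set" where "F n \<equiv> corad_filt C n"

lemma coradical_subspace: "subspace class_ring (coradical C) C"
proof -
  have "\<Union> (simple_subcoalgebras C) \<subseteq> carrier C"
    by (auto simp: simple_subcoalgebras_def subcoalgebra_def dest: subspaceD(1))
  then show ?thesis unfolding coradical_def by (rule span_subspace)
qed

text \<open>The elements whose comultiplication lies in the tensor square of the coradical form a
  subspace, and it contains every simple subcoalgebra, hence their span.\<close>

lemma coradical_subcoalgebra: "subcoalgebra C (coradical C)"
  unfolding subcoalgebra_def
proof (intro conjI ballI coradical_subspace)
  let ?W = "{x \<in> carrier C. comult C x \<in> tensors C C (coradical C) (coradical C)}"
  have D: "D \<subseteq> coradical C" if "D \<in> simple_subcoalgebras C" for D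
  proof -
    have "\<Union> (simple_subcoalgebras C) \<subseteq> carrier C"
      by (auto simp: simple_subcoalgebras_def subcoalgebra_def dest: subspaceD(1))
    from module.in_own_span[OF module this] that show ?thesis unfolding coradical_def by blast
  qed
  have "\<Union> (simple_subcoalgebras C) \<subseteq> ?W"
  proof
    fix x assume "x \<in> \<Union> (simple_subcoalgebras C)"
    then obtain E where E: "E \<in> simple_subcoalgebras C" "x \<in> E" by auto
    then have "subspace class_ring E C" "comult C x \<in> tensors C C E E"
      by (auto simp: simple_subcoalgebras_def subcoalgebra_def)
    then show "x \<in> ?W" using D[OF E(1)] E(2) subspaceD(1) by (auto elim: tensors_mono)
  qed
  then show "comult C x \<in> tensors C C (coradical C) (coradical C)" if "x \<in> coradical C" for x
    using span_induct[OF subspace_tensors[OF coradical_subspace coradical_subspace]] that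
    unfolding coradical_def by blast
qed

lemma wedge_iff':
  assumes A: "subspace class_ring A C" and B: "subspace class_ring B C"
  shows "x \<in> wedge C A B \<longleftrightarrow> x \<in> carrier C \<and> (\<forall>f\<in>linear_forms C. \<forall>g\<in>linear_forms C.
    (\<forall>a\<in>A. f a = 0) \<longrightarrow> (\<forall>b\<in>B. g b = 0) \<longrightarrow> conv f g x = 0)"
proof (cases "x \<in> carrier C")
  case True
  then show ?thesis using wedge_iff[OF vs A B True comult_tensor[OF True]] by (simp add: conv_def)
qed (simp add: wedge_def)

lemma wedge_subspace:
  assumes A: "subspace class_ring A C" and B: "subspace class_ring B C"
  shows "subspace class_ring (wedge C A B) C"
  unfolding subspace_iff by (auto simp: wedge_iff'[OF A B] linear_formsD conv_form)

lemma filt_subspace: "subspace class_ring (F n) C"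
  by (induction n) (auto intro: coradical_subspace wedge_subspace)

lemma filt_carrier: "x \<in> F n \<Longrightarrow> x \<in> carrier C"
  using subspaceD(1)[OF filt_subspace] .

lemma conv_coradical:
  assumes "x \<in> F 0" "f \<in> linear_forms C" "g \<in> linear_forms C" "(\<forall>y\<in>F 0. f y = 0) \<or> (\<forall>y\<in>F 0. g y = 0)"
  shows "conv f g x = 0"
proof -
  have "comult C x \<in> tensors C C (F 0) (F 0)"
    using coradical_subcoalgebra assms(1) by (simp add: subcoalgebra_def)
  then show ?thesis unfolding conv_def using form_prod[OF assms(2,3)] assms(4)
    by (elim tensorsE) (auto intro!: sum.neutral)
qed

lemma filt_SucI:
  assumes "x \<in> carrier C" "\<And>f g. f \<in> linear_forms C \<Longrightarrow> g \<in> linear_forms C \<Longrightarrow>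
    \<forall>y\<in>F 0. f y = 0 \<Longrightarrow> \<forall>y\<in>F n. g y = 0 \<Longrightarrow> conv f g x = 0"
  shows "x \<in> F (Suc n)"
  using assms by (auto simp: wedge_iff'[OF coradical_subspace filt_subspace])

lemma filt_SucD:
  assumes "x \<in> F (Suc n)" "f \<in> linear_forms C" "g \<in> linear_forms C" "\<forall>y\<in>F 0. f y = 0" "\<forall>y\<in>F n. g y = 0"
  shows "conv f g x = 0"
  using assms by (auto simp: wedge_iff'[OF coradical_subspace filt_subspace])

lemma filt_mono_Suc: "F n \<subseteq> F (Suc n)"
proof (induction n)
  case 0
  show ?case by (auto intro!: filt_SucI filt_carrier[of _ 0] conv_coradical simp del: corad_filt.simps)
next
  case (Suc n)
  show ?case
  proof
    fix x assume "x \<in> F (Suc n)"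
    then show "x \<in> F (Suc (Suc n))" using Suc filt_SucD[of x n] filt_carrier
      by (intro filt_SucI) blast+
  qed
qed

lemma filt_mono: "m \<le> n \<Longrightarrow> F m \<subseteq> F n"
  by (rule lift_Suc_mono_le[of F]) (use filt_mono_Suc in auto)

text \<open>The contraction z = (f \<otimes> id)\<Delta>(x) stays in \<open>F n\<close>, where g
  vanishes. Indeed f0 * g0 at z is (f * f0) * g0 at x, and f * f0 vanishes on the coradical together
  with f0, because the coradical is a subcoalgebra.\<close>

lemma conv_filt_right:
  assumes "x \<in> F n" "f \<in> linear_forms C" "g \<in> linear_forms C" "\<forall>y\<in>F n. g y = 0"
  shows "conv f g x = 0"
proof (cases n)
  case 0
  then show ?thesis using assms conv_coradical by blast
next
  case (Suc m)
  have x: "x \<in> carrier C" using assms filt_carrier by blast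
  obtain z where z: "z \<in> carrier C" "\<And>g. g \<in> linear_forms C \<Longrightarrow> g z = conv f g x"
    by (rule contraction_left[OF x assms(2)]) blast
  have "z \<in> F (Suc m)"
  proof (rule filt_SucI[OF z(1)])
    fix f0 g0 assume h: "f0 \<in> linear_forms C" "g0 \<in> linear_forms C" "\<forall>y\<in>F 0. f0 y = 0" "\<forall>y\<in>F m. g0 y = 0"
    have "conv f0 g0 z = conv (conv f f0) g0 x"
      by (simp add: z(2) conv_form h conv_assoc[OF x assms(2)])
    also have "\<dots> = 0"
      by (rule filt_SucD[of x m]) (use assms Suc h conv_form in \<open>auto intro!: conv_coradical simp del: corad_filt.simps\<close>)
    finally show "conv f0 g0 z = 0" .
  qed
  then show ?thesis using assms z Suc by auto
qed

text \<open>Contracting x on the right by g lowers the filtration by j. If g0 kills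
  \<open>F i\<close>, then g0 * g kills \<open>F (i + j)\<close> by induction, so f0 * (g0 * g)
  kills \<open>F (Suc (i + j))\<close> for every f0 that kills the coradical; this puts the
  contraction into \<open>F (Suc i)\<close>.\<close>

lemma conv_filt_aux:
  assumes "x \<in> F (i + j)" "f \<in> linear_forms C" "g \<in> linear_forms C" "\<forall>y\<in>F i. f y = 0" "\<forall>y\<in>corad_below C j. g y = 0"
  shows "conv f g x = 0"
  using assms
proof (induction i arbitrary: f x)
  case 0
  show ?case
  proof (cases j)
    case 0 then show ?thesis using "0.prems" conv_coradical by simp
  next
    case (Suc j')
    then show ?thesis using "0.prems" filt_SucD[of x j' f g] by (simp add: corad_below_def del: corad_filt.simps)
  qed
next
  case (Suc i)
  have x: "x \<in> carrier C" using Suc.prems filt_carrier by blast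
  obtain z where z: "z \<in> carrier C" "\<And>f. f \<in> linear_forms C \<Longrightarrow> f z = conv f g x"
    by (rule contraction_right[OF x Suc.prems(3)]) blast
  have "z \<in> F (Suc i)"
  proof (rule filt_SucI[OF z(1)])
    fix f0 g0 assume h: "f0 \<in> linear_forms C" "g0 \<in> linear_forms C" "\<forall>y\<in>F 0. f0 y = 0" "\<forall>y\<in>F i. g0 y = 0"
    have "conv f0 g0 z = conv f0 (conv g0 g) x"
      using z(2)[OF conv_form[OF h(1,2)]] conv_assoc[OF x h(1,2) Suc.prems(3)] by simp
    also have "\<dots> = 0"
      using filt_SucD[of x "i + j" f0 "conv g0 g"] Suc h by (simp add: conv_form del: corad_filt.simps)
    finally show "conv f0 g0 z = 0" .
  qed
  then show ?case using Suc.prems z by auto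
qed

text \<open>This is the dual form of the inclusion of \<Delta>(F(n)) in the sum of the F(k)
  \<otimes> F(n - k): a form that kills \<open>corad_below C i\<close> only sees degrees from i
  on.\<close>

lemma conv_filt:
  assumes "x \<in> F n" "f \<in> linear_forms C" "g \<in> linear_forms C" "\<forall>y\<in>corad_below C i. f y = 0"
    "\<forall>y\<in>corad_below C j. g y = 0" "n < i + j"
  shows "conv f g x = 0"
proof (cases i)
  case 0
  then obtain j' where "j = Suc j'" "n \<le> j'" using assms(6) by (cases j) auto
  then show ?thesis using conv_filt_right[OF assms(1-3)] assms(5) filt_mono[of n j']
    by (auto simp: corad_below_def)
next
  case (Suc i')
  then have "x \<in> F (i' + j)" using assms(1,6) filt_mono[of n "i' + j"] by auto
  then show ?thesis using conv_filt_aux[of x i' j f g] assms Suc by (simp add: corad_below_def)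
qed

lemma below_subspace: "subspace class_ring (corad_below C n) C"
  by (cases n) (auto simp: corad_below_def subspace_zero filt_subspace simp del: corad_filt.simps)

lemma below_filt: "corad_below C n \<subseteq> F n"
  using filt_mono_Suc subspaceD(2)[OF filt_subspace]
  by (cases n) (auto simp: corad_below_def simp del: corad_filt.simps)

lemma filt_below: "m < n \<Longrightarrow> F m \<subseteq> corad_below C n"
  using filt_mono by (cases n) (auto simp: corad_below_def simp del: corad_filt.simps)

lemma filt_projections:
  obtains P where "\<And>n. P n \<in> LinearCombinations.module_hom class_ring C C"
    "\<And>n x. x \<in> carrier C \<Longrightarrow> P n x \<in> F n" "\<And>n x. x \<in> F n \<Longrightarrow> P n x = x"
proof -
  have "\<forall>n. \<exists>P. P \<in> LinearCombinations.module_hom class_ring C C \<and> (\<forall>x\<in>carrier C. P x \<in> F n) \<and> (\<forall>x\<in>F n. P x = x)"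
    using projection[OF filt_subspace] by metis
  then obtain P where "\<forall>n. P n \<in> LinearCombinations.module_hom class_ring C C \<and>
    (\<forall>x\<in>carrier C. P n x \<in> F n) \<and> (\<forall>x\<in>F n. P n x = x)" using choice by metis
  then show thesis by (intro that[of P]) auto
qed

text \<open>With projections P onto the filtration steps, g can be replaced on \<open>F n\<close> by
  a telescoping sum of forms g \<circ> Q(j), and next to the j-th of them f can be replaced by f
  \<circ> P(n - j). The tensor obtained in this way has the required shape and agrees with
  \<Delta>(x) on all products of forms.\<close>

lemma comult_filt:
  assumes x: "x \<in> F n"
  shows "\<exists>(r::nat) i a b. (\<forall>l<r. i l \<le> n \<and> a l \<in> F (i l) \<and> b l \<in> F (n - i l)) \<and>
     comult C x = (\<lambda>\<beta>\<in>bilinear_forms C C. \<Sum>l<r. \<beta> (a l) (b l))"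
proof -
  have xc: "x \<in> carrier C" using x filt_carrier by blast
  obtain P where P: "\<And>n. P n \<in> LinearCombinations.module_hom class_ring C C"
    "\<And>n x. x \<in> carrier C \<Longrightarrow> P n x \<in> F n" "\<And>n x. x \<in> F n \<Longrightarrow> P n x = x" by (rule filt_projections) blast
  have Pc: "x \<in> carrier C \<Longrightarrow> P n x \<in> carrier C" for n x using P(2) filt_carrier by blast
  obtain N :: nat and a b where r: "\<And>i. i < N \<Longrightarrow> a i \<in> carrier C" "\<And>i. i < N \<Longrightarrow> b i \<in> carrier C"
    "\<And>\<beta>. \<beta> \<in> bilinear_forms C C \<Longrightarrow> comult C x \<beta> = (\<Sum>i<N. \<beta> (a i) (b i))" by (rule comult_sum[OF xc]) blast
  \<comment> \<open>The j-th difference of the projections: it takes values in \<open>F j\<close>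
    and kills \<open>F (j - 1)\<close> for positive j.\<close>
  define Q where "Q j y = (case j of 0 \<Rightarrow> P 0 y | Suc k \<Rightarrow> P (Suc k) y \<ominus> P k y)" for j y
  have Q: "Q j y \<in> F j" if "y \<in> carrier C" for j y
  proof (cases j)
    case (Suc k)
    have "P k y \<in> F (Suc k)" using P(2)[OF that, of k] filt_mono_Suc by blast
    then show ?thesis using P(2)[OF that, of "Suc k"] subspaceD(5)[OF filt_subspace, of _ "Suc k"]
      by (simp add: Q_def Suc del: corad_filt.simps)
  qed (use P(2)[OF that, of 0] in \<open>simp add: Q_def del: corad_filt.simps\<close>)
  have Qc: "Q j y \<in> carrier C" if "y \<in> carrier C" for j y using Q[OF that] filt_carrier by blast
  define T where "T = (\<lambda>\<beta>\<in>bilinear_forms C C. \<Sum>(j, l)\<in>{..n} \<times> {..<N}. \<beta> (P (n - j) (a l)) (Q j (b l)))"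
  have Tt: "T \<in> tensors C C (carrier C) (carrier C)"
    by (rule tensors_sumI[where I = "{..n} \<times> {..<N}" and a = "\<lambda>(j, l). P (n - j) (a l)" and b = "\<lambda>(j, l). Q j (b l)"])
      (use r Pc Qc in \<open>auto simp: T_def case_prod_unfold\<close>)
  have "comult C x = T"
  proof (rule tensor_eqI[OF vs vs comult_tensor[OF xc] Tt])
    fix f g assume fg: "f \<in> linear_forms C" "g \<in> linear_forms C"
    have fP: "(\<lambda>y. f (P k y)) \<in> linear_forms C" and gP: "(\<lambda>y. g (P k y)) \<in> linear_forms C" for k
      using fg by (auto intro: linear_form_comp[OF vs P(1)])
    define g' where "g' j y = (case j of 0 \<Rightarrow> g (P 0 y) | Suc k \<Rightarrow> g (P (Suc k) y) - g (P k y))" for j y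
    have g': "g' j \<in> linear_forms C" for j
      unfolding g'_def by (cases j) (auto intro!: linear_form_diff gP)
    have gQ: "g (Q j y) = g' j y" if "y \<in> carrier C" for j y
      using that fg Pc by (cases j) (auto simp: g'_def Q_def linear_formsD)
    have g'z: "\<forall>y\<in>corad_below C j. g' j y = 0" for j
    proof (cases j)
      case 0 then show ?thesis using g' by (auto simp: corad_below_def linear_formsD)
    next
      case (Suc k)
      then show ?thesis using P(3)[of _ k] P(3)[of _ "Suc k"] filt_mono_Suc[of k]
        by (auto simp: corad_below_def g'_def subset_iff simp del: corad_filt.simps)
    qed
    have tele: "(\<Sum>j\<le>n. g' j y) = g (P n y)" for y n
      by (induction n) (auto simp: g'_def)
    have "conv f g x = conv f (\<lambda>y. g (P n y)) x + conv f (\<lambda>y. g y - g (P n y)) x"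
      by (rule conv_split(1)[OF xc fg gP])
    also have "conv f (\<lambda>y. g y - g (P n y)) x = 0"
      by (rule conv_filt_right[OF x]) (use fg gP P(3) linear_form_diff in auto)
    also have "conv f (\<lambda>y. g (P n y)) x = (\<Sum>j\<le>n. conv f (g' j) x)"
      unfolding conv_def tele[symmetric]
      by (subst comult_linear(4)[symmetric]) (use xc fg g' in \<open>auto intro!: form_prod simp: sum_distrib_left\<close>)
    also have "\<dots> = (\<Sum>j\<le>n. conv (\<lambda>y. f (P (n - j) y)) (g' j) x)"
    proof (rule sum.cong[OF refl])
      fix j assume "j \<in> {..n}"
      have "conv f (g' j) x = conv (\<lambda>y. f (P (n - j) y)) (g' j) x + conv (\<lambda>y. f y - f (P (n - j) y)) (g' j) x"
        by (rule conv_split(2)[OF xc fg(1) g' fP])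
      \<comment> \<open>The left factor kills degrees up to n - j, the right factor degrees up to j
        - 1, and n < Suc (n - j) + j.\<close>
      also have "conv (\<lambda>y. f y - f (P (n - j) y)) (g' j) x = 0"
        by (rule conv_filt[OF x, of _ _ "Suc (n - j)" j])
          (use \<open>j \<in> _\<close> fg fP g' g'z P(3) linear_form_diff in \<open>auto simp: corad_below_def simp del: corad_filt.simps\<close>)
      finally show "conv f (g' j) x = conv (\<lambda>y. f (P (n - j) y)) (g' j) x" by simp
    qed
    also have "\<dots> = (\<Sum>j\<le>n. \<Sum>l<N. f (P (n - j) (a l)) * g (Q j (b l)))"
      unfolding conv_def using r gQ by (simp add: form_prod[OF fP g'])
    also have "\<dots> = T (\<lambda>a b. f a * g b)"
      by (simp add: T_def form_prod[OF fg] sum.cartesian_product)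
    finally show "comult C x (\<lambda>a b. f a * g b) = T (\<lambda>a b. f a * g b)" by (simp add: conv_def)
  qed
  moreover have "finite ({..n} \<times> {..<N})" by simp
  then obtain M :: nat and h where h: "bij_betw h {..<M} ({..n} \<times> {..<N})" by (rule finite_enumerate)
  define i' where "i' l = n - fst (h l)" for l
  define a' where "a' l = P (n - fst (h l)) (a (snd (h l)))" for l
  define b' where "b' l = Q (fst (h l)) (b (snd (h l)))" for l
  have "T = (\<lambda>\<beta>\<in>bilinear_forms C C. \<Sum>l<M. \<beta> (a' l) (b' l))"
    unfolding T_def
  proof (rule restrict_ext)
    fix \<beta>
    show "(\<Sum>(j, l)\<in>{..n} \<times> {..<N}. \<beta> (P (n - j) (a l)) (Q j (b l))) = (\<Sum>l<M. \<beta> (a' l) (b' l))"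
      using sum.reindex_bij_betw[OF h, of "\<lambda>(j, l). \<beta> (P (n - j) (a l)) (Q j (b l))"]
      by (simp add: case_prod_unfold a'_def b'_def)
  qed
  moreover have "i' l \<le> n \<and> a' l \<in> F (i' l) \<and> b' l \<in> F (n - i' l)" if "l < M" for l
  proof -
    have "h l \<in> {..n} \<times> {..<N}" using h that by (auto simp: bij_betw_def)
    then have "fst (h l) \<le> n" "snd (h l) < N" by auto
    then show ?thesis using P(2) Q r by (simp add: i'_def a'_def b'_def)
  qed
  ultimately show ?thesis by blast
qed

end

section \<open>Algebras and bialgebras\<close>

locale kalg =
  fixes A :: "('k::field, 'v, 'm) module_scheme" (structure)
  assumes k_algebra: "k_algebra A"
begin

sublocale vs A using k_algebra by (simp add: vs_def k_algebra_def)
sublocale ring A using k_algebra by (simp add: k_algebra_def)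

lemma vs: "vs A" by unfold_locales

lemma smult_mult [simp]:
  assumes "x \<in> carrier A" "y \<in> carrier A"
  shows "(c \<odot> x) \<otimes> y = c \<odot> (x \<otimes> y)" "x \<otimes> (c \<odot> y) = c \<odot> (x \<otimes> y)"
proof -
  have "c \<odot> (x \<otimes> y) = (c \<odot> x) \<otimes> y \<and> c \<odot> (x \<otimes> y) = x \<otimes> (c \<odot> y)"
    using k_algebra assms unfolding k_algebra_def by blast
  then show "(c \<odot> x) \<otimes> y = c \<odot> (x \<otimes> y)" "x \<otimes> (c \<odot> y) = c \<odot> (x \<otimes> y)" by auto
qed

lemma mult_hom:
  assumes "z \<in> carrier A"
  shows "(\<lambda>x. x \<otimes> z) \<in> LinearCombinations.module_hom class_ring A A"
    "(\<lambda>x. z \<otimes> x) \<in> LinearCombinations.module_hom class_ring A A"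
  using assms by (auto simp: LinearCombinations.module_hom_def l_distr r_distr)

lemma mult_form:
  assumes "\<phi> \<in> linear_forms A" "z \<in> carrier A"
  shows "(\<lambda>x. \<phi> (x \<otimes> z)) \<in> linear_forms A" "(\<lambda>x. \<phi> (z \<otimes> x)) \<in> linear_forms A"
  using linear_form_comp[OF vs mult_hom(1)[OF assms(2)] assms(1)] linear_form_comp[OF vs mult_hom(2)[OF assms(2)] assms(1)]
  by auto

lemma mult_bilinear:
  assumes "\<beta> \<in> bilinear_forms A A" "z \<in> carrier A" "z' \<in> carrier A"
  shows "(\<lambda>x y. \<beta> (z \<otimes> x) (z' \<otimes> y)) \<in> bilinear_forms A A"
    "(\<lambda>x y. \<beta> (x \<otimes> z) (y \<otimes> z')) \<in> bilinear_forms A A"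
  using bilinear_form_comp[OF vs vs mult_hom(2)[OF assms(2)] mult_hom(2)[OF assms(3)] assms(1)]
    bilinear_form_comp[OF vs vs mult_hom(1)[OF assms(2)] mult_hom(1)[OF assms(3)] assms(1)] by auto

lemma form_finsum:
  assumes "\<phi> \<in> linear_forms A" "\<And>i. i \<in> I \<Longrightarrow> e i \<in> carrier A"
  shows "\<phi> (finsum A e I) = (\<Sum>i\<in>I. \<phi> (e i))"
  using assms(2)
proof (induction I rule: infinite_finite_induct)
  case (insert i I)
  have e: "e i \<in> carrier A" "finsum A e I \<in> carrier A" using insert by (auto intro!: finsum_closed)
  have "finsum A e (insert i I) = e i \<oplus> finsum A e I"
    using insert by (intro finsum_insert) auto
  then show ?case using insert e by (simp add: linear_formsD(1)[OF assms(1)])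
qed (use linear_formsD(3)[OF assms(1)] in simp_all)

end

locale bialg =
  fixes H :: "('k::field, 'v) coalg" (structure)
  assumes bialgebra: "bialgebra H"
begin

sublocale kalg H using bialgebra by (simp add: kalg_def bialgebra_def)
sublocale coalg H using bialgebra by (simp add: coalg_def bialgebra_def)

lemma comult_mult:
  "x \<in> carrier H \<Longrightarrow> y \<in> carrier H \<Longrightarrow> \<beta> \<in> bilinear_forms H H \<Longrightarrow>
   comult H (x \<otimes> y) \<beta> = comult H x (\<lambda>x1 x2. comult H y (\<lambda>y1 y2. \<beta> (x1 \<otimes> y1) (x2 \<otimes> y2)))"
  using bialgebra by (simp add: bialgebra_def)

lemma comult_one: "\<beta> \<in> bilinear_forms H H \<Longrightarrow> comult H \<one> \<beta> = \<beta> \<one> \<one>"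
  using bialgebra by (simp add: bialgebra_def pure_tensor_def)

lemma counit_mult: "x \<in> carrier H \<Longrightarrow> y \<in> carrier H \<Longrightarrow> counit H (x \<otimes> y) = counit H x * counit H y"
  and counit_one: "counit H \<one> = 1"
  using bialgebra by (auto simp: bialgebra_def)

lemma comult_mult_bilinear:
  assumes "y \<in> carrier H" "\<beta> \<in> bilinear_forms H H"
  shows "(\<lambda>x1 x2. comult H y (\<lambda>y1 y2. \<beta> (x1 \<otimes> y1) (x2 \<otimes> y2))) \<in> bilinear_forms H H"
  by (intro bilinear_formsI tensor_linear_form[OF vs vs vs comult_tensor[OF assms(1)]] mult_bilinear assms(2))
    (use assms(2) in \<open>auto intro: mult_form bilinear_formsD
       mult_form[OF bilinear_formsD(1)[OF assms(2)]] mult_form[OF bilinear_formsD(2)[OF assms(2)]]\<close>)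

lemma comult_mult_sum:
  fixes n m :: nat
  assumes xy: "x \<in> carrier H" "y \<in> carrier H" and \<beta>: "\<beta> \<in> bilinear_forms H H"
    and "\<And>\<beta>. \<beta> \<in> bilinear_forms H H \<Longrightarrow> comult H x \<beta> = (\<Sum>l<n. \<beta> (a l) (b l))"
    and "\<And>\<beta>. \<beta> \<in> bilinear_forms H H \<Longrightarrow> comult H y \<beta> = (\<Sum>l<m. \<beta> (c l) (d l))"
    and ab: "\<And>l. l < n \<Longrightarrow> a l \<in> carrier H" "\<And>l. l < n \<Longrightarrow> b l \<in> carrier H"
  shows "comult H (x \<otimes> y) \<beta> = (\<Sum>(l, k)\<in>{..<n} \<times> {..<m}. \<beta> (a l \<otimes> c k) (b l \<otimes> d k))"
proof -
  have "comult H (x \<otimes> y) \<beta> = (\<Sum>l<n. comult H y (\<lambda>y1 y2. \<beta> (a l \<otimes> y1) (b l \<otimes> y2)))"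
    using assms(4)[OF comult_mult_bilinear[OF xy(2) \<beta>]] comult_mult[OF xy \<beta>] by simp
  also have "\<dots> = (\<Sum>l<n. \<Sum>k<m. \<beta> (a l \<otimes> c k) (b l \<otimes> d k))"
    by (rule sum.cong[OF refl]) (use assms(5)[OF mult_bilinear(1)[OF \<beta>]] ab in auto)
  finally show ?thesis by (simp add: sum.cartesian_product)
qed

end

section \<open>Cosets of subspaces and their representatives\<close>

context vs
begin

lemma coset_iff: "subspace class_ring W V \<Longrightarrow> x \<in> carrier V \<Longrightarrow> y \<in> W +> x \<longleftrightarrow> y \<in> carrier V \<and> y \<ominus> x \<in> W"
proof -
  assume W: "subspace class_ring W V" and x: "x \<in> carrier V"
  have "y = w \<oplus> x \<longleftrightarrow> y \<in> carrier V \<and> y \<ominus> x = w" if "w \<in> W" for w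
    using x subspaceD(1)[OF W that] by (auto simp: minus_eq a_assoc r_neg l_neg)
  then show ?thesis unfolding a_r_coset_def' by auto
qed

lemma coset_eq_iff:
  assumes W: "subspace class_ring W V" and "x \<in> carrier V" "y \<in> carrier V"
  shows "W +> x = W +> y \<longleftrightarrow> x \<ominus> y \<in> W"
proof
  assume "W +> x = W +> y"
  moreover have "x \<in> W +> x" using coset_iff[OF W assms(2), of x] assms subspaceD(2)[OF W] by (simp add: r_neg minus_eq)
  ultimately show "x \<ominus> y \<in> W" using coset_iff[OF W assms(3)] by simp
next
  assume d: "x \<ominus> y \<in> W"
  have 1: "z \<ominus> y = (z \<ominus> x) \<oplus> (x \<ominus> y)" "z \<ominus> x = (z \<ominus> y) \<oplus> (- 1) \<odot> (x \<ominus> y)" if "z \<in> carrier V" for z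
    by (rule forms_separate; use that assms in \<open>simp add: linear_formsD\<close>)+
  show "W +> x = W +> y"
    unfolding set_eq_iff coset_iff[OF W assms(2)] coset_iff[OF W assms(3)]
    using 1 subspaceD[OF W] d by metis
qed

lemma coset_add:
  assumes W: "subspace class_ring W V" and "x \<in> carrier V" "y \<in> carrier V"
  shows "(W +> x) <+> (W +> y) = W +> (x \<oplus> y)"
proof -
  have "additive_subgroup W V"
    by (rule additive_subgroupI) (unfold_locales, use subspaceD[OF W] in
      \<open>auto simp flip: a_inv_def simp: subset_iff\<close>, metis W subspaceD(2,5) minus_eq l_zero a_inv_closed subspaceD(1))
  then have "abelian_subgroup W V" by (intro abelian_subgroupI3 abelian_group_axioms)
  from abelian_subgroup.a_rcos_sum[OF this assms(2,3)] show ?thesis .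
qed

lemma coset_zero: "subspace class_ring W V \<Longrightarrow> W +> \<zero> = W"
  unfolding a_r_coset_def' using subspaceD(1) by force

lemma rep_coset:
  assumes W: "subspace class_ring W V" and x: "x \<in> carrier V"
  shows "rep (W +> x) \<in> carrier V" "rep (W +> x) \<ominus> x \<in> W"
proof -
  have "x \<in> W +> x" using coset_iff[OF W x, of x] x subspaceD(2)[OF W] by (simp add: r_neg minus_eq)
  then have "rep (W +> x) \<in> W +> x" unfolding rep_def by (rule someI)
  then show "rep (W +> x) \<in> carrier V" "rep (W +> x) \<ominus> x \<in> W" using coset_iff[OF W x] by auto
qed

end

text \<open>Both sides run over the splittings of n into three parts. This is the index manipulation
  behind associativity of a Cauchy product, for \<open>gr H\<close> as well as for the free
  algebra.\<close>

lemma sum_triangle: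
  fixes f :: "nat \<Rightarrow> nat \<Rightarrow> nat \<Rightarrow> 'a::comm_monoid_add"
  shows "(\<Sum>i\<le>n. \<Sum>j\<le>i. f j (i - j) (n - i)) = (\<Sum>i\<le>n. \<Sum>j\<le>n - i. f i j (n - i - j))"
proof -
  have "(\<Sum>i\<le>n. \<Sum>j\<le>i. f j (i - j) (n - i)) = (\<Sum>(i, j)\<in>(SIGMA i:{..n}. {..i}). f j (i - j) (n - i))"
    by (simp add: sum.Sigma)
  also have "\<dots> = (\<Sum>(i, j)\<in>(SIGMA i:{..n}. {..n - i}). f i j (n - i - j))"
    by (rule sum.reindex_bij_witness[where i = "\<lambda>(i, j). (i + j, i)" and j = "\<lambda>(i, j). (j, i - j)"])
      (auto simp: diff_diff_eq)
  finally show ?thesis by (simp add: sum.Sigma)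
qed

section \<open>The associated graded algebra\<close>

lemma vectorspaceI:
  fixes V :: "('k::field, 'v, 'm) module_scheme" (structure)
  assumes "\<zero> \<in> carrier V" "\<And>x y. x \<in> carrier V \<Longrightarrow> y \<in> carrier V \<Longrightarrow> x \<oplus> y \<in> carrier V"
    "\<And>c x. x \<in> carrier V \<Longrightarrow> c \<odot> x \<in> carrier V"
    "\<And>x y. x \<in> carrier V \<Longrightarrow> y \<in> carrier V \<Longrightarrow> x \<oplus> y = y \<oplus> x"
    "\<And>x y z. x \<in> carrier V \<Longrightarrow> y \<in> carrier V \<Longrightarrow> z \<in> carrier V \<Longrightarrow> (x \<oplus> y) \<oplus> z = x \<oplus> (y \<oplus> z)"
    "\<And>x. x \<in> carrier V \<Longrightarrow> x \<oplus> \<zero> = x"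
    "\<And>c d x. x \<in> carrier V \<Longrightarrow> (c * d) \<odot> x = c \<odot> (d \<odot> x)"
    "\<And>x. x \<in> carrier V \<Longrightarrow> 1 \<odot> x = x" "\<And>x. x \<in> carrier V \<Longrightarrow> 0 \<odot> x = \<zero>"
    "\<And>c d x. x \<in> carrier V \<Longrightarrow> (c + d) \<odot> x = c \<odot> x \<oplus> d \<odot> x"
    "\<And>c x y. x \<in> carrier V \<Longrightarrow> y \<in> carrier V \<Longrightarrow> c \<odot> (x \<oplus> y) = c \<odot> x \<oplus> c \<odot> y"
  shows "vectorspace class_ring V"
proof -
  have "field (class_ring :: 'k ring)" by (rule class_field)
  then have "Module.module class_ring V"
  proof (intro module_criteria)
    show "\<forall>v\<in>carrier V. \<exists>neg_v\<in>carrier V. v \<oplus> neg_v = \<zero>"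
    proof
      fix v assume v: "v \<in> carrier V"
      have "v \<oplus> (- 1) \<odot> v = (1 + (- 1)) \<odot> v" using assms(8)[OF v] assms(10)[OF v, of 1 "- 1"] by simp
      also have "\<dots> = \<zero>" using assms(9)[OF v] by simp
      finally show "\<exists>neg_v\<in>carrier V. v \<oplus> neg_v = \<zero>" using assms(3)[OF v] by blast
    qed
  qed (use assms in \<open>auto simp: field_def domain_def\<close>)
  then show ?thesis using \<open>field class_ring\<close> by (simp add: vectorspace_def)
qed

locale dc_hopf =
  fixes H :: "('k::field, 'h) coalg" (structure)
  assumes hopf_algebra: "hopf_algebra H" and dual_chevalley: "dual_chevalley H"
begin

sublocale bialg H using hopf_algebra by (simp add: bialg_def hopf_algebra_def)

abbreviation below :: "nat \<Rightarrow> 'h set" where "below n \<equiv> corad_below H n"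

lemma one_coradical: "\<one> \<in> F 0"
  using dual_chevalley by (simp add: dual_chevalley_def hopf_subalgebra_def)

lemma mult_coradical: "x \<in> F 0 \<Longrightarrow> y \<in> F 0 \<Longrightarrow> x \<otimes> y \<in> F 0"
  using dual_chevalley by (simp add: dual_chevalley_def hopf_subalgebra_def)

declare corad_filt.simps [simp del]

text \<open>Induction on n + m through \<Delta>(x y). If both left factors of a term have degree 0,
  their product lies in the coradical, which is closed under multiplication, and f kills it. In
  every other term the right factors have total degree less than n + m, so their product lies in
  \<open>F k\<close> by induction, where g vanishes.\<close>

lemma filt_mult: "x \<in> F n \<Longrightarrow> y \<in> F m \<Longrightarrow> x \<otimes> y \<in> F (n + m)"
proof (induction "n + m" arbitrary: n m x y rule: less_induct)
  case less
  show ?case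
  proof (cases "n + m")
    case 0
    then show ?thesis using less.prems mult_coradical by simp
  next
    case (Suc k)
    have c: "x \<in> carrier H" "y \<in> carrier H" using less.prems filt_carrier by blast+
    obtain r :: nat and i a b where x: "\<And>l. l < r \<Longrightarrow> i l \<le> n" "\<And>l. l < r \<Longrightarrow> a l \<in> F (i l)"
      "\<And>l. l < r \<Longrightarrow> b l \<in> F (n - i l)" "comult H x = (\<lambda>\<beta>\<in>bilinear_forms H H. \<Sum>l<r. \<beta> (a l) (b l))"
      using comult_filt[OF less.prems(1)] by blast
    obtain s :: nat and j c' d where y: "\<And>l. l < s \<Longrightarrow> j l \<le> m" "\<And>l. l < s \<Longrightarrow> c' l \<in> F (j l)"
      "\<And>l. l < s \<Longrightarrow> d l \<in> F (m - j l)" "comult H y = (\<lambda>\<beta>\<in>bilinear_forms H H. \<Sum>l<s. \<beta> (c' l) (d l))"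
      using comult_filt[OF less.prems(2)] by blast
    have "x \<otimes> y \<in> F (Suc k)"
    proof (rule filt_SucI)
      fix f g assume fg: "f \<in> linear_forms H" "g \<in> linear_forms H" "\<forall>y\<in>F 0. f y = 0" "\<forall>y\<in>F k. g y = 0"
      have "conv f g (x \<otimes> y) = (\<Sum>(l, q)\<in>{..<r} \<times> {..<s}. f (a l \<otimes> c' q) * g (b l \<otimes> d q))"
        unfolding conv_def
        by (rule comult_mult_sum[OF c form_prod[OF fg(1,2)]])
          (use filt_carrier[OF x(2)] filt_carrier[OF x(3)] in \<open>simp_all add: x(4) y(4)\<close>)
      also have "\<dots> = 0"
      proof (rule sum.neutral, safe)
        fix l q assume lq: "l < r" "q < s"
        show "f (a l \<otimes> c' q) * g (b l \<otimes> d q) = 0"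
        proof (cases "i l = 0 \<and> j q = 0")
          case True
          then have "a l \<otimes> c' q \<in> F 0" using mult_coradical x(2)[OF lq(1)] y(2)[OF lq(2)] by simp
          then show ?thesis using fg by simp
        next
          case False
          have le: "i l \<le> n" "j q \<le> m" using x(1) y(1) lq by auto
          then have "(n - i l) + (m - j q) \<le> k" "(n - i l) + (m - j q) < n + m" using False Suc by linarith+
          then have "b l \<otimes> d q \<in> F k"
            using less.hyps[of "n - i l" "m - j q"] x(3)[OF lq(1)] y(3)[OF lq(2)] filt_mono by blast
          then show ?thesis using fg by simp
        qed
      qed
      finally show "conv f g (x \<otimes> y) = 0" .
    qed (use c in simp)
    then show ?thesis by (simp add: Suc)
  qed
qed

lemma below_mult: "x \<in> below n \<Longrightarrow> y \<in> F m \<Longrightarrow> x \<otimes> y \<in> below (n + m)"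
  and mult_below: "x \<in> F n \<Longrightarrow> y \<in> below m \<Longrightarrow> x \<otimes> y \<in> below (n + m)"
proof -
  show "x \<in> below n \<Longrightarrow> y \<in> F m \<Longrightarrow> x \<otimes> y \<in> below (n + m)"
    using filt_mult[of x "n - 1" y m] filt_carrier subspaceD(2)[OF below_subspace]
    by (cases n) (auto simp: corad_below_def split: nat.splits)
  show "x \<in> F n \<Longrightarrow> y \<in> below m \<Longrightarrow> x \<otimes> y \<in> below (n + m)"
    using filt_mult[of x n y "m - 1"] filt_carrier subspaceD(2)[OF below_subspace]
    by (cases m) (auto simp: corad_below_def split: nat.splits)
qed

lemma below_carrier: "x \<in> below n \<Longrightarrow> x \<in> carrier H"
  using subspaceD(1)[OF below_subspace] .

text \<open>Sequences of representatives. The operations of \<open>gr H\<close> pick representatives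
  by \<open>rep\<close>; computing through \<open>lft\<close> replaces the picked ones by given
  ones.\<close>

definition seqs :: "(nat \<Rightarrow> 'h) set" where
  "seqs = {X. (\<forall>n. X n \<in> F n) \<and> finite {n. X n \<notin> below n}}"

definition lft :: "(nat \<Rightarrow> 'h) \<Rightarrow> nat \<Rightarrow> 'h set" where
  "lft X = (\<lambda>n. below n +> X n)"

lemma seqsD: "X \<in> seqs \<Longrightarrow> X n \<in> F n" "X \<in> seqs \<Longrightarrow> X n \<in> carrier H" "X \<in> seqs \<Longrightarrow> finite {n. X n \<notin> below n}"
  using filt_carrier by (auto simp: seqs_def)

lemma coset_eqI:
  assumes "x \<in> carrier H" "y \<in> carrier H"
    "\<And>\<phi>. \<phi> \<in> linear_forms H \<Longrightarrow> \<forall>z\<in>below n. \<phi> z = 0 \<Longrightarrow> \<phi> x = \<phi> y"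
  shows "below n +> x = below n +> y"
  unfolding coset_eq_iff[OF below_subspace assms(1,2)]
  by (rule in_subspaceI[OF below_subspace]) (use assms in \<open>auto simp: linear_formsD\<close>)

lemma lft_eqI:
  assumes "\<And>n. X n \<in> carrier H" "\<And>n. Y n \<in> carrier H"
    "\<And>n \<phi>. \<phi> \<in> linear_forms H \<Longrightarrow> \<forall>z\<in>below n. \<phi> z = 0 \<Longrightarrow> \<phi> (X n) = \<phi> (Y n)"
  shows "lft X = lft Y"
  unfolding lft_def using assms by (intro ext coset_eqI) auto

lemma lft_eq_below: "x \<in> carrier H \<Longrightarrow> below n +> x = below n \<longleftrightarrow> x \<in> below n"
  using coset_eq_iff[OF below_subspace, of x \<zero> n] coset_zero[OF below_subspace] by (simp add: minus_eq)

lemma gr_simps [simp]: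
  "carrier (gr H) = {f. (\<forall>n. \<exists>h\<in>F n. f n = below n +> h) \<and> finite {n. f n \<noteq> below n}}"
  "\<zero>\<^bsub>gr H\<^esub> = below" "\<one>\<^bsub>gr H\<^esub> = gr_class H 0 \<one>"
  "f \<oplus>\<^bsub>gr H\<^esub> g = (\<lambda>n. f n <+> g n)"
  "c \<odot>\<^bsub>gr H\<^esub> f = (\<lambda>n. below n +> (c \<odot> rep (f n)))"
  "f \<otimes>\<^bsub>gr H\<^esub> g = (\<lambda>n. below n +> (\<Oplus>i\<in>{..n}. rep (f i) \<otimes> rep (g (n - i))))"
  by (simp_all add: gr_def with_coalg_def gr_alg_def)

lemma lft_in: "X \<in> seqs \<Longrightarrow> lft X \<in> carrier (gr H)"
  using lft_eq_below[OF seqsD(2)[of X]] seqsD(3)[of X] by (auto simp: lft_def dest: seqsD(1))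

lemma grE:
  assumes "f \<in> carrier (gr H)"
  obtains X where "X \<in> seqs" "f = lft X"
proof -
  have "\<forall>n. \<exists>h. h \<in> F n \<and> f n = below n +> h" using assms by auto
  then obtain X where X: "\<forall>n. X n \<in> F n \<and> f n = below n +> X n" using choice by metis
  then have f: "f = lft X" by (auto simp: lft_def)
  have "f n \<noteq> below n \<longleftrightarrow> X n \<notin> below n" for n
    using lft_eq_below[of "X n" n] X filt_carrier by metis
  then have "X \<in> seqs" using assms X by (auto simp: seqs_def)
  with f that show thesis by blast
qed

lemma rep_lft:
  assumes "X \<in> seqs"
  shows "rep (lft X n) \<in> F n" "rep (lft X n) \<in> carrier H"
    "\<phi> \<in> linear_forms H \<Longrightarrow> \<forall>z\<in>below n. \<phi> z = 0 \<Longrightarrow> \<phi> (rep (lft X n)) = \<phi> (X n)"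
proof -
  note r = rep_coset[OF below_subspace seqsD(2)[OF assms], of n n, folded lft_def[THEN fun_cong]]
  show c: "rep (lft X n) \<in> carrier H" using r by (simp add: lft_def)
  have d: "rep (lft X n) \<ominus> X n \<in> below n" using r by (simp add: lft_def)
  have "rep (lft X n) = (rep (lft X n) \<ominus> X n) \<oplus> X n"
    using c seqsD(2)[OF assms] by (simp add: minus_eq a_assoc l_neg)
  then show "rep (lft X n) \<in> F n"
    using d below_filt[of n] seqsD(1)[OF assms] subspaceD(3)[OF filt_subspace] by (metis subsetD)
  show "\<phi> \<in> linear_forms H \<Longrightarrow> \<forall>z\<in>below n. \<phi> z = 0 \<Longrightarrow> \<phi> (rep (lft X n)) = \<phi> (X n)"
    using d c seqsD(2)[OF assms] by (auto simp: linear_formsD)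
qed

lemma rep_diff: "X \<in> seqs \<Longrightarrow> rep (lft X n) \<ominus> X n \<in> below n"
  using rep_coset(2)[OF below_subspace seqsD(2)] by (simp add: lft_def)

lemma seqs_zero: "(\<lambda>_. \<zero>) \<in> seqs"
  using subspaceD(2)[OF filt_subspace] subspaceD(2)[OF below_subspace] by (auto simp: seqs_def)

lemma seqs_add:
  assumes "X \<in> seqs" "Y \<in> seqs" shows "(\<lambda>n. X n \<oplus> Y n) \<in> seqs"
proof -
  have "{n. X n \<oplus> Y n \<notin> below n} \<subseteq> {n. X n \<notin> below n} \<union> {n. Y n \<notin> below n}"
    using subspaceD(3)[OF below_subspace] by auto
  then have "finite {n. X n \<oplus> Y n \<notin> below n}"
    by (rule finite_subset) (use seqsD(3) assms in blast)
  then show ?thesis using seqsD(1)[OF assms(1)] seqsD(1)[OF assms(2)] subspaceD(3)[OF filt_subspace]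
    by (simp add: seqs_def)
qed

lemma seqs_smult:
  assumes "X \<in> seqs" shows "(\<lambda>n. c \<odot> X n) \<in> seqs"
proof -
  have "finite {n. c \<odot> X n \<notin> below n}"
    by (rule finite_subset[OF _ seqsD(3)[OF assms]]) (use subspaceD(4)[OF below_subspace] in auto)
  then show ?thesis using seqsD(1)[OF assms] subspaceD(4)[OF filt_subspace] by (simp add: seqs_def)
qed

definition cauchy :: "(nat \<Rightarrow> 'h) \<Rightarrow> (nat \<Rightarrow> 'h) \<Rightarrow> nat \<Rightarrow> 'h" where
  "cauchy X Y n = (\<Oplus>i\<in>{..n}. X i \<otimes> Y (n - i))"

lemma finsum_in: "subspace class_ring W H \<Longrightarrow> (\<And>i. i \<in> A \<Longrightarrow> e i \<in> W) \<Longrightarrow> finsum H e A \<in> W"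
  using lincomb_in[of W A e "\<lambda>_. 1"] subspaceD(1)[of W]
  by (simp add: lincomb_def cong: finsum_cong)

lemma seqs_cauchy:
  assumes X: "X \<in> seqs" and Y: "Y \<in> seqs" shows "cauchy X Y \<in> seqs"
proof -
  have "cauchy X Y n \<in> F n" for n
    unfolding cauchy_def
  proof (rule finsum_in[OF filt_subspace])
    fix i assume "i \<in> {..n}"
    then show "X i \<otimes> Y (n - i) \<in> F n" using filt_mult[OF seqsD(1)[OF X] seqsD(1)[OF Y], of i "n - i"] by simp
  qed
  \<comment> \<open>A component of the product can only be nonzero in a degree that is a sum of
    degrees in which X and Y are nonzero.\<close>
  moreover have "{n. cauchy X Y n \<notin> below n} \<subseteq> (\<lambda>(i, j). i + j) ` ({n. X n \<notin> below n} \<times> {n. Y n \<notin> below n})"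
  proof (rule ccontr)
    assume "\<not> ?thesis"
    then obtain n where n: "cauchy X Y n \<notin> below n"
      "n \<notin> (\<lambda>(i, j). i + j) ` ({n. X n \<notin> below n} \<times> {n. Y n \<notin> below n})" by auto
    have "cauchy X Y n \<in> below n" unfolding cauchy_def
    proof (rule finsum_in[OF below_subspace])
      fix i assume "i \<in> {..n}"
      then have i: "i + (n - i) = n" by simp
      then have "X i \<in> below i \<or> Y (n - i) \<in> below (n - i)" using n(2) by force
      then show "X i \<otimes> Y (n - i) \<in> below n"
        using below_mult[OF _ seqsD(1)[OF Y], of "X i" i "n - i"] mult_below[OF seqsD(1)[OF X], of "Y (n - i)" "n - i" i] i
        by auto
    qed
    with n show False by simp
  qed
  moreover have "finite ((\<lambda>(i, j). i + j) ` ({n. X n \<notin> below n} \<times> {n. Y n \<notin> below n}))"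
    using seqsD(3) X Y by blast
  ultimately show ?thesis unfolding seqs_def using finite_subset by blast
qed

lemma lft_zero: "\<zero>\<^bsub>gr H\<^esub> = lft (\<lambda>_. \<zero>)"
  using coset_zero[OF below_subspace] by (simp add: lft_def)

lemma lft_add: "X \<in> seqs \<Longrightarrow> Y \<in> seqs \<Longrightarrow> lft X \<oplus>\<^bsub>gr H\<^esub> lft Y = lft (\<lambda>n. X n \<oplus> Y n)"
  using coset_add[OF below_subspace seqsD(2) seqsD(2)] by (simp add: lft_def)

lemma lft_smult:
  assumes "X \<in> seqs" shows "c \<odot>\<^bsub>gr H\<^esub> lft X = lft (\<lambda>n. c \<odot> X n)"
proof -
  have "lft (\<lambda>n. c \<odot> rep (lft X n)) = lft (\<lambda>n. c \<odot> X n)"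
    by (rule lft_eqI) (use assms rep_lft seqsD in \<open>auto simp: linear_formsD\<close>)
  then show ?thesis by (simp add: lft_def)
qed

lemma form_cauchy:
  assumes "\<phi> \<in> linear_forms H" "\<And>n. X n \<in> carrier H" "\<And>n. Y n \<in> carrier H"
  shows "\<phi> (cauchy X Y n) = (\<Sum>i\<le>n. \<phi> (X i \<otimes> Y (n - i)))"
  unfolding cauchy_def by (rule form_finsum) (use assms in auto)

lemma cauchy_closed:
  assumes "\<And>n. X n \<in> carrier H" "\<And>n. Y n \<in> carrier H"
  shows "cauchy X Y n \<in> carrier H"
  unfolding cauchy_def using assms by (intro finsum_closed) auto

text \<open>Independence of representatives: they are exchanged one factor at a time, and a
  correction in \<open>below\<close>, multiplied by an element of complementary degree, lies in
  \<open>below n\<close>.\<close>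

lemma lft_mult:
  assumes X: "X \<in> seqs" and Y: "Y \<in> seqs"
  shows "lft X \<otimes>\<^bsub>gr H\<^esub> lft Y = lft (cauchy X Y)"
proof -
  let ?X = "\<lambda>n. rep (lft X n)" and ?Y = "\<lambda>n. rep (lft Y n)"
  have "lft (cauchy ?X ?Y) = lft (cauchy X Y)"
  proof (rule lft_eqI)
    fix n \<phi> assume \<phi>: "\<phi> \<in> linear_forms H" "\<forall>z\<in>below n. \<phi> z = 0"
    have "\<phi> (?X i \<otimes> ?Y (n - i)) = \<phi> (X i \<otimes> Y (n - i))" if "i \<le> n" for i
    proof -
      note c = rep_lft(2)[OF X, of i] rep_lft(2)[OF Y, of "n - i"] seqsD(2)[OF X, of i] seqsD(2)[OF Y, of "n - i"]
      have "\<phi> (?X i \<otimes> ?Y (n - i)) - \<phi> (X i \<otimes> ?Y (n - i)) = \<phi> ((?X i \<ominus> X i) \<otimes> ?Y (n - i))"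
        using c linear_formsD(4)[OF mult_form(1)[OF \<phi>(1) c(2)] c(1) c(3)] by simp
      also have "\<dots> = 0"
        using below_mult[OF rep_diff[OF X, of i] rep_lft(1)[OF Y, of "n - i"]] that \<phi>(2) by simp
      finally have 1: "\<phi> (?X i \<otimes> ?Y (n - i)) = \<phi> (X i \<otimes> ?Y (n - i))" by simp
      have "\<phi> (X i \<otimes> ?Y (n - i)) - \<phi> (X i \<otimes> Y (n - i)) = \<phi> (X i \<otimes> (?Y (n - i) \<ominus> Y (n - i)))"
        using c linear_formsD(4)[OF mult_form(2)[OF \<phi>(1) c(3)] c(2) c(4)] by simp
      also have "\<dots> = 0"
        using mult_below[OF seqsD(1)[OF X, of i] rep_diff[OF Y, of "n - i"]] that \<phi>(2) by simp
      finally show ?thesis using 1 by simp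
    qed
    then show "\<phi> (cauchy ?X ?Y n) = \<phi> (cauchy X Y n)"
      by (simp add: form_cauchy[OF \<phi>(1)] rep_lft(2) seqsD(2) X Y)
  qed (use cauchy_closed seqsD(2) rep_lft(2) X Y in auto)
  then show ?thesis by (simp add: lft_def cauchy_def)
qed

definition single :: "nat \<Rightarrow> 'h \<Rightarrow> nat \<Rightarrow> 'h" where
  "single n h = (\<lambda>k. if k = n then h else \<zero>)"

lemma single_seqs: "h \<in> F n \<Longrightarrow> single n h \<in> seqs"
proof -
  assume "h \<in> F n"
  moreover have "{k. single n h k \<notin> below k} \<subseteq> {n}" using subspaceD(2)[OF below_subspace] by (auto simp: single_def)
  then have "finite {k. single n h k \<notin> below k}" by (rule finite_subset) simp
  ultimately show ?thesis using subspaceD(2)[OF filt_subspace] by (auto simp: seqs_def single_def)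
qed

lemma gr_class_lft: "gr_class H n h = lft (single n h)"
  by (simp add: gr_class_def lft_def single_def)

lemma gr_class_in: "h \<in> F n \<Longrightarrow> gr_class H n h \<in> carrier (gr H)"
  unfolding gr_class_lft using lft_in single_seqs by blast

declare gr_simps [simp del]

lemma one_gr: "\<one>\<^bsub>gr H\<^esub> = lft (single 0 \<one>)" by (simp add: gr_simps gr_class_lft)

lemma vectorspace_gr: "vectorspace class_ring (gr H)"
proof (rule vectorspaceI)
  show "\<zero>\<^bsub>gr H\<^esub> \<in> carrier (gr H)" unfolding lft_zero by (rule lft_in[OF seqs_zero])
  fix x assume "x \<in> carrier (gr H)"
  then obtain X where X: "X \<in> seqs" "x = lft X" by (rule grE)
  show "c \<odot>\<^bsub>gr H\<^esub> x \<in> carrier (gr H)" for c using X by (simp add: lft_smult lft_in seqs_smult)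
  show "x \<oplus>\<^bsub>gr H\<^esub> \<zero>\<^bsub>gr H\<^esub> = x" using X by (simp add: lft_zero lft_add seqs_zero seqsD(2))
  show "(c * d) \<odot>\<^bsub>gr H\<^esub> x = c \<odot>\<^bsub>gr H\<^esub> (d \<odot>\<^bsub>gr H\<^esub> x)" for c d
    using X by (simp add: lft_smult seqs_smult smult_smult seqsD(2))
  show "1 \<odot>\<^bsub>gr H\<^esub> x = x" using X by (simp add: lft_smult seqsD(2))
  show "0 \<odot>\<^bsub>gr H\<^esub> x = \<zero>\<^bsub>gr H\<^esub>" using X by (simp add: lft_smult seqsD(2) lft_zero)
  show "(c + d) \<odot>\<^bsub>gr H\<^esub> x = c \<odot>\<^bsub>gr H\<^esub> x \<oplus>\<^bsub>gr H\<^esub> d \<odot>\<^bsub>gr H\<^esub> x" for c d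
    using X by (simp add: lft_smult seqs_smult lft_add smult_add seqsD(2))
  fix y assume "y \<in> carrier (gr H)"
  then obtain Y where Y: "Y \<in> seqs" "y = lft Y" by (rule grE)
  show "x \<oplus>\<^bsub>gr H\<^esub> y \<in> carrier (gr H)" using X Y by (simp add: lft_add lft_in seqs_add)
  show "x \<oplus>\<^bsub>gr H\<^esub> y = y \<oplus>\<^bsub>gr H\<^esub> x" using X Y by (simp add: lft_add a_comm seqsD(2))
  show "c \<odot>\<^bsub>gr H\<^esub> (x \<oplus>\<^bsub>gr H\<^esub> y) = c \<odot>\<^bsub>gr H\<^esub> x \<oplus>\<^bsub>gr H\<^esub> c \<odot>\<^bsub>gr H\<^esub> y" for c
    using X Y by (simp add: lft_smult seqs_smult seqs_add lft_add smult_distrib seqsD(2))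
  fix z assume "z \<in> carrier (gr H)"
  then obtain Z where Z: "Z \<in> seqs" "z = lft Z" by (rule grE)
  show "(x \<oplus>\<^bsub>gr H\<^esub> y) \<oplus>\<^bsub>gr H\<^esub> z = x \<oplus>\<^bsub>gr H\<^esub> (y \<oplus>\<^bsub>gr H\<^esub> z)"
    using X Y Z by (simp add: lft_add seqs_add a_assoc seqsD(2))
qed

lemma k_algebra_gr: "k_algebra (gr H)"
proof -
  interpret G: vs "gr H" using vectorspace_gr by (rule vs.intro)
  have S: "X n \<in> carrier H" if "X \<in> seqs" for X n using seqsD(2)[OF that] .
  have "ring (gr H)"
  proof (rule ringI[OF G.abelian_group])
    show "monoid (gr H)"
    proof (rule monoidI)
      show "\<one>\<^bsub>gr H\<^esub> \<in> carrier (gr H)" unfolding one_gr by (rule lft_in[OF single_seqs[OF one_coradical]])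
      fix x assume "x \<in> carrier (gr H)"
      then obtain X where X: "X \<in> seqs" "x = lft X" by (rule grE)
      show "\<one>\<^bsub>gr H\<^esub> \<otimes>\<^bsub>gr H\<^esub> x = x"
      proof -
        have "lft (cauchy (single 0 \<one>) X) = lft X"
        proof (rule lft_eqI)
          fix n \<phi> assume \<phi>: "\<phi> \<in> linear_forms H"
          have "\<phi> (cauchy (single 0 \<one>) X n) = (\<Sum>i\<le>n. if i = 0 then \<phi> (X n) else 0)"
            unfolding form_cauchy[OF \<phi> S[OF single_seqs[OF one_coradical]] S[OF X(1)]]
            by (rule sum.cong[OF refl]) (use S[OF X(1)] in \<open>auto simp: single_def linear_formsD(3)[OF \<phi>]\<close>)
          then show "\<phi> (cauchy (single 0 \<one>) X n) = \<phi> (X n)" by simp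
        qed (use S[OF X(1)] S[OF single_seqs[OF one_coradical]] cauchy_closed in auto)
        then show ?thesis using X by (simp add: one_gr lft_mult single_seqs one_coradical)
      qed
      show "x \<otimes>\<^bsub>gr H\<^esub> \<one>\<^bsub>gr H\<^esub> = x"
      proof -
        have "lft (cauchy X (single 0 \<one>)) = lft X"
        proof (rule lft_eqI)
          fix n \<phi> assume \<phi>: "\<phi> \<in> linear_forms H"
          have "\<phi> (cauchy X (single 0 \<one>) n) = (\<Sum>i\<le>n. if i = n then \<phi> (X n) else 0)"
            unfolding form_cauchy[OF \<phi> S[OF X(1)] S[OF single_seqs[OF one_coradical]]]
            by (rule sum.cong[OF refl]) (use S[OF X(1)] in \<open>auto simp: single_def linear_formsD(3)[OF \<phi>]\<close>)
          then show "\<phi> (cauchy X (single 0 \<one>) n) = \<phi> (X n)" by simp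
        qed (use S[OF X(1)] S[OF single_seqs[OF one_coradical]] cauchy_closed in auto)
        then show ?thesis using X by (simp add: one_gr lft_mult single_seqs one_coradical)
      qed
      fix y assume "y \<in> carrier (gr H)"
      then obtain Y where Y: "Y \<in> seqs" "y = lft Y" by (rule grE)
      show "x \<otimes>\<^bsub>gr H\<^esub> y \<in> carrier (gr H)" using X Y by (simp add: lft_mult lft_in seqs_cauchy)
      fix z assume "z \<in> carrier (gr H)"
      then obtain Z where Z: "Z \<in> seqs" "z = lft Z" by (rule grE)
      note C = S[OF X(1)] S[OF Y(1)] S[OF Z(1)]
      have "lft (cauchy (cauchy X Y) Z) = lft (cauchy X (cauchy Y Z))"
      proof (rule lft_eqI)
        fix n \<phi> assume \<phi>: "\<phi> \<in> linear_forms H"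
        have "\<phi> (cauchy (cauchy X Y) Z n) = (\<Sum>i\<le>n. \<Sum>j\<le>i. \<phi> ((X j \<otimes> Y (i - j)) \<otimes> Z (n - i)))"
          unfolding form_cauchy[OF \<phi> cauchy_closed[OF C(1,2)] C(3)]
          by (rule sum.cong[OF refl], rule form_cauchy[OF mult_form(1)[OF \<phi> C(3)] C(1,2)])
        also have "\<dots> = (\<Sum>i\<le>n. \<Sum>j\<le>n - i. \<phi> ((X i \<otimes> Y j) \<otimes> Z (n - i - j)))"
          by (rule sum_triangle[where f = "\<lambda>i j k. \<phi> ((X i \<otimes> Y j) \<otimes> Z k)"])
        also have "\<dots> = (\<Sum>i\<le>n. \<Sum>j\<le>n - i. \<phi> (X i \<otimes> (Y j \<otimes> Z (n - i - j))))"
          using C by (simp add: m_assoc)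
        also have "\<dots> = \<phi> (cauchy X (cauchy Y Z) n)"
          unfolding form_cauchy[OF \<phi> C(1) cauchy_closed[OF C(2,3)]]
          by (rule sum.cong[OF refl], rule form_cauchy[OF mult_form(2)[OF \<phi> C(1)] C(2,3), symmetric])
        finally show "\<phi> (cauchy (cauchy X Y) Z n) = \<phi> (cauchy X (cauchy Y Z) n)" .
      qed (use C cauchy_closed in auto)
      then show "(x \<otimes>\<^bsub>gr H\<^esub> y) \<otimes>\<^bsub>gr H\<^esub> z = x \<otimes>\<^bsub>gr H\<^esub> (y \<otimes>\<^bsub>gr H\<^esub> z)"
        using X Y Z by (simp add: lft_mult seqs_cauchy)
    qed
  next
    fix x y z assume "x \<in> carrier (gr H)" "y \<in> carrier (gr H)" "z \<in> carrier (gr H)"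
    then obtain X Y Z where X: "X \<in> seqs" "x = lft X" and Y: "Y \<in> seqs" "y = lft Y" and Z: "Z \<in> seqs" "z = lft Z"
      by (metis grE)
    note C = S[OF X(1)] S[OF Y(1)] S[OF Z(1)] S[OF seqs_add[OF X(1) Y(1)]]
    have "lft (cauchy (\<lambda>n. X n \<oplus> Y n) Z) = lft (\<lambda>n. cauchy X Z n \<oplus> cauchy Y Z n)"
      by (rule lft_eqI)
        (use C cauchy_closed[OF C(1,3)] cauchy_closed[OF C(2,3)] cauchy_closed[OF C(4,3)] in
          \<open>simp_all add: linear_formsD form_cauchy l_distr sum.distrib\<close>)
    then show "(x \<oplus>\<^bsub>gr H\<^esub> y) \<otimes>\<^bsub>gr H\<^esub> z = x \<otimes>\<^bsub>gr H\<^esub> z \<oplus>\<^bsub>gr H\<^esub> y \<otimes>\<^bsub>gr H\<^esub> z"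
      using X Y Z by (simp add: lft_mult lft_add seqs_cauchy seqs_add)
    have "lft (cauchy Z (\<lambda>n. X n \<oplus> Y n)) = lft (\<lambda>n. cauchy Z X n \<oplus> cauchy Z Y n)"
      by (rule lft_eqI)
        (use C cauchy_closed[OF C(3,1)] cauchy_closed[OF C(3,2)] cauchy_closed[OF C(3,4)] in
          \<open>simp_all add: linear_formsD form_cauchy r_distr sum.distrib\<close>)
    then show "z \<otimes>\<^bsub>gr H\<^esub> (x \<oplus>\<^bsub>gr H\<^esub> y) = z \<otimes>\<^bsub>gr H\<^esub> x \<oplus>\<^bsub>gr H\<^esub> z \<otimes>\<^bsub>gr H\<^esub> y"
      using X Y Z by (simp add: lft_mult lft_add seqs_cauchy seqs_add)
  qed
  moreover have "c \<odot>\<^bsub>gr H\<^esub> (x \<otimes>\<^bsub>gr H\<^esub> y) = (c \<odot>\<^bsub>gr H\<^esub> x) \<otimes>\<^bsub>gr H\<^esub> y \<and>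
      c \<odot>\<^bsub>gr H\<^esub> (x \<otimes>\<^bsub>gr H\<^esub> y) = x \<otimes>\<^bsub>gr H\<^esub> (c \<odot>\<^bsub>gr H\<^esub> y)"
    if xy: "x \<in> carrier (gr H)" "y \<in> carrier (gr H)" for c x y
  proof -
    obtain X Y where X: "X \<in> seqs" "x = lft X" and Y: "Y \<in> seqs" "y = lft Y" using xy by (metis grE)
    note C = S[OF X(1)] S[OF Y(1)] S[OF seqs_smult[OF X(1)]] S[OF seqs_smult[OF Y(1)]]
    have "lft (\<lambda>n. c \<odot> cauchy X Y n) = lft (cauchy (\<lambda>n. c \<odot> X n) Y)"
      "lft (\<lambda>n. c \<odot> cauchy X Y n) = lft (cauchy X (\<lambda>n. c \<odot> Y n))"
      by (rule lft_eqI; use C cauchy_closed[OF C(1,2)] cauchy_closed[OF C(3,2)] cauchy_closed[OF C(1,4)] in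
          \<open>simp add: linear_formsD form_cauchy sum_distrib_left\<close>)+
    then show ?thesis using X Y by (simp add: lft_mult lft_smult seqs_cauchy seqs_smult)
  qed
  ultimately show ?thesis unfolding k_algebra_def using vectorspace_gr by blast
qed

end

section \<open>Homogeneous elements of the graded algebra\<close>

context dc_hopf
begin

sublocale G: kalg "gr H" by unfold_locales (rule k_algebra_gr)

lemma gr_class_add:
  "x \<in> F n \<Longrightarrow> y \<in> F n \<Longrightarrow> gr_class H n (x \<oplus> y) = gr_class H n x \<oplus>\<^bsub>gr H\<^esub> gr_class H n y"
  unfolding gr_class_lft by (simp add: lft_add single_seqs) (simp add: single_def fun_eq_iff lft_def)

lemma gr_class_smult:
  "x \<in> F n \<Longrightarrow> gr_class H n (c \<odot> x) = c \<odot>\<^bsub>gr H\<^esub> gr_class H n x"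
  unfolding gr_class_lft by (simp add: lft_smult single_seqs) (simp add: single_def fun_eq_iff lft_def)

lemma gr_class_below:
  assumes "x \<in> below n" shows "gr_class H n x = \<zero>\<^bsub>gr H\<^esub>"
  unfolding gr_class_lft lft_zero
  by (rule lft_eqI) (use assms below_carrier in \<open>auto simp: single_def linear_formsD\<close>)

lemma gr_class_mult:
  assumes h: "h \<in> F n" and g: "g \<in> F m"
  shows "gr_class H n h \<otimes>\<^bsub>gr H\<^esub> gr_class H m g = gr_class H (n + m) (h \<otimes> g)"
proof -
  have c: "single n h k \<in> carrier H" "single m g k \<in> carrier H" "single (n + m) (h \<otimes> g) k \<in> carrier H" for k
    using filt_carrier[OF h] filt_carrier[OF g] by (auto simp: single_def)
  have "lft (cauchy (single n h) (single m g)) = lft (single (n + m) (h \<otimes> g))"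
  proof (rule lft_eqI)
    fix k \<phi> assume \<phi>: "\<phi> \<in> linear_forms H"
    have "\<phi> (cauchy (single n h) (single m g) k) = (\<Sum>i\<le>k. if i = n then (if k - n = m then \<phi> (h \<otimes> g) else 0) else 0)"
      unfolding form_cauchy[OF \<phi> c(1,2)]
      by (rule sum.cong[OF refl])
        (use filt_carrier[OF h] filt_carrier[OF g] in \<open>auto simp: single_def linear_formsD(3)[OF \<phi>]\<close>)
    also have "\<dots> = (if n \<le> k \<and> k - n = m then \<phi> (h \<otimes> g) else 0)" by simp
    also have "\<dots> = \<phi> (single (n + m) (h \<otimes> g) k)"
      by (auto simp: single_def linear_formsD(3)[OF \<phi>])
    finally show "\<phi> (cauchy (single n h) (single m g) k) = \<phi> (single (n + m) (h \<otimes> g) k)" .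
  qed (use c cauchy_closed in auto)
  then show ?thesis unfolding gr_class_lft by (simp add: lft_mult single_seqs h g)
qed

text \<open>Induction on the finite set of degrees in which an element is nonzero: splitting off the
  component of one degree leaves a smaller set.\<close>

lemma gr_induct [consumes 1, case_names hom add]:
  assumes f: "f \<in> carrier (gr H)"
    and cl: "\<And>n h. h \<in> F n \<Longrightarrow> P (gr_class H n h)"
    and add: "\<And>x y. x \<in> carrier (gr H) \<Longrightarrow> y \<in> carrier (gr H) \<Longrightarrow> P x \<Longrightarrow> P y \<Longrightarrow> P (x \<oplus>\<^bsub>gr H\<^esub> y)"
  shows "P f"
proof -
  have "P (lft X)" if "finite S" "X \<in> seqs" "{n. X n \<notin> below n} = S" for X S
    using that
  proof (induction S arbitrary: X rule: finite_induct)
    case empty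
    have "lft X = lft (single 0 \<zero>)"
      by (rule lft_eqI) (use empty seqsD in \<open>auto simp: single_def linear_formsD\<close>)
    then show ?case using cl[of \<zero> 0] subspaceD(2)[OF filt_subspace] by (simp add: gr_class_lft)
  next
    case (insert n S)
    define Y where "Y = X(n := \<zero>)"
    have z: "\<zero> \<in> below k" "\<zero> \<in> F k" for k using subspaceD(2)[OF below_subspace] subspaceD(2)[OF filt_subspace] by auto
    have yS: "{n. Y n \<notin> below n} = S" using insert z by (auto simp: Y_def)
    then have Y: "Y \<in> seqs" using insert.hyps insert.prems z by (auto simp: seqs_def Y_def)
    have "P (lft Y)" by (rule insert.IH[OF Y yS])
    moreover have "lft X = gr_class H n (X n) \<oplus>\<^bsub>gr H\<^esub> lft Y"
      unfolding gr_class_lft using lft_add[OF single_seqs[OF seqsD(1)[OF insert.prems(1)]] Y]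
      by (simp add: single_def Y_def lft_def fun_eq_iff seqsD(2)[OF insert.prems(1)])
    ultimately show ?case using add[OF gr_class_in lft_in] cl seqsD(1)[OF insert.prems(1)] Y by simp
  qed
  moreover obtain X where "X \<in> seqs" "f = lft X" using f by (rule grE)
  ultimately show ?thesis using seqsD(3) by blast
qed

lemma gr_forms_eq:
  assumes "f \<in> carrier (gr H)" "\<phi> \<in> linear_forms (gr H)" "\<psi> \<in> linear_forms (gr H)"
    "\<And>n h. h \<in> F n \<Longrightarrow> \<phi> (gr_class H n h) = \<psi> (gr_class H n h)"
  shows "\<phi> f = \<psi> f"
  using assms(1) by (induction rule: gr_induct) (use assms(2-) in \<open>auto simp: G.linear_formsD\<close>)

definition comp :: "nat \<Rightarrow> (nat \<Rightarrow> 'h set) \<Rightarrow> nat \<Rightarrow> 'h set" where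
  "comp d f = (\<lambda>k. if k = d then f k else below k)"

lemma comp_lft: "comp d (lft X) = gr_class H d (X d)"
  unfolding gr_class_lft comp_def lft_def single_def using coset_zero[OF below_subspace] by (intro ext) simp

lemma comp_class: "h \<in> F n \<Longrightarrow> comp d (gr_class H n h) = (if n = d then gr_class H n h else \<zero>\<^bsub>gr H\<^esub>)"
  by (auto simp: gr_class_lft[of n h] comp_lft single_def) (auto simp: gr_class_lft single_def gr_class_below lft_zero)

lemma comp_hom: "comp d \<in> LinearCombinations.module_hom class_ring (gr H) (gr H)"
  unfolding LinearCombinations.module_hom_def
proof (safe, goal_cases)
  case (1 x)
  then obtain X where "X \<in> seqs" "x = lft X" by (rule grE)
  then show ?case using gr_class_in seqsD(1) by (simp add: comp_lft)
next
  case (2 x y)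
  then obtain X Y where "X \<in> seqs" "x = lft X" "Y \<in> seqs" "y = lft Y" by (metis grE)
  then show ?case by (simp add: comp_lft lft_add gr_class_add seqsD(1))
next
  case (3 c x)
  then obtain X where "X \<in> seqs" "x = lft X" by (metis grE)
  then show ?case by (simp add: comp_lft lft_smult gr_class_smult seqsD(1))
qed

lemma gr_proj_lft: "X \<in> seqs \<Longrightarrow> gr_proj (lft X) = X 0"
  using rep_diff[of X 0] rep_lft(2)[of X 0] seqsD(2)[of X 0]
  by (simp add: gr_proj_def corad_below_def minus_other_side)

lemma gr_proj_class: "h \<in> F n \<Longrightarrow> gr_proj (gr_class H n h) = (if n = 0 then h else \<zero>)"
  by (simp add: gr_class_lft gr_proj_lft single_seqs) (simp add: single_def)

lemma gr_proj_hom: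
  shows "x \<in> carrier (gr H) \<Longrightarrow> gr_proj x \<in> F 0"
    "x \<in> carrier (gr H) \<Longrightarrow> y \<in> carrier (gr H) \<Longrightarrow> gr_proj (x \<oplus>\<^bsub>gr H\<^esub> y) = gr_proj x \<oplus> gr_proj y"
    "x \<in> carrier (gr H) \<Longrightarrow> gr_proj (c \<odot>\<^bsub>gr H\<^esub> x) = c \<odot> gr_proj x"
    "x \<in> carrier (gr H) \<Longrightarrow> y \<in> carrier (gr H) \<Longrightarrow> gr_proj (x \<otimes>\<^bsub>gr H\<^esub> y) = gr_proj x \<otimes> gr_proj y"
proof -
  assume x: "x \<in> carrier (gr H)"
  then obtain X where X: "X \<in> seqs" "x = lft X" by (rule grE)
  show "gr_proj x \<in> F 0" using X by (simp add: gr_proj_lft seqsD(1))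
  show "gr_proj (c \<odot>\<^bsub>gr H\<^esub> x) = c \<odot> gr_proj x"
    using X seqs_smult by (simp add: gr_proj_lft lft_smult)
  assume y: "y \<in> carrier (gr H)"
  then obtain Y where Y: "Y \<in> seqs" "y = lft Y" by (rule grE)
  show "gr_proj (x \<oplus>\<^bsub>gr H\<^esub> y) = gr_proj x \<oplus> gr_proj y"
    using X Y seqs_add by (simp add: gr_proj_lft lft_add)
  have "cauchy X Y 0 = X 0 \<otimes> Y 0"
    using seqsD(2)[OF X(1)] seqsD(2)[OF Y(1)] by (simp add: cauchy_def)
  then show "gr_proj (x \<otimes>\<^bsub>gr H\<^esub> y) = gr_proj x \<otimes> gr_proj y"
    using X Y seqs_cauchy by (simp add: gr_proj_lft lft_mult)
qed

subsection \<open>Comultiplication of the graded algebra\<close>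

lemma bilinear_forms_gr: "bilinear_forms (gr_alg H) (gr_alg H) = bilinear_forms (gr H) (gr H)"
  by (simp add: bilinear_forms_def linear_forms_def gr_def with_coalg_def)

definition Pr :: "nat \<Rightarrow> 'h \<Rightarrow> 'h" where
  "Pr = (SOME P. (\<forall>n. P n \<in> LinearCombinations.module_hom class_ring H H) \<and>
    (\<forall>n. \<forall>x\<in>carrier H. P n x \<in> F n) \<and> (\<forall>n. \<forall>x\<in>F n. P n x = x))"

lemma Pr: "Pr n \<in> LinearCombinations.module_hom class_ring H H" "x \<in> carrier H \<Longrightarrow> Pr n x \<in> F n" "x \<in> F n \<Longrightarrow> Pr n x = x"
proof -
  have "\<exists>P. (\<forall>n. P n \<in> LinearCombinations.module_hom class_ring H H) \<and>
    (\<forall>n. \<forall>x\<in>carrier H. P n x \<in> F n) \<and> (\<forall>n. \<forall>x\<in>F n. P n x = x)"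
    using filt_projections by metis
  from someI_ex[OF this, folded Pr_def]
  show "Pr n \<in> LinearCombinations.module_hom class_ring H H" "x \<in> carrier H \<Longrightarrow> Pr n x \<in> F n" "x \<in> F n \<Longrightarrow> Pr n x = x"
    by auto
qed

lemma class_Pr_hom: "(\<lambda>a. gr_class H i (Pr i a)) \<in> LinearCombinations.module_hom class_ring H (gr H)"
  using Pr(1)[of i] Pr(2)[of _ i]
  by (auto simp: LinearCombinations.module_hom_def gr_class_in gr_class_add gr_class_smult)

text \<open>A bilinear form on \<open>H\<close> that computes the class of a tensor in \<open>\<Sum>\<^sub>i H\<^sub>i \<otimes> H\<^bsub>n-i\<^esub>\<close>.\<close>

definition spl :: "nat \<Rightarrow> ((nat \<Rightarrow> 'h set) \<Rightarrow> (nat \<Rightarrow> 'h set) \<Rightarrow> 'k) \<Rightarrow> 'h \<Rightarrow> 'h \<Rightarrow> 'k" where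
  "spl n \<beta> = (\<lambda>a b. \<Sum>i\<le>n. \<beta> (gr_class H i (Pr i a)) (gr_class H (n - i) (Pr (n - i) b)))"

lemma spl_bilinear: "\<beta> \<in> bilinear_forms (gr H) (gr H) \<Longrightarrow> spl n \<beta> \<in> bilinear_forms H H"
  unfolding spl_def by (intro bilinear_form_sum vs bilinear_form_comp[OF vs vs class_Pr_hom class_Pr_hom])

text \<open>An element that lies below the degree in which its class is taken is fixed by the
  projection, and its class in that degree is zero.\<close>

lemma spl_term:
  assumes \<beta>: "\<beta> \<in> bilinear_forms (gr H) (gr H)" and a: "a \<in> F i" and b: "b \<in> F j" and "i < k \<or> j < l"
  shows "\<beta> (gr_class H k (Pr k a)) (gr_class H l (Pr l b)) = 0"
proof -
  have c: "gr_class H k (Pr k a) \<in> carrier (gr H)" "gr_class H l (Pr l b) \<in> carrier (gr H)"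
    using Pr(2) filt_carrier a b gr_class_in by blast+
  from assms(4) show ?thesis
  proof
    assume "i < k"
    then have "a \<in> below k" using a filt_below by blast
    then have "gr_class H k (Pr k a) = \<zero>\<^bsub>gr H\<^esub>" using below_filt Pr(3) gr_class_below by (metis subsetD)
    then show ?thesis using G.linear_formsD(3)[OF bilinear_formsD(2)[OF \<beta> c(2)]] by simp
  next
    assume "j < l"
    then have "b \<in> below l" using b filt_below by blast
    then have "gr_class H l (Pr l b) = \<zero>\<^bsub>gr H\<^esub>" using below_filt Pr(3) gr_class_below by (metis subsetD)
    then show ?thesis using G.linear_formsD(3)[OF bilinear_formsD(1)[OF \<beta> c(1)]] by simp
  qed
qed

text \<open>The degrees add up to n on both sides, so every summand but the i-th takes one of its
  two classes in too high a degree.\<close>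

lemma spl_eq:
  assumes \<beta>: "\<beta> \<in> bilinear_forms (gr H) (gr H)" and a: "a \<in> F i" and b: "b \<in> F (n - i)" and i: "i \<le> n"
  shows "spl n \<beta> a b = \<beta> (gr_class H i a) (gr_class H (n - i) b)"
proof -
  have "spl n \<beta> a b = (\<Sum>k\<le>n. if k = i then \<beta> (gr_class H i a) (gr_class H (n - i) b) else 0)"
    unfolding spl_def
  proof (rule sum.cong[OF refl])
    fix k assume k: "k \<in> {..n}"
    show "\<beta> (gr_class H k (Pr k a)) (gr_class H (n - k) (Pr (n - k) b)) =
      (if k = i then \<beta> (gr_class H i a) (gr_class H (n - i) b) else 0)"
    proof (cases "k = i")
      case False
      then have "i < k \<or> n - i < n - k" using k i by auto
      with spl_term[OF \<beta> a b this] False show ?thesis by simp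
    qed (use a b Pr(3) in simp)
  qed
  then show ?thesis using i by simp
qed

lemma spl_below:
  assumes \<beta>: "\<beta> \<in> bilinear_forms (gr H) (gr H)" and a: "a \<in> F i" and b: "b \<in> F j" and i: "i + j < n"
  shows "spl n \<beta> a b = 0"
  unfolding spl_def by (rule sum.neutral) (use i in \<open>auto intro!: spl_term[OF \<beta> a b]\<close>)

lemma comult_spl_below:
  assumes \<beta>: "\<beta> \<in> bilinear_forms (gr H) (gr H)" and h: "h \<in> below n"
  shows "comult H h (spl n \<beta>) = 0"
proof (cases n)
  case 0
  then show ?thesis using h linear_formsD(3)[OF comult_form[OF spl_bilinear[OF \<beta>]]] by (simp add: corad_below_def)
next
  case (Suc m)
  then have "h \<in> F m" using h by (simp add: corad_below_def)
  from comult_filt[OF this] obtain r :: nat and i a b where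
    "\<forall>l<r. i l \<le> m \<and> a l \<in> F (i l) \<and> b l \<in> F (m - i l)"
    "comult H h = (\<lambda>\<beta>\<in>bilinear_forms H H. \<Sum>l<r. \<beta> (a l) (b l))" by blast
  then show ?thesis using spl_bilinear[OF \<beta>] Suc by (auto intro!: sum.neutral spl_below[OF \<beta>])
qed

text \<open>The description ranges over all decompositions of \<Delta>(h) by degree. Each of them
  evaluates at \<beta> to \<Delta>(h) at \<open>spl n \<beta>\<close>, a form on H that knows
  nothing of the decomposition; this gives uniqueness, and \<open>comult_filt\<close> gives
  existence.\<close>

lemma gr_comult_hom_eq:
  assumes h: "h \<in> F n"
  shows "gr_comult_hom H n h = (\<lambda>\<beta>\<in>bilinear_forms (gr H) (gr H). comult H h (spl n \<beta>))"
proof -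
  have eq: "(\<lambda>\<beta>\<in>bilinear_forms (gr H) (gr H). \<Sum>l<r. \<beta> (gr_class H (i l) (a l)) (gr_class H (n - i l) (b l))) =
      (\<lambda>\<beta>\<in>bilinear_forms (gr H) (gr H). comult H h (spl n \<beta>))"
    if "\<forall>l<r. i l \<le> n \<and> a l \<in> F (i l) \<and> b l \<in> F (n - i l)"
      "comult H h = (\<lambda>\<beta>\<in>bilinear_forms H H. \<Sum>l<r. \<beta> (a l) (b l))" for r :: nat and i a b
    by (rule restrict_ext) (use that spl_bilinear spl_eq in \<open>auto intro!: sum.cong\<close>)
  show ?thesis unfolding gr_comult_hom_def bilinear_forms_gr
  proof (rule the_equality)
    from comult_filt[OF h] obtain r :: nat and i a b where
      r: "\<forall>l<r. i l \<le> n \<and> a l \<in> F (i l) \<and> b l \<in> F (n - i l)"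
      "comult H h = (\<lambda>\<beta>\<in>bilinear_forms H H. \<Sum>l<r. \<beta> (a l) (b l))" by blast
    show "\<exists>(r::nat) i a b. (\<forall>l<r. i l \<le> n \<and> a l \<in> F (i l) \<and> b l \<in> F (n - i l)) \<and>
      comult H h = (\<lambda>\<beta>\<in>bilinear_forms H H. \<Sum>l<r. \<beta> (a l) (b l)) \<and>
      (\<lambda>\<beta>\<in>bilinear_forms (gr H) (gr H). comult H h (spl n \<beta>)) =
      (\<lambda>\<beta>\<in>bilinear_forms (gr H) (gr H). \<Sum>l<r. \<beta> (gr_class H (i l) (a l)) (gr_class H (n - i l) (b l)))"
      by (rule exI[of _ r], rule exI[of _ i], rule exI[of _ a], rule exI[of _ b])
        (intro conjI r(1) r(2) eq[OF r, symmetric])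
  next
    fix T assume "\<exists>(r::nat) i a b. (\<forall>l<r. i l \<le> n \<and> a l \<in> F (i l) \<and> b l \<in> F (n - i l)) \<and>
      comult H h = (\<lambda>\<beta>\<in>bilinear_forms H H. \<Sum>l<r. \<beta> (a l) (b l)) \<and>
      T = (\<lambda>\<beta>\<in>bilinear_forms (gr H) (gr H). \<Sum>l<r. \<beta> (gr_class H (i l) (a l)) (gr_class H (n - i l) (b l)))"
    then obtain r :: nat and i a b where r: "\<forall>l<r. i l \<le> n \<and> a l \<in> F (i l) \<and> b l \<in> F (n - i l)"
      "comult H h = (\<lambda>\<beta>\<in>bilinear_forms H H. \<Sum>l<r. \<beta> (a l) (b l))"
      "T = (\<lambda>\<beta>\<in>bilinear_forms (gr H) (gr H). \<Sum>l<r. \<beta> (gr_class H (i l) (a l)) (gr_class H (n - i l) (b l)))"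
      by blast
    show "T = (\<lambda>\<beta>\<in>bilinear_forms (gr H) (gr H). comult H h (spl n \<beta>))"
      unfolding r(3) by (rule eq[OF r(1,2)])
  qed
qed

lemma comult_gr_def: "comult (gr H) = (\<lambda>f. \<lambda>\<beta>\<in>bilinear_forms (gr H) (gr H).
    \<Sum>n | f n \<noteq> below n. gr_comult_hom H n (rep (f n)) \<beta>)"
  unfolding bilinear_forms_gr[symmetric] by (simp add: gr_def with_coalg_def)

text \<open>S may be any finite set containing the support, so that two elements can be treated over
  a common index set.\<close>

lemma comult_lft:
  assumes X: "X \<in> seqs" and \<beta>: "\<beta> \<in> bilinear_forms (gr H) (gr H)"
    and S: "finite S" "{n. X n \<notin> below n} \<subseteq> S"
  shows "comult (gr H) (lft X) \<beta> = (\<Sum>n\<in>S. comult H (X n) (spl n \<beta>))"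
proof -
  have s: "{n. lft X n \<noteq> below n} = {n. X n \<notin> below n}"
    using lft_eq_below[OF seqsD(2)[OF X]] by (auto simp: lft_def)
  have "comult (gr H) (lft X) \<beta> = (\<Sum>n | X n \<notin> below n. gr_comult_hom H n (rep (lft X n)) \<beta>)"
    by (simp only: comult_gr_def restrict_apply \<beta> if_True s)
  also have "\<dots> = (\<Sum>n | X n \<notin> below n. comult H (X n) (spl n \<beta>))"
  proof (rule sum.cong[OF refl])
    fix n
    have "comult H (rep (lft X n)) (spl n \<beta>) = comult H (X n) (spl n \<beta>)"
      by (rule rep_lft(3)[OF X comult_form[OF spl_bilinear[OF \<beta>]]]) (use comult_spl_below[OF \<beta>] in blast)
    then show "gr_comult_hom H n (rep (lft X n)) \<beta> = comult H (X n) (spl n \<beta>)"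
      using gr_comult_hom_eq[OF rep_lft(1)[OF X]] \<beta> by simp
  qed
  also have "\<dots> = (\<Sum>n\<in>S. comult H (X n) (spl n \<beta>))"
    by (rule sum.mono_neutral_left[OF S]) (use comult_spl_below[OF \<beta>] in auto)
  finally show ?thesis .
qed

lemma comult_gr_ext: "comult (gr H) f \<in> extensional (bilinear_forms (gr H) (gr H))"
  by (simp add: comult_gr_def)

lemma comult_gr_form:
  assumes \<beta>: "\<beta> \<in> bilinear_forms (gr H) (gr H)"
  shows "(\<lambda>f. comult (gr H) f \<beta>) \<in> linear_forms (gr H)"
proof (rule G.linear_formsI)
  note D = linear_formsD[OF comult_form[OF spl_bilinear[OF \<beta>]]]
  fix x y assume "x \<in> carrier (gr H)" "y \<in> carrier (gr H)"
  then obtain X Y where X: "X \<in> seqs" "x = lft X" and Y: "Y \<in> seqs" "y = lft Y" by (metis grE)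
  let ?S = "{n. X n \<notin> below n} \<union> {n. Y n \<notin> below n}"
  have S: "finite ?S" using seqsD(3) X Y by blast
  have "{n. X n \<oplus> Y n \<notin> below n} \<subseteq> ?S" using subspaceD(3)[OF below_subspace] by auto
  then show "comult (gr H) (x \<oplus>\<^bsub>gr H\<^esub> y) \<beta> = comult (gr H) x \<beta> + comult (gr H) y \<beta>"
    using X Y comult_lft[OF seqs_add[OF X(1) Y(1)] \<beta> S] comult_lft[OF X(1) \<beta> S] comult_lft[OF Y(1) \<beta> S]
    by (simp add: lft_add D seqsD(2) sum.distrib)
next
  note D = linear_formsD[OF comult_form[OF spl_bilinear[OF \<beta>]]]
  fix c x assume "x \<in> carrier (gr H)"
  then obtain X where X: "X \<in> seqs" "x = lft X" by (rule grE)
  have "{n. c \<odot> X n \<notin> below n} \<subseteq> {n. X n \<notin> below n}" using subspaceD(4)[OF below_subspace] by auto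
  then show "comult (gr H) (c \<odot>\<^bsub>gr H\<^esub> x) \<beta> = c * comult (gr H) x \<beta>"
    using X comult_lft[OF seqs_smult[OF X(1)] \<beta> seqsD(3)[OF X(1)]] comult_lft[OF X(1) \<beta> seqsD(3)[OF X(1)]]
    by (simp add: lft_smult D seqsD(2) sum_distrib_left)
qed

lemma comult_gr_class:
  assumes h: "h \<in> F n" and \<beta>: "\<beta> \<in> bilinear_forms (gr H) (gr H)"
    and L: "\<And>l. l \<in> L \<Longrightarrow> i l \<le> n \<and> a l \<in> F (i l) \<and> b l \<in> F (n - i l)"
    and d: "\<And>\<beta>. \<beta> \<in> bilinear_forms H H \<Longrightarrow> comult H h \<beta> = (\<Sum>l\<in>L. \<beta> (a l) (b l))"
  shows "comult (gr H) (gr_class H n h) \<beta> = (\<Sum>l\<in>L. \<beta> (gr_class H (i l) (a l)) (gr_class H (n - i l) (b l)))"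
proof -
  have "{k. single n h k \<notin> below k} \<subseteq> {n}" using subspaceD(2)[OF below_subspace] by (auto simp: single_def)
  then have "comult (gr H) (gr_class H n h) \<beta> = comult H h (spl n \<beta>)"
    using comult_lft[OF single_seqs[OF h] \<beta>, of "{n}"] by (simp add: gr_class_lft) (simp add: single_def)
  also have "\<dots> = (\<Sum>l\<in>L. spl n \<beta> (a l) (b l))" by (rule d[OF spl_bilinear[OF \<beta>]])
  also have "\<dots> = (\<Sum>l\<in>L. \<beta> (gr_class H (i l) (a l)) (gr_class H (n - i l) (b l)))"
    by (rule sum.cong[OF refl]) (use L spl_eq[OF \<beta>] in blast)
  finally show ?thesis .
qed

lemma comult_class_sum:
  assumes h: "h \<in> F n"
  obtains r :: nat and i a b where "\<And>l. l < r \<Longrightarrow> i l \<le> n" "\<And>l. l < r \<Longrightarrow> a l \<in> F (i l)" "\<And>l. l < r \<Longrightarrow> b l \<in> F (n - i l)"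
    "\<And>\<beta>. \<beta> \<in> bilinear_forms H H \<Longrightarrow> comult H h \<beta> = (\<Sum>l<r. \<beta> (a l) (b l))"
    "\<And>\<beta>. \<beta> \<in> bilinear_forms (gr H) (gr H) \<Longrightarrow>
       comult (gr H) (gr_class H n h) \<beta> = (\<Sum>l<r. \<beta> (gr_class H (i l) (a l)) (gr_class H (n - i l) (b l)))"
proof -
  obtain r :: nat and i a b where r: "\<forall>l<r. i l \<le> n \<and> a l \<in> F (i l) \<and> b l \<in> F (n - i l)"
    "comult H h = (\<lambda>\<beta>\<in>bilinear_forms H H. \<Sum>l<r. \<beta> (a l) (b l))" using comult_filt[OF h] by blast
  show thesis
    by (rule that[of r i a b]) (use r in \<open>auto intro!: comult_gr_class[OF h]\<close>)
qed

lemma comult_gr_tensor: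
  assumes "f \<in> carrier (gr H)"
  shows "comult (gr H) f \<in> tensors (gr H) (gr H) (carrier (gr H)) (carrier (gr H))"
  using assms
proof (induction rule: gr_induct)
  case (hom n h)
  obtain r :: nat and i a b where r: "\<And>l. l < r \<Longrightarrow> i l \<le> n" "\<And>l. l < r \<Longrightarrow> a l \<in> F (i l)" "\<And>l. l < r \<Longrightarrow> b l \<in> F (n - i l)"
    "\<And>\<beta>. \<beta> \<in> bilinear_forms H H \<Longrightarrow> comult H h \<beta> = (\<Sum>l<r. \<beta> (a l) (b l))"
    "\<And>\<beta>. \<beta> \<in> bilinear_forms (gr H) (gr H) \<Longrightarrow>
       comult (gr H) (gr_class H n h) \<beta> = (\<Sum>l<r. \<beta> (gr_class H (i l) (a l)) (gr_class H (n - i l) (b l)))"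
    by (rule comult_class_sum[OF hom]) blast
  show ?case
    by (rule tensors_sumI[where I = "{..<r}" and a = "\<lambda>l. gr_class H (i l) (a l)" and b = "\<lambda>l. gr_class H (n - i l) (b l)"])
      (use r gr_class_in comult_gr_ext in auto)
next
  case (add x y)
  have "comult (gr H) (x \<oplus>\<^bsub>gr H\<^esub> y) =
    (\<lambda>\<beta>\<in>bilinear_forms (gr H) (gr H). comult (gr H) x \<beta> + comult (gr H) y \<beta>)"
    by (rule extensionalityI[OF comult_gr_ext])
      (use add G.linear_formsD(1)[OF comult_gr_form] in auto)
  then show ?case using tensors_add[OF add(3,4)] by (simp only:)
qed

lemmas gr_cong = tensor_cong[OF G.vs G.vs comult_gr_tensor]
lemmas gr_linear = tensor_linear[OF G.vs G.vs comult_gr_tensor]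

lemma comult_gr_mult_bilinear:
  assumes "y \<in> carrier (gr H)" "\<beta> \<in> bilinear_forms (gr H) (gr H)"
  shows "(\<lambda>x1 x2. comult (gr H) y (\<lambda>y1 y2. \<beta> (x1 \<otimes>\<^bsub>gr H\<^esub> y1) (x2 \<otimes>\<^bsub>gr H\<^esub> y2))) \<in> bilinear_forms (gr H) (gr H)"
  by (intro bilinear_formsI tensor_linear_form[OF G.vs G.vs G.vs comult_gr_tensor[OF assms(1)]] G.mult_bilinear assms(2))
    (use assms(2) in \<open>auto intro: G.mult_form bilinear_formsD
       G.mult_form[OF bilinear_formsD(1)[OF assms(2)]] G.mult_form[OF bilinear_formsD(2)[OF assms(2)]]\<close>)

text \<open>Both sides are linear in x and in y, so homogeneous classes suffice. For these,
  multiplicativity in H is read off from decompositions by degree.\<close>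

lemma comult_gr_mult:
  assumes x: "x \<in> carrier (gr H)" and y: "y \<in> carrier (gr H)" and \<beta>: "\<beta> \<in> bilinear_forms (gr H) (gr H)"
  shows "comult (gr H) (x \<otimes>\<^bsub>gr H\<^esub> y) \<beta> =
    comult (gr H) x (\<lambda>x1 x2. comult (gr H) y (\<lambda>y1 y2. \<beta> (x1 \<otimes>\<^bsub>gr H\<^esub> y1) (x2 \<otimes>\<^bsub>gr H\<^esub> y2)))"
    (is "?L x y = ?R x y")
proof -
  have hom: "?L (gr_class H n h) (gr_class H m g) = ?R (gr_class H n h) (gr_class H m g)"
    if h: "h \<in> F n" and g: "g \<in> F m" for n h m g
  proof -
    obtain r :: nat and i a b where r: "\<And>l. l < r \<Longrightarrow> i l \<le> n" "\<And>l. l < r \<Longrightarrow> a l \<in> F (i l)" "\<And>l. l < r \<Longrightarrow> b l \<in> F (n - i l)"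
      "\<And>\<beta>. \<beta> \<in> bilinear_forms H H \<Longrightarrow> comult H h \<beta> = (\<Sum>l<r. \<beta> (a l) (b l))"
      "\<And>\<beta>. \<beta> \<in> bilinear_forms (gr H) (gr H) \<Longrightarrow>
         comult (gr H) (gr_class H n h) \<beta> = (\<Sum>l<r. \<beta> (gr_class H (i l) (a l)) (gr_class H (n - i l) (b l)))"
      by (rule comult_class_sum[OF h]) blast
    obtain s :: nat and j c d where s: "\<And>l. l < s \<Longrightarrow> j l \<le> m" "\<And>l. l < s \<Longrightarrow> c l \<in> F (j l)" "\<And>l. l < s \<Longrightarrow> d l \<in> F (m - j l)"
      "\<And>\<beta>. \<beta> \<in> bilinear_forms H H \<Longrightarrow> comult H g \<beta> = (\<Sum>l<s. \<beta> (c l) (d l))"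
      "\<And>\<beta>. \<beta> \<in> bilinear_forms (gr H) (gr H) \<Longrightarrow>
         comult (gr H) (gr_class H m g) \<beta> = (\<Sum>l<s. \<beta> (gr_class H (j l) (c l)) (gr_class H (m - j l) (d l)))"
      by (rule comult_class_sum[OF g]) blast
    have "?L (gr_class H n h) (gr_class H m g) =
      (\<Sum>(l, k)\<in>{..<r} \<times> {..<s}. \<beta> (gr_class H (i l + j k) (a l \<otimes> c k)) (gr_class H (n + m - (i l + j k)) (b l \<otimes> d k)))"
      unfolding gr_class_mult[OF h g] case_prod_unfold
    proof (rule comult_gr_class[OF filt_mult[OF h g] \<beta>])
      fix p assume "p \<in> {..<r} \<times> {..<s}"
      then obtain l k where p: "p = (l, k)" "l < r" "k < s" by auto
      \<comment> \<open>Subtraction is truncated: this needs \<open>i l \<le> n\<close> and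
        \<open>j k \<le> m\<close>.\<close>
      have "n + m - (i l + j k) = (n - i l) + (m - j k)" using r(1)[OF p(2)] s(1)[OF p(3)] by simp
      then show "i (fst p) + j (snd p) \<le> n + m \<and> a (fst p) \<otimes> c (snd p) \<in> F (i (fst p) + j (snd p)) \<and>
         b (fst p) \<otimes> d (snd p) \<in> F (n + m - (i (fst p) + j (snd p)))"
        using r(1-3)[OF p(2)] s(1-3)[OF p(3)] filt_mult[of "a l" "i l" "c k" "j k"]
          filt_mult[of "b l" "n - i l" "d k" "m - j k"] by (simp add: p(1) add_mono)
    next
      fix \<beta> assume "\<beta> \<in> bilinear_forms H H"
      from comult_mult_sum[OF filt_carrier[OF h] filt_carrier[OF g] this r(4) s(4)]
      show "comult H (h \<otimes> g) \<beta> = (\<Sum>l\<in>{..<r} \<times> {..<s}. \<beta> (a (fst l) \<otimes> c (snd l)) (b (fst l) \<otimes> d (snd l)))"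
        using filt_carrier[OF r(2)] filt_carrier[OF r(3)] by (simp add: case_prod_unfold)
    qed
    also have "\<dots> = (\<Sum>l<r. \<Sum>k<s. \<beta> (gr_class H (i l) (a l) \<otimes>\<^bsub>gr H\<^esub> gr_class H (j k) (c k))
       (gr_class H (n - i l) (b l) \<otimes>\<^bsub>gr H\<^esub> gr_class H (m - j k) (d k)))"
      unfolding sum.cartesian_product
    proof (rule sum.cong[OF refl], safe)
      fix l k assume p: "l < r" "k < s"
      have "n + m - (i l + j k) = (n - i l) + (m - j k)" using r(1)[OF p(1)] s(1)[OF p(2)] by simp
      then show "\<beta> (gr_class H (i l + j k) (a l \<otimes> c k)) (gr_class H (n + m - (i l + j k)) (b l \<otimes> d k)) =
        \<beta> (gr_class H (i l) (a l) \<otimes>\<^bsub>gr H\<^esub> gr_class H (j k) (c k))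
          (gr_class H (n - i l) (b l) \<otimes>\<^bsub>gr H\<^esub> gr_class H (m - j k) (d k))"
        using r(1-3)[OF p(1)] s(1-3)[OF p(2)] by (simp add: gr_class_mult)
    qed
    also have "\<dots> = (\<Sum>l<r. comult (gr H) (gr_class H m g) (\<lambda>y1 y2.
        \<beta> (gr_class H (i l) (a l) \<otimes>\<^bsub>gr H\<^esub> y1) (gr_class H (n - i l) (b l) \<otimes>\<^bsub>gr H\<^esub> y2)))"
      by (rule sum.cong[OF refl], rule s(5)[symmetric])
        (use r gr_class_in in \<open>auto intro!: G.mult_bilinear \<beta>\<close>)
    also have "\<dots> = ?R (gr_class H n h) (gr_class H m g)"
      by (rule r(5)[OF comult_gr_mult_bilinear[OF gr_class_in[OF g] \<beta>], symmetric])
    finally show ?thesis .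
  qed
  have "?L (gr_class H n h) y = ?R (gr_class H n h) y" if h: "h \<in> F n" for n h
  proof (rule gr_forms_eq[OF y])
    show "(\<lambda>y. ?L (gr_class H n h) y) \<in> linear_forms (gr H)"
      using G.mult_form(2)[OF comult_gr_form[OF \<beta>] gr_class_in[OF h]] .
    show "(\<lambda>y. ?R (gr_class H n h) y) \<in> linear_forms (gr H)"
      by (rule tensor_linear_form[OF G.vs G.vs G.vs comult_gr_tensor[OF gr_class_in[OF h]]])
        (auto intro!: comult_gr_mult_bilinear comult_gr_form G.mult_bilinear \<beta>)
  qed (rule hom[OF h])
  then show ?thesis
    by (intro gr_forms_eq[OF x, of "\<lambda>x. ?L x y" "\<lambda>x. ?R x y"]
      G.mult_form(1)[OF comult_gr_form[OF \<beta>] y] comult_gr_form[OF comult_gr_mult_bilinear[OF y \<beta>]])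
qed

lemma comult_gr_one: "\<beta> \<in> bilinear_forms (gr H) (gr H) \<Longrightarrow> comult (gr H) \<one>\<^bsub>gr H\<^esub> \<beta> = \<beta> \<one>\<^bsub>gr H\<^esub> \<one>\<^bsub>gr H\<^esub>"
  using comult_gr_class[OF one_coradical, of \<beta> "{()}" "\<lambda>_. 0" "\<lambda>_. \<one>" "\<lambda>_. \<one>"] one_coradical
  by (simp add: gr_simps(3) comult_one)

lemma counit_gr: "counit (gr H) f = counit H (gr_proj f)"
  by (simp add: gr_def with_coalg_def gr_proj_def)

end

section \<open>Antipodes and multiplicative matrices\<close>

lemma sub_coalg_sel:
  "carrier (sub_coalg C D) = D" "add (sub_coalg C D) = add C" "smult (sub_coalg C D) = smult C"
  "mult (sub_coalg C D) = mult C" "one (sub_coalg C D) = one C" "zero (sub_coalg C D) = zero C"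
  "counit (sub_coalg C D) = counit C"
  by (simp_all add: sub_coalg_def)

lemma is_antipodeD:
  assumes "is_antipode H S" "x \<in> carrier H" "\<phi> \<in> linear_forms H"
  shows "comult H x (\<lambda>a b. \<phi> (S a \<otimes>\<^bsub>H\<^esub> b)) = \<phi> (counit H x \<odot>\<^bsub>H\<^esub> \<one>\<^bsub>H\<^esub>)"
    "comult H x (\<lambda>a b. \<phi> (a \<otimes>\<^bsub>H\<^esub> S b)) = \<phi> (counit H x \<odot>\<^bsub>H\<^esub> \<one>\<^bsub>H\<^esub>)"
  using assms by (auto simp: is_antipode_def)

context bialg
begin

text \<open>S is a left and Q a right convolution inverse of the identity, so the two bracketings of
  S * id * Q give Q x and S x. Q is taken to be an inverse on a subcoalgebra D only, which is the
  situation of the coradical.\<close>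

lemma antipode_unique:
  assumes S: "is_antipode H S" and Q: "Q \<in> LinearCombinations.module_hom class_ring H H"
    and D: "\<And>x. x \<in> D \<Longrightarrow> x \<in> carrier H" "\<And>x. x \<in> D \<Longrightarrow> comult H x \<in> tensors H H D D"
    and q: "\<And>x \<phi>. x \<in> D \<Longrightarrow> \<phi> \<in> linear_forms H \<Longrightarrow> comult H x (\<lambda>a b. \<phi> (a \<otimes> Q b)) = counit H x * \<phi> \<one>"
    and x: "x \<in> D"
  shows "Q x = S x"
proof -
  have Sh: "S \<in> LinearCombinations.module_hom class_ring H H" using S by (simp add: is_antipode_def)
  have c: "a \<in> carrier H \<Longrightarrow> S a \<in> carrier H" "a \<in> carrier H \<Longrightarrow> Q a \<in> carrier H" for a
    using Sh Q by (auto simp: LinearCombinations.module_hom_def)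
  have s: "comult H a (\<lambda>a1 a2. \<phi> (S a1 \<otimes> a2)) = counit H a * \<phi> \<one>" if "a \<in> carrier H" "\<phi> \<in> linear_forms H" for a \<phi>
    using S that by (simp add: is_antipode_def linear_formsD)
  show ?thesis
  proof (rule forms_separate)
    fix \<phi> assume \<phi>: "\<phi> \<in> linear_forms H"
    have bm: "(\<lambda>a b. \<phi>' (a \<otimes> b)) \<in> bilinear_forms H H" if "\<phi>' \<in> linear_forms H" for \<phi>'
      using that by (intro bilinear_formsI mult_form)
    have "(\<lambda>a b c. \<phi> (S a \<otimes> (b \<otimes> Q c))) \<in> trilinear_forms H H H"
      unfolding trilinear_forms_def mem_Collect_eq
    proof (intro conjI ballI)
      fix a assume "a \<in> carrier H"
      then have "(\<lambda>y. \<phi> (S a \<otimes> y)) \<in> linear_forms H" by (intro mult_form(2)[OF \<phi>] c(1))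
      from bilinear_form_comp[OF vs vs _ Q bm[OF this], of id]
      show "(\<lambda>b c. \<phi> (S a \<otimes> (b \<otimes> Q c))) \<in> bilinear_forms H H"
        by (simp add: LinearCombinations.module_hom_def)
    next
      fix b c' assume "b \<in> carrier H" "c' \<in> carrier H"
      then have "(\<lambda>a. \<phi> (a \<otimes> (b \<otimes> Q c'))) \<in> linear_forms H" by (intro mult_form(1)[OF \<phi>] m_closed c(2))
      from linear_form_comp[OF vs Sh this] show "(\<lambda>a. \<phi> (S a \<otimes> (b \<otimes> Q c'))) \<in> linear_forms H" .
    qed
    from coassoc[OF D(1)[OF x] this]
    have eq: "comult H x (\<lambda>a b. comult H a (\<lambda>a1 a2. \<phi> (S a1 \<otimes> (a2 \<otimes> Q b)))) =
      comult H x (\<lambda>a b. comult H b (\<lambda>b1 b2. \<phi> (S a \<otimes> (b1 \<otimes> Q b2))))" .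
    obtain n :: nat and a b where r: "\<And>i. i < n \<Longrightarrow> a i \<in> D" "\<And>i. i < n \<Longrightarrow> b i \<in> D"
      "\<And>\<beta>. \<beta> \<in> bilinear_forms H H \<Longrightarrow> comult H x \<beta> = (\<Sum>i<n. \<beta> (a i) (b i))"
      by (rule tensorsE[OF D(2)[OF x]]) blast
    have QQ: "(\<lambda>x. \<phi> (Q x)) \<in> linear_forms H" "(\<lambda>x. \<phi> (S x)) \<in> linear_forms H"
      using linear_form_comp[OF vs Q \<phi>] linear_form_comp[OF vs Sh \<phi>] by auto
    have "comult H x (\<lambda>a b. comult H a (\<lambda>a1 a2. \<phi> (S a1 \<otimes> (a2 \<otimes> Q b)))) =
      comult H x (\<lambda>a b. counit H a * \<phi> (Q b))"
    proof (rule comult_cong[OF D(1)[OF x]])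
      fix a b assume ab: "a \<in> carrier H" "b \<in> carrier H"
      have "comult H a (\<lambda>a1 a2. \<phi> (S a1 \<otimes> (a2 \<otimes> Q b))) = comult H a (\<lambda>a1 a2. \<phi> ((S a1 \<otimes> a2) \<otimes> Q b))"
        by (rule comult_cong[OF ab(1)]) (use c ab in \<open>simp add: m_assoc\<close>)
      also have "\<dots> = counit H a * \<phi> (\<one> \<otimes> Q b)"
        by (rule s[OF ab(1) mult_form(1)[OF \<phi>]]) (use c ab in blast)
      finally show "comult H a (\<lambda>a1 a2. \<phi> (S a1 \<otimes> (a2 \<otimes> Q b))) = counit H a * \<phi> (Q b)" using c ab by simp
    qed
    also have "\<dots> = \<phi> (Q x)" by (rule counit_left[OF D(1)[OF x] QQ(1)])
    finally have 1: "comult H x (\<lambda>a b. comult H a (\<lambda>a1 a2. \<phi> (S a1 \<otimes> (a2 \<otimes> Q b)))) = \<phi> (Q x)" .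
    have in_b: "comult H b (\<lambda>b1 b2. \<phi> (S a \<otimes> (b1 \<otimes> Q b2))) = \<phi> (S a) * counit H b"
      if "a \<in> carrier H" "b \<in> D" for a b
      using q[OF that(2) mult_form(2)[OF \<phi> c(1)[OF that(1)]]] c that by simp
    have "(\<lambda>a b. comult H b (\<lambda>b1 b2. \<phi> (S a \<otimes> (b1 \<otimes> Q b2)))) \<in> bilinear_forms H H"
    proof (rule bilinear_formsI)
      have bb: "(\<lambda>b1 b2. \<phi> (S a \<otimes> (b1 \<otimes> Q b2))) \<in> bilinear_forms H H" if "a \<in> carrier H" for a
        using bilinear_form_comp[OF vs vs _ Q bm[OF mult_form(2)[OF \<phi> c(1)[OF that]]], of id]
        by (simp add: LinearCombinations.module_hom_def)
      show "(\<lambda>b. comult H b (\<lambda>b1 b2. \<phi> (S a \<otimes> (b1 \<otimes> Q b2)))) \<in> linear_forms H" if "a \<in> carrier H" for a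
        by (rule comult_form[OF bb[OF that]])
      show "(\<lambda>a. comult H b (\<lambda>b1 b2. \<phi> (S a \<otimes> (b1 \<otimes> Q b2)))) \<in> linear_forms H" if "b \<in> carrier H" for b
        by (rule tensor_linear_form[OF vs vs vs comult_tensor[OF that] bb])
          (use linear_form_comp[OF vs Sh mult_form(1)[OF \<phi>]] c in auto)
    qed
    then have "comult H x (\<lambda>a b. comult H b (\<lambda>b1 b2. \<phi> (S a \<otimes> (b1 \<otimes> Q b2)))) = (\<Sum>i<n. \<phi> (S (a i)) * counit H (b i))"
      using r(3) in_b r(1,2) D(1) by simp
    also have "\<dots> = comult H x (\<lambda>a b. \<phi> (S a) * counit H b)"
      using r(3)[OF form_prod[OF QQ(2) counit_form]] by simp
    also have "\<dots> = \<phi> (S x)" by (rule counit_right[OF D(1)[OF x] QQ(2)])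
    finally show "\<phi> (Q x) = \<phi> (S x)" using 1 eq by simp
  qed (use c D(1)[OF x] in auto)
qed

text \<open>An antipode is determined on the carrier only; \<open>antipode\<close> is the
  extensional one.\<close>

lemma antipode_restrict:
  assumes "is_antipode H S" shows "is_antipode H (restrict S (carrier H))"
  unfolding is_antipode_def
proof (intro conjI ballI)
  show "restrict S (carrier H) \<in> LinearCombinations.module_hom class_ring H H"
    using assms by (auto simp: is_antipode_def LinearCombinations.module_hom_def)
  fix x \<phi> assume x: "x \<in> carrier H" and \<phi>: "\<phi> \<in> linear_forms H"
  have "comult H x (\<lambda>a b. \<phi> (restrict S (carrier H) a \<otimes> b)) = comult H x (\<lambda>a b. \<phi> (S a \<otimes> b))"
    "comult H x (\<lambda>a b. \<phi> (a \<otimes> restrict S (carrier H) b)) = comult H x (\<lambda>a b. \<phi> (a \<otimes> S b))"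
    by (rule comult_cong[OF x]; simp)+
  then show "comult H x (\<lambda>a b. \<phi> (restrict S (carrier H) a \<otimes> b)) = \<phi> (counit H x \<odot> \<one>)"
    "comult H x (\<lambda>a b. \<phi> (a \<otimes> restrict S (carrier H) b)) = \<phi> (counit H x \<odot> \<one>)"
    using assms x \<phi> by (auto simp: is_antipode_def)
qed

lemma is_antipode_antipode:
  assumes "is_antipode H S" shows "is_antipode H (antipode H)"
proof -
  let ?S = "restrict S (carrier H)"
  have S: "is_antipode H ?S" by (rule antipode_restrict[OF assms])
  have "antipode H = ?S" unfolding antipode_def
  proof (rule the_equality)
    show "is_antipode H ?S \<and> ?S \<in> extensional (carrier H)" using S by simp
    fix S' assume S': "is_antipode H S' \<and> S' \<in> extensional (carrier H)"
    have "S' x = ?S x" if "x \<in> carrier H" for x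
      by (rule antipode_unique[OF S, where D = "carrier H"])
        (use S' that comult_tensor in \<open>auto simp: is_antipode_def linear_formsD\<close>)
    then show "S' = ?S" using S' by (auto intro: extensionalityI)
  qed
  with S show ?thesis by simp
qed

text \<open>For a multiplicative matrix \<open>c\<close> the matrix \<open>S(c)\<close> is inverse to \<open>c\<close>, and \<open>t \<mapsto> S(c t)\<close> is a
  left inverse of \<open>t \<mapsto> c t\<close> under matrix convolution, of which \<open>t \<mapsto> S(t) S(c)\<close> is a right inverse.\<close>

lemma antipode_matrix:
  fixes c :: "'i \<Rightarrow> 'i \<Rightarrow> 'v"
  assumes I: "finite I" and S: "is_antipode H S"
    and c: "\<And>i j. i \<in> I \<Longrightarrow> j \<in> I \<Longrightarrow> c i j \<in> carrier H"
    and d: "\<And>i j \<beta>. i \<in> I \<Longrightarrow> j \<in> I \<Longrightarrow> \<beta> \<in> bilinear_forms H H \<Longrightarrow> comult H (c i j) \<beta> = (\<Sum>t\<in>I. \<beta> (c i t) (c t j))"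
    and e: "\<And>i j. i \<in> I \<Longrightarrow> j \<in> I \<Longrightarrow> counit H (c i j) = (if i = j then 1 else 0)"
  shows "i \<in> I \<Longrightarrow> j \<in> I \<Longrightarrow> \<phi> \<in> linear_forms H \<Longrightarrow> (\<Sum>t\<in>I. \<phi> (c i t \<otimes> S (c t j))) = (if i = j then \<phi> \<one> else 0)"
    and "i \<in> I \<Longrightarrow> j \<in> I \<Longrightarrow> t \<in> carrier H \<Longrightarrow> S (c i j \<otimes> t) = S t \<otimes> S (c i j)"
proof -
  have Sh: "S \<in> LinearCombinations.module_hom class_ring H H" using S by (simp add: is_antipode_def)
  have Sc: "a \<in> carrier H \<Longrightarrow> S a \<in> carrier H" for a
    using Sh by (auto simp: LinearCombinations.module_hom_def)
  have bm: "(\<lambda>a b. \<phi> (a \<otimes> b)) \<in> bilinear_forms H H" if "\<phi> \<in> linear_forms H" for \<phi>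
    using that by (intro bilinear_formsI mult_form)
  have idh: "(\<lambda>x. x) \<in> LinearCombinations.module_hom class_ring H H" by (simp add: LinearCombinations.module_hom_def)
  have bS1: "(\<lambda>a b. \<phi> (S a \<otimes> b)) \<in> bilinear_forms H H" and bS2: "(\<lambda>a b. \<phi> (a \<otimes> S b)) \<in> bilinear_forms H H"
    if "\<phi> \<in> linear_forms H" for \<phi>
    using bilinear_form_comp[OF vs vs Sh idh bm[OF that]] bilinear_form_comp[OF vs vs idh Sh bm[OF that]] by auto
  have s1: "comult H a (\<lambda>a1 a2. \<phi> (S a1 \<otimes> a2)) = counit H a * \<phi> \<one>"
    and s2: "comult H a (\<lambda>a1 a2. \<phi> (a1 \<otimes> S a2)) = counit H a * \<phi> \<one>"
    if "a \<in> carrier H" "\<phi> \<in> linear_forms H" for a \<phi>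
    using S that by (auto simp: is_antipode_def linear_formsD)
  show inv: "(\<Sum>t\<in>I. \<phi> (c i t \<otimes> S (c t j))) = (if i = j then \<phi> \<one> else 0)"
    if "i \<in> I" "j \<in> I" "\<phi> \<in> linear_forms H" for i j \<phi>
    using s2[OF c[OF that(1,2)] that(3)] d[OF that(1,2) bS2[OF that(3)]] e[OF that(1,2)] by simp
  show "S (c i j \<otimes> t) = S t \<otimes> S (c i j)" if ij: "i \<in> I" "j \<in> I" and t: "t \<in> carrier H"
  proof (rule forms_separate)
    fix \<phi> assume \<phi>: "\<phi> \<in> linear_forms H"
    \<comment> \<open>The triple convolution of S(c t), c t and S(t) S(c), with matrix products over
      m and n. Contracting its first two factors gives S(t) S(c), contracting its last two gives S(c
      t).\<close>
    define \<gamma> where "\<gamma> = (\<lambda>t1 t2 t3. \<Sum>m\<in>I. \<Sum>n\<in>I. \<phi> (S (c i m \<otimes> t1) \<otimes> ((c m n \<otimes> t2) \<otimes> (S t3 \<otimes> S (c n j)))))"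
    have cm: "(\<lambda>x. z \<otimes> x) \<in> LinearCombinations.module_hom class_ring H H" if "z \<in> carrier H" for z
      using mult_hom(2)[OF that] .
    have bil23: "(\<lambda>t2 t3. \<phi>' ((z \<otimes> t2) \<otimes> (S t3 \<otimes> z'))) \<in> bilinear_forms H H"
      if "\<phi>' \<in> linear_forms H" "z \<in> carrier H" "z' \<in> carrier H" for \<phi>' z z'
    proof -
      have "(\<lambda>t. S t \<otimes> z') \<in> LinearCombinations.module_hom class_ring H H"
        using Sh that(3) Sc by (simp add: LinearCombinations.module_hom_def Pi_iff l_distr)
      from bilinear_form_comp[OF vs vs cm[OF that(2)] this bm[OF that(1)]] show ?thesis .
    qed
    have tri: "\<gamma> \<in> trilinear_forms H H H"
      unfolding trilinear_forms_def mem_Collect_eq \<gamma>_def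
    proof (intro conjI ballI)
      fix t1 assume t1: "t1 \<in> carrier H"
      show "(\<lambda>t2 t3. \<Sum>m\<in>I. \<Sum>n\<in>I. \<phi> (S (c i m \<otimes> t1) \<otimes> ((c m n \<otimes> t2) \<otimes> (S t3 \<otimes> S (c n j))))) \<in> bilinear_forms H H"
        by (intro bilinear_form_sum vs bil23 mult_form(2)[OF \<phi>]) (use c ij t1 Sc in auto)
    next
      fix t2 t3 assume t: "t2 \<in> carrier H" "t3 \<in> carrier H"
      show "(\<lambda>t1. \<Sum>m\<in>I. \<Sum>n\<in>I. \<phi> (S (c i m \<otimes> t1) \<otimes> ((c m n \<otimes> t2) \<otimes> (S t3 \<otimes> S (c n j))))) \<in> linear_forms H"
      proof (intro linear_form_sum)
        fix m n assume mn: "m \<in> I" "n \<in> I"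
        have "(\<lambda>x. \<phi> (S x \<otimes> ((c m n \<otimes> t2) \<otimes> (S t3 \<otimes> S (c n j))))) \<in> linear_forms H"
          by (rule linear_form_comp[OF vs Sh mult_form(1)[OF \<phi>]]) (use c ij t mn Sc in auto)
        from linear_form_comp[OF vs cm this, of "c i m"]
        show "(\<lambda>t1. \<phi> (S (c i m \<otimes> t1) \<otimes> ((c m n \<otimes> t2) \<otimes> (S t3 \<otimes> S (c n j))))) \<in> linear_forms H"
          using c ij mn by simp
      qed
    qed
    have "comult H t (\<lambda>a b. comult H a (\<lambda>a1 a2. \<gamma> a1 a2 b)) = comult H t (\<lambda>a b. counit H a * \<phi> (S b \<otimes> S (c i j)))"
    proof (rule comult_cong[OF t])
      fix a b assume ab: "a \<in> carrier H" "b \<in> carrier H"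
      have lf: "(\<lambda>y. \<phi> (y \<otimes> (S b \<otimes> S (c n j)))) \<in> linear_forms H" if "n \<in> I" for n
        using mult_form(1)[OF \<phi>, of "S b \<otimes> S (c n j)"] Sc c ij ab that by simp
      have bil: "(\<lambda>a1 a2. \<phi> ((S (c i m \<otimes> a1) \<otimes> (c m n \<otimes> a2)) \<otimes> (S b \<otimes> S (c n j)))) \<in> bilinear_forms H H"
        if "m \<in> I" "n \<in> I" for m n
        by (rule bilinear_form_comp[OF vs vs cm cm bS1[OF lf[OF that(2)]]]) (use c ij that in auto)
      have "comult H a (\<lambda>a1 a2. \<gamma> a1 a2 b) =
        comult H a (\<lambda>a1 a2. \<Sum>m\<in>I. \<Sum>n\<in>I. \<phi> ((S (c i m \<otimes> a1) \<otimes> (c m n \<otimes> a2)) \<otimes> (S b \<otimes> S (c n j))))"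
        unfolding \<gamma>_def by (rule comult_cong[OF ab(1)]) (use ab c ij Sc in \<open>simp add: m_assoc\<close>)
      also have "\<dots> = (\<Sum>m\<in>I. \<Sum>n\<in>I. comult H a (\<lambda>a1 a2. \<phi> ((S (c i m \<otimes> a1) \<otimes> (c m n \<otimes> a2)) \<otimes> (S b \<otimes> S (c n j)))))"
        by (subst comult_linear(4)[OF ab(1)], (auto intro!: bilinear_form_sum vs bil)[1])
          (intro sum.cong refl comult_linear(4)[OF ab(1)] bil, auto)
      also have "\<dots> = (\<Sum>n\<in>I. \<Sum>m\<in>I. comult H a (\<lambda>a1 a2. \<phi> ((S (c i m \<otimes> a1) \<otimes> (c m n \<otimes> a2)) \<otimes> (S b \<otimes> S (c n j)))))"
        by (rule sum.swap)
      also have "\<dots> = (\<Sum>n\<in>I. comult H (c i n \<otimes> a) (\<lambda>x y. \<phi> ((S x \<otimes> y) \<otimes> (S b \<otimes> S (c n j)))))"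
      proof (rule sum.cong[OF refl])
        fix n assume "n \<in> I"
        then have n: "n \<in> I" by simp
        show "(\<Sum>m\<in>I. comult H a (\<lambda>a1 a2. \<phi> ((S (c i m \<otimes> a1) \<otimes> (c m n \<otimes> a2)) \<otimes> (S b \<otimes> S (c n j))))) =
          comult H (c i n \<otimes> a) (\<lambda>x y. \<phi> ((S x \<otimes> y) \<otimes> (S b \<otimes> S (c n j))))"
          using comult_mult[OF c[OF ij(1) n] ab(1) bS1[OF lf[OF n]]]
            d[OF ij(1) n comult_mult_bilinear[OF ab(1) bS1[OF lf[OF n]]]] by simp
      qed
      also have "\<dots> = (\<Sum>n\<in>I. if i = n then counit H a * \<phi> (S b \<otimes> S (c i j)) else 0)"
        by (rule sum.cong[OF refl]) (use s1[OF _ lf] c ij ab Sc e in \<open>auto simp: counit_mult\<close>)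
      also have "\<dots> = counit H a * \<phi> (S b \<otimes> S (c i j))" using ij I by simp
      finally show "comult H a (\<lambda>a1 a2. \<gamma> a1 a2 b) = counit H a * \<phi> (S b \<otimes> S (c i j))" .
    qed
    also have "\<dots> = \<phi> (S t \<otimes> S (c i j))"
      by (rule counit_left[OF t linear_form_comp[OF vs Sh mult_form(1)[OF \<phi>]]]) (use c ij Sc in auto)
    finally have 1: "comult H t (\<lambda>a b. comult H a (\<lambda>a1 a2. \<gamma> a1 a2 b)) = \<phi> (S t \<otimes> S (c i j))" .
    have "comult H t (\<lambda>a b. comult H b (\<lambda>b1 b2. \<gamma> a b1 b2)) = comult H t (\<lambda>a b. \<phi> (S (c i j \<otimes> a)) * counit H b)"
    proof (rule comult_cong[OF t])
      fix a b assume ab: "a \<in> carrier H" "b \<in> carrier H"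
      have lf: "(\<lambda>y. \<phi> (S (c i m \<otimes> a) \<otimes> (c m n \<otimes> (y \<otimes> S (c n j))))) \<in> linear_forms H" if "m \<in> I" "n \<in> I" for m n
        using mult_form(1)[OF mult_form(2)[OF mult_form(2)[OF \<phi>, of "S (c i m \<otimes> a)"], of "c m n"], of "S (c n j)"]
          Sc c ij ab that by simp
      have "comult H b (\<lambda>b1 b2. \<gamma> a b1 b2) =
        comult H b (\<lambda>b1 b2. \<Sum>m\<in>I. \<Sum>n\<in>I. \<phi> (S (c i m \<otimes> a) \<otimes> (c m n \<otimes> ((b1 \<otimes> S b2) \<otimes> S (c n j)))))"
        unfolding \<gamma>_def by (rule comult_cong[OF ab(2)]) (use ab c ij Sc in \<open>simp add: m_assoc\<close>)
      also have "\<dots> = (\<Sum>m\<in>I. \<Sum>n\<in>I. comult H b (\<lambda>b1 b2. \<phi> (S (c i m \<otimes> a) \<otimes> (c m n \<otimes> ((b1 \<otimes> S b2) \<otimes> S (c n j))))))"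
        by (subst comult_linear(4)[OF ab(2)], (auto intro!: bilinear_form_sum vs bS2[OF lf])[1])
          (intro sum.cong refl comult_linear(4)[OF ab(2)] bS2[OF lf], auto)
      also have "\<dots> = (\<Sum>m\<in>I. \<Sum>n\<in>I. counit H b * \<phi> (S (c i m \<otimes> a) \<otimes> (c m n \<otimes> S (c n j))))"
        by (intro sum.cong refl) (use s2[OF ab(2) lf] c ij ab Sc in auto)
      also have "\<dots> = (\<Sum>m\<in>I. counit H b * (if m = j then \<phi> (S (c i m \<otimes> a)) else 0))"
      proof (rule sum.cong[OF refl])
        fix m assume "m \<in> I"
        then have m: "m \<in> I" by simp
        have l: "(\<lambda>y. \<phi> (S (c i m \<otimes> a) \<otimes> y)) \<in> linear_forms H"
          by (rule mult_form(2)[OF \<phi>]) (use Sc c ij ab m in auto)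
        show "(\<Sum>n\<in>I. counit H b * \<phi> (S (c i m \<otimes> a) \<otimes> (c m n \<otimes> S (c n j)))) =
          counit H b * (if m = j then \<phi> (S (c i m \<otimes> a)) else 0)"
          using inv[OF m ij(2) l] Sc c ij ab m by (simp flip: sum_distrib_left)
      qed
      also have "\<dots> = \<phi> (S (c i j \<otimes> a)) * counit H b"
        using ij I by (simp add: if_distrib[of "\<lambda>x. _ * x"] cong: if_cong)
      finally show "comult H b (\<lambda>b1 b2. \<gamma> a b1 b2) = \<phi> (S (c i j \<otimes> a)) * counit H b" .
    qed
    also have "\<dots> = \<phi> (S (c i j \<otimes> t))"
      by (rule counit_right[OF t]) (use linear_form_comp[OF vs cm linear_form_comp[OF vs Sh \<phi>], of "c i j"] c ij in auto)
    finally show "\<phi> (S (c i j \<otimes> t)) = \<phi> (S t \<otimes> S (c i j))" using 1 coassoc[OF t tri] by simp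
  qed (use Sc c ij t in auto)
qed

end

section \<open>The antipode of the coradical\<close>

context dc_hopf
begin

lemma antipode_H: "is_antipode H (antipode H)"
  using hopf_algebra is_antipode_antipode by (auto simp: hopf_algebra_def)

lemma antipode_coradical: "x \<in> F 0 \<Longrightarrow> antipode H x \<in> F 0"
  using dual_chevalley by (simp add: dual_chevalley_def hopf_subalgebra_def corad_filt.simps)

lemma comult_F0: "x \<in> F 0 \<Longrightarrow> comult H x \<in> tensors H H (F 0) (F 0)"
  using coradical_subcoalgebra by (simp add: subcoalgebra_def corad_filt.simps)

lemma subspace_vs: "subspace class_ring W H \<Longrightarrow> vs (H\<lparr>carrier := W\<rparr>)"
  using vectorspace.subspace_is_vs[OF vectorspace] by (simp add: vs_def)

lemma linear_forms_sub:
  "subspace class_ring W H \<Longrightarrow> \<phi> \<in> linear_forms H \<Longrightarrow> \<phi> \<in> linear_forms (H\<lparr>carrier := W\<rparr>)"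
  using subspaceD(1)[of W] by (auto simp: linear_forms_def)

lemma Pr0_hom: "Pr 0 \<in> LinearCombinations.module_hom class_ring H (H\<lparr>carrier := F 0\<rparr>)"
  using Pr(1)[of 0] Pr(2)[of _ 0] by (auto simp: LinearCombinations.module_hom_def)

text \<open>Composition with \<open>Pr 0\<close> extends bilinear forms from the coradical to H. So
  a tensor over the coradical is determined by its image over H, which settles uniqueness in the
  description behind \<open>sub_coalg\<close>.\<close>

lemma corad_comult:
  assumes x: "x \<in> F 0" and \<beta>: "\<beta> \<in> bilinear_forms (H\<lparr>carrier := F 0\<rparr>) (H\<lparr>carrier := F 0\<rparr>)"
  shows "comult (corad_hopf H) x \<beta> = comult H x (\<lambda>a b. \<beta> (Pr 0 a) (Pr 0 b))"
proof -
  let ?L = "H\<lparr>carrier := F 0\<rparr>"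
  let ?P = "\<lambda>T. T \<in> carrier (tensor_product ?L ?L) \<and> tensor_map H H id id T = comult H x"
  have bP: "(\<lambda>a b. \<gamma> (Pr 0 a) (Pr 0 b)) \<in> bilinear_forms H H" if "\<gamma> \<in> bilinear_forms ?L ?L" for \<gamma>
    by (rule bilinear_form_comp[OF vs vs Pr0_hom Pr0_hom that])
  have sb: "\<gamma> \<in> bilinear_forms ?L ?L" if "\<gamma> \<in> bilinear_forms H H" for \<gamma>
    by (rule bilinear_formsI)
      (use that filt_carrier in \<open>auto intro!: linear_forms_sub filt_subspace dest: bilinear_formsD\<close>)
  have val: "T \<gamma> = comult H x (\<lambda>a b. \<gamma> (Pr 0 a) (Pr 0 b))" if T: "?P T" and g: "\<gamma> \<in> bilinear_forms ?L ?L" for T \<gamma>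
  proof -
    have "T \<in> tensors ?L ?L (carrier ?L) (carrier ?L)" using T by simp
    then have "T \<gamma> = T (\<lambda>a b. \<gamma> (Pr 0 a) (Pr 0 b))"
      by (rule tensor_cong[OF subspace_vs[OF filt_subspace] subspace_vs[OF filt_subspace]]) (simp add: Pr(3))
    also have "\<dots> = tensor_map H H id id T (\<lambda>a b. \<gamma> (Pr 0 a) (Pr 0 b))"
      using bP[OF g] by (simp add: tensor_map_def)
    finally show ?thesis using T by simp
  qed
  obtain n :: nat and a b where r: "\<And>i. i < n \<Longrightarrow> a i \<in> F 0" "\<And>i. i < n \<Longrightarrow> b i \<in> F 0"
    "\<And>\<beta>. \<beta> \<in> bilinear_forms H H \<Longrightarrow> comult H x \<beta> = (\<Sum>i<n. \<beta> (a i) (b i))"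
    "comult H x \<in> extensional (bilinear_forms H H)" by (rule tensorsE[OF comult_F0[OF x]]) blast
  define T where "T = (\<lambda>\<gamma>\<in>bilinear_forms ?L ?L. \<Sum>i<n. \<gamma> (a i) (b i))"
  have "T \<in> tensors ?L ?L (carrier ?L) (carrier ?L)"
    by (rule tensors_sumI[where I = "{..<n}" and a = a and b = b]) (use r in \<open>auto simp: T_def\<close>)
  moreover have "tensor_map H H id id T = comult H x"
    by (rule extensionalityI[OF _ r(4)]) (auto simp: tensor_map_def r(3) T_def dest: sb)
  ultimately have "?P T" by simp
  moreover have "T' = T" if "?P T'" for T'
  proof (rule extensionalityI)
    show "T' \<in> extensional (bilinear_forms ?L ?L)" using that by (auto elim: tensorsE)
    show "T \<in> extensional (bilinear_forms ?L ?L)" by (simp add: T_def)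
    show "T' \<gamma> = T \<gamma>" if "\<gamma> \<in> bilinear_forms ?L ?L" for \<gamma>
      using val[OF \<open>?P T'\<close> that] val[OF \<open>?P T\<close> that] by simp
  qed
  ultimately have "(THE T. ?P T) = T" by (rule the_equality)
  moreover have "comult (corad_hopf H) x = (THE T. ?P T)" by (simp add: sub_coalg_def corad_filt.simps)
  ultimately show ?thesis using val[OF \<open>?P T\<close> \<beta>] by simp
qed

text \<open>The antipode of H restricts to an antipode of the coradical. Conversely an antipode S'
  of the coradical, prolonged to H as S' \<circ> \<open>Pr 0\<close>, is a right inverse of the
  identity on \<open>F 0\<close>, so \<open>antipode_unique\<close> with D = \<open>F 0\<close>
  identifies it with that of H there.\<close>

lemma antipode_corad: "x \<in> F 0 \<Longrightarrow> antipode (corad_hopf H) x = antipode H x"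
proof -
  let ?L = "H\<lparr>carrier := F 0\<rparr>" and ?S = "restrict (antipode H) (F 0)"
  have Sh: "antipode H \<in> LinearCombinations.module_hom class_ring H H" using antipode_H by (simp add: is_antipode_def)
  have sel: "carrier (corad_hopf H) = F 0" "linear_forms (corad_hopf H) = linear_forms ?L"
    by (simp_all add: sub_coalg_sel corad_filt.simps linear_forms_def)
  have F0: "x \<in> F 0 \<Longrightarrow> x \<in> carrier H" for x using filt_carrier .
  interpret L: vs ?L by (rule subspace_vs[OF filt_subspace])
  have Lm: "(\<lambda>x. \<phi> (x \<otimes> z)) \<in> linear_forms ?L" "(\<lambda>x. \<phi> (z \<otimes> x)) \<in> linear_forms ?L"
    if "\<phi> \<in> linear_forms ?L" "z \<in> F 0" for \<phi> z
    using that mult_coradical F0 by (auto simp: linear_forms_def l_distr r_distr)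
  have idL: "(\<lambda>x. x) \<in> LinearCombinations.module_hom class_ring ?L ?L" by (simp add: LinearCombinations.module_hom_def)
  have bmL: "(\<lambda>a b. \<phi> (a \<otimes> b)) \<in> bilinear_forms ?L ?L" if "\<phi> \<in> linear_forms ?L" for \<phi>
    by (rule bilinear_formsI) (use Lm[OF that] in auto)
  have PP: "comult H x (\<lambda>a b. \<beta> (Pr 0 a) (Pr 0 b)) = comult H x \<gamma>"
    if "x \<in> F 0" "\<beta> \<in> bilinear_forms ?L ?L" "\<gamma> \<in> bilinear_forms H H" "\<And>a b. a \<in> F 0 \<Longrightarrow> b \<in> F 0 \<Longrightarrow> \<beta> a b = \<gamma> a b" for x \<beta> \<gamma>
    using comult_F0[OF that(1)] bilinear_form_comp[OF vs vs Pr0_hom Pr0_hom that(2)] that(3,4) Pr(3)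
    by (elim tensorsE) (auto intro!: sum.cong)
  have SL: "?S \<in> LinearCombinations.module_hom class_ring ?L ?L"
    using Sh antipode_coradical F0 subspaceD(3,4)[OF filt_subspace[of 0]]
    by (simp add: LinearCombinations.module_hom_def Pi_iff)
  have isS: "is_antipode (corad_hopf H) ?S"
    unfolding is_antipode_def sel
  proof (intro conjI ballI)
    show "?S \<in> LinearCombinations.module_hom class_ring (corad_hopf H) (corad_hopf H)"
      using SL by (simp add: LinearCombinations.module_hom_def sub_coalg_sel corad_filt.simps)
    fix x \<phi> assume x: "x \<in> F 0" and \<phi>: "\<phi> \<in> linear_forms ?L"
    have \<phi>P: "(\<lambda>x. \<phi> (Pr 0 x)) \<in> linear_forms H" by (rule linear_form_comp[OF vs Pr0_hom \<phi>])
    have bH: "(\<lambda>a b. \<phi> (Pr 0 (a \<otimes> b))) \<in> bilinear_forms H H"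
      using \<phi>P by (intro bilinear_formsI mult_form[OF \<phi>P])
    have idh: "(\<lambda>x. x) \<in> LinearCombinations.module_hom class_ring H H" by (simp add: LinearCombinations.module_hom_def)
    have aH: "comult H x (\<lambda>a b. (\<lambda>x. \<phi> (Pr 0 x)) (antipode H a \<otimes> b)) = (\<lambda>x. \<phi> (Pr 0 x)) (counit H x \<odot> \<one>)"
      "comult H x (\<lambda>a b. (\<lambda>x. \<phi> (Pr 0 x)) (a \<otimes> antipode H b)) = (\<lambda>x. \<phi> (Pr 0 x)) (counit H x \<odot> \<one>)"
      by (rule is_antipodeD[OF antipode_H F0[OF x] \<phi>P])+
    have o: "counit H x \<odot> \<one> \<in> F 0" using one_coradical subspaceD(4)[OF filt_subspace] by blast
    have "comult (corad_hopf H) x (\<lambda>a b. \<phi> (?S a \<otimes> b)) = comult H x (\<lambda>a b. \<phi> (Pr 0 (antipode H a \<otimes> b)))"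
      unfolding corad_comult[OF x bilinear_form_comp[OF L.vs_axioms L.vs_axioms SL idL bmL[OF \<phi>]]]
      by (rule PP[OF x bilinear_form_comp[OF L.vs_axioms L.vs_axioms SL idL bmL[OF \<phi>]] bilinear_form_comp[OF vs vs Sh idh bH]])
        (use antipode_coradical mult_coradical Pr(3) in auto)
    then show "comult (corad_hopf H) x (\<lambda>a b. \<phi> (?S a \<otimes>\<^bsub>corad_hopf H\<^esub> b)) =
      \<phi> (counit (corad_hopf H) x \<odot>\<^bsub>corad_hopf H\<^esub> \<one>\<^bsub>corad_hopf H\<^esub>)"
      using aH Pr(3)[OF o] by (simp add: sub_coalg_sel)
    have "comult (corad_hopf H) x (\<lambda>a b. \<phi> (a \<otimes> ?S b)) = comult H x (\<lambda>a b. \<phi> (Pr 0 (a \<otimes> antipode H b)))"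
      unfolding corad_comult[OF x bilinear_form_comp[OF L.vs_axioms L.vs_axioms idL SL bmL[OF \<phi>]]]
      by (rule PP[OF x bilinear_form_comp[OF L.vs_axioms L.vs_axioms idL SL bmL[OF \<phi>]] bilinear_form_comp[OF vs vs idh Sh bH]])
        (use antipode_coradical mult_coradical Pr(3) in auto)
    then show "comult (corad_hopf H) x (\<lambda>a b. \<phi> (a \<otimes>\<^bsub>corad_hopf H\<^esub> ?S b)) =
      \<phi> (counit (corad_hopf H) x \<odot>\<^bsub>corad_hopf H\<^esub> \<one>\<^bsub>corad_hopf H\<^esub>)"
      using aH Pr(3)[OF o] by (simp add: sub_coalg_sel)
  qed
  have "antipode (corad_hopf H) = ?S" unfolding antipode_def[of "corad_hopf H"] sel
  proof (rule the_equality)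
    show "is_antipode (corad_hopf H) ?S \<and> ?S \<in> extensional (F 0)" using isS by simp
    fix S' assume S': "is_antipode (corad_hopf H) S' \<and> S' \<in> extensional (F 0)"
    then have S'h: "S' \<in> LinearCombinations.module_hom class_ring ?L ?L"
      by (simp add: is_antipode_def LinearCombinations.module_hom_def sub_coalg_sel corad_filt.simps)
    have Q: "(\<lambda>x. S' (Pr 0 x)) \<in> LinearCombinations.module_hom class_ring H H"
      using S'h Pr0_hom F0 by (auto simp: LinearCombinations.module_hom_def Pi_iff)
    have "S' x = antipode H x" if x: "x \<in> F 0" for x
    proof -
      have "(\<lambda>x. S' (Pr 0 x)) x = antipode H x"
      proof (rule antipode_unique[OF antipode_H Q, where D = "F 0"])
        fix y \<phi> assume y: "y \<in> F 0" and \<phi>: "\<phi> \<in> linear_forms H"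
        have \<phi>L: "\<phi> \<in> linear_forms ?L" by (rule linear_forms_sub[OF filt_subspace \<phi>])
        have b: "(\<lambda>a b. \<phi> (a \<otimes> S' b)) \<in> bilinear_forms ?L ?L"
          by (rule bilinear_form_comp[OF L.vs_axioms L.vs_axioms idL S'h bmL[OF \<phi>L]])
        have idh: "(\<lambda>x. x) \<in> LinearCombinations.module_hom class_ring H H" by (simp add: LinearCombinations.module_hom_def)
        have bm: "(\<lambda>a b. \<phi> (a \<otimes> b)) \<in> bilinear_forms H H" using \<phi> by (intro bilinear_formsI mult_form)
        have "comult H y (\<lambda>a b. \<phi> (a \<otimes> S' (Pr 0 b))) = comult (corad_hopf H) y (\<lambda>a b. \<phi> (a \<otimes> S' b))"
          unfolding corad_comult[OF y b]
          by (rule PP[OF y b bilinear_form_comp[OF vs vs idh Q bm], symmetric]) (simp add: Pr(3))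
        also have "\<dots> = \<phi> (counit H y \<odot> \<one>)"
        proof -
          have "\<forall>x\<in>F 0. \<forall>\<phi>\<in>linear_forms ?L. comult (corad_hopf H) x (\<lambda>a b. \<phi> (a \<otimes> S' b)) = \<phi> (counit H x \<odot> \<one>)"
            using S' unfolding is_antipode_def sel by (simp add: sub_coalg_sel)
          then show ?thesis using y \<phi>L by blast
        qed
        finally show "comult H y (\<lambda>a b. \<phi> (a \<otimes> S' (Pr 0 b))) = counit H y * \<phi> \<one>"
          using \<phi> by (simp add: linear_formsD)
      qed (use F0 comult_F0 x in auto)
      then show ?thesis using Pr(3)[OF x] by simp
    qed
    then show "S' = ?S" using S' by (auto intro: extensionalityI)
  qed
  then show "x \<in> F 0 \<Longrightarrow> antipode (corad_hopf H) x = antipode H x" by simp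
qed

end

section \<open>Diagonal braidings\<close>

text \<open>The scalar by which the braiding moves the letter i past the word w.\<close>

fun chi :: "('i \<Rightarrow> 'i \<Rightarrow> 'k::field) \<Rightarrow> 'i \<Rightarrow> 'i list \<Rightarrow> 'k" where
  "chi q i [] = 1"
| "chi q i (j # w) = q i j * chi q i w"

text \<open>The comultiplication of the tensor algebra of a vector space with diagonal braiding
  \<open>x\<^sub>i \<otimes> x\<^sub>j \<mapsto> q\<^sub>i\<^sub>j x\<^sub>j \<otimes> x\<^sub>i\<close>, in Sweedler notation: \<open>\<beta>\<close> is applied to \<open>\<Delta>(w)\<close>.\<close>

fun dconv :: "('i \<Rightarrow> 'i \<Rightarrow> 'k::field) \<Rightarrow> ('i list \<Rightarrow> 'i list \<Rightarrow> 'k) \<Rightarrow> 'i list \<Rightarrow> 'k" where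
  "dconv q \<beta> [] = \<beta> [] []"
| "dconv q \<beta> (i # w) = dconv q (\<lambda>a b. chi q i a * \<beta> a (i # b)) w + dconv q (\<lambda>a b. \<beta> (i # a) b) w"

lemma dconv_sum: "finite A \<Longrightarrow> dconv q (\<lambda>a b. \<Sum>i\<in>A. \<beta> i a b) w = (\<Sum>i\<in>A. dconv q (\<beta> i) w)"
  by (induction w arbitrary: \<beta>) (auto simp: sum_distrib_left sum.distrib)

lemma dconv_add: "dconv q (\<lambda>a b. \<beta> a b + \<gamma> a b) w = dconv q \<beta> w + dconv q \<gamma> w"
  by (induction w arbitrary: \<beta> \<gamma>) (auto simp: algebra_simps)

lemma dconv_scale: "dconv q (\<lambda>a b. c * \<beta> a b) w = c * dconv q \<beta> w"
proof (induction w arbitrary: \<beta>)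
  case (Cons i w)
  have "(\<lambda>a b. chi q i a * (c * \<beta> a (i # b))) = (\<lambda>a b. c * (chi q i a * \<beta> a (i # b)))"
    by (simp add: algebra_simps)
  then show ?case by (simp add: Cons algebra_simps)
qed auto

text \<open>Neither the coefficients nor the words depend on \<beta>, so the value of
  \<open>dconv\<close> comes from a finite tensor.\<close>

lemma dconv_rep:
  "\<exists>(n::nat) f a b. \<forall>\<beta>. dconv q \<beta> w = (\<Sum>i<n. f i * \<beta> (a i) (b i))"
proof (induction w)
  case Nil
  show ?case by (rule exI[of _ 1], rule exI[of _ "\<lambda>_. 1"], rule exI[of _ "\<lambda>_. []"], rule exI[of _ "\<lambda>_. []"]) simp
next
  case (Cons j w)
  then obtain n :: nat and f a b where h: "\<And>\<beta>. dconv q \<beta> w = (\<Sum>i<n. f i * \<beta> (a i) (b i))" by auto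
  define f' where "f' i = (if i < n then f i * chi q j (a i) else f (i - n))" for i
  define a' where "a' i = (if i < n then a i else j # a (i - n))" for i
  define b' where "b' i = (if i < n then j # b i else b (i - n))" for i
  have "dconv q \<beta> (j # w) = (\<Sum>i<n + n. f' i * \<beta> (a' i) (b' i))" for \<beta>
  proof -
    have "(\<Sum>i<n + n. f' i * \<beta> (a' i) (b' i)) =
        (\<Sum>i<n. f' i * \<beta> (a' i) (b' i)) + (\<Sum>i\<in>{n..<n + n}. f' i * \<beta> (a' i) (b' i))"
      by (subst lessThan_atLeast0, subst lessThan_atLeast0, rule sum.atLeastLessThan_concat[symmetric]) auto
    also have "(\<Sum>i\<in>{n..<n + n}. f' i * \<beta> (a' i) (b' i)) = (\<Sum>i<n. f' (i + n) * \<beta> (a' (i + n)) (b' (i + n)))"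
      using sum.shift_bounds_nat_ivl[of "\<lambda>i. f' i * \<beta> (a' i) (b' i)" 0 n n] by (simp add: lessThan_atLeast0)
    finally show ?thesis by (simp add: h f'_def a'_def b'_def mult.assoc)
  qed
  then show ?case by blast
qed

text \<open>The data of the theorem in coordinates. \<open>c_dual\<close> states linear independence
  of the entries of c through dual forms. In \<open>braiding\<close> the scalar does not depend on
  k, because a diagonal K multiplies whole rows.\<close>

locale matrix_hopf = dc_hopf H for H :: "('k::field, 'h) coalg" (structure) +
  fixes c :: "'i::finite \<Rightarrow> 'i \<Rightarrow> nat \<Rightarrow> 'h set" and z :: "'i \<Rightarrow> nat \<Rightarrow> 'h set" and q :: "'i \<Rightarrow> 'i \<Rightarrow> 'k"
  assumes c_in: "c i j \<in> carrier (gr H)"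
    and c_comult: "\<beta> \<in> bilinear_forms (gr H) (gr H) \<Longrightarrow> comult (gr H) (c i j) \<beta> = (\<Sum>t\<in>UNIV. \<beta> (c i t) (c t j))"
    and c_counit: "counit (gr H) (c i j) = (if i = j then 1 else 0)"
    and c_dual: "\<exists>\<psi>\<in>linear_forms (gr H). \<forall>k l. \<psi> (c k l) = (if k = i \<and> l = j then 1 else 0)"
    and z_degree: "z i \<in> gr_component H 1"
    and z_comult: "\<beta> \<in> bilinear_forms (gr H) (gr H) \<Longrightarrow>
      comult (gr H) (z i) \<beta> = (\<Sum>k\<in>UNIV. \<beta> (c i k) (z k)) + \<beta> (z i) \<one>\<^bsub>gr H\<^esub>"
    and z_nonzero: "\<exists>i. z i \<noteq> \<zero>\<^bsub>gr H\<^esub>"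
    and braiding: "c i k \<otimes>\<^bsub>gr H\<^esub> z j = q i j \<odot>\<^bsub>gr H\<^esub> (z j \<otimes>\<^bsub>gr H\<^esub> c i k)"
    and generated: "alg_generated (gr H) (range z) = coinvariants H"
begin

lemma comult_gr_seq:
  assumes X: "X \<in> seqs" and \<beta>: "\<beta> \<in> bilinear_forms (gr H) (gr H)"
  shows "comult (gr H) (lft X) \<beta> = (\<Sum>n | X n \<notin> below n. comult (gr H) (gr_class H n (X n)) \<beta>)"
proof -
  have "comult (gr H) (gr_class H n (X n)) \<beta> = comult H (X n) (spl n \<beta>)" for n
  proof -
    have "{k. single n (X n) k \<notin> below k} \<subseteq> {n}" using subspaceD(2)[OF below_subspace] by (auto simp: single_def)
    then show ?thesis
      using comult_lft[OF single_seqs[OF seqsD(1)[OF X]] \<beta>, of "{n}"] by (simp add: gr_class_lft) (simp add: single_def)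
  qed
  then show ?thesis using comult_lft[OF X \<beta> seqsD(3)[OF X]] by simp
qed

text \<open>If the top degree part of a multiplicative matrix \<open>c\<close> had positive degree \<open>d\<close>, a form \<open>\<phi>\<close>
  concentrated in degree \<open>d\<close> would satisfy \<open>\<phi>(c) \<psi>(c) \<phi>(c) = 0\<close> for all \<open>\<psi>\<close>, since
  \<open>\<phi> * \<psi> * \<phi>\<close> lives in degrees at least \<open>2 d\<close>.\<close>

lemma c_degree: "c i j = gr_class H 0 (gr_proj (c i j))"
proof -
  have "\<forall>i j. \<exists>X. X \<in> seqs \<and> c i j = lft X" using grE[OF c_in] by metis
  then obtain X where X: "\<And>i j. X i j \<in> seqs" "\<And>i j. c i j = lft (X i j)" by metis
  \<comment> \<open>The positive degrees in which some entry of c is nonzero.\<close>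
  define bad where "bad = (\<Union>i. \<Union>j. {n. X i j n \<notin> below n}) - {0}"
  have fin: "finite bad" unfolding bad_def using seqsD(3)[OF X(1)] by auto
  have "bad = {}"
  proof (rule ccontr)
    assume "bad \<noteq> {}"
    define d where "d = Max bad"
    have "d \<in> bad" using fin \<open>bad \<noteq> {}\<close> by (simp add: d_def)
    then obtain p p' where p: "X p p' d \<notin> below d" and d0: "d > 0" unfolding bad_def by blast
    have top: "n \<le> d" if "X i j n \<notin> below n" for i j n
    proof (cases "n = 0")
      case False
      then have "n \<in> bad" using that by (auto simp: bad_def)
      then show ?thesis using fin by (simp add: d_def)
    qed simp
    obtain g where g: "g \<in> linear_forms H" "g (X p p' d) = 1" "\<And>w. w \<in> below d \<Longrightarrow> g w = 0"
      by (rule separating_form[OF below_subspace seqsD(2)[OF X(1)] p]) blast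
    define \<phi> where "\<phi> f = g (rep (f d))" for f
    have \<phi>l: "\<phi> (lft Y) = g (Y d)" if "Y \<in> seqs" for Y
      unfolding \<phi>_def by (rule rep_lft(3)[OF that g(1)]) (use g(3) in blast)
    have \<phi>: "\<phi> \<in> linear_forms (gr H)"
    proof (rule G.linear_formsI)
      fix x y assume "x \<in> carrier (gr H)" "y \<in> carrier (gr H)"
      then obtain Y Z where "Y \<in> seqs" "x = lft Y" "Z \<in> seqs" "y = lft Z" by (metis grE)
      then show "\<phi> (x \<oplus>\<^bsub>gr H\<^esub> y) = \<phi> x + \<phi> y"
        using seqs_add seqsD(2) by (simp add: lft_add \<phi>l linear_formsD(1)[OF g(1)])
    next
      fix a x assume "x \<in> carrier (gr H)"
      then obtain Y where "Y \<in> seqs" "x = lft Y" by (metis grE)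
      then show "\<phi> (a \<odot>\<^bsub>gr H\<^esub> x) = a * \<phi> x"
        using seqs_smult seqsD(2) by (simp add: lft_smult \<phi>l linear_formsD(2)[OF g(1)])
    qed
    have \<phi>c: "\<phi> (gr_class H n h) = (if n = d then g h else 0)" if "h \<in> F n" for n h
      using \<phi>l[OF single_seqs[OF that]] by (simp add: gr_class_lft) (simp add: single_def linear_formsD(3)[OF g(1)])
    \<comment> \<open>Taking \<psi> dual to \<open>c p' p\<close> makes the value of \<phi> * \<psi>
      * \<phi> at \<open>c p p'\<close> the square of \<phi>(\<open>c p p'\<close>).\<close>
    obtain \<psi> where \<psi>: "\<psi> \<in> linear_forms (gr H)" "\<And>k l. \<psi> (c k l) = (if k = p' \<and> l = p then 1 else 0)"
      using c_dual[of p' p] by blast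
    define \<rho> where "\<rho> b = comult (gr H) b (\<lambda>s t. \<psi> s * \<phi> t)" for b
    have b1: "(\<lambda>s t. \<psi> s * \<phi> t) \<in> bilinear_forms (gr H) (gr H)"
      by (rule bilinear_form_prod[OF G.vs G.vs \<psi>(1) \<phi>])
    have \<rho>: "\<rho> \<in> linear_forms (gr H)" unfolding \<rho>_def by (rule comult_gr_form[OF b1])
    have b2: "(\<lambda>s t. \<phi> s * \<rho> t) \<in> bilinear_forms (gr H) (gr H)"
      by (rule bilinear_form_prod[OF G.vs G.vs \<phi> \<rho>])
    have \<rho>0: "\<rho> (gr_class H n h) = 0" if h: "h \<in> F n" and n: "n < d" for n h
    proof -
      obtain r :: nat and i a b where r: "\<And>l. l < r \<Longrightarrow> i l \<le> n" "\<And>l. l < r \<Longrightarrow> b l \<in> F (n - i l)"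
        "\<And>\<beta>. \<beta> \<in> bilinear_forms (gr H) (gr H) \<Longrightarrow>
         comult (gr H) (gr_class H n h) \<beta> = (\<Sum>l<r. \<beta> (gr_class H (i l) (a l)) (gr_class H (n - i l) (b l)))"
        by (rule comult_class_sum[OF h]) blast
      show ?thesis unfolding \<rho>_def r(3)[OF b1] using r n by (intro sum.neutral) (auto simp: \<phi>c)
    qed
    \<comment> \<open>The left leg must have degree d to be seen by \<phi>. What is left for \<rho>
      then has degree at most n - d, which is below d as d is positive.\<close>
    have z: "comult (gr H) (gr_class H n h) (\<lambda>s t. \<phi> s * \<rho> t) = 0" if h: "h \<in> F n" and n: "n \<le> d" for n h
    proof -
      obtain r :: nat and i a b where r: "\<And>l. l < r \<Longrightarrow> i l \<le> n" "\<And>l. l < r \<Longrightarrow> a l \<in> F (i l)" "\<And>l. l < r \<Longrightarrow> b l \<in> F (n - i l)"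
        "\<And>\<beta>. \<beta> \<in> bilinear_forms (gr H) (gr H) \<Longrightarrow>
         comult (gr H) (gr_class H n h) \<beta> = (\<Sum>l<r. \<beta> (gr_class H (i l) (a l)) (gr_class H (n - i l) (b l)))"
        by (rule comult_class_sum[OF h]) blast
      show ?thesis unfolding r(4)[OF b2]
      proof (rule sum.neutral, safe)
        fix l assume l: "l < r"
        show "\<phi> (gr_class H (i l) (a l)) * \<rho> (gr_class H (n - i l) (b l)) = 0"
        proof (cases "i l = d")
          case True
          then have "n - i l < d" using n d0 by simp
          then show ?thesis using \<rho>0[OF r(3)[OF l]] by simp
        qed (use \<phi>c[OF r(2)[OF l]] in simp)
      qed
    qed
    have "comult (gr H) (c p p) (\<lambda>s t. \<phi> s * \<rho> t) = 0" for p
      unfolding X(2) comult_gr_seq[OF X(1) b2] by (rule sum.neutral) (use z seqsD(1)[OF X(1)] top in blast)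
    have "comult (gr H) (c p p') (\<lambda>s t. \<phi> s * \<rho> t) = 0"
      unfolding X(2) comult_gr_seq[OF X(1) b2] by (rule sum.neutral) (use z seqsD(1)[OF X(1)] top in blast)
    moreover have "comult (gr H) (c p p') (\<lambda>s t. \<phi> s * \<rho> t) =
      (\<Sum>t\<in>UNIV. \<phi> (c p t) * (\<Sum>s\<in>UNIV. \<psi> (c t s) * \<phi> (c s p')))"
      unfolding c_comult[OF b2] by (simp add: \<rho>_def c_comult[OF b1])
    also have "\<dots> = (\<Sum>t\<in>UNIV. if t = p' then \<phi> (c p p') * \<phi> (c p p') else 0)"
    proof (rule sum.cong[OF refl])
      fix t
      have "(\<Sum>s\<in>UNIV. \<psi> (c t s) * \<phi> (c s p')) = (\<Sum>s\<in>UNIV. if s = p then (if t = p' then \<phi> (c p p') else 0) else 0)"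
        by (rule sum.cong[OF refl]) (simp add: \<psi>(2))
      then show "\<phi> (c p t) * (\<Sum>s\<in>UNIV. \<psi> (c t s) * \<phi> (c s p')) = (if t = p' then \<phi> (c p p') * \<phi> (c p p') else 0)"
        by simp
    qed
    finally have "\<phi> (c p p') = 0" by simp
    then show False using \<phi>l[OF X(1)] g(2) by (simp add: X(2))
  qed
  then have b: "X i j n \<in> below n" if "n > 0" for n using that by (auto simp: bad_def)
  have "lft (X i j) = lft (single 0 (X i j 0))"
    by (rule lft_eqI) (use seqsD(2)[OF X(1)] b in \<open>auto simp: single_def linear_formsD(3)\<close>)
  then show ?thesis unfolding X(2) gr_proj_lft[OF X(1)] gr_class_lft .
qed

definition d :: "'i \<Rightarrow> 'i \<Rightarrow> 'h" where "d i j = gr_proj (c i j)"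

lemma d_in: "d i j \<in> F 0" "d i j \<in> carrier H"
  using gr_proj_hom(1)[OF c_in] filt_carrier by (auto simp: d_def)

lemma c_d: "c i j = gr_class H 0 (d i j)"
  unfolding d_def by (rule c_degree)

lemma gr_proj_lin: "gr_proj \<in> LinearCombinations.module_hom class_ring (gr H) H"
proof -
  have "gr_proj x \<in> carrier H" if "x \<in> carrier (gr H)" for x using gr_proj_hom(1)[OF that] filt_carrier by blast
  then show ?thesis using gr_proj_hom by (simp add: LinearCombinations.module_hom_def)
qed

lemma d_comult: "\<beta> \<in> bilinear_forms H H \<Longrightarrow> comult H (d i j) \<beta> = (\<Sum>t\<in>UNIV. \<beta> (d i t) (d t j))"
proof -
  assume \<beta>: "\<beta> \<in> bilinear_forms H H"
  let ?\<beta> = "\<lambda>a b. \<beta> (gr_proj a) (gr_proj b)"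
  have b: "?\<beta> \<in> bilinear_forms (gr H) (gr H)"
    by (rule bilinear_form_comp[OF G.vs G.vs gr_proj_lin gr_proj_lin \<beta>])
  obtain r :: nat and i' a b where r: "\<And>l. l < r \<Longrightarrow> i' l \<le> 0" "\<And>l. l < r \<Longrightarrow> a l \<in> F (i' l)" "\<And>l. l < r \<Longrightarrow> b l \<in> F (0 - i' l)"
    "\<And>\<beta>. \<beta> \<in> bilinear_forms H H \<Longrightarrow> comult H (d i j) \<beta> = (\<Sum>l<r. \<beta> (a l) (b l))"
    "\<And>\<beta>. \<beta> \<in> bilinear_forms (gr H) (gr H) \<Longrightarrow>
       comult (gr H) (gr_class H 0 (d i j)) \<beta> = (\<Sum>l<r. \<beta> (gr_class H (i' l) (a l)) (gr_class H (0 - i' l) (b l)))"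
    by (rule comult_class_sum[OF d_in(1)]) blast
  have "comult H (d i j) \<beta> = comult (gr H) (c i j) ?\<beta>"
    using r(1-3) by (simp add: r(4)[OF \<beta>] c_d r(5)[OF b] gr_proj_class)
  then show ?thesis by (simp add: c_comult[OF b] d_def)
qed

lemma d_counit: "counit H (d i j) = (if i = j then 1 else 0)"
  using c_counit counit_gr by (simp add: d_def)

abbreviation S :: "'h \<Rightarrow> 'h" where "S \<equiv> antipode H"

lemma S_hom: "S \<in> LinearCombinations.module_hom class_ring H H"
  using antipode_H by (simp add: is_antipode_def)

definition \<sigma> :: "(nat \<Rightarrow> 'h set) \<Rightarrow> nat \<Rightarrow> 'h set" where
  "\<sigma> r = gr_class H 0 (antipode (corad_hopf H) (gr_proj r))"

lemma \<sigma>_eq: "r \<in> carrier (gr H) \<Longrightarrow> \<sigma> r = gr_class H 0 (S (gr_proj r))"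
  by (simp add: \<sigma>_def antipode_corad gr_proj_hom(1))

lemma S_lin:
  "x \<in> carrier H \<Longrightarrow> S x \<in> carrier H"
  "x \<in> carrier H \<Longrightarrow> y \<in> carrier H \<Longrightarrow> S (x \<oplus> y) = S x \<oplus> S y"
  "x \<in> carrier H \<Longrightarrow> S (a \<odot> x) = a \<odot> S x"
  using S_hom by (auto simp: LinearCombinations.module_hom_def)

lemma S_zero: "S \<zero> = \<zero>"
  using S_lin(3)[of \<one> 0] S_lin(1)[of \<one>] by simp

lemma \<sigma>_hom: "\<sigma> \<in> LinearCombinations.module_hom class_ring (gr H) (gr H)"
proof -
  have "gr_proj x \<in> carrier H" if "x \<in> carrier (gr H)" for x using gr_proj_hom(1)[OF that] filt_carrier by blast
  then show ?thesis
    by (simp add: LinearCombinations.module_hom_def Pi_iff \<sigma>_eq gr_proj_hom gr_class_in antipode_coradical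
      gr_class_add gr_class_smult S_lin)
qed

lemma \<sigma>_in: "r \<in> carrier (gr H) \<Longrightarrow> \<sigma> r \<in> carrier (gr H)"
  using \<sigma>_hom by (auto simp: LinearCombinations.module_hom_def)

lemmas d_antipode = antipode_matrix[OF finite_UNIV antipode_H d_in(2) d_comult d_counit, simplified]

lemma \<sigma>_mult_c: "t \<in> carrier (gr H) \<Longrightarrow> \<sigma> (c i j \<otimes>\<^bsub>gr H\<^esub> t) = \<sigma> t \<otimes>\<^bsub>gr H\<^esub> \<sigma> (c i j)"
  using gr_proj_hom(1)[of t] filt_carrier[of "gr_proj t" 0]
  by (simp add: \<sigma>_eq c_in gr_proj_hom gr_class_mult antipode_coradical d_def[symmetric] d_in d_antipode(2))

lemma c_inverse:
  assumes "\<phi> \<in> linear_forms (gr H)"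
  shows "(\<Sum>t\<in>UNIV. \<phi> (c i t \<otimes>\<^bsub>gr H\<^esub> \<sigma> (c t j))) = (if i = j then \<phi> \<one>\<^bsub>gr H\<^esub> else 0)"
proof -
  have f: "(\<lambda>y. \<phi> (gr_class H 0 (Pr 0 y))) \<in> linear_forms H"
    by (rule linear_form_comp[OF vs class_Pr_hom assms])
  have "c i t \<otimes>\<^bsub>gr H\<^esub> \<sigma> (c t j) = gr_class H 0 (Pr 0 (d i t \<otimes> S (d t j)))" for t
    using mult_coradical[OF d_in(1) antipode_coradical[OF d_in(1)]]
    by (simp add: \<sigma>_eq c_in d_def[symmetric] c_d[of i t] gr_class_mult d_in antipode_coradical Pr(3))
  then show ?thesis
    using d_antipode(1)[OF f, of i j] Pr(3)[OF one_coradical] by (simp add: gr_simps(3))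
qed

lemma z_in: "z i \<in> carrier (gr H)"
  using z_degree[of i] gr_class_in by (auto simp: gr_component_def)

lemma z_class: obtains h where "h \<in> F 1" "z i = gr_class H 1 h"
  using z_degree[of i] by (auto simp: gr_component_def)

text \<open>\<open>z i\<close> has degree 1, so the projection to degree 0 annihilates the
  product.\<close>

lemma \<sigma>_mult_z: "t \<in> carrier (gr H) \<Longrightarrow> \<sigma> (z i \<otimes>\<^bsub>gr H\<^esub> t) = \<zero>\<^bsub>gr H\<^esub>"
proof -
  assume t: "t \<in> carrier (gr H)"
  obtain h where h: "h \<in> F 1" "z i = gr_class H 1 h" by (rule z_class)
  have "gr_proj (z i) = \<zero>" using gr_proj_class[OF h(1)] h(2) by simp
  then show ?thesis
    using t filt_carrier[OF gr_proj_hom(1)[OF t]] subspaceD(2)[OF below_subspace, of 0]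
    by (simp add: \<sigma>_eq z_in gr_proj_hom gr_class_below S_zero)
qed

subsection \<open>The braided comultiplication\<close>

definition K :: "((nat \<Rightarrow> 'h set) \<Rightarrow> (nat \<Rightarrow> 'h set) \<Rightarrow> 'k) \<Rightarrow> (nat \<Rightarrow> 'h set) \<Rightarrow> (nat \<Rightarrow> 'h set) \<Rightarrow> 'k" where
  "K \<beta> = (\<lambda>r1 s. comult (gr H) s (\<lambda>r2 r3. \<beta> (r1 \<otimes>\<^bsub>gr H\<^esub> \<sigma> r2) r3))"

text \<open>The value at \<beta> of
  \<open>r\<^sub>1 S(\<pi>(r\<^sub>2)) \<otimes> r\<^sub>3\<close>, the braided comultiplication
  written on all of \<open>gr H\<close>.\<close>

definition E :: "((nat \<Rightarrow> 'h set) \<Rightarrow> (nat \<Rightarrow> 'h set) \<Rightarrow> 'k) \<Rightarrow> (nat \<Rightarrow> 'h set) \<Rightarrow> 'k" where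
  "E \<beta> r = comult (gr H) r (K \<beta>)"

lemma id_hom: "(\<lambda>x. x) \<in> LinearCombinations.module_hom class_ring V V"
  by (simp add: LinearCombinations.module_hom_def)

lemma K_inner:
  assumes "\<beta> \<in> bilinear_forms (gr H) (gr H)" "r \<in> carrier (gr H)"
  shows "(\<lambda>r2 r3. \<beta> (r \<otimes>\<^bsub>gr H\<^esub> \<sigma> r2) r3) \<in> bilinear_forms (gr H) (gr H)"
proof -
  have "(\<lambda>r2. r \<otimes>\<^bsub>gr H\<^esub> \<sigma> r2) \<in> LinearCombinations.module_hom class_ring (gr H) (gr H)"
    using \<sigma>_hom assms(2) by (auto simp: LinearCombinations.module_hom_def Pi_iff G.r_distr)
  from bilinear_form_comp[OF G.vs G.vs this id_hom assms(1)] show ?thesis .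
qed

lemma K_bilinear:
  assumes "\<beta> \<in> bilinear_forms (gr H) (gr H)"
  shows "K \<beta> \<in> bilinear_forms (gr H) (gr H)"
  unfolding K_def
proof (rule bilinear_formsI)
  show "(\<lambda>s. comult (gr H) s (\<lambda>r2 r3. \<beta> (r \<otimes>\<^bsub>gr H\<^esub> \<sigma> r2) r3)) \<in> linear_forms (gr H)" if "r \<in> carrier (gr H)" for r
    by (rule comult_gr_form[OF K_inner[OF assms that]])
  show "(\<lambda>r. comult (gr H) s (\<lambda>r2 r3. \<beta> (r \<otimes>\<^bsub>gr H\<^esub> \<sigma> r2) r3)) \<in> linear_forms (gr H)" if "s \<in> carrier (gr H)" for s
    by (rule tensor_linear_form[OF G.vs G.vs G.vs comult_gr_tensor[OF that] K_inner[OF assms]])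
      (auto intro!: G.mult_form(1)[OF bilinear_formsD(2)[OF assms]] \<sigma>_in)
qed

lemma E_form: "\<beta> \<in> bilinear_forms (gr H) (gr H) \<Longrightarrow> E \<beta> \<in> linear_forms (gr H)"
  unfolding E_def by (rule comult_gr_form[OF K_bilinear])

lemma comult_z_mult:
  assumes s: "s \<in> carrier (gr H)" and \<gamma>: "\<gamma> \<in> bilinear_forms (gr H) (gr H)"
  shows "comult (gr H) (z i \<otimes>\<^bsub>gr H\<^esub> s) \<gamma> =
    (\<Sum>k\<in>UNIV. comult (gr H) s (\<lambda>s1 s2. \<gamma> (c i k \<otimes>\<^bsub>gr H\<^esub> s1) (z k \<otimes>\<^bsub>gr H\<^esub> s2))) +
    comult (gr H) s (\<lambda>s1 s2. \<gamma> (z i \<otimes>\<^bsub>gr H\<^esub> s1) s2)"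
proof -
  have "comult (gr H) s (\<lambda>s1 s2. \<gamma> (z i \<otimes>\<^bsub>gr H\<^esub> s1) (\<one>\<^bsub>gr H\<^esub> \<otimes>\<^bsub>gr H\<^esub> s2)) =
    comult (gr H) s (\<lambda>s1 s2. \<gamma> (z i \<otimes>\<^bsub>gr H\<^esub> s1) s2)"
    by (rule gr_cong[OF s]) simp
  then show ?thesis
    by (simp add: comult_gr_mult[OF z_in s \<gamma>] z_comult[OF comult_gr_mult_bilinear[OF s \<gamma>]])
qed

text \<open>Expand \<Delta> twice on z(i) s. A factor z in the middle leg dies under
  \<open>\<sigma>\<close>. A factor z(l) in the right leg leaves c(i,k) in the left and c(k,l) in
  the middle leg; there \<open>\<sigma>\<close> reverses the product and puts \<sigma>(c(k,l))
  behind everything else. A factor z(i) in the left leg stays in front.\<close>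

lemma E_step:
  assumes s: "s \<in> carrier (gr H)" and \<beta>: "\<beta> \<in> bilinear_forms (gr H) (gr H)"
  shows "E \<beta> (z i \<otimes>\<^bsub>gr H\<^esub> s) =
    E (\<lambda>p t. \<Sum>k\<in>UNIV. \<Sum>l\<in>UNIV. \<beta> ((c i k \<otimes>\<^bsub>gr H\<^esub> p) \<otimes>\<^bsub>gr H\<^esub> \<sigma> (c k l)) (z l \<otimes>\<^bsub>gr H\<^esub> t)) s +
    E (\<lambda>p t. \<beta> (z i \<otimes>\<^bsub>gr H\<^esub> p) t) s"
proof -
  define \<beta>' where "\<beta>' k l = (\<lambda>p t. \<beta> ((c i k \<otimes>\<^bsub>gr H\<^esub> p) \<otimes>\<^bsub>gr H\<^esub> \<sigma> (c k l)) (z l \<otimes>\<^bsub>gr H\<^esub> t))" for k l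
  have \<beta>'b: "\<beta>' k l \<in> bilinear_forms (gr H) (gr H)" for k l
  proof -
    have "(\<lambda>p. (c i k \<otimes>\<^bsub>gr H\<^esub> p) \<otimes>\<^bsub>gr H\<^esub> \<sigma> (c k l)) \<in> LinearCombinations.module_hom class_ring (gr H) (gr H)"
      using c_in \<sigma>_in[OF c_in] by (auto simp: LinearCombinations.module_hom_def G.r_distr G.l_distr)
    from bilinear_form_comp[OF G.vs G.vs this G.mult_hom(2)[OF z_in] \<beta>] show ?thesis by (simp add: \<beta>'_def)
  qed
  have Kz: "K \<beta> r1 (z k \<otimes>\<^bsub>gr H\<^esub> s2) =
      (\<Sum>l\<in>UNIV. comult (gr H) s2 (\<lambda>t2 t3. \<beta> (r1 \<otimes>\<^bsub>gr H\<^esub> (\<sigma> t2 \<otimes>\<^bsub>gr H\<^esub> \<sigma> (c k l))) (z l \<otimes>\<^bsub>gr H\<^esub> t3)))"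
    if r: "r1 \<in> carrier (gr H)" and s2: "s2 \<in> carrier (gr H)" for r1 s2 k
  proof -
    note b = K_inner[OF \<beta> r]
    have "comult (gr H) s2 (\<lambda>s1 s2. \<beta> (r1 \<otimes>\<^bsub>gr H\<^esub> \<sigma> (z k \<otimes>\<^bsub>gr H\<^esub> s1)) s2) = comult (gr H) s2 (\<lambda>_ _. 0)"
      by (rule gr_cong[OF s2]) (use r in \<open>simp add: \<sigma>_mult_z G.linear_formsD(3)[OF bilinear_formsD(2)[OF \<beta>]]\<close>)
    also have "\<dots> = 0" by (rule gr_linear(3)[OF s2])
    finally have z: "comult (gr H) s2 (\<lambda>s1 s2. \<beta> (r1 \<otimes>\<^bsub>gr H\<^esub> \<sigma> (z k \<otimes>\<^bsub>gr H\<^esub> s1)) s2) = 0" .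
    have "K \<beta> r1 (z k \<otimes>\<^bsub>gr H\<^esub> s2) =
      (\<Sum>l\<in>UNIV. comult (gr H) s2 (\<lambda>t2 t3. \<beta> (r1 \<otimes>\<^bsub>gr H\<^esub> \<sigma> (c k l \<otimes>\<^bsub>gr H\<^esub> t2)) (z l \<otimes>\<^bsub>gr H\<^esub> t3)))"
      unfolding K_def comult_z_mult[OF s2 b] z by simp
    also have "\<dots> = (\<Sum>l\<in>UNIV. comult (gr H) s2 (\<lambda>t2 t3. \<beta> (r1 \<otimes>\<^bsub>gr H\<^esub> (\<sigma> t2 \<otimes>\<^bsub>gr H\<^esub> \<sigma> (c k l))) (z l \<otimes>\<^bsub>gr H\<^esub> t3)))"
      by (intro sum.cong refl gr_cong[OF s2]) (simp add: \<sigma>_mult_c)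
    finally show ?thesis .
  qed
  have "E \<beta> (z i \<otimes>\<^bsub>gr H\<^esub> s) =
    (\<Sum>k\<in>UNIV. comult (gr H) s (\<lambda>s1 s2. K \<beta> (c i k \<otimes>\<^bsub>gr H\<^esub> s1) (z k \<otimes>\<^bsub>gr H\<^esub> s2))) +
    comult (gr H) s (\<lambda>s1 s2. K \<beta> (z i \<otimes>\<^bsub>gr H\<^esub> s1) s2)"
    unfolding E_def by (rule comult_z_mult[OF s K_bilinear[OF \<beta>]])
  also have "comult (gr H) s (\<lambda>s1 s2. K \<beta> (z i \<otimes>\<^bsub>gr H\<^esub> s1) s2) = E (\<lambda>p t. \<beta> (z i \<otimes>\<^bsub>gr H\<^esub> p) t) s"
    unfolding E_def K_def
  proof (rule gr_cong[OF s])
    fix s1 s2 assume s12: "s1 \<in> carrier (gr H)" "s2 \<in> carrier (gr H)"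
    show "comult (gr H) s2 (\<lambda>r2 r3. \<beta> ((z i \<otimes>\<^bsub>gr H\<^esub> s1) \<otimes>\<^bsub>gr H\<^esub> \<sigma> r2) r3) =
      comult (gr H) s2 (\<lambda>r2 r3. \<beta> (z i \<otimes>\<^bsub>gr H\<^esub> (s1 \<otimes>\<^bsub>gr H\<^esub> \<sigma> r2)) r3)"
      by (rule gr_cong[OF s12(2)]) (use z_in \<sigma>_in s12 in \<open>simp add: G.m_assoc\<close>)
  qed
  also have "(\<Sum>k\<in>UNIV. comult (gr H) s (\<lambda>s1 s2. K \<beta> (c i k \<otimes>\<^bsub>gr H\<^esub> s1) (z k \<otimes>\<^bsub>gr H\<^esub> s2))) =
    (\<Sum>k\<in>UNIV. \<Sum>l\<in>UNIV. E (\<beta>' k l) s)"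
  proof (rule sum.cong[OF refl])
    fix k
    have "comult (gr H) s (\<lambda>s1 s2. K \<beta> (c i k \<otimes>\<^bsub>gr H\<^esub> s1) (z k \<otimes>\<^bsub>gr H\<^esub> s2)) =
      comult (gr H) s (\<lambda>s1 s2. \<Sum>l\<in>UNIV. K (\<beta>' k l) s1 s2)"
    proof (rule gr_cong[OF s])
      fix s1 s2 assume s12: "s1 \<in> carrier (gr H)" "s2 \<in> carrier (gr H)"
      show "K \<beta> (c i k \<otimes>\<^bsub>gr H\<^esub> s1) (z k \<otimes>\<^bsub>gr H\<^esub> s2) = (\<Sum>l\<in>UNIV. K (\<beta>' k l) s1 s2)"
        unfolding Kz[OF G.m_closed[OF c_in s12(1)] s12(2)] unfolding K_def \<beta>'_def
        by (intro sum.cong refl gr_cong[OF s12(2)]) (use c_in \<sigma>_in s12 in \<open>simp add: G.m_assoc\<close>)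
    qed
    also have "\<dots> = (\<Sum>l\<in>UNIV. E (\<beta>' k l) s)"
      unfolding E_def by (rule gr_linear(4)[OF s K_bilinear[OF \<beta>'b]])
    finally show "comult (gr H) s (\<lambda>s1 s2. K \<beta> (c i k \<otimes>\<^bsub>gr H\<^esub> s1) (z k \<otimes>\<^bsub>gr H\<^esub> s2)) = (\<Sum>l\<in>UNIV. E (\<beta>' k l) s)" .
  qed
  also have "(\<Sum>k\<in>UNIV. \<Sum>l\<in>UNIV. E (\<beta>' k l) s) = E (\<lambda>p t. \<Sum>k\<in>UNIV. \<Sum>l\<in>UNIV. \<beta>' k l p t) s"
  proof -
    have "K (\<lambda>p t. \<Sum>k\<in>UNIV. \<Sum>l\<in>UNIV. \<beta>' k l p t) s1 s2 = (\<Sum>k\<in>UNIV. \<Sum>l\<in>UNIV. K (\<beta>' k l) s1 s2)"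
      if "s1 \<in> carrier (gr H)" "s2 \<in> carrier (gr H)" for s1 s2
      unfolding K_def
      by (subst gr_linear(4)[OF that(2)], (intro bilinear_form_sum G.vs K_inner \<beta>'b that)[1],
          intro sum.cong refl gr_linear(4)[OF that(2)] K_inner \<beta>'b that)
    then have "E (\<lambda>p t. \<Sum>k\<in>UNIV. \<Sum>l\<in>UNIV. \<beta>' k l p t) s = comult (gr H) s (\<lambda>s1 s2. \<Sum>k\<in>UNIV. \<Sum>l\<in>UNIV. K (\<beta>' k l) s1 s2)"
      unfolding E_def by (intro gr_cong[OF s])
    also have "\<dots> = (\<Sum>k\<in>UNIV. \<Sum>l\<in>UNIV. E (\<beta>' k l) s)"
      unfolding E_def
      by (subst gr_linear(4)[OF s], (intro bilinear_form_sum G.vs K_bilinear \<beta>'b)[1],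
          intro sum.cong refl gr_linear(4)[OF s] K_bilinear \<beta>'b)
    finally show ?thesis by simp
  qed
  finally show ?thesis by (simp add: \<beta>'_def)
qed

primrec U :: "'i list \<Rightarrow> nat \<Rightarrow> 'h set" where
  "U [] = \<one>\<^bsub>gr H\<^esub>"
| "U (i # w) = z i \<otimes>\<^bsub>gr H\<^esub> U w"

lemma U_in: "U w \<in> carrier (gr H)"
  by (induction w) (auto simp: z_in)

lemma U_append: "U (w @ w') = U w \<otimes>\<^bsub>gr H\<^esub> U w'"
  by (induction w) (auto simp: U_in z_in G.m_assoc)

lemma c_U: "c i k \<otimes>\<^bsub>gr H\<^esub> U w = chi q i w \<odot>\<^bsub>gr H\<^esub> (U w \<otimes>\<^bsub>gr H\<^esub> c i k)"
proof (induction w)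
  case (Cons j w)
  have "c i k \<otimes>\<^bsub>gr H\<^esub> U (j # w) = (c i k \<otimes>\<^bsub>gr H\<^esub> z j) \<otimes>\<^bsub>gr H\<^esub> U w"
    by (simp add: c_in z_in U_in G.m_assoc)
  also have "\<dots> = q i j \<odot>\<^bsub>gr H\<^esub> (z j \<otimes>\<^bsub>gr H\<^esub> (c i k \<otimes>\<^bsub>gr H\<^esub> U w))"
    by (simp add: braiding c_in z_in U_in G.m_assoc)
  finally show ?case by (simp add: Cons c_in z_in U_in G.m_assoc G.smult_smult)
qed (simp add: c_in)

text \<open>Moving c(i,k) past \<open>U a\<close> produces the scalar \<open>chi q i a\<close>. Then
  c(i,k) stands next to \<sigma>(c(k,l)), and the sum over k cancels the two by
  \<open>c_inverse\<close>, leaving only l = i. What remains is the recursion of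
  \<open>dconv\<close>.\<close>

lemma E_word: "\<beta> \<in> bilinear_forms (gr H) (gr H) \<Longrightarrow> E \<beta> (U w) = dconv q (\<lambda>a b. \<beta> (U a) (U b)) w"
proof (induction w arbitrary: \<beta>)
  case Nil
  have "\<sigma> \<one>\<^bsub>gr H\<^esub> = \<one>\<^bsub>gr H\<^esub>"
  proof -
    have p: "gr_proj \<one>\<^bsub>gr H\<^esub> = \<one>" by (simp add: gr_simps(3) gr_proj_class[OF one_coradical])
    have "S \<one> = \<one>"
    proof (rule forms_separate)
      have c: "S \<one> \<in> carrier H" using S_hom by (auto simp: LinearCombinations.module_hom_def)
      then show "S \<one> \<in> carrier H" .
      fix \<phi> assume \<phi>: "\<phi> \<in> linear_forms H"
      have "(\<lambda>a b. \<phi> (S a \<otimes> b)) \<in> bilinear_forms H H"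
        using bilinear_form_comp[OF vs vs S_hom id_hom, of "\<lambda>a b. \<phi> (a \<otimes> b)"] mult_form[OF \<phi>]
        by (auto intro: bilinear_formsI)
      from comult_one[OF this] is_antipodeD(1)[OF antipode_H one_closed \<phi>]
      show "\<phi> (S \<one>) = \<phi> \<one>" using c by (simp add: counit_one)
    qed simp
    then show ?thesis unfolding \<sigma>_eq[OF G.one_closed] p by (simp only: gr_simps(3))
  qed
  then show ?case
    unfolding U.simps E_def comult_gr_one[OF K_bilinear[OF Nil]] unfolding K_def comult_gr_one[OF K_inner[OF Nil G.one_closed]]
    by simp
next
  case (Cons i w)
  have b1: "(\<lambda>p t. \<beta> (z i \<otimes>\<^bsub>gr H\<^esub> p) t) \<in> bilinear_forms (gr H) (gr H)"
    by (rule bilinear_form_comp[OF G.vs G.vs G.mult_hom(2)[OF z_in] id_hom Cons.prems])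
  have b2: "(\<lambda>p t. \<beta> ((c i k \<otimes>\<^bsub>gr H\<^esub> p) \<otimes>\<^bsub>gr H\<^esub> \<sigma> (c k l)) (z l \<otimes>\<^bsub>gr H\<^esub> t)) \<in> bilinear_forms (gr H) (gr H)" for k l
  proof -
    have "(\<lambda>p. (c i k \<otimes>\<^bsub>gr H\<^esub> p) \<otimes>\<^bsub>gr H\<^esub> \<sigma> (c k l)) \<in> LinearCombinations.module_hom class_ring (gr H) (gr H)"
      using c_in \<sigma>_in[OF c_in] by (auto simp: LinearCombinations.module_hom_def G.r_distr G.l_distr)
    from bilinear_form_comp[OF G.vs G.vs this G.mult_hom(2)[OF z_in] Cons.prems] show ?thesis .
  qed
  have key: "(\<Sum>k\<in>UNIV. \<Sum>l\<in>UNIV. \<beta> ((c i k \<otimes>\<^bsub>gr H\<^esub> U a) \<otimes>\<^bsub>gr H\<^esub> \<sigma> (c k l)) (z l \<otimes>\<^bsub>gr H\<^esub> U b)) =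
    chi q i a * \<beta> (U a) (z i \<otimes>\<^bsub>gr H\<^esub> U b)" for a b
  proof -
    define \<phi> where "\<phi> l = (\<lambda>y. \<beta> (U a \<otimes>\<^bsub>gr H\<^esub> y) (z l \<otimes>\<^bsub>gr H\<^esub> U b))" for l
    have \<beta>l: "(\<lambda>v. \<beta> v (z l \<otimes>\<^bsub>gr H\<^esub> U b)) \<in> linear_forms (gr H)" for l
      by (rule bilinear_formsD(2)[OF Cons.prems]) (simp add: z_in U_in)
    have \<phi>: "\<phi> l \<in> linear_forms (gr H)" for l
      unfolding \<phi>_def by (rule G.mult_form(2)[OF \<beta>l U_in])
    have "\<beta> ((c i k \<otimes>\<^bsub>gr H\<^esub> U a) \<otimes>\<^bsub>gr H\<^esub> \<sigma> (c k l)) (z l \<otimes>\<^bsub>gr H\<^esub> U b) =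
      chi q i a * \<phi> l (c i k \<otimes>\<^bsub>gr H\<^esub> \<sigma> (c k l))" for k l
      using G.linear_formsD(2)[OF \<beta>l[of l], of "U a \<otimes>\<^bsub>gr H\<^esub> (c i k \<otimes>\<^bsub>gr H\<^esub> \<sigma> (c k l))" "chi q i a"]
      by (simp add: c_U \<phi>_def c_in U_in \<sigma>_in G.m_assoc)
    then have "(\<Sum>k\<in>UNIV. \<Sum>l\<in>UNIV. \<beta> ((c i k \<otimes>\<^bsub>gr H\<^esub> U a) \<otimes>\<^bsub>gr H\<^esub> \<sigma> (c k l)) (z l \<otimes>\<^bsub>gr H\<^esub> U b)) =
      (\<Sum>l\<in>UNIV. chi q i a * (\<Sum>k\<in>UNIV. \<phi> l (c i k \<otimes>\<^bsub>gr H\<^esub> \<sigma> (c k l))))"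
      by (simp add: sum_distrib_left) (rule sum.swap)
    also have "\<dots> = (\<Sum>l\<in>UNIV. if l = i then chi q i a * \<phi> i \<one>\<^bsub>gr H\<^esub> else 0)"
      by (rule sum.cong[OF refl]) (auto simp: c_inverse[OF \<phi>])
    finally show ?thesis by (simp add: \<phi>_def U_in)
  qed
  have "E \<beta> (U (i # w)) =
    dconv q (\<lambda>a b. \<Sum>k\<in>UNIV. \<Sum>l\<in>UNIV. \<beta> ((c i k \<otimes>\<^bsub>gr H\<^esub> U a) \<otimes>\<^bsub>gr H\<^esub> \<sigma> (c k l)) (z l \<otimes>\<^bsub>gr H\<^esub> U b)) w +
    dconv q (\<lambda>a b. \<beta> (z i \<otimes>\<^bsub>gr H\<^esub> U a) (U b)) w"
    unfolding U.simps E_step[OF U_in Cons.prems]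
    by (subst Cons.IH, (intro bilinear_form_sum G.vs b2)[1], subst Cons.IH[OF b1], rule refl)
  then show ?case by (simp add: key)
qed

end

section \<open>The coinvariants as the span of the words in the generators\<close>

context matrix_hopf
begin

inductive_set ws :: "(nat \<Rightarrow> 'h set) set" where
  word: "U w \<in> ws"
| add: "x \<in> ws \<Longrightarrow> y \<in> ws \<Longrightarrow> x \<oplus>\<^bsub>gr H\<^esub> y \<in> ws"
| smult: "x \<in> ws \<Longrightarrow> a \<odot>\<^bsub>gr H\<^esub> x \<in> ws"

lemma ws_in: "x \<in> ws \<Longrightarrow> x \<in> carrier (gr H)"
  by (induction rule: ws.induct) (auto simp: U_in)

lemma ws_subspace: "subspace class_ring ws (gr H)"
proof -
  have "\<zero>\<^bsub>gr H\<^esub> \<in> ws" using ws.smult[OF ws.word, of 0 "[]"] by simp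
  then show ?thesis unfolding G.subspace_iff using ws_in ws.add ws.smult by auto
qed

lemma ws_mult: "x \<in> ws \<Longrightarrow> y \<in> ws \<Longrightarrow> x \<otimes>\<^bsub>gr H\<^esub> y \<in> ws"
proof (induction rule: ws.induct)
  case (word w)
  then show ?case
  proof (induction rule: ws.induct)
    case (word w') then show ?case using ws.word[of "w @ w'"] by (simp add: U_append)
  qed (auto simp: U_in ws_in G.r_distr intro: ws.intros)
qed (auto simp: U_in ws_in G.l_distr intro: ws.intros)

text \<open>Products of words are words, so the span of the words is already the generated
  subalgebra.\<close>

lemma coinvariants_ws: "coinvariants H = ws"
proof -
  have z: "z i \<in> ws" for i using ws.word[of "[i]"] by (simp add: z_in)
  have one: "\<one>\<^bsub>gr H\<^esub> \<in> ws" using ws.word[of "[]"] by simp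
  have "alg_generated (gr H) (range z) = ws"
  proof
    show "alg_generated (gr H) (range z) \<subseteq> ws"
      unfolding alg_generated_def using z ws_subspace one ws_mult by blast
    have gen: "x \<in> B" if "x \<in> ws" and B: "range z \<subseteq> B" "subspace class_ring B (gr H)" "\<one>\<^bsub>gr H\<^esub> \<in> B"
      "\<forall>x\<in>B. \<forall>y\<in>B. x \<otimes>\<^bsub>gr H\<^esub> y \<in> B" for x B
      using that(1)
    proof (induction rule: ws.induct)
      case (word w)
      show ?case
      proof (induction w)
        case (Cons i w)
        have "z i \<in> B" using B(1) by blast
        with Cons B(4) show ?case by (simp only: U.simps)
      qed (use B(3) in simp)
    qed (use G.subspaceD(3,4)[OF B(2)] in auto)
    show "ws \<subseteq> alg_generated (gr H) (range z)"
    proof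
      fix x assume x: "x \<in> ws"
      show "x \<in> alg_generated (gr H) (range z)" unfolding alg_generated_def
        by (rule InterI, unfold mem_Collect_eq, elim conjE) (rule gen[OF x])
    qed
  qed
  then show ?thesis using generated by simp
qed

lemma R_simps:
  "carrier (braided_R H) = ws" "add (braided_R H) = add (gr H)" "smult (braided_R H) = smult (gr H)"
  "zero (braided_R H) = zero (gr H)" "counit (braided_R H) = counit (gr H)"
  by (simp_all add: braided_R_def Let_def coinvariants_ws)

lemma linear_forms_R: "linear_forms (braided_R H) = linear_forms ((gr H)\<lparr>carrier := ws\<rparr>)"
  by (simp add: linear_forms_def R_simps)

lemma bilinear_forms_R:
  "bilinear_forms (braided_R H) (braided_R H) = bilinear_forms ((gr H)\<lparr>carrier := ws\<rparr>) ((gr H)\<lparr>carrier := ws\<rparr>)"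
  by (simp add: bilinear_forms_def linear_forms_R R_simps)

lemma vs_R: "vs (braided_R H)"
proof -
  have v: "vectorspace class_ring ((gr H)\<lparr>carrier := ws\<rparr>)"
    using vectorspace.subspace_is_vs[OF G.vectorspace ws_subspace] by simp
  interpret W: vs "(gr H)\<lparr>carrier := ws\<rparr>" by (rule vs.intro[OF v])
  have "vectorspace class_ring (braided_R H)"
    by (rule vectorspaceI)
      (use W.zero_closed W.add.m_closed W.smult_closed W.a_comm W.a_assoc W.smult_smult W.smult_add W.smult_distrib W.smult_0 W.smult_1 W.r_zero
        in \<open>simp_all add: R_simps\<close>)
  then show ?thesis by (rule vs.intro)
qed

sublocale R: vs "braided_R H" by (rule vs_R)

text \<open>A projection of \<open>gr H\<close> onto R; forms on R are extended along it so that
  \<open>E\<close> can be applied to them.\<close>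

definition Q :: "(nat \<Rightarrow> 'h set) \<Rightarrow> nat \<Rightarrow> 'h set" where
  "Q = (SOME P. P \<in> LinearCombinations.module_hom class_ring (gr H) (gr H) \<and>
    (\<forall>x\<in>carrier (gr H). P x \<in> ws) \<and> (\<forall>x\<in>ws. P x = x))"

lemma Q: "Q \<in> LinearCombinations.module_hom class_ring (gr H) (gr H)"
  "x \<in> carrier (gr H) \<Longrightarrow> Q x \<in> ws" "x \<in> ws \<Longrightarrow> Q x = x"
proof -
  have "\<exists>P. P \<in> LinearCombinations.module_hom class_ring (gr H) (gr H) \<and>
    (\<forall>x\<in>carrier (gr H). P x \<in> ws) \<and> (\<forall>x\<in>ws. P x = x)"
    using G.projection[OF ws_subspace] by metis
  from someI_ex[OF this, folded Q_def] show "Q \<in> LinearCombinations.module_hom class_ring (gr H) (gr H)"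
    "x \<in> carrier (gr H) \<Longrightarrow> Q x \<in> ws" "x \<in> ws \<Longrightarrow> Q x = x" by auto
qed

lemma Q_hom: "Q \<in> LinearCombinations.module_hom class_ring (gr H) (braided_R H)"
  using Q(1,2) by (auto simp: LinearCombinations.module_hom_def R_simps)

lemma form_R: "\<phi> \<in> linear_forms (gr H) \<Longrightarrow> \<phi> \<in> linear_forms (braided_R H)"
  using ws_in by (auto simp: linear_forms_def R_simps)

lemma bilinear_R: "\<beta> \<in> bilinear_forms (gr H) (gr H) \<Longrightarrow> \<beta> \<in> bilinear_forms (braided_R H) (braided_R H)"
  by (rule bilinear_formsI) (auto simp: R_simps dest!: ws_in dest: bilinear_formsD intro!: form_R)

lemma bilinear_Q:
  "\<gamma> \<in> bilinear_forms (braided_R H) (braided_R H) \<Longrightarrow> (\<lambda>a b. \<gamma> (Q a) (Q b)) \<in> bilinear_forms (gr H) (gr H)"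
  by (rule bilinear_form_comp[OF G.vs G.vs Q_hom Q_hom])

lemma form_Q: "\<phi> \<in> linear_forms (braided_R H) \<Longrightarrow> (\<lambda>a. \<phi> (Q a)) \<in> linear_forms (gr H)"
  by (rule linear_form_comp[OF G.vs Q_hom])

text \<open>On words \<open>E\<close> only evaluates its form at pairs of words, where Q is the
  identity. In effect the braided comultiplication maps R to R \<otimes> R.\<close>

lemma E_Q:
  assumes r: "r \<in> ws" and \<beta>: "\<beta> \<in> bilinear_forms (gr H) (gr H)"
  shows "E (\<lambda>a b. \<beta> (Q a) (Q b)) r = E \<beta> r"
proof -
  have b: "(\<lambda>a b. \<beta> (Q a) (Q b)) \<in> bilinear_forms (gr H) (gr H)"
    by (rule bilinear_Q[OF bilinear_R[OF \<beta>]])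
  show ?thesis using r
  proof (induction rule: ws.induct)
    case (word w) then show ?case by (simp add: E_word[OF b] E_word[OF \<beta>] Q(3)[OF ws.word])
  qed (simp_all add: ws_in G.linear_formsD[OF E_form[OF b]] G.linear_formsD[OF E_form[OF \<beta>]])
qed

lemma braided_tensor:
  assumes "r \<in> ws"
  shows "(\<lambda>\<gamma>\<in>bilinear_forms (braided_R H) (braided_R H). E (\<lambda>a b. \<gamma> (Q a) (Q b)) r) \<in>
    tensors (braided_R H) (braided_R H) ws ws"
  using assms
proof (induction rule: ws.induct)
  case (word w)
  obtain n :: nat and f a b where d: "\<And>\<beta>. dconv q \<beta> w = (\<Sum>i<n. f i * \<beta> (a i) (b i))"
    using dconv_rep[of q w] by blast
  show ?case
  proof (rule tensors_sumI[where I = "{..<n}" and a = "\<lambda>i. f i \<odot>\<^bsub>gr H\<^esub> U (a i)" and b = "\<lambda>i. U (b i)"])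
    fix \<gamma> assume \<gamma>: "\<gamma> \<in> bilinear_forms (braided_R H) (braided_R H)"
    have "\<gamma> (f i \<odot>\<^bsub>gr H\<^esub> U (a i)) (U (b i)) = f i * \<gamma> (U (a i)) (U (b i))" for i
      using R.linear_formsD(2)[OF bilinear_formsD(2)[OF \<gamma>, of "U (b i)"], of "U (a i)" "f i"]
      by (simp add: R_simps ws.word)
    then show "(\<lambda>\<gamma>\<in>bilinear_forms (braided_R H) (braided_R H). E (\<lambda>a b. \<gamma> (Q a) (Q b)) (U w)) \<gamma> =
      (\<Sum>i\<in>{..<n}. \<gamma> (f i \<odot>\<^bsub>gr H\<^esub> U (a i)) (U (b i)))"
      using \<gamma> by (simp add: E_word[OF bilinear_Q[OF \<gamma>]] d Q(3)[OF ws.word])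
  qed (auto intro: ws.intros simp: extensional_def)
next
  case (add x y)
  have "(\<lambda>\<gamma>\<in>bilinear_forms (braided_R H) (braided_R H). E (\<lambda>a b. \<gamma> (Q a) (Q b)) (x \<oplus>\<^bsub>gr H\<^esub> y)) =
    (\<lambda>\<gamma>\<in>bilinear_forms (braided_R H) (braided_R H).
      (\<lambda>\<gamma>\<in>bilinear_forms (braided_R H) (braided_R H). E (\<lambda>a b. \<gamma> (Q a) (Q b)) x) \<gamma> +
      (\<lambda>\<gamma>\<in>bilinear_forms (braided_R H) (braided_R H). E (\<lambda>a b. \<gamma> (Q a) (Q b)) y) \<gamma>)"
    by (rule restrict_ext) (use add in \<open>simp add: ws_in G.linear_formsD(1)[OF E_form[OF bilinear_Q]]\<close>)
  then show ?case using tensors_add[OF add.IH] by (simp only:)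
next
  case (smult x a)
  have "(\<lambda>\<gamma>\<in>bilinear_forms (braided_R H) (braided_R H). E (\<lambda>a b. \<gamma> (Q a) (Q b)) (a \<odot>\<^bsub>gr H\<^esub> x)) =
    (\<lambda>\<gamma>\<in>bilinear_forms (braided_R H) (braided_R H).
      a * (\<lambda>\<gamma>\<in>bilinear_forms (braided_R H) (braided_R H). E (\<lambda>a b. \<gamma> (Q a) (Q b)) x) \<gamma>)"
    by (rule restrict_ext) (use smult in \<open>simp add: ws_in G.linear_formsD(2)[OF E_form[OF bilinear_Q]]\<close>)
  moreover have "(\<lambda>\<gamma>\<in>bilinear_forms (braided_R H) (braided_R H).
      a * (\<lambda>\<gamma>\<in>bilinear_forms (braided_R H) (braided_R H). E (\<lambda>a b. \<gamma> (Q a) (Q b)) x) \<gamma>) \<in>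
      tensors (braided_R H) (braided_R H) ws ws"
    by (rule tensors_scale[OF vs_R vs_R smult.IH]) (auto simp: R_simps intro: ws.smult)
  ultimately show ?case by (simp only:)
qed

text \<open>A tensor over R is determined by its image over \<open>gr H\<close>, as forms on R
  extend along Q, and \<open>E_Q\<close> shows that the given tensor has the required image.\<close>

lemma comult_R:
  assumes r: "r \<in> ws"
  shows "comult (braided_R H) r = (\<lambda>\<gamma>\<in>bilinear_forms (braided_R H) (braided_R H). E (\<lambda>a b. \<gamma> (Q a) (Q b)) r)"
proof -
  let ?R = "(gr H)\<lparr>carrier := ws\<rparr>"
  let ?P = "\<lambda>T. T \<in> carrier (tensor_product ?R ?R) \<and>
    tensor_map (gr H) (gr H) id id T = (\<lambda>\<beta>\<in>bilinear_forms (gr H) (gr H). E \<beta> r)"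
  let ?T = "\<lambda>\<gamma>\<in>bilinear_forms (braided_R H) (braided_R H). E (\<lambda>a b. \<gamma> (Q a) (Q b)) r"
  have t: "carrier (tensor_product ?R ?R) = tensors (braided_R H) (braided_R H) ws ws"
    by (simp add: tensors_def bilinear_forms_R)
  have "comult (braided_R H) r = (THE T. ?P T)"
    by (simp add: braided_R_def Let_def coinvariants_ws E_def K_def \<sigma>_def)
  also have "\<dots> = ?T"
  proof (rule the_equality)
    have "tensor_map (gr H) (gr H) id id ?T = (\<lambda>\<beta>\<in>bilinear_forms (gr H) (gr H). E \<beta> r)"
      unfolding tensor_map_def by (rule restrict_ext) (use bilinear_R E_Q[OF r] in auto)
    then show "?P ?T" unfolding t using braided_tensor[OF r] by blast
  next
    fix T assume T: "?P T"
    then have Tt: "T \<in> tensors (braided_R H) (braided_R H) (carrier (braided_R H)) (carrier (braided_R H))"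
      unfolding t R_simps by blast
    show "T = ?T"
    proof (rule extensionalityI)
      show "T \<in> extensional (bilinear_forms (braided_R H) (braided_R H))" using Tt by (auto elim: tensorsE)
      fix \<gamma> assume \<gamma>: "\<gamma> \<in> bilinear_forms (braided_R H) (braided_R H)"
      have "T \<gamma> = T (\<lambda>a b. \<gamma> (Q a) (Q b))"
        by (rule tensor_cong[OF vs_R vs_R Tt]) (simp add: R_simps Q(3))
      also have "\<dots> = tensor_map (gr H) (gr H) id id T (\<lambda>a b. \<gamma> (Q a) (Q b))"
        using bilinear_Q[OF \<gamma>] by (simp add: tensor_map_def)
      also have "\<dots> = E (\<lambda>a b. \<gamma> (Q a) (Q b)) r" using T bilinear_Q[OF \<gamma>] by simp
      finally show "T \<gamma> = ?T \<gamma>" using \<gamma> by simp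
    qed simp
  qed
  finally show ?thesis .
qed

lemma comult_R_tensor: "r \<in> ws \<Longrightarrow> comult (braided_R H) r \<in> tensors (braided_R H) (braided_R H) ws ws"
  using comult_R braided_tensor by simp

lemma comult_R_word:
  "\<gamma> \<in> bilinear_forms (braided_R H) (braided_R H) \<Longrightarrow>
   comult (braided_R H) (U w) \<gamma> = dconv q (\<lambda>a b. \<gamma> (U a) (U b)) w"
  by (simp add: comult_R ws.word E_word[OF bilinear_Q] Q(3))

lemma comult_R_form:
  "\<gamma> \<in> bilinear_forms (braided_R H) (braided_R H) \<Longrightarrow> (\<lambda>r. comult (braided_R H) r \<gamma>) \<in> linear_forms (braided_R H)"
  by (rule R.linear_formsI)
    (simp_all add: R_simps comult_R ws.intros ws_in G.linear_formsD[OF E_form[OF bilinear_Q]])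

lemma gr_proj_U: "gr_proj (U (i # w)) = \<zero>"
proof -
  obtain h where h: "h \<in> F 1" "z i = gr_class H 1 h" by (rule z_class)
  have "gr_proj (z i) = \<zero>" using gr_proj_class[OF h(1)] h(2) by simp
  then show ?thesis using filt_carrier[OF gr_proj_hom(1)[OF U_in[of w]]] by (simp add: gr_proj_hom z_in U_in)
qed

lemma counit_U: "counit (braided_R H) (U w) = (if w = [] then 1 else 0)"
proof (cases w)
  case Nil
  then show ?thesis
    by (simp add: R_simps counit_gr gr_simps(3) gr_proj_class[OF one_coradical] counit_one)
next
  case (Cons i w')
  then show ?thesis unfolding R_simps counit_gr Cons gr_proj_U by (simp add: linear_formsD(3)[OF counit_form])
qed

lemma counit_R_form: "counit (braided_R H) \<in> linear_forms (braided_R H)"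
proof (rule R.linear_formsI)
  have c: "gr_proj x \<in> carrier H" if "x \<in> ws" for x using filt_carrier[OF gr_proj_hom(1)[OF ws_in[OF that]]] .
  show "counit (braided_R H) (x \<oplus>\<^bsub>braided_R H\<^esub> y) = counit (braided_R H) x + counit (braided_R H) y"
    if "x \<in> carrier (braided_R H)" "y \<in> carrier (braided_R H)" for x y
    using that c by (simp add: R_simps counit_gr gr_proj_hom ws_in linear_formsD[OF counit_form])
  show "counit (braided_R H) (a \<odot>\<^bsub>braided_R H\<^esub> x) = a * counit (braided_R H) x"
    if "x \<in> carrier (braided_R H)" for a x
    using that c by (simp add: R_simps counit_gr gr_proj_hom ws_in linear_formsD[OF counit_form])
qed

subsection \<open>Relations among words\<close>

text \<open>Substitution of the generators for the letters of a noncommutative polynomial p.\<close>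

definition ev :: "('i list \<Rightarrow> 'k) \<Rightarrow> nat \<Rightarrow> 'h set" where
  "ev p = G.lincomb {w. p w \<noteq> 0} p U"

lemma ev_ws: "ev p \<in> ws"
  unfolding ev_def by (rule G.lincomb_in[OF ws_subspace ws.word])

lemma form_ev_gr:
  assumes "\<phi> \<in> linear_forms (gr H)" "finite A" "{w. p w \<noteq> 0} \<subseteq> A"
  shows "\<phi> (ev p) = (\<Sum>w\<in>A. p w * \<phi> (U w))"
proof -
  have "\<phi> (ev p) = (\<Sum>w | p w \<noteq> 0. p w * \<phi> (U w))"
    unfolding ev_def by (rule G.form_lincomb[OF assms(1) U_in])
  also have "\<dots> = (\<Sum>w\<in>A. p w * \<phi> (U w))" by (rule sum.mono_neutral_left) (use assms in auto)
  finally show ?thesis .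
qed

lemma form_ev:
  assumes "\<phi> \<in> linear_forms (braided_R H)" "finite A" "{w. p w \<noteq> 0} \<subseteq> A"
  shows "\<phi> (ev p) = (\<Sum>w\<in>A. p w * \<phi> (U w))"
  using form_ev_gr[OF form_Q[OF assms(1)] assms(2,3)] by (simp add: Q(3) ev_ws ws.word)

lemma ev_surj: "r \<in> ws \<Longrightarrow> \<exists>p. finite {w. p w \<noteq> 0} \<and> r = ev p"
proof (induction rule: ws.induct)
  case (word w)
  show ?case
  proof (rule exI[of _ "\<lambda>v. if v = w then 1 else 0"], rule conjI)
    show "U w = ev (\<lambda>v. if v = w then 1 else 0)"
      by (rule G.forms_separate) (auto simp: U_in ws_in[OF ev_ws] form_ev_gr[of _ "{w}"])
  qed simp
next
  case (add x y)
  then obtain p p' where p: "finite {w. p w \<noteq> 0}" "x = ev p" "finite {w. p' w \<noteq> 0}" "y = ev p'" by blast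
  let ?A = "{w. p w \<noteq> 0} \<union> {w. p' w \<noteq> 0}"
  have s: "{w. p w + p' w \<noteq> 0} \<subseteq> ?A" by auto
  have A: "finite ?A" using p by simp
  have "x \<oplus>\<^bsub>gr H\<^esub> y = ev (\<lambda>w. p w + p' w)"
  proof (rule G.forms_separate)
    fix \<phi> assume \<phi>: "\<phi> \<in> linear_forms (gr H)"
    show "\<phi> (x \<oplus>\<^bsub>gr H\<^esub> y) = \<phi> (ev (\<lambda>w. p w + p' w))"
      using form_ev_gr[OF \<phi> A s] form_ev_gr[OF \<phi> A, of p] form_ev_gr[OF \<phi> A, of p'] add(1,2)
      by (simp add: G.linear_formsD[OF \<phi>] ws_in ev_ws p sum.distrib algebra_simps)
  qed (use add ev_ws ws_in in auto)
  then show ?case using finite_subset[OF s A] by (intro exI[of _ "\<lambda>w. p w + p' w"] conjI)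
next
  case (smult x a)
  then obtain p where p: "finite {w. p w \<noteq> 0}" "x = ev p" by blast
  have s: "{w. a * p w \<noteq> 0} \<subseteq> {w. p w \<noteq> 0}" by auto
  have "a \<odot>\<^bsub>gr H\<^esub> x = ev (\<lambda>w. a * p w)"
  proof (rule G.forms_separate)
    fix \<phi> assume \<phi>: "\<phi> \<in> linear_forms (gr H)"
    show "\<phi> (a \<odot>\<^bsub>gr H\<^esub> x) = \<phi> (ev (\<lambda>w. a * p w))"
      using form_ev_gr[OF \<phi> p(1) s] form_ev_gr[OF \<phi> p(1), of p]
      by (simp add: G.linear_formsD[OF \<phi>] ws_in ev_ws p sum_distrib_left mult.assoc)
  qed (use smult ev_ws ws_in in auto)
  then show ?case using finite_subset[OF s p(1)] by (intro exI[of _ "\<lambda>w. a * p w"] conjI)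
qed

lemma U_class: "\<exists>h\<in>F (length w). U w = gr_class H (length w) h"
proof (induction w)
  case Nil
  show ?case using one_coradical by (auto simp: gr_simps(3))
next
  case (Cons i w)
  then obtain g where g: "g \<in> F (length w)" "U w = gr_class H (length w) g" by blast
  obtain h where h: "h \<in> F 1" "z i = gr_class H 1 h" by (rule z_class)
  show ?case using gr_class_mult[OF h(1) g(1)] filt_mult[OF h(1) g(1)] by (auto simp: g(2) h(2))
qed

lemma comp_U: "comp n (U w) = (if length w = n then U w else \<zero>\<^bsub>gr H\<^esub>)"
  using U_class[of w] comp_class by auto

text \<open>A word lies in the degree given by its length, so the projection \<open>comp n\<close>
  of \<open>gr H\<close> picks out the part of a relation in degree n.\<close>

lemma ev_homogeneous:
  assumes p: "finite {w. p w \<noteq> 0}" and z: "ev p = \<zero>\<^bsub>gr H\<^esub>"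
  shows "ev (\<lambda>w. if length w = n then p w else 0) = \<zero>\<^bsub>gr H\<^esub>"
proof (rule G.forms_separate)
  let ?A = "{w. p w \<noteq> 0}" and ?p = "\<lambda>w. if length w = n then p w else 0"
  fix \<phi> assume \<phi>: "\<phi> \<in> linear_forms (gr H)"
  have \<phi>n: "(\<lambda>x. \<phi> (comp n x)) \<in> linear_forms (gr H)" by (rule linear_form_comp[OF G.vs comp_hom \<phi>])
  have "\<phi> (ev ?p) = (\<Sum>w\<in>?A. ?p w * \<phi> (U w))" by (rule form_ev_gr[OF \<phi> p]) auto
  also have "\<dots> = (\<Sum>w\<in>?A. p w * \<phi> (comp n (U w)))"
    by (rule sum.cong) (auto simp: comp_U G.linear_formsD(3)[OF \<phi>])
  also have "\<dots> = \<phi> (comp n (ev p))" using form_ev_gr[OF \<phi>n p subset_refl] by simp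
  also have "\<dots> = \<phi> (comp n \<zero>\<^bsub>gr H\<^esub>)" by (simp add: z)
  also have "\<dots> = \<phi> \<zero>\<^bsub>gr H\<^esub>" using G.linear_formsD(3)[OF \<phi>n] G.linear_formsD(3)[OF \<phi>] by simp
  finally show "\<phi> (ev ?p) = \<phi> \<zero>\<^bsub>gr H\<^esub>" .
qed (use ev_ws ws_in in auto)

text \<open>Some z(j) is nonzero. Let g be a form concentrated in degree 1 with value 1 at z(j), and
  \<psi> dual to the entry c(i,j). Then \<psi> \<otimes> g takes \<Delta>(z(k)) to 1 for k = i and
  to 0 otherwise, the summand with the unit vanishing by degree. So one nonzero entry forces the
  whole column to be independent.\<close>

lemma z_independent:
  assumes "\<And>\<phi>. \<phi> \<in> linear_forms (gr H) \<Longrightarrow> (\<Sum>k\<in>UNIV. a k * \<phi> (z k)) = 0"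
  shows "a i = 0"
proof -
  obtain j where j: "z j \<noteq> \<zero>\<^bsub>gr H\<^esub>" using z_nonzero by blast
  obtain g1 where g1: "g1 \<in> linear_forms (gr H)" "g1 (z j) = 1"
    by (rule G.separating_form[OF G.subspace_zero z_in[of j]]) (use j in auto)
  define g where "g x = g1 (comp 1 x)" for x
  have g: "g \<in> linear_forms (gr H)" unfolding g_def by (rule linear_form_comp[OF G.vs comp_hom g1(1)])
  obtain h where h: "h \<in> F 1" "z j = gr_class H 1 h" by (rule z_class)
  have gj: "g (z j) = 1" using g1(2) comp_class[OF h(1), of 1] by (simp add: g_def h(2))
  have g0: "g \<one>\<^bsub>gr H\<^esub> = 0"
    using comp_class[OF one_coradical, of 1] G.linear_formsD(3)[OF g1(1)] by (simp add: g_def gr_simps(3))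
  obtain \<psi> where \<psi>: "\<psi> \<in> linear_forms (gr H)" "\<And>k l. \<psi> (c k l) = (if k = i \<and> l = j then 1 else 0)"
    using c_dual[of i j] by blast
  have b: "(\<lambda>s t. \<psi> s * g t) \<in> bilinear_forms (gr H) (gr H)"
    by (rule bilinear_form_prod[OF G.vs G.vs \<psi>(1) g])
  have "comult (gr H) (z k) (\<lambda>s t. \<psi> s * g t) = (if k = i then 1 else 0)" for k
  proof -
    have "(\<Sum>t\<in>UNIV. \<psi> (c k t) * g (z t)) = (\<Sum>t\<in>UNIV. if t = j then (if k = i then 1 else 0) else 0)"
      by (rule sum.cong[OF refl]) (auto simp: \<psi>(2) gj)
    then show ?thesis by (simp add: z_comult[OF b] g0)
  qed
  then have "(\<Sum>k\<in>UNIV. a k * (if k = i then 1 else 0)) = 0"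
    using assms[OF comult_gr_form[OF b]] by simp
  then show ?thesis by (simp add: if_distrib[of "\<lambda>x. _ * x"] cong: if_cong)
qed

end

section \<open>The free algebra\<close>

lemma UNIV_letter: "UNIV = {LX, LY}"
  using letter.exhaust by auto

instance letter :: finite
  by standard (simp add: UNIV_letter)

definition word :: "letter list \<Rightarrow> letter list \<Rightarrow> 'k::field" where
  "word w = (\<lambda>v. if v = w then 1 else 0)"

lemma free_alg_simps:
  "carrier free_alg = {p. finite {w. p w \<noteq> 0}}"
  "p \<otimes>\<^bsub>free_alg\<^esub> q = (\<lambda>w. \<Sum>i\<le>length w. p (take i w) * q (drop i w))"
  "\<one>\<^bsub>free_alg\<^esub> = word []" "\<zero>\<^bsub>free_alg\<^esub> = (\<lambda>w. 0)"
  "p \<oplus>\<^bsub>free_alg\<^esub> q = (\<lambda>w. p w + q w)" "c \<odot>\<^bsub>free_alg\<^esub> p = (\<lambda>w. c * p w)"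
  by (simp_all add: free_alg_def word_def)

lemma vectorspace_free_alg: "vectorspace class_ring (free_alg :: ('k::field, letter list \<Rightarrow> 'k) module)"
proof (rule vectorspaceI)
  fix p q :: "letter list \<Rightarrow> 'k"
  assume "p \<in> carrier free_alg" "q \<in> carrier free_alg"
  then have "finite ({w. p w \<noteq> 0} \<union> {w. q w \<noteq> 0})" by (simp add: free_alg_simps)
  then have "finite {w. p w + q w \<noteq> 0}" by (rule rev_finite_subset) auto
  then show "p \<oplus>\<^bsub>free_alg\<^esub> q \<in> carrier free_alg" by (simp add: free_alg_simps)
next
  fix c and p :: "letter list \<Rightarrow> 'k"
  assume "p \<in> carrier free_alg"
  then have "finite {w. p w \<noteq> 0}" by (simp add: free_alg_simps)
  then have "finite {w. c * p w \<noteq> 0}" by (rule rev_finite_subset) auto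
  then show "c \<odot>\<^bsub>free_alg\<^esub> p \<in> carrier free_alg" by (simp add: free_alg_simps)
qed (auto simp: free_alg_simps algebra_simps)

lemma ring_free_alg: "ring (free_alg :: ('k::field, letter list \<Rightarrow> 'k) module)"
proof -
  interpret vs "free_alg :: ('k, letter list \<Rightarrow> 'k) module" by (rule vs.intro[OF vectorspace_free_alg])
  show ?thesis
  proof (rule ringI[OF abelian_group])
    show "monoid (free_alg :: ('k, letter list \<Rightarrow> 'k) module)"
    proof (rule monoidI)
      fix p q :: "letter list \<Rightarrow> 'k"
      assume p: "p \<in> carrier free_alg" and q: "q \<in> carrier free_alg"
      have "{w. (p \<otimes>\<^bsub>free_alg\<^esub> q) w \<noteq> 0} \<subseteq> (\<lambda>(u, v). u @ v) ` ({w. p w \<noteq> 0} \<times> {w. q w \<noteq> 0})"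
      proof
        fix w assume "w \<in> {w. (p \<otimes>\<^bsub>free_alg\<^esub> q) w \<noteq> 0}"
        then have "\<not> (\<forall>i\<in>{..length w}. p (take i w) * q (drop i w) = 0)"
          using sum.neutral[of "{..length w}" "\<lambda>i. p (take i w) * q (drop i w)"] by (auto simp: free_alg_simps)
        then obtain i where "p (take i w) \<noteq> 0" "q (drop i w) \<noteq> 0" by auto
        then show "w \<in> (\<lambda>(u, v). u @ v) ` ({w. p w \<noteq> 0} \<times> {w. q w \<noteq> 0})"
          by (intro image_eqI[of _ _ "(take i w, drop i w)"]) auto
      qed
      then show "p \<otimes>\<^bsub>free_alg\<^esub> q \<in> carrier free_alg"
        using p q by (auto simp: free_alg_simps(1) intro: finite_subset)
      fix r :: "letter list \<Rightarrow> 'k"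
      assume r: "r \<in> carrier free_alg"
      show "(p \<otimes>\<^bsub>free_alg\<^esub> q) \<otimes>\<^bsub>free_alg\<^esub> r = p \<otimes>\<^bsub>free_alg\<^esub> (q \<otimes>\<^bsub>free_alg\<^esub> r)"
      proof
        fix w
        let ?n = "length w" and ?f = "\<lambda>a b (_::nat). p (take a w) * q (take b (drop a w)) * r (drop (a + b) w)"
        have "((p \<otimes>\<^bsub>free_alg\<^esub> q) \<otimes>\<^bsub>free_alg\<^esub> r) w = (\<Sum>i\<le>?n. \<Sum>j\<le>i. ?f j (i - j) (?n - i))"
          unfolding free_alg_simps sum_distrib_right
          by (intro sum.cong) (auto simp: min_def drop_take)
        also have "\<dots> = (\<Sum>i\<le>?n. \<Sum>j\<le>?n - i. ?f i j (?n - i - j))" by (rule sum_triangle)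
        also have "\<dots> = (p \<otimes>\<^bsub>free_alg\<^esub> (q \<otimes>\<^bsub>free_alg\<^esub> r)) w"
          unfolding free_alg_simps sum_distrib_left
          by (intro sum.cong) (auto simp: mult.assoc add.commute)
        finally show "((p \<otimes>\<^bsub>free_alg\<^esub> q) \<otimes>\<^bsub>free_alg\<^esub> r) w = (p \<otimes>\<^bsub>free_alg\<^esub> (q \<otimes>\<^bsub>free_alg\<^esub> r)) w" .
      qed
    next
      show "\<one>\<^bsub>free_alg\<^esub> \<in> carrier (free_alg :: ('k, letter list \<Rightarrow> 'k) module)" by (simp add: free_alg_simps word_def)
      fix p :: "letter list \<Rightarrow> 'k"
      show "\<one>\<^bsub>free_alg\<^esub> \<otimes>\<^bsub>free_alg\<^esub> p = p"
      proof
        fix w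
        have "(\<one>\<^bsub>free_alg\<^esub> \<otimes>\<^bsub>free_alg\<^esub> p) w = (\<Sum>i\<le>length w. if i = 0 then p w else 0)"
          unfolding free_alg_simps word_def by (intro sum.cong) auto
        then show "(\<one>\<^bsub>free_alg\<^esub> \<otimes>\<^bsub>free_alg\<^esub> p) w = p w" by simp
      qed
      show "p \<otimes>\<^bsub>free_alg\<^esub> \<one>\<^bsub>free_alg\<^esub> = p"
      proof
        fix w
        have "(p \<otimes>\<^bsub>free_alg\<^esub> \<one>\<^bsub>free_alg\<^esub>) w = (\<Sum>i\<le>length w. if i = length w then p w else 0)"
          unfolding free_alg_simps word_def by (intro sum.cong) auto
        then show "(p \<otimes>\<^bsub>free_alg\<^esub> \<one>\<^bsub>free_alg\<^esub>) w = p w" by simp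
      qed
    qed
  qed (auto simp: free_alg_simps algebra_simps sum.distrib)
qed

lemma k_algebra_free_alg: "k_algebra (free_alg :: ('k::field, letter list \<Rightarrow> 'k) module)"
  unfolding k_algebra_def using vectorspace_free_alg ring_free_alg
  by (auto simp: free_alg_simps sum_distrib_left algebra_simps)

interpretation FA: kalg "free_alg :: ('k::field, letter list \<Rightarrow> 'k) module"
  by unfold_locales (rule k_algebra_free_alg)

lemma word_in: "word w \<in> carrier free_alg"
  by (simp add: free_alg_simps word_def)

lemma word_mult: "word u \<otimes>\<^bsub>free_alg\<^esub> word v = (word (u @ v) :: letter list \<Rightarrow> 'k::field)"
proof
  fix w
  have "((word u :: letter list \<Rightarrow> 'k) \<otimes>\<^bsub>free_alg\<^esub> word v) w =
    (\<Sum>i\<le>length w. if i = length u then (if w = u @ v then 1 else 0) else 0)"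
    unfolding free_alg_simps word_def
  proof (intro sum.cong refl)
    fix i assume i: "i \<in> {..length w}"
    have "take i w = u \<and> drop i w = v \<longleftrightarrow> i = length u \<and> w = u @ v"
      using i by (metis append_eq_conv_conj append_take_drop_id atMost_iff length_take min.absorb2)
    then show "(if take i w = u then 1 else 0) * (if drop i w = v then 1 else 0) =
      (if i = length u then if w = u @ v then (1::'k) else 0 else 0)"
      by (cases "take i w = u"; cases "drop i w = v") simp_all
  qed
  then show "((word u :: letter list \<Rightarrow> 'k) \<otimes>\<^bsub>free_alg\<^esub> word v) w = word (u @ v) w"
    by (auto simp: word_def)
qed

lemma word_power: "word u [^]\<^bsub>free_alg\<^esub> m = (word (concat (replicate m u)) :: letter list \<Rightarrow> 'k::field)"
proof (induction m)
  case (Suc m)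
  have "concat (replicate m u) @ u = concat (replicate (Suc m) u)"
    by (induction m) auto
  then show ?case using Suc by (simp add: word_mult)
qed (simp add: free_alg_simps(3))

lemma gen_word: "gen_x = word [LX]" "gen_y = word [LY]"
  by (simp_all add: gen_x_def gen_y_def word_def)

lemma form_word_sum:
  fixes p :: "letter list \<Rightarrow> 'k::field"
  assumes \<phi>: "\<phi> \<in> linear_forms free_alg" and "finite A" "{w. p w \<noteq> 0} \<subseteq> A"
  shows "\<phi> p = (\<Sum>w\<in>A. p w * \<phi> (word w))"
  using assms(2,3)
proof (induction A arbitrary: p rule: finite_induct)
  case empty
  then have "p = \<zero>\<^bsub>free_alg\<^esub>" by (auto simp: free_alg_simps)
  then show ?case using FA.linear_formsD(3)[OF \<phi>] by simp
next
  case (insert v A)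
  define p' where "p' = p(v := 0)"
  have s: "{w. p' w \<noteq> 0} \<subseteq> A" using insert.prems by (auto simp: p'_def)
  then have p': "p' \<in> carrier free_alg" using insert.hyps(1) finite_subset by (auto simp: free_alg_simps)
  have "p = p' \<oplus>\<^bsub>free_alg\<^esub> p v \<odot>\<^bsub>free_alg\<^esub> word v" by (auto simp: free_alg_simps p'_def word_def)
  then have "\<phi> p = \<phi> p' + p v * \<phi> (word v)"
    using FA.linear_formsD[OF \<phi>] p' word_in FA.smult_closed by metis
  also have "\<phi> p' = (\<Sum>w\<in>A. p w * \<phi> (word w))"
    unfolding insert.IH[OF s] by (rule sum.cong) (use insert.hyps in \<open>auto simp: p'_def\<close>)
  finally show ?case using insert.hyps by simp
qed

text \<open>The linear extension of a function on words to the free algebra.\<close>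

definition pair :: "(letter list \<Rightarrow> 'k::field) \<Rightarrow> (letter list \<Rightarrow> 'k) \<Rightarrow> 'k" where
  "pair \<phi> p = (\<Sum>w | p w \<noteq> 0. p w * \<phi> w)"

lemma pair_sum: "finite A \<Longrightarrow> {w. p w \<noteq> 0} \<subseteq> A \<Longrightarrow> pair \<phi> p = (\<Sum>w\<in>A. p w * \<phi> w)"
  unfolding pair_def by (rule sum.mono_neutral_left) auto

lemma pair_form: "pair (\<phi> :: letter list \<Rightarrow> 'k::field) \<in> linear_forms free_alg"
proof (rule FA.linear_formsI)
  fix p r :: "letter list \<Rightarrow> 'k" assume "p \<in> carrier free_alg" "r \<in> carrier free_alg"
  then have A: "finite ({w. p w \<noteq> 0} \<union> {w. r w \<noteq> 0})" (is "finite ?A") by (simp add: free_alg_simps)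
  have "pair \<phi> (p \<oplus>\<^bsub>free_alg\<^esub> r) = (\<Sum>w\<in>?A. (p w + r w) * \<phi> w)"
    by (subst pair_sum[OF A]) (auto simp: free_alg_simps)
  then show "pair \<phi> (p \<oplus>\<^bsub>free_alg\<^esub> r) = pair \<phi> p + pair \<phi> r"
    using pair_sum[OF A, of p \<phi>] pair_sum[OF A, of r \<phi>] by (simp add: sum.distrib algebra_simps)
next
  fix c and p :: "letter list \<Rightarrow> 'k" assume "p \<in> carrier free_alg"
  then have A: "finite {w. p w \<noteq> 0}" by (simp add: free_alg_simps)
  have "pair \<phi> (c \<odot>\<^bsub>free_alg\<^esub> p) = (\<Sum>w | p w \<noteq> 0. (c * p w) * \<phi> w)"
    by (subst pair_sum[OF A]) (auto simp: free_alg_simps)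
  then show "pair \<phi> (c \<odot>\<^bsub>free_alg\<^esub> p) = c * pair \<phi> p"
    by (simp add: pair_def sum_distrib_left mult.assoc)
qed

lemma pair_word [simp]: "pair \<phi> (word w) = \<phi> w"
  using pair_sum[of "{w}" "word w" \<phi>] by (auto simp: word_def)

section \<open>Convolution of functions on words\<close>

definition cnv :: "('i \<Rightarrow> 'i \<Rightarrow> 'k::field) \<Rightarrow> ('i list \<Rightarrow> 'k) \<Rightarrow> ('i list \<Rightarrow> 'k) \<Rightarrow> 'i list \<Rightarrow> 'k" where
  "cnv q \<phi> \<psi> = dconv q (\<lambda>a b. \<phi> a * \<psi> b)"

definition unt :: "'i list \<Rightarrow> 'k::field" where
  "unt w = (if w = [] then 1 else 0)"

lemma unt_simps [simp]: "unt [] = 1" "unt (i # w) = 0"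
  by (simp_all add: unt_def)

lemma cnv_Nil: "cnv q \<phi> \<psi> [] = \<phi> [] * \<psi> []"
  by (simp add: cnv_def)

lemma cnv_Cons:
  "cnv q \<phi> \<psi> (i # w) = cnv q (\<lambda>a. chi q i a * \<phi> a) (\<lambda>b. \<psi> (i # b)) w + cnv q (\<lambda>a. \<phi> (i # a)) \<psi> w"
  by (simp add: cnv_def mult.assoc)

lemma dconv_cong:
  "(\<And>a b. length a + length b = length w \<Longrightarrow> \<beta> a b = \<gamma> a b) \<Longrightarrow> dconv q \<beta> w = dconv q \<gamma> w"
proof (induction w arbitrary: \<beta> \<gamma>)
  case (Cons i w)
  have "dconv q (\<lambda>a b. chi q i a * \<beta> a (i # b)) w = dconv q (\<lambda>a b. chi q i a * \<gamma> a (i # b)) w"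
    by (rule Cons.IH) (simp add: Cons.prems)
  moreover have "dconv q (\<lambda>a b. \<beta> (i # a) b) w = dconv q (\<lambda>a b. \<gamma> (i # a) b) w"
    by (rule Cons.IH) (simp add: Cons.prems)
  ultimately show ?case by simp
qed simp

lemma dconv_zero: "dconv q (\<lambda>a b. 0) w = 0"
  using dconv_scale[of q 0 "\<lambda>a b. 0" w] by simp

lemma cnv_lin:
  "cnv q (\<lambda>w. \<phi> w + \<phi>' w) \<psi> w = cnv q \<phi> \<psi> w + cnv q \<phi>' \<psi> w"
  "cnv q \<phi> (\<lambda>w. \<psi> w + \<psi>' w) w = cnv q \<phi> \<psi> w + cnv q \<phi> \<psi>' w"
  "cnv q (\<lambda>w. c * \<phi> w) \<psi> w = c * cnv q \<phi> \<psi> w"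
  "cnv q \<phi> (\<lambda>w. c * \<psi> w) w = c * cnv q \<phi> \<psi> w"
  "finite A \<Longrightarrow> cnv q (\<lambda>w. \<Sum>i\<in>A. \<Phi> i w) \<psi> w = (\<Sum>i\<in>A. cnv q (\<Phi> i) \<psi> w)"
  "finite A \<Longrightarrow> cnv q \<phi> (\<lambda>w. \<Sum>i\<in>A. \<Psi> i w) w = (\<Sum>i\<in>A. cnv q \<phi> (\<Psi> i) w)"
  by (simp_all add: cnv_def distrib_left distrib_right dconv_add sum_distrib_left sum_distrib_right dconv_sum
      mult.assoc mult.left_commute[of _ c] dconv_scale)

lemma cnv_zero: "cnv q (\<lambda>_. 0) \<psi> w = 0" "cnv q \<phi> (\<lambda>_. 0) w = 0"
  by (simp_all add: cnv_def dconv_zero)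

lemma dconv_chi: "dconv q (\<lambda>a b. chi q i a * chi q i b * \<beta> a b) w = chi q i w * dconv q \<beta> w"
proof (induction w arbitrary: \<beta>)
  case (Cons j w)
  have e: "(\<lambda>a b. chi q j a * (chi q i a * chi q i (j # b) * \<beta> a (j # b))) =
      (\<lambda>a b. q i j * (chi q i a * chi q i b * (chi q j a * \<beta> a (j # b))))"
    "(\<lambda>a b. chi q i (j # a) * chi q i b * \<beta> (j # a) b) =
      (\<lambda>a b. q i j * (chi q i a * chi q i b * \<beta> (j # a) b))"
    by (simp_all add: fun_eq_iff)
  show ?case
    unfolding dconv.simps e dconv_scale Cons by (simp add: algebra_simps)
qed simp

lemma chi_cnv: "chi q i w * cnv q \<phi> \<psi> w = cnv q (\<lambda>a. chi q i a * \<phi> a) (\<lambda>b. chi q i b * \<psi> b) w"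
  unfolding cnv_def dconv_chi[symmetric] by (simp add: algebra_simps)

text \<open>Recursion on the word; \<open>chi_cnv\<close> carries the scalar of the first letter
  into an inner convolution.\<close>

lemma cnv_assoc: "cnv q (cnv q \<phi> \<psi>) \<rho> w = cnv q \<phi> (cnv q \<psi> \<rho>) w"
proof (induction w arbitrary: \<phi> \<psi> \<rho>)
  case (Cons i w)
  have e: "(\<lambda>a. chi q i a * cnv q \<phi> \<psi> a) = cnv q (\<lambda>a. chi q i a * \<phi> a) (\<lambda>b. chi q i b * \<psi> b)" for \<phi> \<psi>
    by (rule ext, rule chi_cnv)
  have c: "(\<lambda>a. cnv q \<phi> \<psi> (i # a)) =
    (\<lambda>a. cnv q (\<lambda>a. chi q i a * \<phi> a) (\<lambda>b. \<psi> (i # b)) a + cnv q (\<lambda>a. \<phi> (i # a)) \<psi> a)" for \<phi> \<psi>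
    by (rule ext, rule cnv_Cons)
  show ?case by (simp add: cnv_Cons[of q _ _ i w] e c cnv_lin Cons)
qed (simp add: cnv_Nil)

lemma cnv_unt: "cnv q unt \<phi> w = \<phi> w" "cnv q \<phi> unt w = \<phi> w"
proof -
  show "cnv q unt \<phi> w = \<phi> w"
  proof (induction w arbitrary: \<phi>)
    case (Cons i w)
    have "(\<lambda>a. chi q i a * unt a) = unt" by (auto simp: unt_def)
    then show ?case by (simp add: cnv_Cons Cons cnv_zero)
  qed (simp add: cnv_Nil unt_def)
  show "cnv q \<phi> unt w = \<phi> w"
  proof (induction w arbitrary: \<phi>)
    case (Cons i w)
    show ?case by (simp add: cnv_Cons Cons cnv_zero)
  qed (simp add: cnv_Nil unt_def)
qed

lemma cnv_cong_degree:
  assumes "\<And>a. length a < m \<Longrightarrow> \<phi> a = 0" "\<And>a. length a < m \<Longrightarrow> \<phi>' a = 0" "\<And>a. length a = m \<Longrightarrow> \<phi> a = \<phi>' a"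
    "\<And>a. length a < n \<Longrightarrow> \<psi> a = 0" "\<And>a. length a < n \<Longrightarrow> \<psi>' a = 0" "\<And>a. length a = n \<Longrightarrow> \<psi> a = \<psi>' a"
    "length w \<le> m + n"
  shows "cnv q \<phi> \<psi> w = cnv q \<phi>' \<psi>' w"
  unfolding cnv_def
proof (rule dconv_cong)
  fix a b :: "'a list" assume "length a + length b = length w"
  then consider "length a < m" | "length b < n" | "length a = m" "length b = n" using assms(7) by linarith
  then show "\<phi> a * \<psi> b = \<phi>' a * \<psi>' b" by cases (use assms in auto)
qed

lemma cnv_degree:
  assumes "\<And>a. length a < m \<Longrightarrow> \<phi> a = 0" "\<And>a. length a < n \<Longrightarrow> \<psi> a = 0" "length w < m + n"
  shows "cnv q \<phi> \<psi> w = 0"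
proof -
  have "cnv q \<phi> \<psi> w = dconv q (\<lambda>a b. 0) w" unfolding cnv_def
  proof (rule dconv_cong)
    fix a b :: "'a list" assume "length a + length b = length w"
    then have "length a < m \<or> length b < n" using assms(3) by linarith
    then show "\<phi> a * \<psi> b = 0" using assms by auto
  qed
  then show ?thesis by (simp add: dconv_zero)
qed

text \<open>The image of the word p under the algebra map that sends each letter l to the functional
  \<open>\<Theta> l\<close>.\<close>

primrec cw :: "('i \<Rightarrow> 'i \<Rightarrow> 'k::field) \<Rightarrow> ('j \<Rightarrow> 'i list \<Rightarrow> 'k) \<Rightarrow> 'j list \<Rightarrow> 'i list \<Rightarrow> 'k" where
  "cw q \<Theta> [] = unt"
| "cw q \<Theta> (l # p) = cnv q (\<Theta> l) (cw q \<Theta> p)"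

lemma cw_append: "cw q \<Theta> (p @ p') w = cnv q (cw q \<Theta> p) (cw q \<Theta> p') w"
proof (induction p arbitrary: w)
  case (Cons l p)
  have "cw q \<Theta> (p @ p') = cnv q (cw q \<Theta> p) (cw q \<Theta> p')" by (rule ext, rule Cons)
  then show ?case by (simp add: cnv_assoc)
qed (simp add: cnv_unt)

lemma cw_degree:
  assumes "\<And>l. \<Theta> l [] = 0"
  shows "length w < length p \<Longrightarrow> cw q \<Theta> p w = 0"
proof (induction p arbitrary: w)
  case (Cons l p)
  show ?case unfolding cw.simps
    by (rule cnv_degree[of 1 _ "length p"]) (use Cons assms in auto)
qed simp

text \<open>On words no longer than the product itself, each factor is only seen on single letters,
  so terms of higher degree in the factors do not show.\<close>

lemma cw_cong_degree:
  assumes "\<And>l. \<Theta> l [] = 0" "\<And>l. \<Theta>' l [] = 0" "\<And>l i. \<Theta> l [i] = \<Theta>' l [i]"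
  shows "length w \<le> length p \<Longrightarrow> cw q \<Theta> p w = cw q \<Theta>' p w"
proof (induction p arbitrary: w)
  case (Cons l p)
  show ?case unfolding cw.simps
    by (rule cnv_cong_degree[of 1 _ _ "length p"])
      (use Cons assms cw_degree[of \<Theta>] cw_degree[of \<Theta>'] in \<open>auto simp: length_Suc_conv\<close>)
qed simp

lemma finite_words: "finite {p :: 'j::finite list. length p = n}"
  using finite_lists_length_eq[of "UNIV :: 'j set" n] by simp

text \<open>A linear substitution keeps the length of products, so vanishing of all products of a
  given length carries over.\<close>

lemma cw_comb:
  fixes \<Theta> \<Theta>' :: "'j::finite \<Rightarrow> 'i list \<Rightarrow> 'k::field"
  assumes "\<And>l w. \<Theta>' l w = (\<Sum>l'\<in>UNIV. A l l' * \<Theta> l' w)"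
  shows "\<exists>B. \<forall>w. cw q \<Theta>' p w = (\<Sum>p' | length p' = length p. B p' * cw q \<Theta> p' w)"
proof (induction p)
  case Nil
  have "{p' :: 'j list. length p' = length []} = {[]}" by auto
  then show ?case by (intro exI[of _ "\<lambda>_. 1"]) simp
next
  case (Cons l p)
  then obtain B where B: "\<And>w. cw q \<Theta>' p w = (\<Sum>p' | length p' = length p. B p' * cw q \<Theta> p' w)" by blast
  let ?W = "{p' :: 'j list. length p' = length p}"
  define B' where "B' p' = A l (hd p') * B (tl p')" for p'
  have "cw q \<Theta>' (l # p) w = (\<Sum>p' | length p' = length (l # p). B' p' * cw q \<Theta> p' w)" for w
  proof -
    have t: "\<Theta>' l = (\<lambda>w. \<Sum>l'\<in>UNIV. A l l' * \<Theta> l' w)" "cw q \<Theta>' p = (\<lambda>w. \<Sum>p'\<in>?W. B p' * cw q \<Theta> p' w)"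
      using assms B by auto
    have "cw q \<Theta>' (l # p) w = (\<Sum>l'\<in>UNIV. \<Sum>p'\<in>?W. A l l' * (B p' * cnv q (\<Theta> l') (cw q \<Theta> p') w))"
      unfolding cw.simps t by (simp add: cnv_lin finite_words sum_distrib_left)
    also have "\<dots> = (\<Sum>(l', p')\<in>UNIV \<times> ?W. B' (l' # p') * cw q \<Theta> (l' # p') w)"
      by (simp add: sum.cartesian_product B'_def mult.assoc)
    also have "\<dots> = (\<Sum>p' | length p' = length (l # p). B' p' * cw q \<Theta> p' w)"
      by (rule sum.reindex_bij_witness[where i = "\<lambda>p'. (hd p', tl p')" and j = "\<lambda>(l', p'). l' # p'"])
        (auto simp: length_Suc_conv)
    finally show ?thesis .
  qed
  then show ?case by blast
qed

text \<open>Left convolution with the coordinate of l is a skew derivation: it deletes one letter l,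
  with a factor q(j,l) for each letter j in front of it.\<close>

lemma cnv_letter:
  "cnv q (\<lambda>w. if w = [l] then 1 else 0) \<phi> [] = 0"
  "cnv q (\<lambda>w. if w = [l] then 1 else 0) \<phi> (j # w) =
     q j l * cnv q (\<lambda>w. if w = [l] then 1 else 0) (\<lambda>b. \<phi> (j # b)) w + (if j = l then \<phi> w else 0)"
proof -
  have 1: "(\<lambda>a. chi q j a * (if a = [l] then 1 else 0)) = (\<lambda>a. q j l * (if a = [l] then 1 else 0))" by auto
  have 2: "(\<lambda>a. if j # a = [l] then 1 else 0) = (\<lambda>a. (if j = l then 1 else 0) * unt a)" by (auto simp: unt_def)
  show "cnv q (\<lambda>w. if w = [l] then 1 else 0) \<phi> (j # w) =
     q j l * cnv q (\<lambda>w. if w = [l] then 1 else 0) (\<lambda>b. \<phi> (j # b)) w + (if j = l then \<phi> w else 0)"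
    unfolding cnv_Cons 1 2 cnv_lin by (simp add: cnv_unt)
qed (simp add: cnv_Nil)

section \<open>Alternating words\<close>

fun flip :: "letter \<Rightarrow> letter" where
  "flip LX = LY" | "flip LY = LX"

lemma flip_simps [simp]: "flip (flip i) = i" "flip i \<noteq> i" "i \<noteq> flip i" "flip i = flip j \<longleftrightarrow> i = j"
  by (cases i; cases j; simp)+

lemma neq_flip: "i \<noteq> j \<Longrightarrow> j = flip i"
  by (cases i; cases j) auto

primrec alt :: "letter \<Rightarrow> nat \<Rightarrow> letter list" where
  "alt i 0 = []"
| "alt i (Suc n) = i # alt (flip i) n"

lemma length_alt [simp]: "length (alt i n) = n"
  by (induction n arbitrary: i) auto

lemma alt_add: "alt i (m + n) = alt i m @ alt (if even m then i else flip i) n"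
  by (induction m arbitrary: i) auto

lemma alt_or_repeat: "w = alt i (length w) \<or> w = alt (flip i) (length w) \<or> (\<exists>a j b. w = a @ [j, j] @ b)"
proof (induction w arbitrary: i)
  case (Cons j w)
  from Cons[of j] consider "w = alt j (length w)" | "w = alt (flip j) (length w)" | "\<exists>a j b. w = a @ [j, j] @ b" by auto
  then show ?case
  proof cases
    case 1
    then show ?thesis
    proof (cases w)
      case Nil then show ?thesis using neq_flip[of i j] by auto
    next
      case (Cons k w')
      with 1 have "j # w = [] @ [j, j] @ w'" by simp
      then show ?thesis by blast
    qed
  next
    case 2
    then have "j # w = alt j (length (j # w))" by simp
    then show ?thesis using neq_flip[of i j] by metis
  next
    case 3
    then obtain a k b where "j # w = (j # a) @ [k, k] @ b" by auto
    then show ?thesis by blast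
  qed
qed simp

text \<open>The scalar for moving the letter l to the front past \<open>alt i n\<close>.\<close>

primrec alt_chi :: "(letter \<Rightarrow> letter \<Rightarrow> 'k::field) \<Rightarrow> letter \<Rightarrow> letter \<Rightarrow> nat \<Rightarrow> 'k" where
  "alt_chi q l i 0 = 1"
| "alt_chi q l i (Suc n) = q i l * alt_chi q l (flip i) n"

text \<open>The last letter of \<open>alt i (Suc n)\<close>; the index counts from 0.\<close>

definition alt_last :: "letter \<Rightarrow> nat \<Rightarrow> letter" where
  "alt_last i n = (if even n then i else flip i)"

abbreviation ind :: "'i \<Rightarrow> 'i list \<Rightarrow> 'k::field" where
  "ind l \<equiv> \<lambda>w. if w = [l] then 1 else 0"

text \<open>Convolving with \<open>ind l\<close> deletes one letter \<open>l\<close>; inside an alternating word this creates a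
  repetition, so that only the first and the last letter matter.\<close>

lemma cnv_ind_alt:
  assumes "\<And>a j b. \<phi> (a @ [j, j] @ b) = 0"
  shows "cnv q (ind l) \<phi> (alt i (Suc n)) = (if l = i then \<phi> (alt (flip i) n) else 0) +
    (if n \<ge> 1 \<and> l = alt_last i n then alt_chi q l i n * \<phi> (alt i n) else 0)"
  using assms
proof (induction n arbitrary: i \<phi>)
  case 0
  then show ?case by (simp add: cnv_letter)
next
  case (Suc n)
  \<comment> \<open>Deleting the second letter leaves two copies of i side by side, unless the word
    ends there.\<close>
  have r: "\<phi> (i # alt i n) = (if n = 0 then \<phi> [i] else 0)"
    using Suc.prems[of "[]" i "alt (flip i) (n - 1)"] by (cases n) auto
  have l: "alt_last i (Suc n) = alt_last (flip i) n" by (simp add: alt_last_def)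
  have "cnv q (ind l) \<phi> (alt i (Suc (Suc n))) =
    q i l * cnv q (ind l) (\<lambda>b. \<phi> (i # b)) (alt (flip i) (Suc n)) + (if i = l then \<phi> (alt (flip i) (Suc n)) else 0)"
    by (simp only: alt.simps(2)[of i "Suc n"] cnv_letter)
  also have "cnv q (ind l) (\<lambda>b. \<phi> (i # b)) (alt (flip i) (Suc n)) =
    (if l = flip i then \<phi> (i # alt i n) else 0) +
    (if n \<ge> 1 \<and> l = alt_last (flip i) n then alt_chi q l (flip i) n * \<phi> (i # alt (flip i) n) else 0)"
  proof -
    have "\<phi> (i # (a @ [j, j] @ b)) = 0" for a j b using Suc.prems[of "i # a" j b] by simp
    from Suc.IH[of "\<lambda>b. \<phi> (i # b)" "flip i", OF this] show ?thesis by simp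
  qed
  finally show ?case unfolding r l by (cases n) (auto simp: alt_last_def)
qed

lemma alt_chi_even: "alt_chi q i i (2 * k) = (q i i * q (flip i) i) ^ k"
  by (induction k) (auto simp: algebra_simps)

lemma alt_chi_odd: "alt_chi q (flip i) i (Suc (2 * k)) = q i (flip i) * (q (flip i) (flip i) * q i (flip i)) ^ k"
proof -
  have "alt_chi q (flip i) i (Suc (2 * k)) = q i (flip i) * alt_chi q (flip i) (flip i) (2 * k)" by simp
  then show ?thesis by (simp only: alt_chi_even flip_simps)
qed

lemma pair_lin:
  "finite A \<Longrightarrow> pair (\<lambda>w. \<Sum>i\<in>A. b i * \<Phi> i w) p = (\<Sum>i\<in>A. b i * pair (\<Phi> i) p)"
  "pair (\<lambda>w. \<phi> w + \<psi> w) p = pair \<phi> p + pair \<psi> p"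
  "pair (\<lambda>w. \<phi> w - \<psi> w) p = pair \<phi> p - pair \<psi> p"
  by (simp_all add: pair_def sum_distrib_left sum.distrib sum_subtractf algebra_simps sum.swap[of _ A])

section \<open>Braided Hopf algebras of rank two\<close>

text \<open>\<open>\<theta> p w\<close> is the class of the word p modulo I, paired with the word w
  in the generators of R. Of I only nilpotency and short relations are retained: the first
  alternative of \<open>\<theta>_rel\<close> stems from \<open>ideal2\<close> and
  \<open>ideal4\<close>, the second from \<open>ideal1\<close>, the third from
  \<open>ideal3\<close>.\<close>

locale tame_core = matrix_hopf H c z q
  for H :: "('k::field, 'h) coalg" (structure) and c :: "letter \<Rightarrow> letter \<Rightarrow> nat \<Rightarrow> 'h set"
    and z :: "letter \<Rightarrow> nat \<Rightarrow> 'h set" and q :: "letter \<Rightarrow> letter \<Rightarrow> 'k" +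
  fixes \<theta> :: "letter list \<Rightarrow> letter list \<Rightarrow> 'k" and N :: nat
  assumes \<theta>_unit: "\<theta> [] w = unt w"
    and \<theta>_mult: "\<theta> (p @ p') w = cnv q (\<theta> p) (\<theta> p') w"
    and \<theta>_zero: "N \<le> length p \<Longrightarrow> \<theta> p w = 0"
    and \<theta>_desc: "\<exists>\<phi>\<in>linear_forms (braided_R H). \<forall>w. \<theta> p w = \<phi> (U w)"
    and \<theta>_sep: "r \<in> carrier free_alg \<Longrightarrow> (\<And>p. pair (\<theta> p) r = 0) \<Longrightarrow> ev r = \<zero>\<^bsub>gr H\<^esub>"
    and \<theta>_rel: "(\<forall>w. \<theta> [LX, LX] w = 0 \<and> \<theta> [LY, LY] w = 0) \<or>
      (\<forall>w. \<theta> [LX, LY] w = 0 \<and> \<theta> [LX, LX] w = \<theta> [LY, LY] w) \<or>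
      (\<forall>w. \<theta> [LX, LY] w = 0 \<and> \<theta> [LY, LX] w = 0) \<and> (\<exists>n\<ge>1. \<forall>w. \<theta> (replicate n LX) w = \<theta> (replicate n LY) w)"
begin

section \<open>Functionals on words that factor through R, and the normalisation of the given
  ones\<close>

definition descends :: "(letter list \<Rightarrow> 'k) \<Rightarrow> bool" where
  "descends \<phi> \<longleftrightarrow> (\<exists>\<phi>'\<in>linear_forms (braided_R H). \<forall>w. \<phi> w = \<phi>' (U w))"

lemma descends_U: "descends \<phi> \<Longrightarrow> U w = \<zero>\<^bsub>gr H\<^esub> \<Longrightarrow> \<phi> w = 0"
  using R.linear_formsD(3) by (auto simp: descends_def R_simps)

lemma descends_cnv: "descends \<phi> \<Longrightarrow> descends \<psi> \<Longrightarrow> descends (cnv q \<phi> \<psi>)"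
proof -
  assume "descends \<phi>" "descends \<psi>"
  then obtain \<phi>' \<psi>' where 1: "\<phi>' \<in> linear_forms (braided_R H)" "\<And>w. \<phi> w = \<phi>' (U w)"
    "\<psi>' \<in> linear_forms (braided_R H)" "\<And>w. \<psi> w = \<psi>' (U w)" by (auto simp: descends_def)
  have b: "(\<lambda>a b. \<phi>' a * \<psi>' b) \<in> bilinear_forms (braided_R H) (braided_R H)"
    by (rule bilinear_form_prod[OF vs_R vs_R 1(1,3)])
  show ?thesis unfolding descends_def
    by (rule bexI[OF _ comult_R_form[OF b]]) (simp add: comult_R_word[OF b] cnv_def 1)
qed

lemma descends_lin:
  "descends \<phi> \<Longrightarrow> descends \<psi> \<Longrightarrow> descends (\<lambda>w. \<phi> w - \<psi> w)"
  "(\<And>i. i \<in> A \<Longrightarrow> descends (\<Phi> i)) \<Longrightarrow> descends (\<lambda>w. \<Sum>i\<in>A. b i * \<Phi> i w)"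
proof -
  assume "descends \<phi>" "descends \<psi>"
  then obtain \<phi>' \<psi>' where 1: "\<phi>' \<in> linear_forms (braided_R H)" "\<And>w. \<phi> w = \<phi>' (U w)"
    "\<psi>' \<in> linear_forms (braided_R H)" "\<And>w. \<psi> w = \<psi>' (U w)" by (auto simp: descends_def)
  show "descends (\<lambda>w. \<phi> w - \<psi> w)" unfolding descends_def
    by (rule bexI[OF _ R.linear_form_diff[OF 1(1,3)]]) (simp add: 1)
next
  assume "\<And>i. i \<in> A \<Longrightarrow> descends (\<Phi> i)"
  then have "\<exists>\<phi>'. i \<in> A \<longrightarrow> \<phi>' \<in> linear_forms (braided_R H) \<and> (\<forall>w. \<Phi> i w = \<phi>' (U w))" for i
    unfolding descends_def by blast
  then obtain \<phi>' where 1: "\<And>i. i \<in> A \<Longrightarrow> \<phi>' i \<in> linear_forms (braided_R H) \<and> (\<forall>w. \<Phi> i w = \<phi>' i (U w))" by metis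
  then have "(\<lambda>x. \<Sum>i\<in>A. b i * \<phi>' i x) \<in> linear_forms (braided_R H)"
    by (intro R.linear_form_sum R.linear_form_scale) blast
  then show "descends (\<lambda>w. \<Sum>i\<in>A. b i * \<Phi> i w)" unfolding descends_def
    by (rule bexI[rotated]) (simp add: 1)
qed

lemma descends_unt: "descends unt"
  unfolding descends_def by (rule bexI[OF _ counit_R_form]) (simp add: counit_U unt_def)

lemma descends_cw: "(\<And>l. descends (\<Theta> l)) \<Longrightarrow> descends (cw q \<Theta> p)"
  by (induction p) (auto intro: descends_unt descends_cnv)

lemma ev_word: "ev (word w) = U w"
  by (rule G.forms_separate) (auto simp: ws_in[OF ev_ws] U_in form_ev_gr[of _ "{w}"] word_def)

lemma \<theta>_cons: "\<theta> (l # p) w = cnv q (\<theta> [l]) (\<theta> p) w"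
  using \<theta>_mult[of "[l]" p w] by simp

lemma \<theta>_cw: "\<theta> p = cw q (\<lambda>l. \<theta> [l]) p"
proof (induction p)
  case (Cons l p)
  show ?case unfolding cw.simps Cons[symmetric] by (rule ext) (rule \<theta>_cons)
qed (auto simp: \<theta>_unit)

text \<open>The map taking p to \<open>\<theta> p []\<close> is multiplicative, so its values at x
  and y are scalars that satisfy the relations. Each of the three systems of relations has only the
  zero solution in the field.\<close>

lemma \<theta>_letter_Nil: "\<theta> [l] [] = 0"
proof -
  have m: "\<theta> [l, l'] [] = \<theta> [l] [] * \<theta> [l'] []" for l l' using \<theta>_cons[of l "[l']" "[]"] by (simp add: cnv_Nil)
  have r: "\<theta> (replicate n l) [] = \<theta> [l] [] ^ n" for n l
  proof (induction n)
    case (Suc n) then show ?case using \<theta>_cons[of l "replicate n l" "[]"] by (simp add: cnv_Nil)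
  qed (simp add: \<theta>_unit unt_def)
  have "\<theta> [LX] [] = 0 \<and> \<theta> [LY] [] = 0"
    using \<theta>_rel
  proof (elim disjE conjE exE)
    fix n assume "n \<ge> 1" "\<forall>w. \<theta> (replicate n LX) w = \<theta> (replicate n LY) w" "\<forall>w. \<theta> [LX, LY] w = 0 \<and> \<theta> [LY, LX] w = 0"
    then have "\<theta> [LX] [] ^ n = \<theta> [LY] [] ^ n" "\<theta> [LX] [] * \<theta> [LY] [] = 0" by (metis r, metis m)
    then show ?thesis using \<open>n \<ge> 1\<close> by (auto simp: power_0_left)
  next
    assume "\<forall>w. \<theta> [LX, LY] w = 0 \<and> \<theta> [LX, LX] w = \<theta> [LY, LY] w"
    then have "\<theta> [LX] [] * \<theta> [LY] [] = 0" "\<theta> [LX] [] * \<theta> [LX] [] = \<theta> [LY] [] * \<theta> [LY] []" by (metis m, metis m)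
    then show ?thesis by auto
  next
    assume "\<forall>w. \<theta> [LX, LX] w = 0 \<and> \<theta> [LY, LY] w = 0"
    then have "\<theta> [LX] [] * \<theta> [LX] [] = 0" "\<theta> [LY] [] * \<theta> [LY] [] = 0" by (metis m, metis m)
    then show ?thesis by auto
  qed
  then show ?thesis by (cases l) auto
qed

abbreviation M :: "letter \<Rightarrow> letter \<Rightarrow> 'k" where "M l i \<equiv> \<theta> [l] [i]"

text \<open>A vector (a, b) in the kernel of M makes a x + b y vanish under all \<theta>, since
  products of two or more factors vanish on single letters. By separation this is a linear relation
  between the generators, which are independent.\<close>

lemma null_vector:
  assumes "M LX LX * a + M LX LY * b = 0" "M LY LX * a + M LY LY * b = 0"
  shows "a = 0 \<and> b = 0"
proof -
  define r :: "letter list \<Rightarrow> 'k" where "r = a \<odot>\<^bsub>free_alg\<^esub> word [LX] \<oplus>\<^bsub>free_alg\<^esub> b \<odot>\<^bsub>free_alg\<^esub> word [LY]"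
  have r: "r \<in> carrier free_alg" unfolding r_def by (intro FA.a_closed FA.smult_closed word_in)
  have pr: "pair \<phi> r = a * \<phi> [LX] + b * \<phi> [LY]" for \<phi>
    unfolding r_def by (simp add: word_in FA.linear_formsD[OF pair_form])
  have "pair (\<theta> p) r = 0" for p
  proof (cases "length p \<le> 1")
    case True
    then consider "p = []" | l where "p = [l]" by (cases p) auto
    then show ?thesis
    proof cases
      case 1 then show ?thesis by (simp add: pr \<theta>_unit)
    next
      case (2 l) then show ?thesis using assms by (cases l) (simp_all add: pr mult.commute)
    qed
  next
    case False
    then have "\<theta> p [i] = 0" for i
      by (subst \<theta>_cw, intro cw_degree \<theta>_letter_Nil) simp
    then show ?thesis by (simp add: pr)
  qed
  then have "ev r = \<zero>\<^bsub>gr H\<^esub>" using \<theta>_sep[OF r] by blast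
  moreover have "\<phi> (ev r) = a * \<phi> (z LX) + b * \<phi> (z LY)" if "\<phi> \<in> linear_forms (gr H)" for \<phi>
  proof -
    have "\<phi> (ev r) = (\<Sum>w\<in>{[LX], [LY]}. r w * \<phi> (U w))"
      by (rule form_ev_gr[OF that]) (auto simp: r_def free_alg_simps word_def split: if_splits)
    then show ?thesis by (simp add: r_def free_alg_simps word_def z_in)
  qed
  ultimately have "(\<Sum>k\<in>UNIV. (case k of LX \<Rightarrow> a | LY \<Rightarrow> b) * \<phi> (z k)) = 0" if "\<phi> \<in> linear_forms (gr H)" for \<phi>
    using that G.linear_formsD(3)[OF that] by (simp add: UNIV_letter)
  from z_independent[OF this, of LX] z_independent[OF this, of LY] show ?thesis by simp
qed

definition dt :: 'k where "dt = M LX LX * M LY LY - M LX LY * M LY LX"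

lemma dt: "dt \<noteq> 0"
proof
  assume d: "dt = 0"
  \<comment> \<open>If the determinant is zero, the adjugate provides these kernel vectors; they
    force M = 0, and then (1, 0) is in the kernel as well.\<close>
  have "M LX LY = 0 \<and> - M LX LX = 0" by (rule null_vector) (use d in \<open>simp_all add: dt_def algebra_simps\<close>)
  moreover have "M LY LY = 0 \<and> - M LY LX = 0" by (rule null_vector) (use d in \<open>simp_all add: dt_def algebra_simps\<close>)
  ultimately have "(1::'k) = 0 \<and> (0::'k) = 0" by (intro null_vector) auto
  then show False by simp
qed

lemma cnv_two:
  assumes "\<phi> [] = 0" "\<psi> [] = 0"
  shows "cnv q \<phi> \<psi> [i, j] = q i j * \<phi> [j] * \<psi> [i] + \<phi> [i] * \<psi> [j]"
  using assms by (simp add: cnv_Cons cnv_Nil)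

lemma \<theta>_two: "\<theta> [l, l'] [i, j] = q i j * M l j * M l' i + M l i * M l' j"
  using \<theta>_cons[of l "[l']" "[i, j]"] by (simp add: cnv_two \<theta>_letter_Nil)

text \<open>At the word [i, i] a product of two functionals has the value (q(i,i) + 1) M(l,i)
  M(l',i). If q(i,i) + 1 were nonzero, the quadratic relations would annihilate column i of M, or
  for xy = yx = 0 one entry of it; in the latter case the value at the word [i, j] with j the other
  letter makes the determinant vanish.\<close>

lemma q_diag: "q i i = - 1"
proof (rule ccontr)
  assume "q i i \<noteq> - 1"
  then have q1: "q i i + 1 \<noteq> 0" by (simp add: eq_neg_iff_add_eq_0)
  have sq: "M l i * M l' i = 0" if "\<theta> [l, l'] [i, i] = 0" for l l'
  proof -
    have "(q i i + 1) * (M l i * M l' i) = 0" using that by (simp add: \<theta>_two algebra_simps)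
    then show ?thesis using q1 by simp
  qed
  let ?j = "flip i"
  have d: "M LX i * M LY ?j - M LX ?j * M LY i \<noteq> 0"
    using dt by (cases i) (simp_all add: dt_def algebra_simps)
  show False
    using \<theta>_rel
  proof (elim disjE conjE exE)
    assume "\<forall>w. \<theta> [LX, LX] w = 0 \<and> \<theta> [LY, LY] w = 0"
    then have "M LX i = 0" "M LY i = 0" using sq[of LX LX] sq[of LY LY] by auto
    then show False using d by simp
  next
    assume h: "\<forall>w. \<theta> [LX, LY] w = 0 \<and> \<theta> [LX, LX] w = \<theta> [LY, LY] w"
    then have "\<theta> [LX, LX] [i, i] = \<theta> [LY, LY] [i, i]" by blast
    then have "(q i i + 1) * (M LX i * M LX i) = (q i i + 1) * (M LY i * M LY i)" by (simp add: \<theta>_two algebra_simps)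
    then have "M LX i * M LX i = M LY i * M LY i" "M LX i * M LY i = 0" using q1 sq[of LX LY] h by auto
    then have "M LX i = 0" "M LY i = 0" by auto
    then show False using d by simp
  next
    assume h: "\<forall>w. \<theta> [LX, LY] w = 0 \<and> \<theta> [LY, LX] w = 0"
    then have "M LX i = 0 \<or> M LY i = 0" using sq[of LX LY] by simp
    then show False
    proof
      assume 0: "M LX i = 0"
      have "\<theta> [LY, LX] [i, ?j] = 0" using h by blast
      then show False using d 0 by (simp add: \<theta>_two)
    next
      assume 0: "M LY i = 0"
      have "\<theta> [LX, LY] [i, ?j] = 0" using h by blast
      then show False using d 0 by (simp add: \<theta>_two)
    qed
  qed
qed

text \<open>The inverse of M, as adjugate over determinant.\<close>

definition Ainv :: "letter \<Rightarrow> letter \<Rightarrow> 'k" where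
  "Ainv l l' = (if l = l' then M (flip l) (flip l) else - M l l') / dt"

text \<open>The functionals in new coordinates, chosen so that \<open>\<tau> l\<close> agrees with
  the coordinate of l on single letters.\<close>

definition \<tau> :: "letter \<Rightarrow> letter list \<Rightarrow> 'k" where
  "\<tau> l w = (\<Sum>l'\<in>UNIV. Ainv l l' * \<theta> [l'] w)"

definition T :: "letter list \<Rightarrow> letter list \<Rightarrow> 'k" where "T = cw q \<tau>"

lemma \<tau>_Nil: "\<tau> l [] = 0" by (simp add: \<tau>_def \<theta>_letter_Nil)

lemma \<tau>_letter: "\<tau> l [i] = (if l = i then 1 else 0)"
proof -
  have "\<tau> l [i] = (if l = i then dt else 0) / dt"
    by (cases l; cases i) (simp_all add: \<tau>_def UNIV_letter Ainv_def dt_def algebra_simps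
        flip: add_divide_distrib diff_divide_distrib)
  then show ?thesis using dt by simp
qed

lemma \<theta>_\<tau>: "\<theta> [l] w = (\<Sum>i\<in>UNIV. M l i * \<tau> i w)"
proof -
  have "(\<Sum>i\<in>UNIV. M l i * \<tau> i w) = (M l LX * (M LY LY * \<theta> [LX] w - M LX LY * \<theta> [LY] w) +
      M l LY * (M LX LX * \<theta> [LY] w - M LY LX * \<theta> [LX] w)) / dt"
    by (simp add: \<tau>_def UNIV_letter Ainv_def add_divide_distrib diff_divide_distrib algebra_simps)
  also have "\<dots> = dt * \<theta> [l] w / dt"
    by (cases l) (simp_all add: dt_def algebra_simps)
  finally show ?thesis using dt by simp
qed

lemma T_append: "T (p @ p') w = cnv q (T p) (T p') w"
  by (simp add: T_def cw_append)

lemma T_letter: "T [l] = \<tau> l"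
  by (rule ext) (simp add: T_def cnv_unt)

lemma T_zero: "N \<le> length p \<Longrightarrow> T p w = 0"
proof -
  assume n: "N \<le> length p"
  obtain B where "\<And>w. T p w = (\<Sum>p' | length p' = length p. B p' * cw q (\<lambda>l. \<theta> [l]) p' w)"
    using cw_comb[of \<tau> Ainv "\<lambda>l. \<theta> [l]" q p] by (auto simp: T_def \<tau>_def)
  then show ?thesis using n by (simp add: \<theta>_zero flip: \<theta>_cw)
qed

lemma \<tau>_desc: "descends (\<tau> l)"
  unfolding \<tau>_def using \<theta>_desc by (intro descends_lin) (auto simp: descends_def)

lemma T_desc: "descends (T p)"
  unfolding T_def by (rule descends_cw[OF \<tau>_desc])

lemma T_sep: "r \<in> carrier free_alg \<Longrightarrow> (\<And>p. pair (T p) r = 0) \<Longrightarrow> ev r = \<zero>\<^bsub>gr H\<^esub>"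
proof (rule \<theta>_sep)
  fix p assume r: "r \<in> carrier free_alg" "\<And>p. pair (T p) r = 0"
  obtain B where "\<And>w. cw q (\<lambda>l. \<theta> [l]) p w = (\<Sum>p' | length p' = length p. B p' * T p' w)"
    using cw_comb[of "\<lambda>l. \<theta> [l]" M \<tau> q p, OF \<theta>_\<tau>] by (auto simp: T_def)
  then have "\<theta> p = (\<lambda>w. \<Sum>p' | length p' = length p. B p' * T p' w)" using \<theta>_cw[of p] by auto
  then show "pair (\<theta> p) r = 0" by (simp add: pair_lin(1)[OF finite_words] r(2))
qed

lemma T_degree: "length w < length p \<Longrightarrow> T p w = 0"
  unfolding T_def by (rule cw_degree) (simp_all add: \<tau>_Nil)

text \<open>r with its parts of degree 0 and 1 corrected so that the products of at most one factor
  vanish on it too, when a is the constant coefficient of r; its parts of degree at least 2 are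
  untouched.\<close>

definition low :: "(letter list \<Rightarrow> 'k) \<Rightarrow> 'k \<Rightarrow> letter list \<Rightarrow> 'k" where
  "low r a = ((r \<oplus>\<^bsub>free_alg\<^esub> (- a) \<odot>\<^bsub>free_alg\<^esub> word []) \<oplus>\<^bsub>free_alg\<^esub>
     (- pair (\<tau> LX) r) \<odot>\<^bsub>free_alg\<^esub> word [LX]) \<oplus>\<^bsub>free_alg\<^esub> (- pair (\<tau> LY) r) \<odot>\<^bsub>free_alg\<^esub> word [LY]"

text \<open>Products of two or more factors vanish on words of length at most 1, so they do not
  notice the correction; the unit and the \<open>\<tau> l\<close> vanish by the choice of the
  subtracted terms.\<close>

lemma low:
  assumes r: "r \<in> carrier free_alg" and hi: "\<And>p. 2 \<le> length p \<Longrightarrow> p \<noteq> [] \<Longrightarrow> pair (T p) r = 0"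
  shows "low r (r []) \<in> carrier free_alg" "ev (low r (r [])) = \<zero>\<^bsub>gr H\<^esub>"
proof -
  show c: "low r (r []) \<in> carrier free_alg"
    unfolding low_def by (intro FA.a_closed FA.smult_closed word_in r)
  have pl: "pair \<phi> (low r (r [])) = pair \<phi> r - r [] * \<phi> [] - pair (\<tau> LX) r * \<phi> [LX] - pair (\<tau> LY) r * \<phi> [LY]" for \<phi>
    unfolding low_def using r by (simp add: word_in FA.linear_formsD[OF pair_form])
  have "pair unt r = r []"
  proof -
    have "pair unt r = (\<Sum>w | r w \<noteq> 0. if w = [] then r [] else 0)"
      unfolding pair_def by (rule sum.cong) (auto simp: unt_def)
    then show ?thesis using r by (simp add: free_alg_simps)
  qed
  then have "pair (T p) (low r (r [])) = 0" for p
  proof (cases "length p \<le> 1")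
    case True
    then consider "p = []" | l where "p = [l]" by (cases p) auto
    then show ?thesis
    proof cases
      case 1 then show ?thesis using \<open>pair unt r = r []\<close> by (simp add: pl T_def)
    next
      case (2 l) then show ?thesis by (cases l) (simp_all add: pl T_letter \<tau>_Nil \<tau>_letter)
    qed
  next
    case False
    then have "2 \<le> length p" "p \<noteq> []" by auto
    then show ?thesis using hi[of p] T_degree[of "[]" p] T_degree[of "[_]" p] by (simp add: pl)
  qed
  then show "ev (low r (r [])) = \<zero>\<^bsub>gr H\<^esub>" by (rule T_sep[OF c])
qed

text \<open>The corrected element is a relation in R by \<open>low\<close>, and its part of degree n
  at least 2 is r itself. So a homogeneous relation needs to be tested on products of two or more
  factors only.\<close>

lemma homogeneous_zero:
  assumes r: "r \<in> carrier free_alg" and n: "\<And>w. r w \<noteq> 0 \<Longrightarrow> length w = n" "2 \<le> n"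
    and hi: "\<And>p. 2 \<le> length p \<Longrightarrow> pair (T p) r = 0"
  shows "ev r = \<zero>\<^bsub>gr H\<^esub>"
proof -
  have "ev (\<lambda>w. if length w = n then low r (r []) w else 0) = \<zero>\<^bsub>gr H\<^esub>"
    by (rule ev_homogeneous) (use low[OF r hi] in \<open>auto simp: free_alg_simps(1)\<close>)
  moreover have "(\<lambda>w. if length w = n then low r (r []) w else 0) = r"
  proof
    fix w
    have "r w = 0" if "length w \<noteq> n" using n(1) that by blast
    then show "(if length w = n then low r (r []) w else 0) = r w"
      using n(2) by (auto simp: low_def free_alg_simps word_def)
  qed
  ultimately show ?thesis by simp
qed

text \<open>Products of exactly two factors take the value (q(i,i) + 1) \<tau>(l)(i) \<tau>(l')(i) =
  0 at [i, i]; longer ones vanish by degree.\<close>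

lemma U_square: "U [i, i] = \<zero>\<^bsub>gr H\<^esub>"
proof -
  have "ev (word [i, i]) = \<zero>\<^bsub>gr H\<^esub>"
  proof (rule homogeneous_zero[OF word_in, of _ 2])
    fix p :: "letter list" assume p: "2 \<le> length p"
    show "pair (T p) (word [i, i]) = 0"
    proof (cases "length p = 2")
      case True
      then obtain l l' where "p = [l, l']" by (auto simp: numeral_2_eq_2 length_Suc_conv)
      moreover have "T [l, l'] [i, i] = 0"
        using T_append[of "[l]" "[l']" "[i, i]"] by (simp add: T_letter cnv_two \<tau>_Nil \<tau>_letter q_diag)
      ultimately show ?thesis by simp
    next
      case False then show ?thesis using p by (simp add: T_degree)
    qed
  qed (auto simp: word_def split: if_splits)
  then show ?thesis by (simp add: ev_word)
qed

lemma U_repeat: "U (a @ [i, i] @ b) = \<zero>\<^bsub>gr H\<^esub>"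
  using U_append[of "[i, i]" b] U_append[of a "[i, i] @ b"] by (simp add: U_in U_square del: U.simps)

lemma descends_repeat: "descends \<phi> \<Longrightarrow> \<phi> (a @ [i, i] @ b) = 0"
  by (rule descends_U[OF _ U_repeat])

text \<open>By \<open>kernel_lemma\<close> it is enough that \<open>\<tau> l\<close> and the
  coordinate of l agree on every r killed by the products of two or more factors. After the
  correction \<open>low\<close>, such an r is a relation in R, and its part of degree 1 is a
  relation between independent generators with coefficients
  \<open>r [k] - pair (\<tau> k) r\<close>.\<close>

lemma \<tau>_ind: "\<exists>b. \<forall>w. \<tau> l w = ind l w + (\<Sum>p | 2 \<le> length p \<and> length p < N. b p * T p w)"
proof -
  let ?P = "{p :: letter list. 2 \<le> length p \<and> length p < N}"
  have fin: "finite ?P"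
    by (rule finite_subset[of _ "\<Union>n<N. {p. length p = n}"]) (auto simp: finite_words)
  have "\<exists>b. \<forall>r\<in>carrier free_alg. pair (\<lambda>w. \<tau> l w - ind l w) r = (\<Sum>p\<in>?P. b p * pair (T p) r)"
  proof (rule FA.kernel_lemma[OF fin pair_form pair_form FA.subspace_carrier])
    fix r :: "letter list \<Rightarrow> 'k" assume r: "r \<in> carrier free_alg" "\<And>p. p \<in> ?P \<Longrightarrow> pair (T p) r = 0"
    have "pair (T p) r = 0" if "2 \<le> length p" for p
      using r(2)[of p] that T_zero[of p] by (cases "length p < N") (auto simp: pair_def)
    note lo = low[OF r(1) this]
    let ?r = "low r (r [])"
    have e1: "ev (\<lambda>w. if length w = 1 then ?r w else 0) = \<zero>\<^bsub>gr H\<^esub>"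
      by (rule ev_homogeneous) (use lo in \<open>auto simp: free_alg_simps(1)\<close>)
    have "(\<Sum>k\<in>UNIV. (r [k] - pair (\<tau> k) r) * \<phi> (z k)) = 0" if \<phi>: "\<phi> \<in> linear_forms (gr H)" for \<phi>
    proof -
      have "\<phi> (ev (\<lambda>w. if length w = 1 then ?r w else 0)) =
        (\<Sum>w\<in>{[LX], [LY]}. (if length w = 1 then ?r w else 0) * \<phi> (U w))"
      proof (rule form_ev_gr[OF \<phi>])
        show "{w. (if length w = 1 then ?r w else 0) \<noteq> 0} \<subseteq> {[LX], [LY]}"
        proof
          fix w assume "w \<in> {w. (if length w = 1 then ?r w else 0) \<noteq> 0}"
          then have "length w = 1" by (auto split: if_splits)
          then obtain k where "w = [k]" by (cases w) auto
          then show "w \<in> {[LX], [LY]}" by (cases k) auto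
        qed
      qed simp
      then show ?thesis unfolding e1
        using G.linear_formsD(3)[OF \<phi>] by (simp add: low_def free_alg_simps word_def UNIV_letter z_in)
    qed
    from z_independent[OF this, of l] have "r [l] = pair (\<tau> l) r" by simp
    moreover have "pair (ind l) r = r [l]"
    proof -
      have "pair (ind l) r = (\<Sum>w | r w \<noteq> 0. if w = [l] then r [l] else 0)"
        unfolding pair_def by (rule sum.cong) auto
      then show ?thesis using r by (simp add: free_alg_simps)
    qed
    ultimately show "pair (\<lambda>w. \<tau> l w - ind l w) r = 0" by (simp add: pair_lin)
  qed
  then obtain b where b: "\<forall>r\<in>carrier free_alg. pair (\<lambda>w. \<tau> l w - ind l w) r = (\<Sum>p\<in>?P. b p * pair (T p) r)" by blast
  have "\<tau> l w = ind l w + (\<Sum>p\<in>?P. b p * T p w)" for w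
    using b[rule_format, OF word_in[of w]] by (simp add: algebra_simps)
  then show ?thesis by blast
qed

lemma ind_desc: "descends (ind l)"
proof -
  obtain b where b: "\<And>w. \<tau> l w = ind l w + (\<Sum>p | 2 \<le> length p \<and> length p < N. b p * T p w)"
    using \<tau>_ind[of l] by blast
  have "descends (\<lambda>w. \<tau> l w - (\<Sum>p | 2 \<le> length p \<and> length p < N. b p * T p w))"
    by (rule descends_lin(1)[OF \<tau>_desc descends_lin(2)[OF T_desc]])
  then show ?thesis by (simp add: b cong: if_cong)
qed

subsection \<open>Pairing of alternating words\<close>

abbreviation W :: "letter list \<Rightarrow> letter list \<Rightarrow> 'k" where "W \<equiv> cw q ind"

lemma W_desc: "descends (W p)"
  by (rule descends_cw[OF ind_desc])

text \<open>Unlike \<open>T\<close>, these products are homogeneous, which makes the pairing of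
  words block diagonal.\<close>

lemma W_degree: "length w \<noteq> length p \<Longrightarrow> W p w = 0"
proof (induction p arbitrary: w)
  case Nil then show ?case by (cases w) auto
next
  case (Cons l p)
  have ih: "cnv q (ind l) \<phi> w = 0" if "\<And>w. length w \<noteq> n \<Longrightarrow> \<phi> w = 0" "length w \<noteq> Suc n" for \<phi> n and w :: "letter list"
    using that
  proof (induction w arbitrary: \<phi> n)
    case (Cons j w)
    have "cnv q (ind l) (\<lambda>b. \<phi> (j # b)) w = 0"
    proof (cases n)
      case 0
      then have "(\<lambda>b. \<phi> (j # b)) = (\<lambda>_. 0)" using Cons.prems(1) by auto
      then show ?thesis by (simp add: cnv_zero)
    next
      case (Suc n')
      show ?thesis by (rule Cons.IH[of n']) (use Cons.prems Suc in auto)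
    qed
    then show ?case using Cons.prems by (simp add: cnv_letter)
  qed (simp add: cnv_letter)
  show ?case unfolding cw.simps by (rule ih[of "length p"]) (use Cons in auto)
qed

definition Qq :: 'k where "Qq = q LX LY * q LY LX"

text \<open>The q-Pochhammer symbol (Q; Q) of length k, that is, the q-factorial times the k-th
  power of 1 - Q.\<close>

definition qfac :: "nat \<Rightarrow> 'k" where "qfac k = (\<Prod>j\<in>{1..k}. 1 - Qq ^ j)"

lemma Qq_flip: "q i (flip i) * q (flip i) i = Qq"
  by (cases i) (simp_all add: Qq_def)

lemma W_alt_step: "W (alt l (Suc n)) (alt i (Suc n)) = (if l = i then W (alt (flip l) n) (alt (flip i) n) else 0) +
    (if n \<ge> 1 \<and> l = alt_last i n then alt_chi q l i n * W (alt (flip l) n) (alt i n) else 0)"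
  using cnv_ind_alt[of "W (alt (flip l) n)" q l i n, OF descends_repeat[OF W_desc]] by simp

text \<open>An alternating word of odd length begins and ends with the same letter, so either both
  deletions contribute, which yields the new factor 1 - Q^k, or neither does. In even length exactly
  one of them contributes. The signs come from q(i,i) = -1.\<close>

lemma W_alt:
  "W (alt i (2 * k + 1)) (alt i (2 * k + 1)) = qfac k"
  "W (alt (flip i) (2 * k + 1)) (alt i (2 * k + 1)) = 0"
  "W (alt i (2 * k + 2)) (alt i (2 * k + 2)) = qfac k"
  "W (alt (flip i) (2 * k + 2)) (alt i (2 * k + 2)) = (- 1) ^ k * q i (flip i) ^ (k + 1) * qfac k"
proof (induction k arbitrary: i)
  case 0
  show "W (alt i (2 * 0 + 1)) (alt i (2 * 0 + 1)) = qfac 0"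
    "W (alt (flip i) (2 * 0 + 1)) (alt i (2 * 0 + 1)) = 0" for i
    using W_alt_step[of _ 0] by (simp_all add: qfac_def)
  note 1 = this
  show "W (alt i (2 * 0 + 2)) (alt i (2 * 0 + 2)) = qfac 0"
    "W (alt (flip i) (2 * 0 + 2)) (alt i (2 * 0 + 2)) = (- 1) ^ 0 * q i (flip i) ^ (0 + 1) * qfac 0" for i
    using W_alt_step[of i 1 i] W_alt_step[of "flip i" 1 i] 1[of i] 1[of "flip i"]
    by (simp_all add: alt_last_def numeral_2_eq_2)
next
  case (Suc k)
  have n: "2 * Suc k + 1 = Suc (2 * k + 2)" "2 * Suc k + 2 = Suc (2 * Suc k + 1)" by auto
  have cf: "alt_chi q i i (2 * k + 2) = (- 1) ^ Suc k * q (flip i) i ^ Suc k" for i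
  proof -
    have "alt_chi q i i (2 * Suc k) = (- q (flip i) i) ^ Suc k" by (simp only: alt_chi_even q_diag) simp
    then show ?thesis by (simp only: power_minus[of "q (flip i) i"]) (simp add: algebra_simps)
  qed
  have cf': "alt_chi q (flip i) i (2 * Suc k + 1) = (- 1) ^ Suc k * q i (flip i) ^ (Suc k + 1)" for i
  proof -
    have "alt_chi q (flip i) i (Suc (2 * Suc k)) = q i (flip i) * (- q i (flip i)) ^ Suc k"
      by (simp only: alt_chi_odd q_diag) simp
    also have "\<dots> = (- 1) ^ Suc k * q i (flip i) ^ (Suc k + 1)"
      by (simp only: power_minus[of "q i (flip i)"]) (simp add: algebra_simps)
    finally show ?thesis by simp
  qed
  have OS: "qfac (Suc k) = qfac k * (1 - Qq ^ Suc k)" by (simp add: qfac_def)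
  have s: "((- 1) ^ Suc k * x) * ((- 1) ^ k * y) = - (x * y)" for x y :: 'k
    by (simp add: power_minus_even algebra_simps flip: power_add mult_2)
  have odd: "W (alt i (2 * Suc k + 1)) (alt i (2 * Suc k + 1)) = qfac (Suc k)" for i
  proof -
    have "W (alt i (2 * Suc k + 1)) (alt i (2 * Suc k + 1)) =
      qfac k + alt_chi q i i (2 * k + 2) * ((- 1) ^ k * q i (flip i) ^ (k + 1) * qfac k)"
      unfolding n(1) W_alt_step using Suc(3)[of "flip i"] Suc(4)[of i] by (simp add: alt_last_def)
    also have "\<dots> = qfac k - (q (flip i) i ^ Suc k * q i (flip i) ^ Suc k) * qfac k"
      unfolding cf using s[of "q (flip i) i ^ Suc k" "q i (flip i) ^ (k + 1) * qfac k"] by (simp add: mult.assoc)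
    also have "q (flip i) i ^ Suc k * q i (flip i) ^ Suc k = Qq ^ Suc k"
      using Qq_flip[of i] by (metis power_mult_distrib mult.commute)
    finally show ?thesis by (simp add: OS algebra_simps)
  qed
  have odd0: "W (alt (flip i) (2 * Suc k + 1)) (alt i (2 * Suc k + 1)) = 0" for i
    unfolding n(1) W_alt_step by (simp add: alt_last_def)
  show "W (alt i (2 * Suc k + 1)) (alt i (2 * Suc k + 1)) = qfac (Suc k)"
    "W (alt (flip i) (2 * Suc k + 1)) (alt i (2 * Suc k + 1)) = 0" for i by (rule odd, rule odd0)
  show "W (alt i (2 * Suc k + 2)) (alt i (2 * Suc k + 2)) = qfac (Suc k)" for i
    unfolding n(2) W_alt_step using odd[of "flip i"] odd0[of i] by (simp add: alt_last_def)
  show "W (alt (flip i) (2 * Suc k + 2)) (alt i (2 * Suc k + 2)) = (- 1) ^ Suc k * q i (flip i) ^ (Suc k + 1) * qfac (Suc k)" for i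
    unfolding n(2) W_alt_step using odd[of i] cf'[of i] by (simp add: alt_last_def)
qed

text \<open>Otherwise \<open>W\<close> would be nonzero at alternating words of every odd length. In
  that position it equals \<open>T\<close>, because \<open>\<tau>\<close> differs from the
  coordinates in higher degree only, and \<open>T\<close> vanishes for products of N or more
  factors.\<close>

lemma ex_root: "\<exists>k\<ge>1. Qq ^ k = 1"
proof (rule ccontr)
  assume "\<not> ?thesis"
  then have "qfac N \<noteq> 0" by (auto simp: qfac_def)
  moreover have "W (alt LX (2 * N + 1)) (alt LX (2 * N + 1)) = T (alt LX (2 * N + 1)) (alt LX (2 * N + 1))"
    unfolding T_def by (rule cw_cong_degree) (auto simp: \<tau>_Nil \<tau>_letter)
  ultimately show False using T_zero[of "alt LX (2 * N + 1)"] W_alt(1)[of LX N] by simp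
qed

definition m :: nat where "m = (LEAST k. k \<ge> 1 \<and> Qq ^ k = 1)"

lemma m: "m \<ge> 1" "Qq ^ m = 1" "1 \<le> k \<Longrightarrow> k < m \<Longrightarrow> Qq ^ k \<noteq> 1"
  using LeastI_ex[of "\<lambda>k. k \<ge> 1 \<and> Qq ^ k = 1"] ex_root not_less_Least[of k "\<lambda>k. k \<ge> 1 \<and> Qq ^ k = 1"]
  by (auto simp: m_def)

lemma qfac_nonzero: "k < m \<Longrightarrow> qfac k \<noteq> 0"
  using m(3) by (auto simp: qfac_def)

text \<open>The constant a of the theorem. Exchanging the two letters replaces it by its inverse,
  since \<open>Qq ^ m = 1\<close>.\<close>

definition s :: 'k where "s = (- 1) ^ (m - 1) * q LY LX ^ m"

lemma q_nonzero: "q LX LY \<noteq> 0" "q LY LX \<noteq> 0"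
  using m(1,2) by (auto simp: Qq_def power_0_left)

lemma s_nonzero: "s \<noteq> 0"
  using q_nonzero by (simp add: s_def)

text \<open>The two longest alternating words agree up to a scalar: their difference is killed by left
  convolution with \<open>ind l\<close>, hence, as \<open>\<tau> l - ind l\<close> consists of longer words, by all words,
  by descending induction on the length.\<close>

lemma U_top: "U (alt LY (2 * m)) = s \<odot>\<^bsub>gr H\<^esub> U (alt LX (2 * m))"
proof -
  obtain k where k: "m = Suc k" using m(1) by (cases m) auto
  define r where "r = word (alt LY (2 * m)) \<oplus>\<^bsub>free_alg\<^esub> (- s) \<odot>\<^bsub>free_alg\<^esub> word (alt LX (2 * m))"
  have r: "r \<in> carrier free_alg" unfolding r_def by (intro FA.a_closed FA.smult_closed word_in)
  have pr: "pair \<phi> r = \<phi> (alt LY (2 * m)) - s * \<phi> (alt LX (2 * m))" for \<phi>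
    unfolding r_def by (simp add: word_in FA.linear_formsD[OF pair_form])
  have cf: "alt_chi q (flip i) i (Suc (2 * k)) = (- 1) ^ k * q i (flip i) ^ m" for i
  proof -
    have "alt_chi q (flip i) i (Suc (2 * k)) = q i (flip i) * (- q i (flip i)) ^ k"
      by (simp only: alt_chi_odd q_diag) simp
    then show ?thesis by (simp only: power_minus[of "q i (flip i)"]) (simp add: k algebra_simps)
  qed
  \<comment> \<open>Deleting l takes the first letter of one word and the last letter of the other,
    and leaves the same word of length 2 m - 1. The two scalars cancel, for l = LX by the definition
    of s, for l = LY by \<open>Qq ^ m = 1\<close>.\<close>
  have kill: "pair (cnv q (ind l) \<phi>) r = 0" if "descends \<phi>" for l \<phi>
  proof -
    note a = cnv_ind_alt[of \<phi> q l _ "Suc (2 * k)", OF descends_repeat[OF that]]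
    have 2: "2 * m = Suc (Suc (2 * k))" by (simp add: k)
    have sg: "(- 1) ^ k * ((- 1) ^ k * x) = x" for x :: 'k
      by (simp flip: power_add mult.assoc mult_2)
    show ?thesis
    proof (cases l)
      case LX
      then show ?thesis using cf[of LY] unfolding pr 2 a by (simp add: alt_last_def s_def k del: alt_chi.simps alt.simps)
    next
      case LY
      have "s * alt_chi q LY LX (Suc (2 * k)) = Qq ^ m"
        using cf[of LX] sg[of "Qq ^ m"] by (simp add: s_def k Qq_def power_mult_distrib algebra_simps del: alt_chi.simps)
      then show ?thesis using LY m(2) unfolding pr 2 a
        by (simp add: alt_last_def mult.assoc[symmetric] del: alt_chi.simps alt.simps)
    qed
  qed
  \<comment> \<open>n bounds the distance of p from length N, where products vanish. Expanding the
    first factor by \<open>\<tau>_ind\<close>, the coordinate term is removed by \<open>kill\<close>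
    and all other products are longer than p.\<close>
  have main: "1 \<le> length p \<Longrightarrow> N \<le> length p + n \<Longrightarrow> pair (T p) r = 0" for n p
  proof (induction n arbitrary: p)
    case 0 then show ?case by (simp add: pair_def T_zero)
  next
    case (Suc n)
    then obtain l p' where p: "p = l # p'" by (cases p) auto
    obtain b where b: "\<And>w. \<tau> l w = ind l w + (\<Sum>p | 2 \<le> length p \<and> length p < N. b p * T p w)"
      using \<tau>_ind[of l] by blast
    let ?P = "{p :: letter list. 2 \<le> length p \<and> length p < N}"
    have fin: "finite ?P"
      by (rule finite_subset[of _ "\<Union>n<N. {p. length p = n}"]) (auto simp: finite_words)
    have "T p = (\<lambda>w. cnv q (ind l) (T p') w + (\<Sum>u\<in>?P. b u * T (u @ p') w))"
    proof
      fix w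
      have "T p w = cnv q (\<tau> l) (T p') w" by (simp add: p T_def)
      also have "\<tau> l = (\<lambda>w. ind l w + (\<Sum>p\<in>?P. b p * T p w))" using b by auto
      also have "cnv q (\<lambda>w. ind l w + (\<Sum>p\<in>?P. b p * T p w)) (T p') w =
        cnv q (ind l) (T p') w + (\<Sum>u\<in>?P. b u * T (u @ p') w)"
        by (simp only: cnv_lin(1,3) cnv_lin(5)[OF fin] T_append)
      finally show "T p w = cnv q (ind l) (T p') w + (\<Sum>u\<in>?P. b u * T (u @ p') w)" .
    qed
    then have "pair (T p) r = pair (cnv q (ind l) (T p')) r + (\<Sum>u\<in>?P. b u * pair (T (u @ p')) r)"
      by (simp only: pair_lin(2) pair_lin(1)[OF fin])
    also have "\<dots> = 0" using kill[OF T_desc] Suc.IH Suc.prems by (auto simp: p intro!: sum.neutral)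
    finally show ?case .
  qed
  have "ev r = \<zero>\<^bsub>gr H\<^esub>"
  proof (rule T_sep[OF r])
    fix p show "pair (T p) r = 0"
    proof (cases p)
      case Nil
      moreover have "alt i (2 * m) \<noteq> []" for i using m(1) length_alt[of i "2 * m"] by (auto simp del: length_alt)
      ultimately show ?thesis by (simp add: pr T_def unt_def)
    qed (use main[of p N] in simp)
  qed
  show ?thesis
  proof (rule G.forms_separate)
    fix \<phi> assume \<phi>: "\<phi> \<in> linear_forms (gr H)"
    have "\<phi> (ev r) = pair (\<lambda>w. \<phi> (U w)) r"
      using form_ev_gr[OF \<phi> _ subset_refl, of r] r by (simp add: pair_def free_alg_simps)
    then show "\<phi> (U (alt LY (2 * m))) = \<phi> (s \<odot>\<^bsub>gr H\<^esub> U (alt LX (2 * m)))"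
      using \<open>ev r = _\<close> G.linear_formsD[OF \<phi>] by (simp add: pr U_in)
  qed (auto simp: U_in)
qed

text \<open>Up to a scalar the word of length 2 m after the first letter i may be replaced by the
  one that begins with i, and then z(i) z(i) = 0.\<close>

lemma U_long: "2 * m < n \<Longrightarrow> U (alt i n) = \<zero>\<^bsub>gr H\<^esub>"
proof -
  assume n: "2 * m < n"
  obtain k where k: "2 * m = Suc k" using m(1) by (cases "2 * m") auto
  have sq: "z j \<otimes>\<^bsub>gr H\<^esub> U (alt j (2 * m)) = \<zero>\<^bsub>gr H\<^esub>" for j
    using U_repeat[of "[]" j "alt (flip j) k"] by (simp add: k)
  have "U (alt i (Suc (2 * m))) = \<zero>\<^bsub>gr H\<^esub>"
  proof (cases i)
    case LX
    then show ?thesis using sq[of LX] by (simp add: U_top U_in z_in)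
  next
    case LY
    have "U (alt LX (2 * m)) = (1 / s) \<odot>\<^bsub>gr H\<^esub> U (alt LY (2 * m))"
      using s_nonzero by (simp add: U_top G.smult_smult U_in)
    then show ?thesis using LY sq[of LY] by (simp add: U_in z_in)
  qed
  then show ?thesis
    using alt_add[of i "Suc (2 * m)" "n - Suc (2 * m)"] n by (simp add: U_append U_in del: alt.simps)
qed

end

section \<open>Duals of quotients of the free algebra\<close>

text \<open>\<open>tail\<close> makes the quotient finite-dimensional, spanned by the classes of
  words of length less than N.\<close>

locale free_quot =
  fixes I :: "(letter list \<Rightarrow> 'k::field) set" and N :: nat
  assumes ideal: "ideal I free_alg"
    and tail: "N \<le> length w \<Longrightarrow> word w \<in> I"
begin

abbreviation F :: "('k, letter list \<Rightarrow> 'k) module" where "F \<equiv> free_alg"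
abbreviation B :: "('k, (letter list \<Rightarrow> 'k) set) module" where "B \<equiv> quot_alg free_alg I"
abbreviation D :: "('k, (letter list \<Rightarrow> 'k) set \<Rightarrow> 'k) coalg" where "D \<equiv> dual_quot I"

sublocale I: ideal I free_alg by (rule ideal)

lemma I_in: "p \<in> I \<Longrightarrow> p \<in> carrier F"
  by (rule I.a_Hcarr)

lemma I_subspace: "subspace class_ring I F"
proof -
  have "c \<odot>\<^bsub>F\<^esub> p \<in> I" if "p \<in> I" for c p
  proof -
    have "c \<odot>\<^bsub>F\<^esub> p = (c \<odot>\<^bsub>F\<^esub> \<one>\<^bsub>F\<^esub>) \<otimes>\<^bsub>F\<^esub> p" using I_in[OF that] by simp
    then show ?thesis using I.I_l_closed[OF that, of "c \<odot>\<^bsub>F\<^esub> \<one>\<^bsub>F\<^esub>"] by simp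
  qed
  then show ?thesis
    unfolding FA.subspace_iff using I_in I.zero_closed I.a_closed by blast
qed

definition cl :: "(letter list \<Rightarrow> 'k) \<Rightarrow> (letter list \<Rightarrow> 'k) set" where
  "cl p = I +>\<^bsub>F\<^esub> p"

lemma cl_eq_iff: "p \<in> carrier F \<Longrightarrow> p' \<in> carrier F \<Longrightarrow> cl p = cl p' \<longleftrightarrow> p \<ominus>\<^bsub>F\<^esub> p' \<in> I"
  unfolding cl_def by (rule FA.coset_eq_iff[OF I_subspace])

lemma B_simps:
  "carrier B = cl ` carrier F"
  "\<zero>\<^bsub>B\<^esub> = cl \<zero>\<^bsub>F\<^esub>" "\<one>\<^bsub>B\<^esub> = cl (word [])"
  "p \<in> carrier F \<Longrightarrow> p' \<in> carrier F \<Longrightarrow> cl p \<oplus>\<^bsub>B\<^esub> cl p' = cl (p \<oplus>\<^bsub>F\<^esub> p')"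
  "p \<in> carrier F \<Longrightarrow> p' \<in> carrier F \<Longrightarrow> cl p \<otimes>\<^bsub>B\<^esub> cl p' = cl (p \<otimes>\<^bsub>F\<^esub> p')"
  "p \<in> carrier F \<Longrightarrow> c \<odot>\<^bsub>B\<^esub> cl p = cl (c \<odot>\<^bsub>F\<^esub> p)"
proof -
  show "carrier B = cl ` carrier F"
    by (auto simp: quot_alg_def quot_space_def cl_def A_RCOSETS_def')
  show "\<zero>\<^bsub>B\<^esub> = cl \<zero>\<^bsub>F\<^esub>"
    by (simp add: quot_alg_def quot_space_def cl_def FA.coset_zero[OF I_subspace])
  show "\<one>\<^bsub>B\<^esub> = cl (word [])"
    by (simp add: quot_alg_def FactRing_def cl_def free_alg_simps(3))
  assume p: "p \<in> carrier F"
  show "c \<odot>\<^bsub>B\<^esub> cl p = cl (c \<odot>\<^bsub>F\<^esub> p)"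
  proof -
    have "I +>\<^bsub>F\<^esub> (c \<odot>\<^bsub>F\<^esub> x) = cl (c \<odot>\<^bsub>F\<^esub> p)" if "x \<in> cl p" for x
    proof -
      have x: "x \<in> carrier F" "x \<ominus>\<^bsub>F\<^esub> p \<in> I" using that FA.coset_iff[OF I_subspace p] by (auto simp: cl_def)
      have "(c \<odot>\<^bsub>F\<^esub> x) \<ominus>\<^bsub>F\<^esub> (c \<odot>\<^bsub>F\<^esub> p) = c \<odot>\<^bsub>F\<^esub> (x \<ominus>\<^bsub>F\<^esub> p)"
        by (rule FA.forms_separate) (use x p in \<open>simp_all add: FA.linear_formsD algebra_simps\<close>)
      then show ?thesis
        using cl_eq_iff[of "c \<odot>\<^bsub>F\<^esub> x" "c \<odot>\<^bsub>F\<^esub> p"] x p FA.subspaceD(4)[OF I_subspace] by (simp add: cl_def)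
    qed
    moreover have "p \<in> cl p"
      using FA.coset_iff[OF I_subspace p, of p] p FA.subspaceD(2)[OF I_subspace] by (simp add: cl_def FA.r_neg FA.minus_eq)
    ultimately show ?thesis by (auto simp: quot_alg_def quot_space_def)
  qed
  assume p': "p' \<in> carrier F"
  show "cl p \<oplus>\<^bsub>B\<^esub> cl p' = cl (p \<oplus>\<^bsub>F\<^esub> p')"
    using FA.coset_add[OF I_subspace p p'] by (simp add: quot_alg_def quot_space_def cl_def)
  show "cl p \<otimes>\<^bsub>B\<^esub> cl p' = cl (p \<otimes>\<^bsub>F\<^esub> p')"
    using I.rcoset_mult_add[OF p p'] by (simp add: quot_alg_def FactRing_def cl_def)
qed

lemma cl_in: "p \<in> carrier F \<Longrightarrow> cl p \<in> carrier B"
  by (simp add: B_simps)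

lemma vs_B: "vs B"
proof (rule vs.intro, rule vectorspaceI)
  show "\<zero>\<^bsub>B\<^esub> \<in> carrier B" by (simp add: B_simps(2) cl_in)
  fix x assume "x \<in> carrier B"
  then obtain p where p: "p \<in> carrier F" "x = cl p" by (auto simp: B_simps(1))
  show "c \<odot>\<^bsub>B\<^esub> x \<in> carrier B" for c using p by (simp add: B_simps(6) cl_in)
  show "x \<oplus>\<^bsub>B\<^esub> \<zero>\<^bsub>B\<^esub> = x" using p by (simp add: B_simps)
  show "(c * d) \<odot>\<^bsub>B\<^esub> x = c \<odot>\<^bsub>B\<^esub> (d \<odot>\<^bsub>B\<^esub> x)" for c d using p by (simp add: B_simps FA.smult_smult)
  show "1 \<odot>\<^bsub>B\<^esub> x = x" "0 \<odot>\<^bsub>B\<^esub> x = \<zero>\<^bsub>B\<^esub>" using p by (simp_all add: B_simps)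
  show "(c + d) \<odot>\<^bsub>B\<^esub> x = c \<odot>\<^bsub>B\<^esub> x \<oplus>\<^bsub>B\<^esub> d \<odot>\<^bsub>B\<^esub> x" for c d using p by (simp add: B_simps FA.smult_add)
  fix y assume "y \<in> carrier B"
  then obtain p' where p': "p' \<in> carrier F" "y = cl p'" by (auto simp: B_simps(1))
  show "x \<oplus>\<^bsub>B\<^esub> y \<in> carrier B" using p p' by (simp add: B_simps(4) cl_in)
  show "x \<oplus>\<^bsub>B\<^esub> y = y \<oplus>\<^bsub>B\<^esub> x" using p p' by (simp add: B_simps FA.a_comm)
  show "c \<odot>\<^bsub>B\<^esub> (x \<oplus>\<^bsub>B\<^esub> y) = c \<odot>\<^bsub>B\<^esub> x \<oplus>\<^bsub>B\<^esub> c \<odot>\<^bsub>B\<^esub> y" for c using p p' by (simp add: B_simps FA.smult_distrib)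
  fix w assume "w \<in> carrier B"
  then obtain p'' where "p'' \<in> carrier F" "w = cl p''" by (auto simp: B_simps(1))
  then show "(x \<oplus>\<^bsub>B\<^esub> y) \<oplus>\<^bsub>B\<^esub> w = x \<oplus>\<^bsub>B\<^esub> (y \<oplus>\<^bsub>B\<^esub> w)" using p p' by (simp add: B_simps FA.a_assoc)
qed

sublocale B: vs B by (rule vs_B)

lemma D_simps:
  "carrier D = linear_forms B \<inter> extensional (carrier B)" "\<zero>\<^bsub>D\<^esub> = (\<lambda>x\<in>carrier B. 0)"
  "f \<oplus>\<^bsub>D\<^esub> g = (\<lambda>x\<in>carrier B. f x + g x)" "c \<odot>\<^bsub>D\<^esub> f = (\<lambda>x\<in>carrier B. c * f x)"
  by (simp_all add: dual_coalgebra_def with_coalg_def dual_space_def)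

lemma restrict_form: "\<phi> \<in> linear_forms B \<Longrightarrow> restrict \<phi> (carrier B) \<in> carrier D"
  using linear_forms_cong[OF vs_B, of "restrict \<phi> (carrier B)" \<phi>] by (simp add: D_simps)

lemma vs_D: "vs D"
proof (rule vs.intro, rule vectorspaceI)
  show "\<zero>\<^bsub>D\<^esub> \<in> carrier D"
    using restrict_form[OF B.linear_form_zero] by (simp add: D_simps)
  fix f assume f: "f \<in> carrier D"
  show "c \<odot>\<^bsub>D\<^esub> f \<in> carrier D" for c
    using restrict_form[OF B.linear_form_scale, of f c] f by (simp add: D_simps)
  show "f \<oplus>\<^bsub>D\<^esub> g \<in> carrier D" if "g \<in> carrier D" for g
    using restrict_form[OF B.linear_form_add, of f g] f that by (simp add: D_simps)
  have "f x = undefined" if "x \<notin> carrier B" for x using f that by (simp add: D_simps extensional_def)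
  then show "f \<oplus>\<^bsub>D\<^esub> \<zero>\<^bsub>D\<^esub> = f" "1 \<odot>\<^bsub>D\<^esub> f = f"
    by (auto simp: D_simps fun_eq_iff)
qed (auto simp: D_simps fun_eq_iff algebra_simps)

sublocale D: vs D by (rule vs_D)

lemma eval_form: "x \<in> carrier B \<Longrightarrow> (\<lambda>f. f x) \<in> linear_forms D"
  by (rule D.linear_formsI) (simp_all add: D_simps)

lemma D_form: "f \<in> carrier D \<Longrightarrow> f \<in> linear_forms B"
  by (simp add: D_simps)

lemma D_eqI: "f \<in> carrier D \<Longrightarrow> g \<in> carrier D \<Longrightarrow> (\<And>x. x \<in> carrier B \<Longrightarrow> f x = g x) \<Longrightarrow> f = g"
  by (rule extensionalityI[of _ "carrier B"]) (auto simp: D_simps)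

lemma cl_form: "\<phi> \<in> linear_forms B \<Longrightarrow> (\<lambda>p. \<phi> (cl p)) \<in> linear_forms F"
  by (rule FA.linear_formsI) (simp_all add: B_simps(4,6)[symmetric] cl_in B.linear_formsD)

lemma form_cl:
  assumes "\<phi> \<in> linear_forms B" "p \<in> carrier F"
  shows "\<phi> (cl p) = pair (\<lambda>w. \<phi> (cl (word w))) p"
  using form_word_sum[OF cl_form[OF assms(1)] _ subset_refl, of p] assms(2) by (simp add: pair_def free_alg_simps(1))

lemma form_I: "\<phi> \<in> linear_forms B \<Longrightarrow> p \<in> I \<Longrightarrow> \<phi> (cl p) = 0"
proof -
  assume \<phi>: "\<phi> \<in> linear_forms B" and p: "p \<in> I"
  have "p \<ominus>\<^bsub>F\<^esub> \<zero>\<^bsub>F\<^esub> = p"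
    by (rule FA.forms_separate) (use I_in[OF p] in \<open>simp_all add: FA.linear_formsD\<close>)
  then have "cl p = \<zero>\<^bsub>B\<^esub>"
    using cl_eq_iff[of p "\<zero>\<^bsub>F\<^esub>"] p I_in[OF p] by (simp add: B_simps(2))
  then show ?thesis using B.linear_formsD(3)[OF \<phi>] by simp
qed

lemma forms_eqI:
  assumes "\<phi> \<in> linear_forms B" "\<psi> \<in> linear_forms B" "\<And>w. \<phi> (cl (word w)) = \<psi> (cl (word w))" "x \<in> carrier B"
  shows "\<phi> x = \<psi> x"
  using assms(4) form_cl[OF assms(1)] form_cl[OF assms(2)] by (auto simp: B_simps(1) assms(3))

text \<open>The form is defined through a chosen preimage of each class; the choice does not matter
  because the pairing with g kills I.\<close>

lemma lift_form:
  assumes "\<And>p. p \<in> I \<Longrightarrow> pair g p = 0"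
  obtains \<phi> where "\<phi> \<in> carrier D" "\<And>p. p \<in> carrier F \<Longrightarrow> \<phi> (cl p) = pair g p"
proof -
  define \<phi> where "\<phi> x = pair g (SOME p. p \<in> carrier F \<and> x = cl p)" for x
  have \<phi>: "\<phi> (cl p) = pair g p" if p: "p \<in> carrier F" for p
  proof -
    let ?p = "SOME p'. p' \<in> carrier F \<and> cl p = cl p'"
    have "?p \<in> carrier F \<and> cl p = cl ?p" by (rule someI[of "\<lambda>p'. p' \<in> carrier F \<and> cl p = cl p'" p]) (simp add: p)
    then have "pair g (p \<ominus>\<^bsub>F\<^esub> ?p) = 0" "?p \<in> carrier F" using assms cl_eq_iff[OF p] by auto
    then show ?thesis unfolding \<phi>_def using p by (simp add: FA.linear_formsD(4)[OF pair_form])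
  qed
  have "\<phi> \<in> linear_forms B"
  proof (rule B.linear_formsI)
    fix x y c assume "x \<in> carrier B"
    then obtain p where p: "p \<in> carrier F" "x = cl p" by (auto simp: B_simps(1))
    then show "\<phi> (c \<odot>\<^bsub>B\<^esub> x) = c * \<phi> x" by (simp add: B_simps(6) \<phi> FA.linear_formsD[OF pair_form])
    assume "y \<in> carrier B"
    then obtain p' where "p' \<in> carrier F" "y = cl p'" by (auto simp: B_simps(1))
    then show "\<phi> (x \<oplus>\<^bsub>B\<^esub> y) = \<phi> x + \<phi> y" using p by (simp add: B_simps(4) \<phi> FA.linear_formsD[OF pair_form])
  qed
  from restrict_form[OF this] show ?thesis
  proof (rule that)
    show "restrict \<phi> (carrier B) (cl p) = pair g p" if "p \<in> carrier F" for p
      using \<phi>[OF that] cl_in[OF that] by simp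
  qed
qed

lemma mult_bilinear:
  assumes "\<phi> \<in> linear_forms B"
  shows "(\<lambda>a b. \<phi> (a \<otimes>\<^bsub>B\<^esub> b)) \<in> bilinear_forms B B"
proof (rule bilinear_formsI; rule B.linear_formsI)
  fix a b b' c assume "a \<in> carrier B" "b \<in> carrier B"
  then obtain p p' where p: "p \<in> carrier F" "a = cl p" "p' \<in> carrier F" "b = cl p'" by (auto simp: B_simps(1))
  then show "\<phi> (a \<otimes>\<^bsub>B\<^esub> (c \<odot>\<^bsub>B\<^esub> b)) = c * \<phi> (a \<otimes>\<^bsub>B\<^esub> b)" "\<phi> ((c \<odot>\<^bsub>B\<^esub> b) \<otimes>\<^bsub>B\<^esub> a) = c * \<phi> (b \<otimes>\<^bsub>B\<^esub> a)"
    by (simp_all add: B_simps FA.linear_formsD[OF cl_form[OF assms]])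
  assume "b' \<in> carrier B"
  then obtain p'' where "p'' \<in> carrier F" "b' = cl p''" by (auto simp: B_simps(1))
  then show "\<phi> (a \<otimes>\<^bsub>B\<^esub> (b \<oplus>\<^bsub>B\<^esub> b')) = \<phi> (a \<otimes>\<^bsub>B\<^esub> b) + \<phi> (a \<otimes>\<^bsub>B\<^esub> b')"
    "\<phi> ((b \<oplus>\<^bsub>B\<^esub> b') \<otimes>\<^bsub>B\<^esub> a) = \<phi> (b \<otimes>\<^bsub>B\<^esub> a) + \<phi> (b' \<otimes>\<^bsub>B\<^esub> a)"
    using p by (simp_all add: B_simps FA.l_distr FA.r_distr FA.linear_formsD[OF cl_form[OF assms]])
qed

text \<open>The classes of short words span the quotient but may be dependent there, so dual
  coordinates are taken from \<open>frame\<close>.\<close>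

lemma dual_frame:
  obtains n :: nat and e \<xi> where "\<And>i. i < n \<Longrightarrow> e i \<in> carrier B" "\<And>i. i < n \<Longrightarrow> \<xi> i \<in> carrier D"
    "\<And>x \<psi>. x \<in> carrier B \<Longrightarrow> \<psi> \<in> linear_forms B \<Longrightarrow> \<psi> x = (\<Sum>i<n. \<xi> i x * \<psi> (e i))"
proof -
  let ?P = "{w :: letter list. length w < N}"
  have fin: "finite ?P" by (rule finite_subset[of _ "\<Union>n<N. {p. length p = n}"]) (auto simp: finite_words)
  then obtain n :: nat and h where h: "bij_betw h {..<n} ?P" by (rule finite_enumerate)
  define e where "e i = cl (word (h i))" for i
  have e: "i < n \<Longrightarrow> e i \<in> carrier B" for i by (simp add: e_def cl_in word_in)
  from B.frame[of n e, OF e] obtain \<xi> where \<xi>: "\<And>i. i < n \<Longrightarrow> \<xi> i \<in> linear_forms B"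
    "\<And>x c. x \<in> carrier B \<Longrightarrow> \<forall>\<psi>\<in>linear_forms B. \<psi> x = (\<Sum>i<n. c i * \<psi> (e i)) \<Longrightarrow>
      \<forall>\<psi>\<in>linear_forms B. \<psi> x = (\<Sum>i<n. \<xi> i x * \<psi> (e i))" by blast
  have s: "\<psi> x = (\<Sum>i<n. restrict (\<xi> i) (carrier B) x * \<psi> (e i))" if x: "x \<in> carrier B" "\<psi> \<in> linear_forms B" for x \<psi>
  proof -
    obtain p where p: "p \<in> carrier F" "x = cl p" using x by (auto simp: B_simps(1))
    have "\<forall>\<psi>\<in>linear_forms B. \<psi> x = (\<Sum>i<n. p (h i) * \<psi> (e i))"
    proof
      fix \<psi> assume \<psi>: "\<psi> \<in> linear_forms B"
      let ?A = "{w. p w \<noteq> 0} \<union> ?P"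
      have fA: "finite ?A" using p fin by (simp add: free_alg_simps)
      have "\<psi> x = (\<Sum>w\<in>?A. p w * \<psi> (cl (word w)))"
        using form_cl[OF \<psi> p(1)] pair_sum[OF fA, of p] p(2) by simp
      also have "\<dots> = (\<Sum>w\<in>?P. p w * \<psi> (cl (word w)))"
        by (rule sum.mono_neutral_right[OF fA]) (auto simp: form_I[OF \<psi> tail])
      also have "\<dots> = (\<Sum>i<n. p (h i) * \<psi> (e i))"
        unfolding e_def by (rule sum.reindex_bij_betw[OF h, symmetric])
      finally show "\<psi> x = (\<Sum>i<n. p (h i) * \<psi> (e i))" .
    qed
    from \<xi>(2)[OF x(1) this] x show ?thesis by simp
  qed
  show ?thesis by (rule that[OF e restrict_form[OF \<xi>(1)] s])
qed

lemma prod_eval_bilinear: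
  "a \<in> carrier B \<Longrightarrow> b \<in> carrier B \<Longrightarrow> (\<lambda>\<phi> \<psi>. \<phi> a * \<psi> b) \<in> bilinear_forms D D"
  by (rule bilinear_form_prod[OF vs_D vs_D eval_form eval_form])

text \<open>By the dual frame every form h on the dual is a combination of evaluations at the
  \<open>e i\<close>, with coefficients \<open>h (\<xi> i)\<close>. Hence products of evaluations
  suffice to separate tensors.\<close>

lemma tensor_dual_eqI:
  assumes T: "T \<in> tensors D D (carrier D) (carrier D)" and U: "U \<in> tensors D D (carrier D) (carrier D)"
    and eq: "\<And>a b. a \<in> carrier B \<Longrightarrow> b \<in> carrier B \<Longrightarrow> T (\<lambda>\<phi> \<psi>. \<phi> a * \<psi> b) = U (\<lambda>\<phi> \<psi>. \<phi> a * \<psi> b)"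
  shows "T = U"
proof (rule tensor_eqI[OF vs_D vs_D T U])
  fix f g assume f: "f \<in> linear_forms D" and g: "g \<in> linear_forms D"
  obtain n :: nat and e \<xi> where e: "\<And>i. i < n \<Longrightarrow> e i \<in> carrier B" "\<And>i. i < n \<Longrightarrow> \<xi> i \<in> carrier D"
    "\<And>x \<psi>. x \<in> carrier B \<Longrightarrow> \<psi> \<in> linear_forms B \<Longrightarrow> \<psi> x = (\<Sum>i<n. \<xi> i x * \<psi> (e i))" by (rule dual_frame) blast
  have ex: "h \<phi> = (\<Sum>i<n. h (\<xi> i) * \<phi> (e i))" if h: "h \<in> linear_forms D" and \<phi>: "\<phi> \<in> carrier D" for h \<phi>
  proof -
    have "\<phi> = D.lincomb {..<n} (\<lambda>i. \<phi> (e i)) \<xi>"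
    proof (rule D_eqI[OF \<phi> D.lincomb_closed])
      show "\<xi> i \<in> carrier D" if "i \<in> {..<n}" for i using e that by simp
      fix x assume x: "x \<in> carrier B"
      have "D.lincomb {..<n} (\<lambda>i. \<phi> (e i)) \<xi> x = (\<Sum>i<n. \<phi> (e i) * \<xi> i x)"
        by (rule D.form_lincomb[OF eval_form[OF x]]) (use e in simp)
      then show "\<phi> x = D.lincomb {..<n} (\<lambda>i. \<phi> (e i)) \<xi> x"
        using e(3)[OF x D_form[OF \<phi>]] by (simp add: mult.commute)
    qed
    then have "h \<phi> = h (D.lincomb {..<n} (\<lambda>i. \<phi> (e i)) \<xi>)" by simp
    also have "\<dots> = (\<Sum>i<n. \<phi> (e i) * h (\<xi> i))" by (rule D.form_lincomb[OF h]) (use e in simp)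
    finally show ?thesis by (simp add: mult.commute)
  qed
  let ?\<gamma> = "\<lambda>k a b. f (\<xi> (fst k)) * g (\<xi> (snd k)) * (a (e (fst k)) * b (e (snd k)))"
  have bl: "?\<gamma> k \<in> bilinear_forms D D" if "k \<in> {..<n} \<times> {..<n}" for k
    by (rule bilinear_form_scale[OF vs_D vs_D prod_eval_bilinear]) (use e that in auto)
  have val: "V (\<lambda>a b. f a * g b) = (\<Sum>k\<in>{..<n} \<times> {..<n}. f (\<xi> (fst k)) * g (\<xi> (snd k)) * V (\<lambda>a b. a (e (fst k)) * b (e (snd k))))"
    if V: "V \<in> tensors D D (carrier D) (carrier D)" for V
  proof -
    have "f a * g b = (\<Sum>k\<in>{..<n} \<times> {..<n}. ?\<gamma> k a b)" if "a \<in> carrier D" "b \<in> carrier D" for a b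
    proof -
      have "f a * g b = (\<Sum>i<n. f (\<xi> i) * a (e i)) * (\<Sum>j<n. g (\<xi> j) * b (e j))"
        by (simp only: ex[OF f that(1)] ex[OF g that(2)])
      also have "\<dots> = (\<Sum>k\<in>{..<n} \<times> {..<n}. f (\<xi> (fst k)) * a (e (fst k)) * (g (\<xi> (snd k)) * b (e (snd k))))"
        by (simp add: sum_product sum.cartesian_product case_prod_unfold)
      finally show ?thesis by (simp add: mult_ac)
    qed
    then have "V (\<lambda>a b. f a * g b) = V (\<lambda>a b. \<Sum>k\<in>{..<n} \<times> {..<n}. ?\<gamma> k a b)"
      by (rule tensor_cong[OF vs_D vs_D V])
    also have "\<dots> = (\<Sum>k\<in>{..<n} \<times> {..<n}. V (?\<gamma> k))" by (rule tensor_linear(4)[OF vs_D vs_D V bl])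
    also have "\<dots> = (\<Sum>k\<in>{..<n} \<times> {..<n}. f (\<xi> (fst k)) * g (\<xi> (snd k)) * V (\<lambda>a b. a (e (fst k)) * b (e (snd k))))"
      by (intro sum.cong refl tensor_linear(2)[OF vs_D vs_D V prod_eval_bilinear]) (use e in auto)
    finally show ?thesis .
  qed
  show "T (\<lambda>a b. f a * g b) = U (\<lambda>a b. f a * g b)"
    unfolding val[OF T] val[OF U] by (intro sum.cong refl) (use e eq in auto)
qed

text \<open>\<open>dual_coalgebra\<close> forms its tensors over the record
  \<open>dual_space\<close>, which shares carrier and operations with D but has another record
  type.\<close>

lemma comult_D_def: "comult D f = (THE T. T \<in> tensors D D (carrier D) (carrier D) \<and>
    (\<forall>a\<in>carrier B. \<forall>b\<in>carrier B. T (\<lambda>\<phi> \<psi>. \<phi> a * \<psi> b) = f (a \<otimes>\<^bsub>B\<^esub> b)))"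
proof -
  have l: "linear_forms (dual_space B) = linear_forms D"
    by (simp add: linear_forms_def dual_coalgebra_def with_coalg_def)
  have b: "bilinear_forms (dual_space B) (dual_space B) = bilinear_forms D D"
    unfolding bilinear_forms_def l by (simp only: dual_coalgebra_def with_coalg_def module.simps partial_object.simps)
  have c: "carrier (dual_space B) = carrier D"
    by (simp only: dual_coalgebra_def with_coalg_def partial_object.simps)
  have t: "tensors (dual_space B) (dual_space B) = tensors D D"
    unfolding tensors_def b ..
  show ?thesis unfolding c[symmetric] t[symmetric] by (simp only: dual_coalgebra_def with_coalg_def coalg.simps carrier_tensor_product)
qed

text \<open>The classes of words span the quotient and both sides are bilinear in a and b, so it is
  enough to test the defining property on words.\<close>

lemma comult_D_eqI:
  assumes T: "T \<in> tensors D D (carrier D) (carrier D)" and f: "f \<in> carrier D"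
    and eq: "\<And>v w. T (\<lambda>\<phi> \<psi>. \<phi> (cl (word v)) * \<psi> (cl (word w))) = f (cl (word (v @ w)))"
  shows "comult D f = T"
proof -
  have *: "T (\<lambda>\<phi> \<psi>. \<phi> a * \<psi> b) = f (a \<otimes>\<^bsub>B\<^esub> b)" if a: "a \<in> carrier B" and b: "b \<in> carrier B" for a b
  proof -
    note m = mult_bilinear[OF D_form[OF f]]
    have L: "(\<lambda>a. T (\<lambda>\<phi> \<psi>. \<phi> a * \<psi> b)) \<in> linear_forms B" if "b \<in> carrier B" for b
    proof (rule tensor_linear_form[OF vs_D vs_D vs_B T prod_eval_bilinear])
      show "(\<lambda>a. \<phi> a * \<psi> b) \<in> linear_forms B" if "\<phi> \<in> carrier D" for \<phi> \<psi>
        by (rule B.linear_form_scale'[OF D_form[OF that]])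
    qed (use that in auto)
    have R: "(\<lambda>b. T (\<lambda>\<phi> \<psi>. \<phi> a * \<psi> b)) \<in> linear_forms B" if "a \<in> carrier B" for a
    proof (rule tensor_linear_form[OF vs_D vs_D vs_B T prod_eval_bilinear])
      show "(\<lambda>b. \<phi> a * \<psi> b) \<in> linear_forms B" if "\<psi> \<in> carrier D" for \<phi> \<psi>
        by (rule B.linear_form_scale[OF D_form[OF that]])
    qed (use that in auto)
    show ?thesis
    proof (rule forms_eqI[OF L[OF b] bilinear_formsD(2)[OF m b] _ a])
      fix v
      show "T (\<lambda>\<phi> \<psi>. \<phi> (cl (word v)) * \<psi> b) = f (cl (word v) \<otimes>\<^bsub>B\<^esub> b)"
        by (rule forms_eqI[OF R bilinear_formsD(1)[OF m] _ b])
          (simp_all add: cl_in word_in eq B_simps(5) word_mult)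
    qed
  qed
  show ?thesis unfolding comult_D_def
  proof (rule the_equality, use T * in simp)
    fix U assume "U \<in> tensors D D (carrier D) (carrier D) \<and>
      (\<forall>a\<in>carrier B. \<forall>b\<in>carrier B. U (\<lambda>\<phi> \<psi>. \<phi> a * \<psi> b) = f (a \<otimes>\<^bsub>B\<^esub> b))"
    then show "U = T" by (intro tensor_dual_eqI) (use T * in auto)
  qed
qed

lemma comult_D:
  assumes f: "f \<in> carrier D"
  shows "comult D f (\<lambda>\<phi> \<psi>. \<phi> (cl (word v)) * \<psi> (cl (word w))) = f (cl (word (v @ w)))"
proof -
  obtain n :: nat and e \<xi> where e: "\<And>i. i < n \<Longrightarrow> e i \<in> carrier B" "\<And>i. i < n \<Longrightarrow> \<xi> i \<in> carrier D"
    "\<And>x \<psi>. x \<in> carrier B \<Longrightarrow> \<psi> \<in> linear_forms B \<Longrightarrow> \<psi> x = (\<Sum>i<n. \<xi> i x * \<psi> (e i))" by (rule dual_frame) blast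
  note m = mult_bilinear[OF D_form[OF f]]
  \<comment> \<open>The sum of the tensors f(e(i) e(j)) \<xi>(i) \<otimes> \<xi>(j), which shows
    that the described comultiplication exists.\<close>
  define T where "T = (\<lambda>\<beta>\<in>bilinear_forms D D. \<Sum>k\<in>{..<n} \<times> {..<n}.
    \<beta> (f (e (fst k) \<otimes>\<^bsub>B\<^esub> e (snd k)) \<odot>\<^bsub>D\<^esub> \<xi> (fst k)) (\<xi> (snd k)))"
  have T: "T \<in> tensors D D (carrier D) (carrier D)"
    by (rule tensors_sumI[where I = "{..<n} \<times> {..<n}" and a = "\<lambda>k. f (e (fst k) \<otimes>\<^bsub>B\<^esub> e (snd k)) \<odot>\<^bsub>D\<^esub> \<xi> (fst k)"
      and b = "\<lambda>k. \<xi> (snd k)"]) (use e(2) in \<open>auto simp: T_def\<close>)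
  have val: "T (\<lambda>\<phi> \<psi>. \<phi> (cl (word v)) * \<psi> (cl (word w))) = f (cl (word (v @ w)))" for v w
  proof -
    let ?a = "cl (word v)" and ?b = "cl (word w)"
    have ab: "?a \<in> carrier B" "?b \<in> carrier B" by (simp_all add: cl_in word_in)
    have "f (cl (word (v @ w))) = f (?a \<otimes>\<^bsub>B\<^esub> ?b)" by (simp add: B_simps(5) word_in word_mult)
    also have "\<dots> = (\<Sum>i<n. \<xi> i ?a * f (e i \<otimes>\<^bsub>B\<^esub> ?b))" by (rule e(3)[OF ab(1) bilinear_formsD(2)[OF m ab(2)]])
    also have "\<dots> = (\<Sum>i<n. \<xi> i ?a * (\<Sum>j<n. \<xi> j ?b * f (e i \<otimes>\<^bsub>B\<^esub> e j)))"
      by (intro sum.cong refl arg_cong2[of _ _ _ _ "(*)"] e(3)[OF ab(2) bilinear_formsD(1)[OF m]]) (simp add: e)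
    also have "\<dots> = T (\<lambda>\<phi> \<psi>. \<phi> ?a * \<psi> ?b)"
      using ab by (simp add: T_def prod_eval_bilinear D_simps sum_distrib_left sum.cartesian_product case_prod_unfold algebra_simps)
    finally show ?thesis by simp
  qed
  show ?thesis unfolding comult_D_eqI[OF T f val] by (rule val)
qed

lemma counit_D: "counit D f = f (cl (word []))"
  by (simp add: dual_coalgebra_def with_coalg_def B_simps(3))

end

section \<open>The ideals of tame type\<close>

lemma ideal_word_context:
  assumes I: "ideal I free_alg" and "word v \<ominus>\<^bsub>free_alg\<^esub> c \<odot>\<^bsub>free_alg\<^esub> word v' \<in> I"
  shows "word (a @ v @ b) \<ominus>\<^bsub>free_alg\<^esub> c \<odot>\<^bsub>free_alg\<^esub> word (a @ v' @ b) \<in> (I :: (letter list \<Rightarrow> 'k::field) set)"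
proof -
  let ?F = "free_alg :: ('k, letter list \<Rightarrow> 'k) module"
  let ?p = "word v \<ominus>\<^bsub>?F\<^esub> c \<odot>\<^bsub>?F\<^esub> word v'"
  have "(word a \<otimes>\<^bsub>?F\<^esub> ?p) \<otimes>\<^bsub>?F\<^esub> word b \<in> I"
    using ideal.I_r_closed[OF I ideal.I_l_closed[OF I assms(2) word_in] word_in] .
  moreover have "(word a \<otimes>\<^bsub>?F\<^esub> ?p) \<otimes>\<^bsub>?F\<^esub> word b = word (a @ v @ b) \<ominus>\<^bsub>?F\<^esub> c \<odot>\<^bsub>?F\<^esub> word (a @ v' @ b)"
  proof (rule FA.forms_separate)
    fix \<phi> assume \<phi>: "\<phi> \<in> linear_forms ?F"
    have "(\<lambda>p. \<phi> ((word a \<otimes>\<^bsub>?F\<^esub> p) \<otimes>\<^bsub>?F\<^esub> word b)) \<in> linear_forms ?F"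
      by (rule FA.mult_form(2)[OF FA.mult_form(1)[OF \<phi> word_in] word_in])
    then show "\<phi> ((word a \<otimes>\<^bsub>?F\<^esub> ?p) \<otimes>\<^bsub>?F\<^esub> word b) = \<phi> (word (a @ v @ b) \<ominus>\<^bsub>?F\<^esub> c \<odot>\<^bsub>?F\<^esub> word (a @ v' @ b))"
      by (simp add: FA.linear_formsD[OF \<phi>] FA.linear_formsD[where \<phi> = "\<lambda>p. \<phi> ((word a \<otimes>\<^bsub>?F\<^esub> p) \<otimes>\<^bsub>?F\<^esub> word b)"] word_in word_mult)
  qed (simp_all add: word_in)
  ultimately show ?thesis by simp
qed

lemma ideal_word_zero: "ideal I free_alg \<Longrightarrow> word v \<in> I \<Longrightarrow> word (a @ v @ b) \<in> (I :: (letter list \<Rightarrow> 'k::field) set)"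
proof -
  assume I: "ideal I free_alg" "word v \<in> I"
  show "word (a @ v @ b) \<in> I"
    using ideal.I_r_closed[OF I(1) ideal.I_l_closed[OF I word_in[of a]] word_in[of b]]
    by (simp only: word_mult append_assoc)
qed

text \<open>The two words are nonzero multiples of each other modulo I.\<close>

lemma ideal_word_cong:
  assumes I: "ideal I free_alg" and r: "word v \<ominus>\<^bsub>free_alg\<^esub> c \<odot>\<^bsub>free_alg\<^esub> word v' \<in> (I :: (letter list \<Rightarrow> 'k::field) set)"
    and c: "c \<noteq> 0"
  shows "word v \<in> I \<longleftrightarrow> word v' \<in> I"
proof -
  let ?F = "free_alg :: ('k, letter list \<Rightarrow> 'k) module"
  have in_F: "p \<in> I \<Longrightarrow> p \<in> carrier ?F" for p
    using additive_subgroup.a_Hcarr[OF ideal.axioms(1)[OF I]] .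
  have sm: "c \<odot>\<^bsub>?F\<^esub> p \<in> I" if "p \<in> I" for c p
  proof -
    have "c \<odot>\<^bsub>?F\<^esub> p = (c \<odot>\<^bsub>?F\<^esub> \<one>\<^bsub>?F\<^esub>) \<otimes>\<^bsub>?F\<^esub> p" using in_F[OF that] by simp
    then show ?thesis using ideal.I_l_closed[OF I that, of "c \<odot>\<^bsub>?F\<^esub> \<one>\<^bsub>?F\<^esub>"] by simp
  qed
  have ad: "p \<in> I \<Longrightarrow> p' \<in> I \<Longrightarrow> p \<oplus>\<^bsub>?F\<^esub> p' \<in> I" for p p'
    using additive_subgroup.a_closed[OF ideal.axioms(1)[OF I]] .
  let ?r = "word v \<ominus>\<^bsub>?F\<^esub> c \<odot>\<^bsub>?F\<^esub> word v'"
  have "word v = ?r \<oplus>\<^bsub>?F\<^esub> c \<odot>\<^bsub>?F\<^esub> word v'" "word v' = (1 / c) \<odot>\<^bsub>?F\<^esub> (word v \<oplus>\<^bsub>?F\<^esub> (- 1) \<odot>\<^bsub>?F\<^esub> ?r)"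
    by (rule FA.forms_separate; use c in \<open>simp add: word_in FA.linear_formsD\<close>)+
  then show ?thesis using ad sm r by metis
qed

lemma alt_concat: "concat (replicate m [i, flip i]) = alt i (2 * m)"
  by (induction m) auto

text \<open>After a letter l is put in front, the two alternating words of length n are still
  proportional modulo I, and one of them now begins with l l. So I contains the alternating words of
  length n + 1, while all other long words contain a square.\<close>

lemma alternating_tail:
  assumes I: "ideal I free_alg" and sq: "\<And>l. word [l, l] \<in> (I :: (letter list \<Rightarrow> 'k::field) set)"
    and r: "word (alt LX n) \<ominus>\<^bsub>free_alg\<^esub> c \<odot>\<^bsub>free_alg\<^esub> word (alt LY n) \<in> I" "c \<noteq> 0" and n: "n \<ge> 1"
  shows "free_quot I (Suc n)"
proof (rule free_quot.intro[OF I])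
  fix w :: "letter list" assume w: "Suc n \<le> length w"
  have rp: "word (a @ [l, l] @ b) \<in> I" for a l b by (rule ideal_word_zero[OF I sq])
  obtain k where k: "n = Suc k" using n by (cases n) auto
  have top: "word (alt i (Suc n)) \<in> I" for i
  proof -
    have "word (l # alt LX n) \<in> I \<longleftrightarrow> word (l # alt LY n) \<in> I" for l
      using ideal_word_cong[OF I ideal_word_context[OF I r(1), of "[l]" "[]"] r(2)] by simp
    moreover have "word (l # alt l n) \<in> I" for l using rp[of "[]" l "alt (flip l) k"] by (simp add: k)
    ultimately show ?thesis by (cases i) auto
  qed
  have e: "Suc n + (length w - Suc n) = length w" using w by simp
  have "word (alt i (length w)) \<in> I" for i
    using alt_add[of i "Suc n" "length w - Suc n", unfolded e] ideal_word_zero[OF I top, of "[]" i] by (simp del: alt.simps)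
  then show "word w \<in> I" using alt_or_repeat[of w LX] rp by metis
qed

text \<open>All that is retained of the shape of I: it contains all long words, and it satisfies one
  of three short systems of relations, the first for \<open>ideal2\<close> and
  \<open>ideal4\<close>, the second for \<open>ideal1\<close>, the third for
  \<open>ideal3\<close>.\<close>

lemma tame_ideal:
  assumes "I \<in> tame_ideals"
  shows "(\<exists>N. free_quot I N) \<and>
    (word [LX, LX] \<in> I \<and> word [LY, LY] \<in> I \<or>
     word [LX, LY] \<in> I \<and> word [LX, LX] \<ominus>\<^bsub>free_alg\<^esub> word [LY, LY] \<in> I \<or>
     word [LX, LY] \<in> I \<and> word [LY, LX] \<in> I \<and>
       (\<exists>n\<ge>1. word (replicate n LX) \<ominus>\<^bsub>free_alg\<^esub> word (replicate n LY) \<in> (I :: (letter list \<Rightarrow> 'k::field) set)))"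
proof -
  let ?F = "free_alg :: ('k, letter list \<Rightarrow> 'k) module"
  note gen = gen_word word_mult word_power append.simps
  have idl: "ideal (Idl\<^bsub>?F\<^esub> S) ?F" "S \<subseteq> Idl\<^bsub>?F\<^esub> S" if "S \<subseteq> carrier ?F" for S
    by (rule FA.genideal_ideal[OF that], rule FA.genideal_self[OF that])
  have cr: "concat (replicate n [l]) = replicate n l" for n and l :: letter by (induction n) auto
  from assms consider (1) a where "a \<noteq> 0" "I = ideal1 a" | (2) a m where "a \<noteq> 0" "m \<ge> 1" "I = ideal2 a m"
    | (3) n where "n \<ge> 2" "I = ideal3 n" | (4) m where "m \<ge> 1" "I = ideal4 m"
    by (auto simp: tame_ideals_def)
  then show ?thesis
  proof cases
    case (1 a)
    let ?S = "{word [LX, LX] \<ominus>\<^bsub>?F\<^esub> word [LY, LY], word [LY, LX] \<ominus>\<^bsub>?F\<^esub> a \<odot>\<^bsub>?F\<^esub> word [LX, LX], word [LX, LY]}"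
    have I: "I = Idl\<^bsub>?F\<^esub> ?S" by (simp add: 1 ideal1_def Let_def gen)
    have S: "?S \<subseteq> carrier ?F" by (simp add: word_in)
    have id: "ideal I ?F" and g: "?S \<subseteq> I" using idl[OF S] I by auto
    have xx: "word [LX, LX] \<ominus>\<^bsub>?F\<^esub> 1 \<odot>\<^bsub>?F\<^esub> word [LY, LY] \<in> I" using g by (simp add: word_in)
    have yx: "word [LY, LX] \<ominus>\<^bsub>?F\<^esub> a \<odot>\<^bsub>?F\<^esub> word [LX, LX] \<in> I" using g by simp
    have xy: "word [LX, LY] \<in> I" using g by simp
    have z: "word (u @ [LX, LY] @ v) \<in> I" for u v by (rule ideal_word_zero[OF id xy])
    \<comment> \<open>Multiply x^2 - y^2 by x from the left and use that x y is in I; the other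
      words of length three follow in the same way.\<close>
    have xxx: "word [LX, LX, LX] \<in> I"
      using ideal_word_cong[OF id ideal_word_context[OF id xx, of "[LX]" "[]"]] z[of "[]" "[LY]"] by simp
    have yyx: "word [LY, LY, LX] \<in> I"
      using ideal_word_cong[OF id ideal_word_context[OF id xx, of "[]" "[LX]"]] xxx by simp
    have yyy: "word [LY, LY, LY] \<in> I"
      using ideal_word_cong[OF id ideal_word_context[OF id xx, of "[]" "[LY]"]] z[of "[LX]" "[]"] by simp
    have yxx: "word [LY, LX, LX] \<in> I"
      using ideal_word_cong[OF id ideal_word_context[OF id yx, of "[]" "[LX]"] 1(1)] xxx by simp
    have three: "word [i, j, k] \<in> I" for i j k
      by (cases i; cases j; cases k)
        (use xxx yyx yyy yxx z[of "[]" "[LX]"] z[of "[]" "[LY]"] z[of "[LX]" "[]"] z[of "[LY]" "[]"] in auto)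
    have "word w \<in> I" if "3 \<le> length w" for w
    proof -
      obtain i j k v where "w = [] @ [i, j, k] @ v"
        using \<open>3 \<le> length w\<close> by (auto simp: numeral_3_eq_3 Suc_le_length_iff)
      then show ?thesis using ideal_word_zero[OF id three, of "[]" i j k v] by simp
    qed
    then have "free_quot I 3" by (intro free_quot.intro id)
    then show ?thesis using g by blast
  next
    case (2 a m)
    let ?S = "{word [LX, LX], word [LY, LY], word (alt LX (2 * m)) \<ominus>\<^bsub>?F\<^esub> a \<odot>\<^bsub>?F\<^esub> word (alt LY (2 * m))}"
    have I: "I = Idl\<^bsub>?F\<^esub> ?S"
      using alt_concat[of m LX] alt_concat[of m LY] by (simp add: 2 ideal2_def Let_def gen)
    have S: "?S \<subseteq> carrier ?F" by (simp add: word_in)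
    have id: "ideal I ?F" and g: "?S \<subseteq> I" using idl[OF S] I by auto
    have sq: "word [l, l] \<in> I" for l using g by (cases l) auto
    have "free_quot I (Suc (2 * m))"
      by (rule alternating_tail[OF id sq _ 2(1)]) (use g 2(2) in auto)
    then show ?thesis using g by blast
  next
    case (3 n)
    let ?S = "{word (replicate n LX) \<ominus>\<^bsub>?F\<^esub> word (replicate n LY), word [LX, LY], word [LY, LX]}"
    have I: "I = Idl\<^bsub>?F\<^esub> ?S" by (simp add: 3 ideal3_def Let_def gen cr)
    have S: "?S \<subseteq> carrier ?F" by (simp add: word_in)
    have id: "ideal I ?F" and g: "?S \<subseteq> I" using idl[OF S] I by auto
    have xx: "word (replicate n LX) \<ominus>\<^bsub>?F\<^esub> 1 \<odot>\<^bsub>?F\<^esub> word (replicate n LY) \<in> I" using g by (simp add: word_in)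
    have z: "word (u @ [i, flip i] @ v) \<in> I" for u i v
      by (rule ideal_word_zero[OF id]) (use g in \<open>cases i; auto\<close>)
    obtain k where k: "n = Suc k" using 3 by (cases n) auto
    have top: "word (replicate (Suc n) i) \<in> I" for i
    proof -
      \<comment> \<open>For l = LX the second word contains x y, so the first, a power of x, lies in
        I; for l = LY the roles are exchanged.\<close>
      have "word (l # replicate n LX) \<in> I \<longleftrightarrow> word (l # replicate n LY) \<in> I" for l
        using ideal_word_cong[OF id ideal_word_context[OF id xx, of "[l]" "[]"]] by simp
      moreover have "word (l # replicate n (flip l)) \<in> I" for l using z[of "[]" l "replicate k (flip l)"] by (simp add: k)
      ultimately show ?thesis by (cases i) (metis flip.simps replicate_Suc)+
    qed
    have rep: "w = replicate (length w) i \<or> (\<exists>u j v. w = u @ [j, flip j] @ v)" if "w \<noteq> [] \<longrightarrow> hd w = i" for w i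
      using that
    proof (induction w arbitrary: i)
      case (Cons j w)
      show ?case
      proof (cases "w \<noteq> [] \<and> hd w \<noteq> j")
        case True
        then have "j # w = [] @ [j, flip j] @ tl w" using neq_flip[of j "hd w"] by (cases w) auto
        then show ?thesis by blast
      next
        case False
        then consider "w = replicate (length w) j" | u k v where "w = u @ [k, flip k] @ v" using Cons.IH[of j] by blast
        then show ?thesis
        proof cases
          case 1 then show ?thesis using Cons.prems by simp
        next
          case (2 u k v)
          then have "j # w = (j # u) @ [k, flip k] @ v" by simp
          then show ?thesis by blast
        qed
      qed
    qed simp
    have "word w \<in> I" if w: "Suc n \<le> length w" for w
    proof -
      from rep[of w "hd w"] consider "w = replicate (length w) (hd w)" | u j v where "w = u @ [j, flip j] @ v" by blast
      then show ?thesis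
      proof cases
        case 1
        have "w = [] @ replicate (Suc n) (hd w) @ replicate (length w - Suc n) (hd w)"
          using 1 w by (metis append_Nil le_add_diff_inverse replicate_add)
        then show ?thesis using ideal_word_zero[OF id top] by metis
      next
        case 2 then show ?thesis using z by simp
      qed
    qed
    then have "free_quot I (Suc n)" by (intro free_quot.intro id)
    moreover have "n \<ge> 1" using 3 by simp
    ultimately show ?thesis using g by blast
  next
    case (4 m)
    let ?S = "{word [LX, LX], word [LY, LY], word (alt LX (2 * m + 1)) \<ominus>\<^bsub>?F\<^esub> word (alt LY (2 * m + 1))}"
    have al: "alt i (2 * m + 1) = alt i (2 * m) @ [i]" for i using alt_add[of i "2 * m" 1] by simp
    have I: "I = Idl\<^bsub>?F\<^esub> ?S"
      using alt_concat[of m LX] alt_concat[of m LY] unfolding al by (simp add: 4 ideal4_def Let_def gen)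
    have S: "?S \<subseteq> carrier ?F" by (simp add: word_in)
    have id: "ideal I ?F" and g: "?S \<subseteq> I" using idl[OF S] I by auto
    have sq: "word [l, l] \<in> I" for l using g by (cases l) auto
    have "free_quot I (Suc (2 * m + 1))"
      by (rule alternating_tail[OF id sq, where c = 1]) (use g in \<open>auto simp: word_in simp del: alt.simps\<close>)
    then show ?thesis using g by blast
  qed
qed

lemma ideal2_eq: "ideal2 a m = Idl\<^bsub>free_alg\<^esub> {word [LX, LX], word [LY, LY],
    word (alt LX (2 * m)) \<ominus>\<^bsub>free_alg\<^esub> a \<odot>\<^bsub>free_alg\<^esub> (word (alt LY (2 * m)) :: letter list \<Rightarrow> 'k::field)}"
  using alt_concat[of m LX] alt_concat[of m LY]
  by (simp add: ideal2_def Let_def gen_word word_mult word_power)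

context tame_core
begin

section \<open>The dual of the braided Hopf algebra\<close>

lemma ideal2_s:
  shows "ideal (ideal2 s m) free_alg" "word [l, l] \<in> ideal2 s m"
    "word (alt LX (2 * m)) \<ominus>\<^bsub>free_alg\<^esub> s \<odot>\<^bsub>free_alg\<^esub> word (alt LY (2 * m)) \<in> ideal2 s m"
proof -
  let ?S = "{word [LX, LX], word [LY, LY], word (alt LX (2 * m)) \<ominus>\<^bsub>free_alg\<^esub> s \<odot>\<^bsub>free_alg\<^esub> word (alt LY (2 * m))}"
  have S: "?S \<subseteq> carrier free_alg" by (simp add: word_in)
  show "ideal (ideal2 s m) free_alg" unfolding ideal2_eq by (rule FA.genideal_ideal[OF S])
  have g: "?S \<subseteq> ideal2 s m" unfolding ideal2_eq by (rule FA.genideal_self[OF S])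
  then show "word [l, l] \<in> ideal2 s m" by (cases l) auto
  show "word (alt LX (2 * m)) \<ominus>\<^bsub>free_alg\<^esub> s \<odot>\<^bsub>free_alg\<^esub> word (alt LY (2 * m)) \<in> ideal2 s m" using g by blast
qed

sublocale J: free_quot "ideal2 s m" "Suc (2 * m)"
  by (rule alternating_tail[OF ideal2_s s_nonzero]) (use m(1) in simp)

lemma R_forms_eqI:
  assumes "\<phi> \<in> linear_forms (braided_R H)" "\<psi> \<in> linear_forms (braided_R H)" "\<And>w. \<phi> (U w) = \<psi> (U w)" "r \<in> ws"
  shows "\<phi> r = \<psi> r"
proof -
  obtain p where p: "finite {w. p w \<noteq> 0}" "r = ev p" using ev_surj[OF assms(4)] by blast
  show ?thesis unfolding p(2) form_ev[OF assms(1) p(1) subset_refl] form_ev[OF assms(2) p(1) subset_refl] assms(3) ..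
qed

definition \<omega> :: "letter list \<Rightarrow> (nat \<Rightarrow> 'h set) \<Rightarrow> 'k" where
  "\<omega> p = (SOME \<phi>. \<phi> \<in> linear_forms (braided_R H) \<and> (\<forall>w. W p w = \<phi> (U w)))"

lemma \<omega>: "\<omega> p \<in> linear_forms (braided_R H)" "\<omega> p (U w) = W p w"
proof -
  have "\<exists>\<phi>. \<phi> \<in> linear_forms (braided_R H) \<and> (\<forall>w. W p w = \<phi> (U w))"
    using W_desc[of p] unfolding descends_def by blast
  from someI_ex[OF this, folded \<omega>_def] show "\<omega> p \<in> linear_forms (braided_R H)" "\<omega> p (U w) = W p w" by auto
qed

lemma W_repeat: "W p (a @ [i, i] @ b) = 0"
  by (rule descends_repeat[OF W_desc])

text \<open>By degree only words of length 2 m matter, and a repetition gives 0. At the word that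
  begins with y the ratio is s by \<open>W_alt\<close>; at the one that begins with x it is s
  because of \<open>Qq ^ m = 1\<close>.\<close>

lemma W_relation: "W (alt LX (2 * m)) w = s * W (alt LY (2 * m)) w"
proof (cases "length w = 2 * m")
  case True
  obtain k where k: "m = Suc k" using m(1) by (cases m) auto
  have e: "2 * m = 2 * k + 2" by (simp add: k)
  have sk: "s = (- 1) ^ k * q LY LX ^ (k + 1)" by (simp add: s_def k)
  have sg: "(- 1) ^ k * ((- 1) ^ k * x) = x" for x :: 'k
    by (simp flip: power_add mult.assoc mult_2)
  have Q: "q LX LY ^ (k + 1) * q LY LX ^ (k + 1) = 1"
    using m(2) by (simp only: power_mult_distrib[symmetric] Qq_def k Suc_eq_plus1)
  from alt_or_repeat[of w LX] consider "w = alt LX (2 * m)" | "w = alt LY (2 * m)" | a i b where "w = a @ [i, i] @ b"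
    unfolding True flip.simps by blast
  then show ?thesis
  proof cases
    case 1
    have "s * W (alt LY (2 * m)) w = (q LX LY ^ (k + 1) * q LY LX ^ (k + 1)) * qfac k"
      unfolding 1 e sk using W_alt(4)[of LX k] sg[of "q LX LY ^ (k + 1) * q LY LX ^ (k + 1) * qfac k"]
      by (simp only: flip.simps mult_ac)
    then show ?thesis using W_alt(3)[of LX k] by (simp only: Q 1 e mult_1_left)
  next
    case 2
    then show ?thesis using W_alt(3)[of LY k] W_alt(4)[of LY k] by (simp only: e sk flip.simps)
  next
    case (3 a i b)
    then show ?thesis by (simp only: W_repeat mult_zero_right)
  qed
qed (simp add: W_degree)

lemma W_square: "W [l, l] w = 0"
proof (cases "length w = 2")
  case True
  then obtain i j where w: "w = [i, j]" by (auto simp: numeral_2_eq_2 length_Suc_conv)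
  have "cnv q (ind l) unt = (ind l :: letter list \<Rightarrow> 'k)" by (rule ext) (rule cnv_unt)
  then have "W [l, l] [i, j] = cnv q (ind l) (ind l) [i, j]" by simp
  then show ?thesis by (simp add: w cnv_two q_diag)
qed (simp add: W_degree del: cw.simps)

text \<open>The elements annihilated at every w form a two-sided ideal, because \<open>W\<close>
  turns concatenation into convolution, and the three generators belong to it.\<close>

lemma pair_ideal2: "p \<in> ideal2 s m \<Longrightarrow> pair (\<lambda>v. W v w) p = 0"
proof -
  let ?F = "free_alg :: ('k, letter list \<Rightarrow> 'k) module"
  define K where "K = {p \<in> carrier ?F. \<forall>w. pair (\<lambda>v. W v w) p = 0}"
  have left: "pair (\<lambda>v. W v w) (x \<otimes>\<^bsub>?F\<^esub> a) = (\<Sum>u | x u \<noteq> 0. x u * cnv q (W u) (\<lambda>w. pair (\<lambda>v. W v w) a) w)"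
    if "x \<in> carrier ?F" "a \<in> carrier ?F" for x a w
  proof -
    have 1: "pair (\<lambda>v. W v w) (word u \<otimes>\<^bsub>?F\<^esub> a) = cnv q (W u) (\<lambda>w. pair (\<lambda>v. W v w) a) w" for u
    proof -
      have fin: "finite {v. a v \<noteq> 0}" using that by (simp add: free_alg_simps)
      have "pair (\<lambda>v. W v w) (word u \<otimes>\<^bsub>?F\<^esub> a) = (\<Sum>v | a v \<noteq> 0. a v * pair (\<lambda>v. W v w) (word u \<otimes>\<^bsub>?F\<^esub> word v))"
        by (rule form_word_sum[OF FA.mult_form(2)[OF pair_form word_in] fin subset_refl])
      also have "\<dots> = (\<Sum>v | a v \<noteq> 0. cnv q (W u) (\<lambda>w. a v * W v w) w)"
        by (simp add: word_mult cw_append cnv_lin(4))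
      also have "\<dots> = cnv q (W u) (\<lambda>w. \<Sum>v | a v \<noteq> 0. a v * W v w) w"
        by (rule cnv_lin(6)[OF fin, symmetric])
      finally show ?thesis by (simp add: pair_def)
    qed
    show ?thesis
      using form_word_sum[OF FA.mult_form(1)[OF pair_form that(2)] _ subset_refl, of x "\<lambda>v. W v w"] that(1)
      by (simp add: 1 free_alg_simps(1))
  qed
  have right: "pair (\<lambda>v. W v w) (a \<otimes>\<^bsub>?F\<^esub> x) = (\<Sum>u | x u \<noteq> 0. x u * cnv q (\<lambda>w. pair (\<lambda>v. W v w) a) (W u) w)"
    if "x \<in> carrier ?F" "a \<in> carrier ?F" for x a w
  proof -
    have 1: "pair (\<lambda>v. W v w) (a \<otimes>\<^bsub>?F\<^esub> word u) = cnv q (\<lambda>w. pair (\<lambda>v. W v w) a) (W u) w" for u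
    proof -
      have fin: "finite {v. a v \<noteq> 0}" using that by (simp add: free_alg_simps)
      have "pair (\<lambda>v. W v w) (a \<otimes>\<^bsub>?F\<^esub> word u) = (\<Sum>v | a v \<noteq> 0. a v * pair (\<lambda>v. W v w) (word v \<otimes>\<^bsub>?F\<^esub> word u))"
        by (rule form_word_sum[OF FA.mult_form(1)[OF pair_form word_in] fin subset_refl])
      also have "\<dots> = (\<Sum>v | a v \<noteq> 0. cnv q (\<lambda>w. a v * W v w) (W u) w)"
        by (simp add: word_mult cw_append cnv_lin(3))
      also have "\<dots> = cnv q (\<lambda>w. \<Sum>v | a v \<noteq> 0. a v * W v w) (W u) w"
        by (rule cnv_lin(5)[OF fin, symmetric])
      finally show ?thesis by (simp add: pair_def)
    qed
    show ?thesis
      using form_word_sum[OF FA.mult_form(2)[OF pair_form that(2)] _ subset_refl, of x "\<lambda>v. W v w"] that(1)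
      by (simp add: 1 free_alg_simps(1))
  qed
  have "ideal K ?F"
  proof (rule idealI[OF FA.ring_axioms])
    show "subgroup K (add_monoid ?F)"
    proof (rule FA.add.subgroupI)
      show "K \<subseteq> carrier ?F" by (auto simp: K_def)
      have "\<zero>\<^bsub>?F\<^esub> \<in> K" by (simp add: K_def FA.linear_formsD(3)[OF pair_form])
      then show "K \<noteq> {}" by blast
      fix a assume a: "a \<in> K"
      then show "\<ominus>\<^bsub>?F\<^esub> a \<in> K"
        using FA.linear_formsD(4)[OF pair_form FA.zero_closed, of a] by (simp add: K_def FA.minus_eq FA.linear_formsD(3)[OF pair_form])
      show "a \<oplus>\<^bsub>?F\<^esub> b \<in> K" if "b \<in> K" for b
        using a that by (simp add: K_def FA.linear_formsD(1)[OF pair_form])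
    qed
    fix a x assume a: "a \<in> K" and x: "x \<in> carrier ?F"
    have z: "(\<lambda>w. pair (\<lambda>v. W v w) a) = (\<lambda>w. 0)" and aF: "a \<in> carrier ?F" using a by (auto simp: K_def)
    show "x \<otimes>\<^bsub>?F\<^esub> a \<in> K" using x aF by (simp add: K_def left z cnv_zero)
    show "a \<otimes>\<^bsub>?F\<^esub> x \<in> K" using x aF by (simp add: K_def right z cnv_zero)
  qed
  moreover have "{word [LX, LX], word [LY, LY], word (alt LX (2 * m)) \<ominus>\<^bsub>?F\<^esub> s \<odot>\<^bsub>?F\<^esub> word (alt LY (2 * m))} \<subseteq> K"
    using W_square W_relation by (simp add: K_def word_in FA.linear_formsD[OF pair_form] del: cw.simps)
  ultimately have "ideal2 s m \<subseteq> K" unfolding ideal2_eq by (rule FA.genideal_minimal)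
  then show "p \<in> ideal2 s m \<Longrightarrow> pair (\<lambda>v. W v w) p = 0" by (auto simp: K_def)
qed

text \<open>A spanning set of 4 m words for R and for the quotient alike. Of the two proportional
  words of length 2 m only the one that begins with x is kept.\<close>

definition nf :: "letter list set" where
  "nf = insert (alt LX (2 * m)) {alt i n | i n. n < 2 * m}"

lemma finite_nf: "finite nf"
proof (rule finite_subset)
  show "nf \<subseteq> (\<Union>n<Suc (2 * m). {p. length p = n})" by (auto simp: nf_def simp del: alt.simps)
qed (simp add: finite_words)

text \<open>Collects the terms of a polynomial according to the normal form g w of each
  word.\<close>

lemma regroup:
  fixes h :: "letter list \<Rightarrow> 'k"
  assumes "finite A" "\<And>w. g w \<in> nf"
  shows "(\<Sum>w\<in>A. p w * (b w * h (g w))) = (\<Sum>v\<in>nf. (\<Sum>w | w \<in> A \<and> g w = v. p w * b w) * h v)"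
proof -
  have "(\<Sum>w\<in>A. p w * (b w * h (g w))) = (\<Sum>v\<in>nf. \<Sum>w | w \<in> A \<and> g w = v. p w * (b w * h (g w)))"
    by (rule sum.group[symmetric, OF assms(1) finite_nf]) (use assms(2) in auto)
  also have "\<dots> = (\<Sum>v\<in>nf. (\<Sum>w | w \<in> A \<and> g w = v. p w * b w) * h v)"
    by (intro sum.cong refl) (simp add: sum_distrib_right mult.assoc)
  finally show ?thesis .
qed

lemma U_nf: "\<exists>c. \<exists>v\<in>nf. U w = c \<odot>\<^bsub>gr H\<^esub> U v"
proof -
  have nf: "[] \<in> nf" "alt LX (2 * m) \<in> nf" using m(1) by (auto simp: nf_def intro!: exI[of _ 0])
  have z: ?thesis if "U w = \<zero>\<^bsub>gr H\<^esub>" using that nf(1) U_in[of "[]"] by (intro exI[of _ 0] bexI[of _ "[]"]) (simp_all del: U.simps)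
  have a: ?thesis if w: "w = alt i (length w)" for i
  proof -
    consider "length w < 2 * m" | "length w = 2 * m" | "2 * m < length w" by linarith
    then show ?thesis
    proof cases
      case 1
      then have "w \<in> nf" using w by (auto simp: nf_def)
      then show ?thesis by (intro exI[of _ 1] bexI[of _ w]) (simp_all add: U_in)
    next
      case 2
      have "U w = (if i = LX then 1 else s) \<odot>\<^bsub>gr H\<^esub> U (alt LX (2 * m))"
        using w unfolding 2 by (cases i) (simp_all add: U_top U_in del: alt.simps)
      then show ?thesis using nf(2) by blast
    next
      case 3
      then show ?thesis using z U_long[of "length w" i] w by simp
    qed
  qed
  show ?thesis using alt_or_repeat[of w LX] a z U_repeat by metis
qed

lemma cl_nf: "\<exists>c. \<exists>v\<in>nf. \<forall>\<phi>\<in>linear_forms J.B. \<phi> (J.cl (word w)) = c * \<phi> (J.cl (word v))"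
proof -
  have nf: "[] \<in> nf" "alt LX (2 * m) \<in> nf" using m(1) by (auto simp: nf_def intro!: exI[of _ 0])
  have z: ?thesis if "word w \<in> ideal2 s m"
    using that nf(1) by (intro exI[of _ 0] bexI[of _ "[]"]) (simp_all add: J.form_I)
  have a: ?thesis if w: "w = alt i (length w)" for i
  proof -
    consider "length w < 2 * m" | "length w = 2 * m" | "2 * m < length w" by linarith
    then show ?thesis
    proof cases
      case 1
      then have "w \<in> nf" using w by (auto simp: nf_def)
      then show ?thesis by (intro exI[of _ 1] bexI[of _ w]) simp_all
    next
      case 2
      \<comment> \<open>Here s stands with the word that begins with y, whereas in
        \<open>U_top\<close> it stands with the other one; so reduction to normal form costs 1 / s
        here and s there.\<close>
      have e: "\<phi> (J.cl (word (alt LX (2 * m)))) = s * \<phi> (J.cl (word (alt LY (2 * m))))" if "\<phi> \<in> linear_forms J.B" for \<phi>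
        using J.form_I[OF that ideal2_s(3)] by (simp add: FA.linear_formsD[OF J.cl_form[OF that]] word_in)
      have "\<phi> (J.cl (word w)) = (if i = LX then 1 else 1 / s) * \<phi> (J.cl (word (alt LX (2 * m))))"
        if "\<phi> \<in> linear_forms J.B" for \<phi>
        using w e[OF that] s_nonzero unfolding 2 by (cases i) (simp_all del: alt.simps)
      then show ?thesis using nf(2) by blast
    next
      case 3
      then show ?thesis using z J.tail[of w] by simp
    qed
  qed
  have "word (u @ [j, j] @ v) \<in> ideal2 s m" for u j v by (rule ideal_word_zero[OF ideal2_s(1,2)])
  then show ?thesis using alt_or_repeat[of w LX] a z by metis
qed

lemma R_nf:
  assumes "r \<in> ws"
  obtains d where "\<And>\<phi>. \<phi> \<in> linear_forms (braided_R H) \<Longrightarrow> \<phi> r = (\<Sum>v\<in>nf. d v * \<phi> (U v))"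
proof -
  obtain c g where g: "\<And>w. g w \<in> nf" "\<And>w. U w = c w \<odot>\<^bsub>gr H\<^esub> U (g w)" using U_nf by metis
  obtain p where p: "finite {w. p w \<noteq> 0}" "r = ev p" using ev_surj[OF assms] by blast
  show ?thesis
  proof (rule that)
    fix \<phi> assume \<phi>: "\<phi> \<in> linear_forms (braided_R H)"
    have e: "\<phi> (U w) = c w * \<phi> (U (g w))" for w
      using R.linear_formsD(2)[OF \<phi>, of "U (g w)" "c w"] by (simp add: R_simps ws.word flip: g(2))
    have "\<phi> r = (\<Sum>w | p w \<noteq> 0. p w * (c w * \<phi> (U (g w))))"
      unfolding p(2) form_ev[OF \<phi> p(1) subset_refl] by (intro sum.cong refl arg_cong2[of _ _ _ _ "(*)"] e)
    then show "\<phi> r = (\<Sum>v\<in>nf. (\<Sum>w | w \<in> {w. p w \<noteq> 0} \<and> g w = v. p w * c w) * \<phi> (U v))"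
      unfolding regroup[OF p(1) g(1), where h = "\<lambda>v. \<phi> (U v)"] .
  qed
qed

lemma B_nf:
  assumes "x \<in> carrier J.B"
  obtains d where "\<And>\<phi>. \<phi> \<in> linear_forms J.B \<Longrightarrow> \<phi> x = (\<Sum>v\<in>nf. d v * \<phi> (J.cl (word v)))"
proof -
  obtain c g where g: "\<And>w. g w \<in> nf"
    "\<And>w \<phi>. \<phi> \<in> linear_forms J.B \<Longrightarrow> \<phi> (J.cl (word w)) = c w * \<phi> (J.cl (word (g w)))" using cl_nf by metis
  obtain p where p: "p \<in> carrier free_alg" "x = J.cl p" using assms by (auto simp: J.B_simps(1))
  have fin: "finite {w. p w \<noteq> 0}" using p(1) by (simp add: free_alg_simps)
  show ?thesis
  proof (rule that)
    fix \<phi> assume \<phi>: "\<phi> \<in> linear_forms J.B"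
    have "\<phi> x = (\<Sum>w | p w \<noteq> 0. p w * \<phi> (J.cl (word w)))"
      using J.form_cl[OF \<phi> p(1)] p(2) by (simp add: pair_def)
    also have "\<dots> = (\<Sum>w | p w \<noteq> 0. p w * (c w * \<phi> (J.cl (word (g w)))))"
      by (intro sum.cong refl arg_cong2[of _ _ _ _ "(*)"] g(2)[OF \<phi>])
    finally show "\<phi> x = (\<Sum>v\<in>nf. (\<Sum>w | w \<in> {w. p w \<noteq> 0} \<and> g w = v. p w * c w) * \<phi> (J.cl (word v)))"
      unfolding regroup[OF fin g(1), where h = "\<lambda>v. \<phi> (J.cl (word v))"] .
  qed
qed

text \<open>The pairing is block diagonal with respect to length. Each length from 1 to 2 m - 1 has
  a two by two block of determinant a^2 (1 - x(LX) x(LY)); the lengths 0 and 2 m have blocks of size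
  one.\<close>

lemma block_nondegenerate:
  fixes G :: "letter list \<Rightarrow> letter list \<Rightarrow> 'k"
  assumes deg: "\<And>p v. length p \<noteq> length v \<Longrightarrow> G p v = 0"
    and nil: "G [] [] \<noteq> 0" and top: "G (alt LX (2 * m)) (alt LX (2 * m)) \<noteq> 0"
    and block: "\<And>n. 1 \<le> n \<Longrightarrow> n < 2 * m \<Longrightarrow> \<exists>a x. a \<noteq> 0 \<and> x LX * x LY \<noteq> 1 \<and>
      (\<forall>i. G (alt i n) (alt i n) = a \<and> G (alt (flip i) n) (alt i n) = x i * a)"
    and z: "\<And>v. v \<in> nf \<Longrightarrow> (\<Sum>p\<in>nf. y p * G p v) = 0"
    and p: "p \<in> nf"
  shows "y p = 0"
proof -
  have red: "(\<Sum>p | p \<in> nf \<and> length p = length v. y p * G p v) = 0" if "v \<in> nf" for v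
  proof -
    have "(\<Sum>p\<in>nf. y p * G p v) = (\<Sum>p | p \<in> nf \<and> length p = length v. y p * G p v)"
      by (rule sum.mono_neutral_right[OF finite_nf]) (auto simp: deg)
    then show ?thesis using z[OF that] by simp
  qed
  consider "p = alt LX (2 * m)" | "p = []" | i n where "p = alt i n" "1 \<le> n" "n < 2 * m"
  proof -
    assume a: "p = alt LX (2 * m) \<Longrightarrow> thesis" "p = [] \<Longrightarrow> thesis"
      "\<And>i n. p = alt i n \<Longrightarrow> 1 \<le> n \<Longrightarrow> n < 2 * m \<Longrightarrow> thesis"
    from p consider "p = alt LX (2 * m)" | i n where "p = alt i n" "n < 2 * m" by (auto simp: nf_def)
    then show thesis
    proof cases
      case (2 i n) then show thesis using a(2) a(3)[of i n] by (cases n) auto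
    qed (rule a(1))
  qed
  then show ?thesis
  proof cases
    case 1
    have "{p \<in> nf. length p = length (alt LX (2 * m))} = {alt LX (2 * m)}" by (auto simp: nf_def simp del: alt.simps)
    then show ?thesis using red[OF p] top unfolding 1 by simp
  next
    case 2
    have "{p \<in> nf. length p = length ([] :: letter list)} = {[]}" using p 2 by auto
    then show ?thesis using red[OF p] nil unfolding 2 by simp
  next
    case (3 i n)
    obtain a x where ax: "a \<noteq> 0" "x LX * x LY \<noteq> 1"
      "\<And>i. G (alt i n) (alt i n) = a" "\<And>i. G (alt (flip i) n) (alt i n) = x i * a" using block[OF 3(2,3)] by blast
    have xx: "x i * x (flip i) \<noteq> 1" for i using ax(2) by (cases i) (simp_all add: mult.commute)
    have in_nf: "alt i n \<in> nf" for i using 3 by (auto simp: nf_def)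
    have ne: "alt (flip i) n \<noteq> alt i n" for i using 3 by (cases n) auto
    have eq: "y (alt i n) + x i * y (alt (flip i) n) = 0" for i
    proof -
      have e: "{p \<in> nf. length p = length (alt i n)} = {alt i n, alt (flip i) n}"
      proof (intro Set.set_eqI iffI)
        fix p' assume "p' \<in> {p \<in> nf. length p = length (alt i n)}"
        then obtain j where "p' = alt j n" using 3 by (auto simp: nf_def simp del: alt.simps)
        then show "p' \<in> {alt i n, alt (flip i) n}" using neq_flip[of i j] by (cases "j = i") auto
      qed (use in_nf in auto)
      have "(y (alt i n) + x i * y (alt (flip i) n)) * a = 0"
        using red[OF in_nf[of i]] ne[of i] unfolding e by (simp add: ax algebra_simps)
      then show ?thesis using ax(1) by simp
    qed
    have "(1 - x i * x (flip i)) * y (alt i n) = (y (alt i n) + x i * y (alt (flip i) n)) -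
        x i * (y (alt (flip i) n) + x (flip i) * y (alt (flip (flip i)) n))"
      by (simp add: algebra_simps)
    also have "\<dots> = 0" unfolding eq by simp
    finally show ?thesis using xx[of i] 3(1) by simp
  qed
qed

text \<open>In odd length the block is diagonal. In even length 2 k + 2 the product of the
  off-diagonal ratios is \<open>Qq ^ (k + 1)\<close>, which is not 1 because k + 1 < m. Transposing
  the block exchanges the two ratios.\<close>

lemma W_block:
  assumes "1 \<le> n" "n < 2 * m"
  shows "\<exists>a x. a \<noteq> 0 \<and> x LX * x LY \<noteq> 1 \<and> (\<forall>i. W (alt i n) (alt i n) = a \<and> W (alt (flip i) n) (alt i n) = x i * a)"
    "\<exists>a x. a \<noteq> 0 \<and> x LX * x LY \<noteq> 1 \<and> (\<forall>i. W (alt i n) (alt i n) = a \<and> W (alt i n) (alt (flip i) n) = x i * a)"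
proof -
  have "\<exists>a x. a \<noteq> 0 \<and> x LX * x LY \<noteq> 1 \<and> (\<forall>i. W (alt i n) (alt i n) = a \<and> W (alt (flip i) n) (alt i n) = x i * a)"
  proof (cases "even n")
    case True
    then obtain j where "n = 2 * j" by (rule evenE)
    moreover from this obtain k where "j = Suc k" using assms by (cases j) auto
    ultimately have n: "n = 2 * k + 2" by simp
    then have k: "k < m" "Suc k < m" using assms by auto
    let ?x = "\<lambda>i. (- 1) ^ k * q i (flip i) ^ (k + 1)"
    have "?x LX * ?x LY = ((- 1) ^ k * (- 1) ^ k) * (q LX LY * q LY LX) ^ (k + 1)"
      by (simp add: power_mult_distrib mult_ac)
    also have "\<dots> = Qq ^ Suc k" by (simp add: Qq_def flip: power_add mult_2)
    finally have "?x LX * ?x LY \<noteq> 1" using m(3)[of "Suc k"] k by simp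
    then show ?thesis
      using qfac_nonzero[OF k(1)] W_alt(3)[of _ k] W_alt(4)[of _ k] unfolding n
      by (intro exI[of _ "qfac k"] exI[of _ ?x]) (simp del: alt.simps cw.simps)
  next
    case False
    then obtain k where n: "n = 2 * k + 1" by (auto elim: oddE)
    then have "k < m" using assms by auto
    then show ?thesis
      using qfac_nonzero[of k] W_alt(1)[of _ k] W_alt(2)[of _ k] unfolding n
      by (intro exI[of _ "qfac k"] exI[of _ "\<lambda>_. 0"]) (simp del: alt.simps cw.simps)
  qed
  then show 1: "\<exists>a x. a \<noteq> 0 \<and> x LX * x LY \<noteq> 1 \<and>
    (\<forall>i. W (alt i n) (alt i n) = a \<and> W (alt (flip i) n) (alt i n) = x i * a)" .
  then obtain a x where ax: "a \<noteq> 0" "x LX * x LY \<noteq> 1"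
    "\<And>i. W (alt i n) (alt i n) = a" "\<And>i. W (alt (flip i) n) (alt i n) = x i * a" by blast
  have "W (alt i n) (alt (flip i) n) = x (flip i) * a" for i using ax(4)[of "flip i"] by simp
  then show "\<exists>a x. a \<noteq> 0 \<and> x LX * x LY \<noteq> 1 \<and> (\<forall>i. W (alt i n) (alt i n) = a \<and> W (alt i n) (alt (flip i) n) = x i * a)"
    using ax by (intro exI[of _ a] exI[of _ "\<lambda>i. x (flip i)"]) (simp add: mult.commute)
qed

lemma W_top_nonzero: "W (alt LX (2 * m)) (alt LX (2 * m)) \<noteq> 0"
proof -
  obtain k where "m = Suc k" using m(1) by (cases m) auto
  then show ?thesis using W_alt(3)[of LX k] qfac_nonzero[of k] by simp
qed

text \<open>For the map from R to the dual, the first claim gives surjectivity and the second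
  injectivity.\<close>

lemma W_nondegenerate:
  "(\<And>v. v \<in> nf \<Longrightarrow> (\<Sum>p\<in>nf. y p * W p v) = 0) \<Longrightarrow> p \<in> nf \<Longrightarrow> y p = 0"
  "(\<And>p. p \<in> nf \<Longrightarrow> (\<Sum>v\<in>nf. y v * W p v) = 0) \<Longrightarrow> v \<in> nf \<Longrightarrow> y v = 0"
proof -
  show "(\<And>v. v \<in> nf \<Longrightarrow> (\<Sum>p\<in>nf. y p * W p v) = 0) \<Longrightarrow> p \<in> nf \<Longrightarrow> y p = 0"
    by (rule block_nondegenerate[of W y p]) (use W_degree W_top_nonzero W_block(1) in auto)
  show "(\<And>p. p \<in> nf \<Longrightarrow> (\<Sum>v\<in>nf. y v * W p v) = 0) \<Longrightarrow> v \<in> nf \<Longrightarrow> y v = 0"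
    by (rule block_nondegenerate[of "\<lambda>v p. W p v" y v]) (use W_degree W_top_nonzero W_block(2) in auto)
qed

text \<open>f r takes the class of a word v to \<open>\<omega> v r\<close>; this is well defined by
  \<open>pair_ideal2\<close>. It is compatible with comultiplication because
  \<open>\<omega> (v @ w)\<close> is the convolution of \<open>\<omega> v\<close> and
  \<open>\<omega> w\<close>, and it is bijective because \<open>W\<close> is nondegenerate on normal
  forms.\<close>

theorem dual_iso: "coalg_iso (braided_R H) (dual_quot (ideal2 s m))"
proof -
  let ?R = "braided_R H"
  have "\<exists>\<phi>. \<phi> \<in> carrier J.D \<and> (\<forall>v. \<phi> (J.cl (word v)) = \<omega> v r)" if r: "r \<in> ws" for r
  proof -
    have "pair (\<lambda>v. \<omega> v r) p = 0" if p: "p \<in> ideal2 s m" for p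
    proof (rule R_forms_eqI[OF _ R.linear_form_zero _ r])
      show "(\<lambda>r. pair (\<lambda>v. \<omega> v r) p) \<in> linear_forms ?R"
        unfolding pair_def by (intro R.linear_form_sum R.linear_form_scale \<omega>)
      show "pair (\<lambda>v. \<omega> v (U w)) p = 0" for w using pair_ideal2[OF p] by (simp add: \<omega>(2))
    qed
    then show ?thesis
    proof (rule J.lift_form)
      fix \<phi> assume "\<phi> \<in> carrier J.D" "\<And>p. p \<in> carrier free_alg \<Longrightarrow> \<phi> (J.cl p) = pair (\<lambda>v. \<omega> v r) p"
      then show ?thesis by (intro exI[of _ \<phi>]) (simp add: word_in)
    qed
  qed
  then obtain f where f: "\<And>r. r \<in> ws \<Longrightarrow> f r \<in> carrier J.D" "\<And>r v. r \<in> ws \<Longrightarrow> f r (J.cl (word v)) = \<omega> v r" by metis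
  have D_eqI: "\<phi> = \<psi>" if "\<phi> \<in> carrier J.D" "\<psi> \<in> carrier J.D" "\<And>v. \<phi> (J.cl (word v)) = \<psi> (J.cl (word v))" for \<phi> \<psi>
    by (rule J.D_eqI[OF that(1,2)], rule J.forms_eqI) (use that J.D_form in auto)
  have cl_in: "J.cl (word v) \<in> carrier J.B" for v by (rule J.cl_in[OF word_in])
  have sm: "f (k \<odot>\<^bsub>?R\<^esub> r) = k \<odot>\<^bsub>J.D\<^esub> f r" if r: "r \<in> carrier ?R" for k r
  proof (rule D_eqI)
    show "f (k \<odot>\<^bsub>?R\<^esub> r) \<in> carrier J.D" "k \<odot>\<^bsub>J.D\<^esub> f r \<in> carrier J.D"
      using f(1) r R.smult_closed[OF r, of k] by (simp_all add: R_simps(1))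
    show "f (k \<odot>\<^bsub>?R\<^esub> r) (J.cl (word v)) = (k \<odot>\<^bsub>J.D\<^esub> f r) (J.cl (word v))" for v
      using f(2) r R.smult_closed[OF r, of k] R.linear_formsD(2)[OF \<omega>(1) r, of v k] by (simp add: R_simps(1) J.D_simps cl_in)
  qed
  have ad: "f (r \<oplus>\<^bsub>?R\<^esub> r') = f r \<oplus>\<^bsub>J.D\<^esub> f r'" if r: "r \<in> carrier ?R" and r': "r' \<in> carrier ?R" for r r'
  proof (rule D_eqI)
    show "f (r \<oplus>\<^bsub>?R\<^esub> r') \<in> carrier J.D" "f r \<oplus>\<^bsub>J.D\<^esub> f r' \<in> carrier J.D"
      using f(1) r r' R.a_closed[OF r r'] by (simp_all add: R_simps(1))
    show "f (r \<oplus>\<^bsub>?R\<^esub> r') (J.cl (word v)) = (f r \<oplus>\<^bsub>J.D\<^esub> f r') (J.cl (word v))" for v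
      using f(2) r r' R.a_closed[OF r r'] R.linear_formsD(1)[OF \<omega>(1) r r', of v] by (simp add: R_simps(1) J.D_simps cl_in)
  qed
  have hom: "f \<in> LinearCombinations.module_hom class_ring ?R J.D"
    using sm ad f(1) by (simp add: LinearCombinations.module_hom_def R_simps(1))
  have com: "comult J.D (f r) = tensor_map J.D J.D f f (comult ?R r)" if r: "r \<in> ws" for r
  proof (rule J.comult_D_eqI[OF _ f(1)[OF r]])
    note T = comult_R_tensor[OF r, folded R_simps(1)]
    have val: "tensor_map J.D J.D f f (comult ?R r) \<beta> = comult ?R r (\<lambda>a b. \<beta> (f a) (f b))" if "\<beta> \<in> bilinear_forms J.D J.D" for \<beta>
      using that by (simp add: tensor_map_def)
    obtain n :: nat and a b where ab: "\<And>i. i < n \<Longrightarrow> a i \<in> carrier ?R" "\<And>i. i < n \<Longrightarrow> b i \<in> carrier ?R"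
      "\<And>\<beta>. \<beta> \<in> bilinear_forms ?R ?R \<Longrightarrow> comult ?R r \<beta> = (\<Sum>i<n. \<beta> (a i) (b i))" using T by (rule tensorsE) blast
    show "tensor_map J.D J.D f f (comult ?R r) \<in> tensors J.D J.D (carrier J.D) (carrier J.D)"
    proof (rule tensors_sumI[where I = "{..<n}" and a = "\<lambda>i. f (a i)" and b = "\<lambda>i. f (b i)"])
      show "tensor_map J.D J.D f f (comult ?R r) \<beta> = (\<Sum>i<n. \<beta> (f (a i)) (f (b i)))" if "\<beta> \<in> bilinear_forms J.D J.D" for \<beta>
        unfolding val[OF that] by (rule ab(3)[OF bilinear_form_comp[OF vs_R vs_R hom hom that]])
    qed (use ab f(1) in \<open>auto simp: R_simps(1) tensor_map_def\<close>)
    fix v w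
    note b = bilinear_form_prod[OF vs_R vs_R \<omega>(1)[of v] \<omega>(1)[of w]]
    have "tensor_map J.D J.D f f (comult ?R r) (\<lambda>\<phi> \<psi>. \<phi> (J.cl (word v)) * \<psi> (J.cl (word w))) =
      comult ?R r (\<lambda>a b. f a (J.cl (word v)) * f b (J.cl (word w)))"
      by (rule val[OF J.prod_eval_bilinear[OF cl_in cl_in]])
    also have "\<dots> = comult ?R r (\<lambda>a b. \<omega> v a * \<omega> w b)"
      by (rule tensor_cong[OF vs_R vs_R T]) (simp add: f(2) R_simps(1))
    also have "\<dots> = \<omega> (v @ w) r"
    proof (rule R_forms_eqI[OF comult_R_form[OF b] \<omega>(1) _ r])
      show "comult ?R (U x) (\<lambda>a b. \<omega> v a * \<omega> w b) = \<omega> (v @ w) (U x)" for x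
        unfolding comult_R_word[OF b] by (simp add: \<omega>(2) cw_append cnv_def)
    qed
    finally show "tensor_map J.D J.D f f (comult ?R r) (\<lambda>\<phi> \<psi>. \<phi> (J.cl (word v)) * \<psi> (J.cl (word w))) = f r (J.cl (word (v @ w)))"
      by (simp add: f(2)[OF r])
  qed
  have cou: "counit J.D (f r) = counit ?R r" if r: "r \<in> ws" for r
    unfolding J.counit_D f(2)[OF r]
    by (rule R_forms_eqI[OF \<omega>(1) counit_R_form _ r]) (simp add: \<omega>(2) counit_U unt_def)
  have inj: "inj_on f ws"
  proof (rule inj_onI)
    fix r r' assume r: "r \<in> ws" "r' \<in> ws" "f r = f r'"
    have c: "r \<in> carrier ?R" "r' \<in> carrier ?R" using r by (simp_all add: R_simps(1))
    have "r \<ominus>\<^bsub>?R\<^esub> r' \<in> ws" using R.minus_closed[OF c] by (simp add: R_simps(1))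
    then obtain d where d: "\<And>\<phi>. \<phi> \<in> linear_forms ?R \<Longrightarrow> \<phi> (r \<ominus>\<^bsub>?R\<^esub> r') = (\<Sum>v\<in>nf. d v * \<phi> (U v))" by (rule R_nf) blast
    have "(\<Sum>v\<in>nf. d v * W p v) = 0" for p
    proof -
      have "\<omega> p (r \<ominus>\<^bsub>?R\<^esub> r') = f r (J.cl (word p)) - f r' (J.cl (word p))"
        using R.linear_formsD(4)[OF \<omega>(1) c] f(2) r(1,2) by simp
      then show ?thesis using d[OF \<omega>(1)[of p]] r(3) by (simp add: \<omega>(2))
    qed
    then have d0: "d v = 0" if "v \<in> nf" for v using W_nondegenerate(2)[of d v] that by blast
    show "r = r'"
    proof (rule R.forms_separate[OF c])
      fix \<phi> assume \<phi>: "\<phi> \<in> linear_forms ?R"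
      show "\<phi> r = \<phi> r'" using d[OF \<phi>] d0 R.linear_formsD(4)[OF \<phi> c] by simp
    qed
  qed
  have surj: "carrier J.D \<subseteq> f ` ws"
  proof
    fix g assume g: "g \<in> carrier J.D"
    \<comment> \<open>The forms f (U v) with v in \<open>nf\<close> have no common zero but 0 in the
      quotient, so they span its dual; no dimensions need to be compared.\<close>
    have "\<exists>a. \<forall>x\<in>carrier J.B. g x = (\<Sum>v\<in>nf. a v * f (U v) x)"
    proof (rule J.B.kernel_lemma[OF finite_nf _ J.D_form[OF g] J.B.subspace_carrier])
      show "f (U v) \<in> linear_forms J.B" for v using J.D_form f(1) ws.word by blast
      fix x assume x: "x \<in> carrier J.B" and z: "\<And>v. v \<in> nf \<Longrightarrow> f (U v) x = 0"
      obtain d where d: "\<And>\<phi>. \<phi> \<in> linear_forms J.B \<Longrightarrow> \<phi> x = (\<Sum>p\<in>nf. d p * \<phi> (J.cl (word p)))"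
        by (rule B_nf[OF x]) blast
      have "(\<Sum>p\<in>nf. d p * W p v) = 0" if "v \<in> nf" for v
        using z[OF that] d[OF J.D_form[OF f(1)[OF ws.word]], of v] f(2)[OF ws.word] by (simp add: \<omega>(2))
      then have "d p = 0" if "p \<in> nf" for p using W_nondegenerate(1)[of d p] that by blast
      then show "g x = 0" using d[OF J.D_form[OF g]] by simp
    qed
    then obtain a where a: "\<And>x. x \<in> carrier J.B \<Longrightarrow> g x = (\<Sum>v\<in>nf. a v * f (U v) x)" by blast
    let ?r = "R.lincomb nf a U"
    have Uc: "U v \<in> carrier ?R" for v by (simp add: R_simps(1) ws.word)
    have r: "?r \<in> ws" using R.lincomb_closed[of nf U a] Uc by (simp add: R_simps(1))
    have "g = f ?r"
    proof (rule D_eqI[OF g f(1)[OF r]])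
      fix v
      have "f ?r (J.cl (word v)) = (\<Sum>p\<in>nf. a p * \<omega> v (U p))"
        unfolding f(2)[OF r] by (rule R.form_lincomb[OF \<omega>(1) Uc])
      then show "g (J.cl (word v)) = f ?r (J.cl (word v))"
        using a[OF cl_in] f(2)[OF ws.word] by simp
    qed
    then show "g \<in> f ` ws" using r by blast
  qed
  have "f \<in> coalg_hom ?R J.D" using hom com cou by (simp add: coalg_hom_def R_simps(1))
  moreover have "bij_betw f (carrier ?R) (carrier J.D)"
    using inj surj f(1) by (auto simp: bij_betw_def R_simps(1))
  ultimately show ?thesis unfolding coalg_iso_def by blast
qed

end

section \<open>Multiplicative and primitive matrices\<close>

text \<open>A basis vector lies outside the span of the others; a form on W that separates it is
  extended to V along a projection.\<close>

lemma (in vs) basis_dual: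
  assumes W: "subspace class_ring W V" and S: "vectorspace.basis class_ring (V\<lparr>carrier := W\<rparr>) S" "finite S" and x: "x \<in> S"
  obtains \<psi> where "\<psi> \<in> linear_forms V" "\<psi> x = 1" "\<And>y. y \<in> S \<Longrightarrow> y \<noteq> x \<Longrightarrow> \<psi> y = 0"
proof -
  let ?W = "V\<lparr>carrier := W\<rparr>"
  have v: "vectorspace class_ring ?W" using vectorspace.subspace_is_vs[OF vectorspace W] by simp
  interpret W: vs ?W by (rule vs.intro[OF v])
  note m = W.module
  have SW: "S \<subseteq> carrier ?W" and li: "\<not> module.lin_dep class_ring ?W S"
    using S(1) by (simp_all add: vectorspace.basis_def[OF v])
  have xn: "x \<notin> LinearCombinations.module.span class_ring ?W (S - {x})"
    using li vectorspace.lindep_span[OF v SW S(2)] x by blast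
  have sub: "S - {x} \<subseteq> carrier ?W" using SW by blast
  obtain g where g: "g \<in> linear_forms ?W" "g x = 1"
    "\<And>w. w \<in> LinearCombinations.module.span class_ring ?W (S - {x}) \<Longrightarrow> g w = 0"
    by (rule W.separating_form[OF vectorspace.span_is_subspace[OF v sub] _ xn]) (use SW x in blast)+
  obtain P where P: "P \<in> LinearCombinations.module_hom class_ring V V" "\<And>y. y \<in> carrier V \<Longrightarrow> P y \<in> W" "\<And>w. w \<in> W \<Longrightarrow> P w = w"
    by (rule projection[OF W]) blast
  have "P \<in> LinearCombinations.module_hom class_ring V ?W"
    using P(1,2) by (simp add: LinearCombinations.module_hom_def)
  from linear_form_comp[OF vs_axioms this g(1)] show ?thesis
  proof (rule that)
    have "x \<in> W" using SW x by auto
    then show "g (P x) = 1" using P(3) g(2) by simp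
    fix y assume y: "y \<in> S" "y \<noteq> x"
    then have "g y = 0" using g(3) LinearCombinations.module.in_own_span[OF m sub] by blast
    moreover have "y \<in> W" using SW y by auto
    ultimately show "g (P y) = 0" using P(3) by simp
  qed
qed

lemma scalar_mat_mult_diag:
  assumes G: "kalg G" and M: "M \<in> carrier_mat n l" "\<And>i j. i < n \<Longrightarrow> j < l \<Longrightarrow> M $$ (i, j) \<in> carrier G" and ij: "i < n" "j < l"
  shows "scalar_mat_mult G (mat_diag n f) M $$ (i, j) = f i \<odot>\<^bsub>G\<^esub> M $$ (i, j)"
proof -
  interpret G: kalg G by (rule G)
  have c: "mat_diag n f $$ (i, k) \<odot>\<^bsub>G\<^esub> M $$ (k, j) \<in> carrier G" if "k \<in> {..<n}" for k
    using M(2) that ij by simp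
  have "(\<Oplus>\<^bsub>G\<^esub>k\<in>{..<n}. mat_diag n f $$ (i, k) \<odot>\<^bsub>G\<^esub> M $$ (k, j)) = f i \<odot>\<^bsub>G\<^esub> M $$ (i, j)"
  proof (rule G.forms_separate)
    fix \<phi> assume \<phi>: "\<phi> \<in> linear_forms G"
    have "\<phi> (\<Oplus>\<^bsub>G\<^esub>k\<in>{..<n}. mat_diag n f $$ (i, k) \<odot>\<^bsub>G\<^esub> M $$ (k, j)) = (\<Sum>k<n. \<phi> (mat_diag n f $$ (i, k) \<odot>\<^bsub>G\<^esub> M $$ (k, j)))"
      by (rule G.form_finsum[OF \<phi> c])
    also have "\<dots> = (\<Sum>k<n. if k = i then f i * \<phi> (M $$ (i, j)) else 0)"
      by (intro sum.cong refl) (use ij M(2) in \<open>simp add: mat_diag_def G.linear_formsD[OF \<phi>]\<close>)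
    also have "\<dots> = \<phi> (f i \<odot>\<^bsub>G\<^esub> M $$ (i, j))" using ij M(2) by (simp add: G.linear_formsD[OF \<phi>])
    finally show "\<phi> (\<Oplus>\<^bsub>G\<^esub>k\<in>{..<n}. mat_diag n f $$ (i, k) \<odot>\<^bsub>G\<^esub> M $$ (k, j)) = \<phi> (f i \<odot>\<^bsub>G\<^esub> M $$ (i, j))" .
  qed (use c M(2) ij in \<open>auto intro!: G.finsum_closed\<close>)
  then show ?thesis using ij M(1) by (simp add: scalar_mat_mult_def mat_diag_def)
qed

text \<open>\<open>\<theta> p w\<close> is the value of f (U w) at the class of p. Multiplicativity
  in p is compatibility of f with the comultiplications, separation is injectivity of f, and the
  relations of I become relations between the functionals.\<close>

lemma tame_core_exists:
  fixes H :: "('k::field, 'h) coalg" and c :: "letter \<Rightarrow> letter \<Rightarrow> nat \<Rightarrow> 'h set"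
  assumes "matrix_hopf H c z q" and I: "I \<in> tame_ideals" and iso: "coalg_iso (braided_R H) (dual_quot I)"
  shows "\<exists>\<theta> N. tame_core H c z q \<theta> N"
proof -
  interpret matrix_hopf H c z q by fact
  obtain N where "free_quot I N" using tame_ideal[OF I] by blast
  then interpret Q: free_quot I N .
  let ?R = "braided_R H"
  obtain f where f: "f \<in> coalg_hom ?R Q.D" "bij_betw f (carrier ?R) (carrier Q.D)" using iso by (auto simp: coalg_iso_def)
  have hom: "f \<in> LinearCombinations.module_hom class_ring ?R Q.D" using f(1) by (simp add: coalg_hom_def)
  have com: "comult Q.D (f r) = tensor_map Q.D Q.D f f (comult ?R r)" "counit Q.D (f r) = counit ?R r" if "r \<in> ws" for r
    using f(1) that by (auto simp: coalg_hom_def R_simps(1))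
  have fD: "f r \<in> carrier Q.D" if "r \<in> ws" for r using f(2) that by (auto simp: bij_betw_def R_simps(1))
  have cl_in: "Q.cl (word p) \<in> carrier Q.B" for p by (rule Q.cl_in[OF word_in])
  have form: "(\<lambda>r. f r (Q.cl (word p))) \<in> linear_forms ?R" for p
    by (rule linear_form_comp[OF vs_R hom Q.eval_form[OF cl_in]])
  define \<theta> where "\<theta> p w = f (U w) (Q.cl (word p))" for p w
  note UD = fD[OF ws.word]
  have rel0: "\<theta> p w = 0" if "word p \<in> I" for p w
    unfolding \<theta>_def by (rule Q.form_I[OF Q.D_form[OF UD] that])
  have rel: "\<theta> p w = \<theta> p' w" if "word p \<ominus>\<^bsub>free_alg\<^esub> word p' \<in> I" for p p' w
    using Q.form_I[OF Q.D_form[OF UD[of w]] that] by (simp add: \<theta>_def word_in FA.linear_formsD[OF Q.cl_form[OF Q.D_form[OF UD]]])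
  have "tame_core_axioms H z q \<theta> N"
  proof
    show "\<theta> [] w = unt w" for w
      using com(2)[OF ws.word[of w]] by (simp add: \<theta>_def Q.counit_D counit_U unt_def)
    show "\<theta> (p @ p') w = cnv q (\<theta> p) (\<theta> p') w" for p p' w
    proof -
      note b = bilinear_form_prod[OF vs_R vs_R form[of p] form[of p']]
      have "\<theta> (p @ p') w = comult Q.D (f (U w)) (\<lambda>\<phi> \<psi>. \<phi> (Q.cl (word p)) * \<psi> (Q.cl (word p')))"
        unfolding \<theta>_def by (rule Q.comult_D[OF UD, symmetric])
      also have "\<dots> = comult ?R (U w) (\<lambda>a b. f a (Q.cl (word p)) * f b (Q.cl (word p')))"
        unfolding com(1)[OF ws.word] tensor_map_def using Q.prod_eval_bilinear[OF cl_in cl_in] by simp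
      also have "\<dots> = cnv q (\<theta> p) (\<theta> p') w" unfolding comult_R_word[OF b] by (simp add: cnv_def \<theta>_def)
      finally show ?thesis .
    qed
    show "\<theta> p w = 0" if "N \<le> length p" for p w by (rule rel0[OF Q.tail[OF that]])
    show "\<exists>\<phi>\<in>linear_forms ?R. \<forall>w. \<theta> p w = \<phi> (U w)" for p
      by (rule bexI[OF _ form[of p]]) (simp add: \<theta>_def)
    show "ev r = \<zero>\<^bsub>gr H\<^esub>" if r: "r \<in> carrier free_alg" and z: "\<And>p. pair (\<theta> p) r = 0" for r
    proof -
      have 0: "\<zero>\<^bsub>?R\<^esub> \<in> carrier ?R" "ev r \<in> carrier ?R" using ev_ws R.zero_closed by (simp_all add: R_simps(1))
      have "f (ev r) = f \<zero>\<^bsub>?R\<^esub>"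
      proof (rule Q.D_eqI)
        show D: "f (ev r) \<in> carrier Q.D" "f \<zero>\<^bsub>?R\<^esub> \<in> carrier Q.D" using 0 by (simp_all add: fD R_simps(1))
        fix x assume x: "x \<in> carrier Q.B"
        show "f (ev r) x = f \<zero>\<^bsub>?R\<^esub> x"
        proof (rule Q.forms_eqI[OF Q.D_form[OF D(1)] Q.D_form[OF D(2)] _ x])
          fix p
          have "f (ev r) (Q.cl (word p)) = pair (\<theta> p) r"
            using form_ev[OF form _ subset_refl, of r p] r by (simp add: pair_def \<theta>_def free_alg_simps(1))
          then show "f (ev r) (Q.cl (word p)) = f \<zero>\<^bsub>?R\<^esub> (Q.cl (word p))"
            using z R.linear_formsD(3)[OF form] by simp
        qed
      qed
      then have "ev r = \<zero>\<^bsub>?R\<^esub>" using inj_onD[OF bij_betw_imp_inj_on[OF f(2)] _ 0(2,1)] by blast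
      then show ?thesis by (simp add: R_simps)
    qed
    from tame_ideal[OF I] consider "word [LX, LX] \<in> I" "word [LY, LY] \<in> I"
      | "word [LX, LY] \<in> I" "word [LX, LX] \<ominus>\<^bsub>free_alg\<^esub> word [LY, LY] \<in> I"
      | n where "word [LX, LY] \<in> I" "word [LY, LX] \<in> I" "n \<ge> 1" "word (replicate n LX) \<ominus>\<^bsub>free_alg\<^esub> word (replicate n LY) \<in> I" by blast
    then show "(\<forall>w. \<theta> [LX, LX] w = 0 \<and> \<theta> [LY, LY] w = 0) \<or>
      (\<forall>w. \<theta> [LX, LY] w = 0 \<and> \<theta> [LX, LX] w = \<theta> [LY, LY] w) \<or>
      (\<forall>w. \<theta> [LX, LY] w = 0 \<and> \<theta> [LY, LX] w = 0) \<and> (\<exists>n\<ge>1. \<forall>w. \<theta> (replicate n LX) w = \<theta> (replicate n LY) w)"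
    proof cases
      case 1 then show ?thesis using rel0 by blast
    next
      case 2 then show ?thesis using rel0 rel by blast
    next
      case 3 then show ?thesis using rel0 rel by blast
    qed
  qed
  then have "tame_core H c z q \<theta> N" by (intro tame_core.intro matrix_hopf_axioms)
  then show ?thesis by blast
qed

theorem proposition1p3:
  fixes H :: "('k::{alg_closed_field, field_char_0}, 'h) coalg"
    and I :: "(letter list \<Rightarrow> 'k) set"
    and bm :: "(nat \<Rightarrow> 'h set) set \<Rightarrow> (nat \<Rightarrow> 'h set) mat"
    and C :: "(nat \<Rightarrow> 'h set) set"
    and X :: "(nat \<Rightarrow> 'h set) vec"
    and c11 c12 c21 c22 u v :: "nat \<Rightarrow> 'h set"
    and K :: "'k mat"
    and \<alpha>1 \<alpha>2 \<alpha>3 \<alpha>4 :: 'k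
  assumes "hopf_algebra H" and "vectorspace.fin_dim class_ring H"
    and "dual_chevalley H"
    and "I \<in> tame_ideals"
    and "iso_to_biproduct (gr H) (dual_quot I) (corad_hopf H)"
    and "coalg_iso (braided_R H) (dual_quot I)"
    and "tame_corep_type (gr H)"
    and "\<forall>D\<in>simple_subcoalgebras (gr H). basic_mult_matrix (gr H) D (bm D)"
    and "is_P_one (gr H) bm {X}"
    and "S_one (gr H) = {C}"
    and "vectorspace.dim class_ring ((gr H)\<lparr>carrier := C\<rparr>) = 4"
    and "bm C = mat_of_rows_list 2 [[c11, c12], [c21, c22]]"
    and "X = vec_of_list [u, v]"
    and "u \<in> gr_component H 1" and "v \<in> gr_component H 1"
    and "K \<in> carrier_mat 4 4" and "invertible_mat K"
    and "mat_of_rows_list 2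
           [[c11 \<otimes>\<^bsub>gr H\<^esub> u, c12 \<otimes>\<^bsub>gr H\<^esub> u],
            [c21 \<otimes>\<^bsub>gr H\<^esub> u, c22 \<otimes>\<^bsub>gr H\<^esub> u],
            [c11 \<otimes>\<^bsub>gr H\<^esub> v, c12 \<otimes>\<^bsub>gr H\<^esub> v],
            [c21 \<otimes>\<^bsub>gr H\<^esub> v, c22 \<otimes>\<^bsub>gr H\<^esub> v]] =
         scalar_mat_mult (gr H) K (mat_of_rows_list 2
           [[u \<otimes>\<^bsub>gr H\<^esub> c11, u \<otimes>\<^bsub>gr H\<^esub> c12],
            [u \<otimes>\<^bsub>gr H\<^esub> c21, u \<otimes>\<^bsub>gr H\<^esub> c22],
            [v \<otimes>\<^bsub>gr H\<^esub> c11, v \<otimes>\<^bsub>gr H\<^esub> c12],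
            [v \<otimes>\<^bsub>gr H\<^esub> c21, v \<otimes>\<^bsub>gr H\<^esub> c22]])"
    and "K = mat_diag 4 (\<lambda>i. [\<alpha>1, \<alpha>2, \<alpha>3, \<alpha>4] ! i)"
    and "alg_generated (gr H) {u, v} = coinvariants H"
  shows "\<exists>a m. a \<noteq> 0 \<and> m \<ge> 1 \<and>
           coalg_iso (braided_R H) (dual_quot (ideal2 a m)) \<and>
           \<alpha>1 = -1 \<and> \<alpha>4 = -1 \<and>
           (a = (-1) ^ (m - 1) * \<alpha>2 ^ m \<or> a = (-1) ^ (m - 1) * \<alpha>3 ^ m) \<and>
           (\<alpha>2 * \<alpha>3) ^ m = 1 \<and> (\<forall>j. 0 < j \<and> j < m \<longrightarrow> (\<alpha>2 * \<alpha>3) ^ j \<noteq> 1)"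
proof -
  interpret dc_hopf H by (rule dc_hopf.intro[OF assms(1,3)])
  let ?G = "gr H"
  define ix :: "letter \<Rightarrow> nat" where "ix i = (case i of LX \<Rightarrow> 0 | LY \<Rightarrow> 1)" for i
  define c where "c i j = bm C $$ (ix i, ix j)" for i j
  define z where "z i = X $ ix i" for i
  \<comment> \<open>Row 2 j + i of K, counted from 0, belongs to the generator z(j) and to row i of
    the matrix of C. So \<alpha>2 is q(LY, LX) and \<alpha>3 is q(LX, LY).\<close>
  define q where "q i j = [\<alpha>1, \<alpha>2, \<alpha>3, \<alpha>4] ! (2 * ix j + ix i)" for i j
  have ix2: "ix i < 2" "{..<2} = ix ` UNIV" "inj ix" for i
    by (auto simp: ix_def UNIV_letter inj_def split: letter.splits)
  have ixsum: "(\<Sum>t<2. g t) = (\<Sum>t\<in>UNIV. g (ix t))" for g :: "nat \<Rightarrow> 'k"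
    unfolding ix2(2) by (rule sum.reindex[OF ix2(3), unfolded o_def])
  have C: "C \<in> S_one ?G" using assms(10) by simp
  then have Cs: "C \<in> simple_subcoalgebras ?G" by (simp add: S_one_def)
  then have Csub: "subspace class_ring C ?G" by (simp add: simple_subcoalgebras_def subcoalgebra_def)
  have bmC: "basic_mult_matrix ?G C (bm C)" using assms(8) Cs by blast
  have dims: "dim_row (bm C) = 2" "dim_vec X = 2" by (simp_all add: assms(12,13) mat_of_rows_list_def)
  let ?E = "(\<lambda>p. bm C $$ p) ` ({..<2} \<times> {..<2})"
  have inj: "inj_on (\<lambda>p. bm C $$ p) ({..<2} \<times> {..<2})" and basis: "vectorspace.basis class_ring (?G\<lparr>carrier := C\<rparr>) ?E"
    and cm: "\<And>i j. comult ?G (c i j) = (\<lambda>\<beta>\<in>bilinear_forms ?G ?G. \<Sum>t<2. \<beta> (bm C $$ (ix i, t)) (bm C $$ (t, ix j)))"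
    and cc: "\<And>i j. counit ?G (c i j) = (if ix i = ix j then 1 else 0)"
    using bmC ix2(1) unfolding basic_mult_matrix_def dims c_def by blast+
  have v: "vectorspace class_ring (?G\<lparr>carrier := C\<rparr>)" using vectorspace.subspace_is_vs[OF G.vectorspace Csub] by simp
  have cE: "c i j \<in> ?E" for i j using ix2(1) by (auto simp: c_def)
  have "?E \<subseteq> C" using basis by (simp add: vectorspace.basis_def[OF v])
  then have c_in: "c i j \<in> carrier ?G" for i j using cE G.subspaceD(1)[OF Csub] by blast
  obtain F where F: "\<forall>D\<in>S_one ?G. complete_family ?G D (bm D) (F D)" "{X} = (\<Union>D\<in>S_one ?G. F D)"
    using assms(9) unfolding is_P_one_def by blast
  then have "complete_family ?G C (bm C) {X}" using assms(10) by simp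
  then have prim: "nontrivial_primitive ?G (bm C) X" by (simp add: complete_family_def Let_def)
  have zc: "z i \<in> carrier ?G" "comult ?G (z i) = (\<lambda>\<beta>\<in>bilinear_forms ?G ?G. (\<Sum>k<2. \<beta> (bm C $$ (ix i, k)) (X $ k)) + \<beta> (z i) \<one>\<^bsub>?G\<^esub>)" for i
    using prim ix2(1)[of i] unfolding nontrivial_primitive_def dims z_def by blast+
  have zu: "z LX = u" "z LY = v" by (simp_all add: z_def ix_def assms(13) vec_of_list_index)
  have cu: "c LX LX = c11" "c LX LY = c12" "c LY LX = c21" "c LY LY = c22"
    by (simp_all add: c_def ix_def assms(12) mat_of_rows_list_def)
  note uv_in = zc(1)[of LX, unfolded zu] zc(1)[of LY, unfolded zu]
  note cs_in = c_in[of LX LX, unfolded cu] c_in[of LX LY, unfolded cu] c_in[of LY LX, unfolded cu] c_in[of LY LY, unfolded cu]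
  have "matrix_hopf_axioms H c z q"
  proof
    show "c i j \<in> carrier ?G" for i j by (rule c_in)
    show "comult ?G (c i j) \<beta> = (\<Sum>t\<in>UNIV. \<beta> (c i t) (c t j))" if "\<beta> \<in> bilinear_forms ?G ?G" for \<beta> i j
      using that by (simp add: cm ixsum flip: c_def)
    show "counit ?G (c i j) = (if i = j then 1 else 0)" for i j
      using ix2(3) by (simp add: cc inj_eq)
    show "\<exists>\<psi>\<in>linear_forms ?G. \<forall>k l. \<psi> (c k l) = (if k = i \<and> l = j then 1 else 0)" for i j
    proof -
      obtain \<psi> where \<psi>: "\<psi> \<in> linear_forms ?G" "\<psi> (c i j) = 1" "\<And>y. y \<in> ?E \<Longrightarrow> y \<noteq> c i j \<Longrightarrow> \<psi> y = 0"
        by (rule G.basis_dual[OF Csub basis _ cE]) blast+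
      have "c k l \<noteq> c i j" if "\<not> (k = i \<and> l = j)" for k l
        using inj_onD[OF inj, of "(ix k, ix l)" "(ix i, ix j)"] ix2(1) that injD[OF ix2(3)] by (auto simp: c_def)
      then have "\<forall>k l. \<psi> (c k l) = (if k = i \<and> l = j then 1 else 0)" using \<psi>(2) \<psi>(3)[OF cE] by auto
      then show ?thesis using \<psi>(1) by blast
    qed
    show "z i \<in> gr_component H 1" for i using zu assms(14,15) by (cases i) simp_all
    show "comult ?G (z i) \<beta> = (\<Sum>k\<in>UNIV. \<beta> (c i k) (z k)) + \<beta> (z i) \<one>\<^bsub>?G\<^esub>" if "\<beta> \<in> bilinear_forms ?G ?G" for \<beta> i
      using that by (simp add: zc(2) ixsum flip: c_def z_def)
    \<comment> \<open>A non-trivial primitive matrix has an entry outside the coradical, which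
      contains zero.\<close>
    show "\<exists>i. z i \<noteq> \<zero>\<^bsub>?G\<^esub>"
    proof -
      obtain n where n: "n < 2" "X $ n \<notin> coradical ?G" using prim unfolding nontrivial_primitive_def dims by blast
      have "\<Union>(simple_subcoalgebras ?G) \<subseteq> carrier ?G"
        using G.subspaceD(6) by (auto simp: simple_subcoalgebras_def subcoalgebra_def)
      then have "subspace class_ring (coradical ?G) ?G"
        unfolding coradical_def by (rule vectorspace.span_is_subspace[OF G.vectorspace])
      then have "\<zero>\<^bsub>?G\<^esub> \<in> coradical ?G" by (rule G.subspaceD(2))
      moreover obtain i where i: "n = ix i" using n(1) ix2(2) by blast
      ultimately have "z i \<noteq> \<zero>\<^bsub>?G\<^esub>" using n(2) unfolding z_def i by metis
      then show ?thesis by blast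
    qed
    show "alg_generated ?G (range z) = coinvariants H" using assms(20) by (simp add: UNIV_letter zu)
    let ?M = "mat_of_rows_list 2 [[u \<otimes>\<^bsub>?G\<^esub> c11, u \<otimes>\<^bsub>?G\<^esub> c12], [u \<otimes>\<^bsub>?G\<^esub> c21, u \<otimes>\<^bsub>?G\<^esub> c22],
      [v \<otimes>\<^bsub>?G\<^esub> c11, v \<otimes>\<^bsub>?G\<^esub> c12], [v \<otimes>\<^bsub>?G\<^esub> c21, v \<otimes>\<^bsub>?G\<^esub> c22]]"
    let ?L = "mat_of_rows_list 2 [[c11 \<otimes>\<^bsub>?G\<^esub> u, c12 \<otimes>\<^bsub>?G\<^esub> u], [c21 \<otimes>\<^bsub>?G\<^esub> u, c22 \<otimes>\<^bsub>?G\<^esub> u],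
      [c11 \<otimes>\<^bsub>?G\<^esub> v, c12 \<otimes>\<^bsub>?G\<^esub> v], [c21 \<otimes>\<^bsub>?G\<^esub> v, c22 \<otimes>\<^bsub>?G\<^esub> v]]"
    have M: "?M $$ (2 * ix j + ix i, ix k) = z j \<otimes>\<^bsub>?G\<^esub> c i k" "?L $$ (2 * ix j + ix i, ix k) = c i k \<otimes>\<^bsub>?G\<^esub> z j" for i j k
      by (cases i; cases j; cases k; simp add: ix_def mat_of_rows_list_def zu cu numeral_eq_Suc)+
    have row: "\<exists>i j. n = 2 * ix j + ix i" if "n < 4" for n
    proof -
      have "n = 2 * ix LX + ix LX \<or> n = 2 * ix LX + ix LY \<or> n = 2 * ix LY + ix LX \<or> n = 2 * ix LY + ix LY"
        using that by (auto simp: ix_def)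
      then show ?thesis by blast
    qed
    have Mc: "?M $$ (n, l) \<in> carrier ?G" if nl: "n < 4" "l < 2" for n l
    proof -
      obtain i j k where "n = 2 * ix j + ix i" "l = ix k" using row[OF nl(1)] nl(2) ix2(2) by blast
      then show ?thesis using M(1) zc(1) c_in by simp
    qed
    have Md: "?M \<in> carrier_mat 4 2" by (rule carrier_matI) (simp_all add: mat_of_rows_list_def)
    show "c i k \<otimes>\<^bsub>?G\<^esub> z j = q i j \<odot>\<^bsub>?G\<^esub> (z j \<otimes>\<^bsub>?G\<^esub> c i k)" for i j k
    proof -
      have l: "2 * ix j + ix i < 4" using ix2(1)[of i] ix2(1)[of j] by simp
      have "?L $$ (2 * ix j + ix i, ix k) = scalar_mat_mult ?G (mat_diag 4 (\<lambda>i. [\<alpha>1, \<alpha>2, \<alpha>3, \<alpha>4] ! i)) ?M $$ (2 * ix j + ix i, ix k)"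
        using assms(18,19) by simp
      also have "\<dots> = q i j \<odot>\<^bsub>?G\<^esub> ?M $$ (2 * ix j + ix i, ix k)"
        unfolding q_def by (rule scalar_mat_mult_diag[OF G.kalg_axioms Md Mc l ix2(1)])
      finally show ?thesis unfolding M .
    qed
  qed
  then have "matrix_hopf H c z q" by (intro matrix_hopf.intro dc_hopf_axioms)
  from tame_core_exists[OF this assms(4,6)] obtain \<theta> N where "tame_core H c z q \<theta> N" by blast
  then interpret T: tame_core H c z q \<theta> N .
  have qs: "q LX LX = \<alpha>1" "q LY LX = \<alpha>2" "q LX LY = \<alpha>3" "q LY LY = \<alpha>4" by (simp_all add: q_def ix_def)
  have Q: "T.Qq = \<alpha>2 * \<alpha>3" by (simp add: T.Qq_def qs mult.commute)
  have "\<alpha>1 = -1" "\<alpha>4 = -1" using T.q_diag[of LX] T.q_diag[of LY] by (simp_all add: qs)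
  moreover have "T.s = (-1) ^ (T.m - 1) * \<alpha>2 ^ T.m" by (simp add: T.s_def qs)
  moreover have "(\<alpha>2 * \<alpha>3) ^ T.m = 1" "\<forall>j. 0 < j \<and> j < T.m \<longrightarrow> (\<alpha>2 * \<alpha>3) ^ j \<noteq> 1"
    using T.m(2) T.m(3) by (simp_all add: Q Suc_le_eq)
  \<comment> \<open>With a = \<open>T.s\<close> and m the order of \<alpha>2 \<alpha>3, the first of
    the two alternatives for a holds.\<close>
  ultimately show ?thesis using T.s_nonzero T.m(1) T.dual_iso by (intro exI[of _ T.s] exI[of _ T.m]) blast
qed

end
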